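(* Let $G$ be a finite group, $u\in G$ a central element with $u^2=1$, $u\neq1$, $U=\langle u\rangle$, and let $k$ be a field whose characteristic is zero or does not divide $|G|$. If $G\not\cong G/U\times U$, then there is a short exact sequence of groups $$1\longrightarrow Br(k)\longrightarrow BM(k,k[G],R_u)\longrightarrow H^2_\sharp(G,k^\cdot)\longrightarrow 1.$$ If $-1$ is a square in $k$, then $H^2_\sharp(G,k^\cdot)$ can be replaced by $H^2(G,k^\cdot)$ in this sequence.
   Context: $Br(k)$ is the classical Brauer group of $k$; $k^\cdot=k\setminus\{0\}$ with trivial $G$-action. $R_u=\frac12(1\otimes1+1\otimes u+u\otimes1-u\otimes u)$ is a triangular structure on $k[G]$. The condition $G\cong G/U\times U$ means that $U$ is a direct summand (direct factor) of $G$. The group $H^2_\sharp(G,k^\cdot)$: for a normalized $2$-cocycle $\sigma\in Z^2(G,k^\cdot)$ and $g\in G$ put $\theta(\sigma)(g,u)=\sigma(g,u)\sigma(u,g)^{-1}\in\{\pm1\}$ and define $|g|_\sigma\in\{0,1\}$ by $(-1)^{|g|_\sigma}=\theta(\sigma)(g,u)$. Then $(\sigma\sharp\omega)(g,h)=\sigma(g,h)\omega(g,h)(-1)^{|g|_\sigma|h|_\omega}$ defines a group structure on $Z^2(G,k^\cdot)$ inducing an abelian group structure on the set $H^2(G,k^\cdot)$; the resulting group is $H^2_\sharp(G,k^\cdot)$. Brauer group $BM(k,H,R)$: for a finite-dimensional quasitriangular Hopf algebra $(H,R)$, $R=\sum R_{(1)}\otimes R_{(2)}$, the category of left $H$-modules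 is braided by $m\otimes n\mapsto\sum (R_{(2)}\cdot n)\otimes(R_{(1)}\cdot m)$. For $H$-module algebras $A,B$, the braided product $A\sharp B$ is $A\otimes B$ with product $(a\sharp x)(b\sharp y)=\sum a(R_{(2)}\cdot b)\sharp(R_{(1)}\cdot x)y$; the $H$-opposite $\overline A$ is the $H$-module $A$ with product $a\bar\cdot b=\sum(R_{(2)}\cdot b)(R_{(1)}\cdot a)$. For a finite-dimensional $H$-module $M$, $\mathrm{End}(M)$ is an $H$-module algebra by $(h\cdot f)(m)=\sum h_{(1)}\cdot f(S(h_{(2)})\cdot m)$. A finite-dimensional $H$-module algebra $A$ is $(H,R)$-Azumaya if the maps $F_1\colon A\sharp\overline A\to\mathrm{End}(A)$, $F_1(a\sharp\bar b)(c)=\sum a(R_{(2)}\cdot c)(R_{(1)}\cdot b)$ and $F_2\colon\overline A\sharp A\to\mathrm{End}(A)^{op}$, $F_2(\bar a\sharp b)(c)=\sum(R_{(2)}\cdot a)(R_{(1)}\cdot c)b$ are isomorphisms. $BM(k,H,R)$ is the set of $(H,R)$-Azumaya algebras modulo $A\sim B$ iff $A\sharp\mathrm{End}(M)\cong B\sharp\mathrm{End}(N)$ as $H$-module algebras for some finite-dimensional $H$-modules $M,N$, with product induced by $\sharp$. *)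

theory Defs
  imports "HOL-Algebra.Algebra"
begin

section \<open>Finite-dimensional spaces with a chosen basis\<close>

text \<open>Scalars are the elements of a type \<open>'k\<close> of class \<open>field\<close>. A finite-dimensional vector space
  is given as \<open>k\<^sup>I\<close> for a finite index set \<open>I\<close>, realised as the functions vanishing off \<open>I\<close>. The space
  \<open>k\<^sup>I \<otimes> k\<^sup>J\<close> is \<open>k\<close> to the power \<open>I \<times> J\<close>, and \<open>End(k\<^sup>I)\<close> consists of the matrices indexed by \<open>I \<times> I\<close>.
  Every finite-dimensional space is isomorphic to one with \<open>I \<subseteq> \<nat>\<close>, so the classes that make up the
  Brauer groups below are formed from algebras with basis indexed by natural numbers.\<close>

definition vspace :: "'i set \<Rightarrow> ('i \<Rightarrow> 'k::field) set" where
  "vspace I = {v. \<forall>i. i \<notin> I \<longrightarrow> v i = 0}"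

definition vadd :: "('i \<Rightarrow> 'k::field) \<Rightarrow> ('i \<Rightarrow> 'k) \<Rightarrow> 'i \<Rightarrow> 'k" where
  "vadd v w = (\<lambda>i. v i + w i)"

definition vscale :: "'k::field \<Rightarrow> ('i \<Rightarrow> 'k) \<Rightarrow> 'i \<Rightarrow> 'k" where
  "vscale c v = (\<lambda>i. c * v i)"

definition bvec :: "'i \<Rightarrow> 'i \<Rightarrow> 'k::field" where
  "bvec i = (\<lambda>j. if j = i then 1 else 0)"

definition linear_on :: "'i set \<Rightarrow> 'j set \<Rightarrow> (('i \<Rightarrow> 'k::field) \<Rightarrow> 'j \<Rightarrow> 'k) \<Rightarrow> bool" where
  "linear_on I J f \<longleftrightarrow> f \<in> vspace I \<rightarrow> vspace J
     \<and> (\<forall>v\<in>vspace I. \<forall>w\<in>vspace I. f (vadd v w) = vadd (f v) (f w))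
     \<and> (\<forall>c. \<forall>v\<in>vspace I. f (vscale c v) = vscale c (f v))"

text \<open>\<open>linext I f\<close> is the linear map on \<open>k\<^sup>I\<close> sending the basis vector \<open>bvec i\<close> to \<open>f i\<close>. In particular,
  for \<open>t \<in> H \<otimes> H\<close> the Sweedler-type sum \<open>\<Sum> F t\<^sub>1 t\<^sub>2\<close> with \<open>F\<close> bilinear is
  \<open>linext (I \<times> I) (\<lambda>(p, q). F (bvec p) (bvec q)) t\<close>, where \<open>I\<close> is the basis of \<open>H\<close>.\<close>

definition linext :: "'i set \<Rightarrow> ('i \<Rightarrow> 'j \<Rightarrow> 'k::field) \<Rightarrow> ('i \<Rightarrow> 'k) \<Rightarrow> 'j \<Rightarrow> 'k" where
  "linext I f v = (\<lambda>j. \<Sum>i\<in>I. v i * f i j)"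

definition tens :: "('i \<Rightarrow> 'k::field) \<Rightarrow> ('j \<Rightarrow> 'k) \<Rightarrow> 'i \<times> 'j \<Rightarrow> 'k" where
  "tens v w = (\<lambda>(i, j). v i * w j)"

definition mat_of :: "'i set \<Rightarrow> (('i \<Rightarrow> 'k::field) \<Rightarrow> 'i \<Rightarrow> 'k) \<Rightarrow> 'i \<times> 'i \<Rightarrow> 'k" where
  "mat_of I f = (\<lambda>(i, j). if i \<in> I \<and> j \<in> I then f (bvec j) i else 0)"

definition mat_app :: "'i set \<Rightarrow> ('i \<times> 'i \<Rightarrow> 'k::field) \<Rightarrow> ('i \<Rightarrow> 'k) \<Rightarrow> 'i \<Rightarrow> 'k" where
  "mat_app I T v = (\<lambda>i. \<Sum>j\<in>I. T (i, j) * v j)"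


section \<open>Finite-dimensional algebras and the classical Brauer group\<close>

record ('i, 'k) falg =
  basis :: "'i set"
  amul :: "('i \<Rightarrow> 'k) \<Rightarrow> ('i \<Rightarrow> 'k) \<Rightarrow> ('i \<Rightarrow> 'k)"
  aone :: "'i \<Rightarrow> 'k"

definition ring_of :: "('i, 'k::field, 'm) falg_scheme \<Rightarrow> ('i \<Rightarrow> 'k) ring" where
  "ring_of A = \<lparr>carrier = vspace (basis A), monoid.mult = amul A, one = aone A,
                ring.zero = (\<lambda>_. 0), add = vadd\<rparr>"

definition fd_algebra :: "('i, 'k::field, 'm) falg_scheme \<Rightarrow> bool" where
  "fd_algebra A \<longleftrightarrow> finite (basis A) \<and> ring (ring_of A)
     \<and> (\<forall>c. \<forall>v\<in>vspace (basis A). \<forall>w\<in>vspace (basis A).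
          amul A (vscale c v) w = vscale c (amul A v w)
        \<and> amul A v (vscale c w) = vscale c (amul A v w))"

definition alg_iso :: "('i, 'k::field, 'm) falg_scheme \<Rightarrow> ('j, 'k, 'n) falg_scheme
    \<Rightarrow> (('i \<Rightarrow> 'k) \<Rightarrow> 'j \<Rightarrow> 'k) \<Rightarrow> bool" where
  "alg_iso A B f \<longleftrightarrow> f \<in> ring_iso (ring_of A) (ring_of B)
     \<and> (\<forall>c. \<forall>v\<in>vspace (basis A). f (vscale c v) = vscale c (f v))"

definition op_alg :: "('i, 'k::field, 'm) falg_scheme \<Rightarrow> ('i, 'k, 'm) falg_scheme" where
  "op_alg A = A\<lparr>amul := (\<lambda>v w. amul A w v)\<rparr>"

definition base_alg :: "(unit, 'k::field) falg" where
  "base_alg = \<lparr>basis = UNIV, amul = (\<lambda>v w x. v x * w x), aone = (\<lambda>_. 1)\<rparr>"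

definition End_alg :: "'i set \<Rightarrow> ('i \<times> 'i, 'k::field) falg" where
  "End_alg I = \<lparr>basis = I \<times> I,
     amul = (\<lambda>S T (i, j). \<Sum>l\<in>I. S (i, l) * T (l, j)),
     aone = mat_of I (\<lambda>v. v)\<rparr>"

definition tensor_alg :: "('i, 'k::field, 'm) falg_scheme \<Rightarrow> ('j, 'k, 'n) falg_scheme
    \<Rightarrow> ('i \<times> 'j, 'k) falg" where
  "tensor_alg A B = \<lparr>basis = basis A \<times> basis B,
     amul = (\<lambda>s t. linext (basis A \<times> basis B) (\<lambda>(i, j).
              linext (basis A \<times> basis B) (\<lambda>(i', j').
                tens (amul A (bvec i) (bvec i')) (amul B (bvec j) (bvec j'))) t) s),
     aone = tens (aone A) (aone B)\<rparr>"

definition central_simple :: "('i, 'k::field, 'm) falg_scheme \<Rightarrow> bool" where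
  "central_simple A \<longleftrightarrow> fd_algebra A
     \<and> {z \<in> vspace (basis A). \<forall>v\<in>vspace (basis A). amul A z v = amul A v z}
         = {vscale c (aone A) | c. True}
     \<and> basis A \<noteq> {}
     \<and> (\<forall>J. ideal J (ring_of A) \<longrightarrow> J = {\<lambda>_. 0} \<or> J = vspace (basis A))"

definition Br_equiv :: "('i, 'k::field, 'm) falg_scheme \<Rightarrow> ('j, 'k, 'n) falg_scheme \<Rightarrow> bool" where
  "Br_equiv A B \<longleftrightarrow> (\<exists>m n. 0 < m \<and> 0 < n \<and>
     (\<exists>f. alg_iso (tensor_alg A (End_alg {..<m::nat})) (tensor_alg B (End_alg {..<n::nat})) f))"

definition Br :: "'k::field itself \<Rightarrow> (nat, 'k) falg set monoid" where
  "Br _ = (let S = {A. central_simple A} in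
     \<lparr>carrier = S // {(A, B). A \<in> S \<and> B \<in> S \<and> Br_equiv A B},
      monoid.mult = (\<lambda>P Q. {C \<in> S. \<exists>A\<in>P. \<exists>B\<in>Q. Br_equiv C (tensor_alg A B)}),
      one = {C \<in> S. Br_equiv C base_alg}\<rparr>)"


section \<open>The Brauer group of a quasitriangular Hopf algebra\<close>

text \<open>Only the structure maps of the Hopf algebra \<open>H\<close> and the element \<open>R \<in> H \<otimes> H\<close> occur in the
  definition of \<open>BM(k, H, R)\<close>; the group algebra and its triangular structure are given explicitly
  further down.\<close>

record ('h, 'k) hopf = "('h, 'k) falg" +
  comult :: "('h \<Rightarrow> 'k) \<Rightarrow> ('h \<times> 'h \<Rightarrow> 'k)"
  counit :: "('h \<Rightarrow> 'k) \<Rightarrow> 'k"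
  antipode :: "('h \<Rightarrow> 'k) \<Rightarrow> ('h \<Rightarrow> 'k)"

record ('h, 'i, 'k) hmod =
  mbasis :: "'i set"
  mact :: "('h \<Rightarrow> 'k) \<Rightarrow> ('i \<Rightarrow> 'k) \<Rightarrow> ('i \<Rightarrow> 'k)"

record ('i, 'k, 'h) hmalg = "('i, 'k) falg" +
  act :: "('h \<Rightarrow> 'k) \<Rightarrow> ('i \<Rightarrow> 'k) \<Rightarrow> ('i \<Rightarrow> 'k)"

definition hmodule :: "('h, 'k::field) hopf \<Rightarrow> ('h, 'i, 'k) hmod \<Rightarrow> bool" where
  "hmodule H M \<longleftrightarrow> finite (mbasis M)
     \<and> (\<forall>h\<in>vspace (basis H). linear_on (mbasis M) (mbasis M) (mact M h))
     \<and> (\<forall>v\<in>vspace (mbasis M). linear_on (basis H) (mbasis M) (\<lambda>h. mact M h v))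
     \<and> (\<forall>g\<in>vspace (basis H). \<forall>h\<in>vspace (basis H). \<forall>v\<in>vspace (mbasis M).
          mact M (amul H g h) v = mact M g (mact M h v))
     \<and> (\<forall>v\<in>vspace (mbasis M). mact M (aone H) v = v)"

definition hmodule_algebra :: "('h, 'k::field) hopf \<Rightarrow> ('i, 'k, 'h) hmalg \<Rightarrow> bool" where
  "hmodule_algebra H A \<longleftrightarrow> fd_algebra A \<and> hmodule H \<lparr>mbasis = basis A, mact = act A\<rparr>
     \<and> (\<forall>h\<in>vspace (basis H). \<forall>a\<in>vspace (basis A). \<forall>b\<in>vspace (basis A).
          act A h (amul A a b) =
            linext (basis H \<times> basis H)
              (\<lambda>(p, q). amul A (act A (bvec p) a) (act A (bvec q) b)) (comult H h))
     \<and> (\<forall>h\<in>vspace (basis H). act A h (aone A) = vscale (counit H h) (aone A))"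

definition hma_iso :: "('h, 'k::field) hopf \<Rightarrow> ('i, 'k, 'h) hmalg \<Rightarrow> ('j, 'k, 'h) hmalg
    \<Rightarrow> (('i \<Rightarrow> 'k) \<Rightarrow> 'j \<Rightarrow> 'k) \<Rightarrow> bool" where
  "hma_iso H A B f \<longleftrightarrow> alg_iso A B f
     \<and> (\<forall>h\<in>vspace (basis H). \<forall>a\<in>vspace (basis A). f (act A h a) = act B h (f a))"

definition base_hma :: "('h, 'k::field) hopf \<Rightarrow> (unit, 'k, 'h) hmalg" where
  "base_hma H = \<lparr>basis = UNIV, amul = (\<lambda>v w x. v x * w x), aone = (\<lambda>_. 1),
     act = (\<lambda>h. vscale (counit H h))\<rparr>"

text \<open>The product is \<open>(a \<sharp> x)(b \<sharp> y) = \<Sum> a(R\<^sub>2\<cdot>b) \<sharp> (R\<^sub>1\<cdot>x)y\<close> and \<open>H\<close> acts diagonally. Throughout,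
  \<open>p\<close> and \<open>q\<close> index the first and second leg of \<open>R\<close> (or of a coproduct).\<close>

definition braided_prod :: "('h, 'k::field) hopf \<Rightarrow> ('h \<times> 'h \<Rightarrow> 'k)
    \<Rightarrow> ('i, 'k, 'h) hmalg \<Rightarrow> ('j, 'k, 'h) hmalg \<Rightarrow> ('i \<times> 'j, 'k, 'h) hmalg" where
  "braided_prod H R A B = \<lparr>basis = basis A \<times> basis B,
     amul = (\<lambda>s t. linext (basis A \<times> basis B) (\<lambda>(i, j).
              linext (basis A \<times> basis B) (\<lambda>(i', j').
                linext (basis H \<times> basis H) (\<lambda>(p, q).
                  tens (amul A (bvec i) (act A (bvec q) (bvec i')))
                       (amul B (act B (bvec p) (bvec j)) (bvec j'))) R) t) s),
     aone = tens (aone A) (aone B),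
     act = (\<lambda>h. linext (basis A \<times> basis B) (\<lambda>(i, j).
              linext (basis H \<times> basis H) (\<lambda>(p, q).
                tens (act A (bvec p) (bvec i)) (act B (bvec q) (bvec j))) (comult H h)))\<rparr>"

definition h_op :: "('h, 'k::field) hopf \<Rightarrow> ('h \<times> 'h \<Rightarrow> 'k)
    \<Rightarrow> ('i, 'k, 'h) hmalg \<Rightarrow> ('i, 'k, 'h) hmalg" where
  "h_op H R A = A\<lparr>amul := (\<lambda>a b. linext (basis H \<times> basis H)
     (\<lambda>(p, q). amul A (act A (bvec q) b) (act A (bvec p) a)) R)\<rparr>"

definition End_hma :: "('h, 'k::field) hopf \<Rightarrow> ('h, 'i, 'k) hmod \<Rightarrow> ('i \<times> 'i, 'k, 'h) hmalg" where
  "End_hma H M = \<lparr>basis = basis (End_alg (mbasis M) :: ('i \<times> 'i, 'k) falg),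
     amul = amul (End_alg (mbasis M)), aone = aone (End_alg (mbasis M)),
     act = (\<lambda>h T. mat_of (mbasis M) (\<lambda>m. linext (basis H \<times> basis H)
        (\<lambda>(p, q). mact M (bvec p) (mat_app (mbasis M) T (mact M (antipode H (bvec q)) m)))
        (comult H h)))\<rparr>"

definition F1 :: "('h, 'k::field) hopf \<Rightarrow> ('h \<times> 'h \<Rightarrow> 'k) \<Rightarrow> ('i, 'k, 'h) hmalg
    \<Rightarrow> ('i \<times> 'i \<Rightarrow> 'k) \<Rightarrow> ('i \<times> 'i \<Rightarrow> 'k)" where
  "F1 H R A t = mat_of (basis A) (\<lambda>c. linext (basis A \<times> basis A) (\<lambda>(i, j).
     linext (basis H \<times> basis H) (\<lambda>(p, q).
       amul A (amul A (bvec i) (act A (bvec q) c)) (act A (bvec p) (bvec j))) R) t)"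

definition F2 :: "('h, 'k::field) hopf \<Rightarrow> ('h \<times> 'h \<Rightarrow> 'k) \<Rightarrow> ('i, 'k, 'h) hmalg
    \<Rightarrow> ('i \<times> 'i \<Rightarrow> 'k) \<Rightarrow> ('i \<times> 'i \<Rightarrow> 'k)" where
  "F2 H R A t = mat_of (basis A) (\<lambda>c. linext (basis A \<times> basis A) (\<lambda>(i, j).
     linext (basis H \<times> basis H) (\<lambda>(p, q).
       amul A (amul A (act A (bvec q) (bvec i)) (act A (bvec p) c)) (bvec j)) R) t)"

text \<open>The algebra \<open>A\<close> here, and the modules \<open>M\<close>, \<open>N\<close> below, are required to be nonzero: \<open>F1\<close> and \<open>F2\<close>
  are bijective for the zero algebra, and \<open>A \<sharp> End(0) = 0\<close> for every \<open>A\<close>.\<close>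

definition azumaya :: "('h, 'k::field) hopf \<Rightarrow> ('h \<times> 'h \<Rightarrow> 'k) \<Rightarrow> ('i, 'k, 'h) hmalg \<Rightarrow> bool" where
  "azumaya H R A \<longleftrightarrow> hmodule_algebra H A \<and> basis A \<noteq> {}
     \<and> alg_iso (braided_prod H R A (h_op H R A)) (End_alg (basis A)) (F1 H R A)
     \<and> alg_iso (braided_prod H R (h_op H R A) A) (op_alg (End_alg (basis A))) (F2 H R A)"

definition BM_equiv :: "('h, 'k::field) hopf \<Rightarrow> ('h \<times> 'h \<Rightarrow> 'k)
    \<Rightarrow> ('i, 'k, 'h) hmalg \<Rightarrow> ('j, 'k, 'h) hmalg \<Rightarrow> bool" where
  "BM_equiv H R A B \<longleftrightarrow> (\<exists>(M :: ('h, nat, 'k) hmod) (N :: ('h, nat, 'k) hmod).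
     hmodule H M \<and> mbasis M \<noteq> {} \<and> hmodule H N \<and> mbasis N \<noteq> {} \<and>
     (\<exists>f. hma_iso H (braided_prod H R A (End_hma H M)) (braided_prod H R B (End_hma H N)) f))"

definition BM :: "'k::field itself \<Rightarrow> ('h, 'k) hopf \<Rightarrow> ('h \<times> 'h \<Rightarrow> 'k)
    \<Rightarrow> (nat, 'k, 'h) hmalg set monoid" where
  "BM _ H R = (let S = {A. azumaya H R A} in
     \<lparr>carrier = S // {(A, B). A \<in> S \<and> B \<in> S \<and> BM_equiv H R A B},
      monoid.mult = (\<lambda>P Q. {C \<in> S. \<exists>A\<in>P. \<exists>B\<in>Q. BM_equiv H R C (braided_prod H R A B)}),
      one = {C \<in> S. BM_equiv H R C (base_hma H)}\<rparr>)"


section \<open>Group algebras\<close>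

definition group_alg :: "('g, 'm) monoid_scheme \<Rightarrow> ('g, 'k::field) hopf" where
  "group_alg G = \<lparr>basis = carrier G,
     amul = (\<lambda>v w. linext (carrier G) (\<lambda>g. linext (carrier G) (\<lambda>h. bvec (g \<otimes>\<^bsub>G\<^esub> h)) w) v),
     aone = bvec \<one>\<^bsub>G\<^esub>,
     comult = linext (carrier G) (\<lambda>g. tens (bvec g) (bvec g)),
     counit = (\<lambda>v. \<Sum>g\<in>carrier G. v g),
     antipode = linext (carrier G) (\<lambda>g. bvec (inv\<^bsub>G\<^esub> g))\<rparr>"

definition R_mat :: "('g, 'm) monoid_scheme \<Rightarrow> 'g \<Rightarrow> 'g \<times> 'g \<Rightarrow> 'k::field" where
  "R_mat G u = (\<lambda>x. (1 / 2) *
     (tens (bvec \<one>\<^bsub>G\<^esub>) (bvec \<one>\<^bsub>G\<^esub>) x + tens (bvec \<one>\<^bsub>G\<^esub>) (bvec u) x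
      + tens (bvec u) (bvec \<one>\<^bsub>G\<^esub>) x - tens (bvec u) (bvec u) x))"


section \<open>Second cohomology with trivial coefficients in the multiplicative group\<close>

text \<open>Cochains are normalized. They take the value \<open>1\<close> outside the carrier so that they are determined
  by their values on \<open>G\<close>.\<close>

definition Z2 :: "'k::field itself \<Rightarrow> ('g, 'm) monoid_scheme \<Rightarrow> ('g \<Rightarrow> 'g \<Rightarrow> 'k) monoid" where
  "Z2 _ G = \<lparr>carrier = {\<sigma>.
       (\<forall>g h. g \<notin> carrier G \<or> h \<notin> carrier G \<longrightarrow> \<sigma> g h = 1)
     \<and> (\<forall>g\<in>carrier G. \<forall>h\<in>carrier G. \<sigma> g h \<noteq> 0)
     \<and> (\<forall>g\<in>carrier G. \<forall>h\<in>carrier G. \<forall>l\<in>carrier G.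
          \<sigma> g h * \<sigma> (g \<otimes>\<^bsub>G\<^esub> h) l = \<sigma> h l * \<sigma> g (h \<otimes>\<^bsub>G\<^esub> l))
     \<and> (\<forall>g\<in>carrier G. \<sigma> \<one>\<^bsub>G\<^esub> g = 1 \<and> \<sigma> g \<one>\<^bsub>G\<^esub> = 1)},
     monoid.mult = (\<lambda>\<sigma> \<omega> g h. \<sigma> g h * \<omega> g h),
     one = (\<lambda>_ _. 1)\<rparr>"

definition B2 :: "'k::field itself \<Rightarrow> ('g, 'm) monoid_scheme \<Rightarrow> ('g \<Rightarrow> 'g \<Rightarrow> 'k) set" where
  "B2 _ G = {\<lambda>g h. if g \<in> carrier G \<and> h \<in> carrier G
                   then \<gamma> g * \<gamma> h * inverse (\<gamma> (g \<otimes>\<^bsub>G\<^esub> h)) else 1 | \<gamma>.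
              (\<forall>g\<in>carrier G. \<gamma> g \<noteq> 0) \<and> \<gamma> \<one>\<^bsub>G\<^esub> = 1}"

definition H2 :: "'k::field itself \<Rightarrow> ('g, 'm) monoid_scheme \<Rightarrow> ('g \<Rightarrow> 'g \<Rightarrow> 'k) set monoid" where
  "H2 K G = (Z2 K G) Mod (B2 K G)"

definition theta :: "('g \<Rightarrow> 'g \<Rightarrow> 'k::field) \<Rightarrow> 'g \<Rightarrow> 'g \<Rightarrow> 'k" where
  "theta \<sigma> g h = \<sigma> g h * inverse (\<sigma> h g)"

definition cdeg :: "'g \<Rightarrow> ('g \<Rightarrow> 'g \<Rightarrow> 'k::field) \<Rightarrow> 'g \<Rightarrow> nat" where
  "cdeg u \<sigma> g = (THE d. d \<in> {0, 1} \<and> (- 1) ^ d = theta \<sigma> g u)"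

definition Z2_sharp :: "'k::field itself \<Rightarrow> ('g, 'm) monoid_scheme \<Rightarrow> 'g
    \<Rightarrow> ('g \<Rightarrow> 'g \<Rightarrow> 'k) monoid" where
  "Z2_sharp K G u = (Z2 K G)\<lparr>monoid.mult :=
     (\<lambda>\<sigma> \<omega> g h. \<sigma> g h * \<omega> g h * (- 1) ^ (cdeg u \<sigma> g * cdeg u \<omega> h))\<rparr>"

text \<open>Same underlying set as \<open>H2\<close>; the product of two classes is their elementwise product in
  \<open>Z2_sharp\<close>.\<close>

definition H2_sharp :: "'k::field itself \<Rightarrow> ('g, 'm) monoid_scheme \<Rightarrow> 'g
    \<Rightarrow> ('g \<Rightarrow> 'g \<Rightarrow> 'k) set monoid" where
  "H2_sharp K G u = (H2 K G)\<lparr>monoid.mult := set_mult (Z2_sharp K G u)\<rparr>"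


section \<open>Direct factors and short exact sequences\<close>

definition direct_factor :: "('g, 'm) monoid_scheme \<Rightarrow> 'g set \<Rightarrow> bool" where
  "direct_factor G U \<longleftrightarrow> U \<lhd> G \<and> (\<exists>N. N \<lhd> G \<and> N \<inter> U = {\<one>\<^bsub>G\<^esub>} \<and> N <#>\<^bsub>G\<^esub> U = carrier G)"

lemma direct_factor_imp_iso:
  assumes "direct_factor G U"
  shows "G \<cong> (G Mod U) \<times>\<times> (G\<lparr>carrier := U\<rparr>)"
proof -
  from assms obtain N where U: "U \<lhd> G" and N: "N \<lhd> G"
    and disj: "N \<inter> U = {\<one>\<^bsub>G\<^esub>}" and prod: "N <#>\<^bsub>G\<^esub> U = carrier G"
    unfolding direct_factor_def by blast
  interpret U: normal U G by (rule U)
  interpret N: normal N G by (rule N)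
  interpret D: group_disjoint_sum G N U
    by (simp add: group_disjoint_sum_def U.is_group U.subgroup_axioms N.subgroup_axioms)
  have gen: "subgroup_generated G N = G\<lparr>carrier := N\<rparr>" "subgroup_generated G U = G\<lparr>carrier := U\<rparr>"
    using N.carrier_subgroup_generated_subgroup U.carrier_subgroup_generated_subgroup
    by (simp_all add: subgroup_generated_def)
  let ?P = "(G\<lparr>carrier := N\<rparr>) \<times>\<times> (G\<lparr>carrier := U\<rparr>)"
  have "(\<lambda>(x, y). x \<otimes>\<^bsub>G\<^esub> y) \<in> iso ?P G"
    using U.iso_group_mul_gen[OF N U] disj prod gen by simp
  then have P: "?P \<cong> G" by (rule is_isoI)
  have grN: "group (G\<lparr>carrier := N\<rparr>)" and grU: "group (G\<lparr>carrier := U\<rparr>)"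
    using N.subgroup_is_group[OF U.is_group] U.subgroup_is_group[OF U.is_group] by auto
  have grP: "group ?P" by (rule DirProd_group[OF grN grU])
  have cancel: "n = n' \<and> v = v'"
    if "n \<in> N" "v \<in> U" "n' \<in> N" "v' \<in> U" "n \<otimes>\<^bsub>G\<^esub> v = n' \<otimes>\<^bsub>G\<^esub> v'" for n v n' v'
    using D.cancel disj that by blast
  have coset: "U #>\<^bsub>G\<^esub> n = n <#\<^bsub>G\<^esub> U" if "n \<in> N" for n
    using U.coset_eq that by auto
  let ?f = "\<lambda>(n, v). (U #>\<^bsub>G\<^esub> n, v)"
  have "?f \<in> iso ?P ((G Mod U) \<times>\<times> (G\<lparr>carrier := U\<rparr>))"
  proof (rule isoI)
    show "?f \<in> hom ?P ((G Mod U) \<times>\<times> (G\<lparr>carrier := U\<rparr>))"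
      by (rule homI) (auto simp: carrier_FactGroup U.rcos_sum)
    have "inj_on ?f (carrier ?P)"
    proof (rule inj_onI, clarsimp)
      fix n v n'
      assume n: "n \<in> N" and n': "n' \<in> N" and eq: "U #>\<^bsub>G\<^esub> n = U #>\<^bsub>G\<^esub> n'"
      have "n \<in> n' <#\<^bsub>G\<^esub> U"
        using U.rcos_self[OF N.mem_carrier[OF n] U.subgroup_axioms] eq coset[OF n'] by simp
      then obtain w where w: "w \<in> U" "n = n' \<otimes>\<^bsub>G\<^esub> w"
        by (auto simp: l_coset_def)
      then have "n \<otimes>\<^bsub>G\<^esub> \<one>\<^bsub>G\<^esub> = n' \<otimes>\<^bsub>G\<^esub> w" using n by simp
      then show "n = n'" using cancel[OF n subgroup.one_closed[OF U.subgroup_axioms] n' w(1)] by simp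
    qed
    moreover have "?f ` carrier ?P = carrier ((G Mod U) \<times>\<times> (G\<lparr>carrier := U\<rparr>))"
    proof -
      have ex: "\<exists>n\<in>N. U #>\<^bsub>G\<^esub> n = U #>\<^bsub>G\<^esub> x" if x: "x \<in> carrier G" for x
      proof -
        have "x \<in> N <#>\<^bsub>G\<^esub> U" using prod x by simp
        then obtain n v where nv: "n \<in> N" "v \<in> U" "x = n \<otimes>\<^bsub>G\<^esub> v"
          by (auto simp: set_mult_def)
        then have "x \<in> U #>\<^bsub>G\<^esub> n"
          unfolding coset[OF nv(1)] l_coset_def by blast
        then show ?thesis
          using U.repr_independence[OF _ N.mem_carrier[OF nv(1)] U.subgroup_axioms] nv(1) by metis
      qed
      have "(\<lambda>n. U #>\<^bsub>G\<^esub> n) ` N = (\<lambda>x. U #>\<^bsub>G\<^esub> x) ` carrier G"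
      proof
        show "(\<lambda>n. U #>\<^bsub>G\<^esub> n) ` N \<subseteq> (\<lambda>x. U #>\<^bsub>G\<^esub> x) ` carrier G"
          using N.subset by blast
        show "(\<lambda>x. U #>\<^bsub>G\<^esub> x) ` carrier G \<subseteq> (\<lambda>n. U #>\<^bsub>G\<^esub> n) ` N"
          by (rule image_subsetI) (metis ex imageI)
      qed
      moreover have "?f ` (N \<times> U) = ((\<lambda>n. U #>\<^bsub>G\<^esub> n) ` N) \<times> U"
        by auto
      ultimately show ?thesis by (simp add: carrier_FactGroup)
    qed
    ultimately show "bij_betw ?f (carrier ?P) (carrier ((G Mod U) \<times>\<times> (G\<lparr>carrier := U\<rparr>)))"
      by (simp add: bij_betw_def)
  qed
  then have Q: "?P \<cong> (G Mod U) \<times>\<times> (G\<lparr>carrier := U\<rparr>)" by (rule is_isoI)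
  show ?thesis by (rule iso_trans[OF group.iso_sym[OF grP P] Q])
qed

text \<open>\<open>short_exact_sequence\<close> from \<^theory>\<open>HOL-Algebra.Exact_Sequence\<close> forces all groups to have the same
  element type.\<close>

definition short_exact :: "('a, 'm) monoid_scheme \<Rightarrow> ('b, 'n) monoid_scheme
    \<Rightarrow> ('c, 'o) monoid_scheme \<Rightarrow> ('a \<Rightarrow> 'b) \<Rightarrow> ('b \<Rightarrow> 'c) \<Rightarrow> bool" where
  "short_exact A B C f g \<longleftrightarrow> group A \<and> group B \<and> group C
     \<and> f \<in> mon A B \<and> g \<in> epi B C \<and> kernel B C g = f ` carrier A"

end

theory Submission
  imports Defs "HOL-Library.Function_Algebras"
begin

text \<open>Since \<open>2\<close> is invertible, every \<open>G\<close>-algebra splits into the eigenspaces of \<open>u\<close> for the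
  eigenvalues \<open>1\<close> (even part) and \<open>-1\<close> (odd part), and \<open>R\<^sub>u\<close> acts on homogeneous elements through
  the sign rule. Thus \<open>\<sharp>\<close> is the super tensor product, \<open>BM(k, k[G], R\<^sub>u)\<close> is a Brauer group of super
  algebras with \<open>G\<close>-action, and the map to cohomology measures how far the action is from being inner
  in the super sense.

  The assumption that \<open>U\<close> is not a direct factor removes the super algebras of odd type. If an
  Azumaya algebra had a nonzero odd central element \<open>z\<close>, then \<open>z\<^sup>2\<close> would be a nonzero scalar, the
  group would act on the line spanned by \<open>z\<close> through a character with values \<open>1\<close> and \<open>-1\<close>, and the
  kernel of that character would be a complement of \<open>U\<close>. From this, \<open>azumaya_cs\<close> shows that an Azumaya
  algebra is central simple as an ordinary algebra. Conversely (\<open>cs_azumaya\<close>) the braided product of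
  central simple algebras is central simple (\<open>cs_bp\<close>), so \<open>F1\<close> and \<open>F2\<close> are injective, and they are bijective
  because source and target have the same dimension.

  By the Skolem-Noether theorem every \<open>g\<close> acts on a central simple \<open>A\<close> by an inner automorphism, and so
  does \<open>g \<otimes> u\<close>. Exactly one of the two is implemented by a unit \<open>x\<^sub>g\<close> whose degree matches
  the choice: an even \<open>x\<^sub>g\<close> with \<open>x\<^sub>g a = g(a) x\<^sub>g\<close>, or an odd one with \<open>x\<^sub>g a = (g \<otimes> u)(a) x\<^sub>g\<close>
  (\<open>superimp_exists\<close>, \<open>superimp_unique\<close>). It is unique up to a scalar, so
  \<open>x\<^sub>g x\<^sub>h = \<sigma>(g, h) x\<^bsub>g \<otimes> h\<^esub>\<close> defines a cocycle whose class depends only on \<open>A\<close>, and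
  the degree of \<open>x\<^sub>g\<close> is \<open>|g|\<^sub>\<sigma>\<close> (\<open>impl_cocycle\<close>). In a super tensor product the tensors
  \<open>x\<^sub>g \<otimes> y\<^sub>g\<close> implement \<open>g\<close>, up to a sign, and the sign rule for multiplying them is exactly the twist in
  the group law of \<open>H\<^sup>2\<^sub>\<sharp>\<close> (\<open>impl_bp\<close>). The endomorphism algebra of a \<open>G\<close>-module is implemented by the
  representation itself, with trivial cocycle, so the class is a Brauer invariant and gives the
  homomorphism \<open>bm_h2\<close> from \<open>BM(k, k[G], R\<^sub>u)\<close> to \<open>H\<^sup>2\<^sub>\<sharp>(G, k\<^sup>\<cdot>)\<close>.

  It is onto because the matrices of the twisted regular representation of \<open>\<sigma>\<close> implement an action
  on a matrix algebra (\<open>impl_surjective\<close>). If the class of \<open>A\<close> is trivial, the \<open>x\<^sub>g\<close> may be chosen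
  even and multiplicative. Left multiplication by them makes \<open>A\<close> a \<open>G\<close>-module \<open>M\<close>, and if \<open>A\<^sub>0\<close> denotes
  \<open>A\<close> with the trivial action, left and right multiplications identify the braided product of the
  opposite of \<open>A\<^sub>0\<close> with \<open>A\<close> as \<open>End(M)\<close>. So \<open>A\<close> and \<open>A\<^sub>0\<close> have the same class, and the kernel
  consists of the classes of algebras with trivial action, which is the image of \<open>Br(k)\<close>. The map from
  \<open>Br(k)\<close> is injective because an equivalence between algebras with trivial action remains one when the
  action on the endomorphism algebras is forgotten (\<open>Br_equiv_beq\<close>).

  Finally, the product of \<open>H\<^sup>2\<^sub>\<sharp>\<close> differs from that of \<open>H\<^sup>2\<close> by the class of the sign cocycle
  \<open>(-1)\<^bsup>d(g) e(h)\<^esup>\<close> built from the degrees \<open>d\<close> and \<open>e\<close> of the factors. These classes form a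
  symmetric bilinear pairing. If \<open>i\<^sup>2 = -1\<close>, the cocycle for \<open>d = e\<close> is the coboundary of
  \<open>g \<mapsto> i\<^bsup>d(g)\<^esup>\<close>, hence the pairing vanishes on the diagonal and has a quadratic refinement \<open>T\<close>
  (\<open>quadratic_refinement\<close>). Multiplying each class by the value of \<open>T\<close> at its degree then turns \<open>H\<^sup>2\<^sub>\<sharp>\<close>
  into \<open>H\<^sup>2\<close>.\<close>

section \<open>Linear maps on coordinate spaces\<close>

interpretation fv: vector_space "vscale :: 'k::field \<Rightarrow> ('i \<Rightarrow> 'k) \<Rightarrow> ('i \<Rightarrow> 'k)"
  by unfold_locales (auto simp: vscale_def fun_eq_iff algebra_simps)

lemma vadd_eq_plus: "vadd v w = v + w"
  by (simp add: vadd_def plus_fun_def)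

lemma vscale_apply [simp]: "vscale c v i = c * v i"
  by (simp add: vscale_def)

lemma sum_fun_apply: "(\<Sum>x\<in>S. F x) j = (\<Sum>x\<in>S. F x j)"
  by (induction S rule: infinite_finite_induct) auto

lemma zero_fun_eq: "(\<lambda>_. 0) = 0"
  by (simp add: zero_fun_def)

lemma linext_sum: "linext I f v = (\<Sum>i\<in>I. vscale (v i) (f i))"
  by (simp add: linext_def fun_eq_iff sum_fun_apply)

lemma vspace_zero [simp]: "0 \<in> vspace I"
  by (simp add: vspace_def)

lemma vspace_add [simp]: "v \<in> vspace I \<Longrightarrow> w \<in> vspace I \<Longrightarrow> v + w \<in> vspace I"
  by (simp add: vspace_def)

lemma vspace_scale [simp]: "v \<in> vspace I \<Longrightarrow> vscale c v \<in> vspace I"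
  by (simp add: vspace_def)

lemma vspace_minus [simp]: "v \<in> vspace I \<Longrightarrow> - v \<in> vspace I"
  by (simp add: vspace_def)

lemma vspace_diff [simp]: "v \<in> vspace I \<Longrightarrow> w \<in> vspace I \<Longrightarrow> v - w \<in> vspace I"
  by (simp add: vspace_def)

lemma vspace_sum [simp]: "(\<And>x. x \<in> S \<Longrightarrow> F x \<in> vspace I) \<Longrightarrow> (\<Sum>x\<in>S. F x) \<in> vspace I"
  by (induction S rule: infinite_finite_induct) auto

lemma vspace_bvec [simp]: "bvec i \<in> vspace I \<longleftrightarrow> i \<in> I"
  by (auto simp: vspace_def bvec_def)

lemma vspace_tens [simp]: "v \<in> vspace I \<Longrightarrow> w \<in> vspace J \<Longrightarrow> tens v w \<in> vspace (I \<times> J)"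
  by (auto simp: vspace_def tens_def)

lemma tens_add_left: "tens (v + w) x = tens v x + tens w x"
  and tens_add_right: "tens x (v + w) = tens x v + tens x w"
  and tens_diff_left: "tens (v - w) x = tens v x - tens w x"
  and tens_diff_right: "tens x (v - w) = tens x v - tens x w"
  and tens_minus_left: "tens (- v) x = - tens v x"
  and tens_minus_right: "tens x (- v) = - tens x v"
  and tens_scale_left: "tens (vscale c v) x = vscale c (tens v x)"
  and tens_scale_right: "tens x (vscale c v) = vscale c (tens x v)"
  and tens_zero_left: "tens 0 x = 0"
  and tens_zero_right: "tens x 0 = 0"
  by (auto simp: tens_def fun_eq_iff algebra_simps)

lemmas tens_simps = tens_add_left tens_add_right tens_diff_left tens_diff_right tens_minus_left
  tens_minus_right tens_scale_left tens_scale_right tens_zero_left tens_zero_right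

lemma tens_bvec: "tens (bvec i) (bvec j) = bvec (i, j)"
  by (auto simp: tens_def bvec_def fun_eq_iff)

lemma bvec_same [simp]: "bvec i i = 1"
  by (simp add: bvec_def)

text \<open>Unlike \<open>linear_on\<close>, this is linearity on the whole function type, so it can be used for rewriting
  without membership conditions.\<close>

definition vlin :: "(('i \<Rightarrow> 'k::field) \<Rightarrow> ('j \<Rightarrow> 'k)) \<Rightarrow> bool" where
  "vlin F \<longleftrightarrow> (\<forall>v w. F (v + w) = F v + F w) \<and> (\<forall>c v. F (vscale c v) = vscale c (F v))"

lemma vlinI: "(\<And>v w. F (v + w) = F v + F w) \<Longrightarrow> (\<And>c v. F (vscale c v) = vscale c (F v)) \<Longrightarrow> vlin F"
  by (simp add: vlin_def)

lemma vlin_add: "vlin F \<Longrightarrow> F (v + w) = F v + F w"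
  and vlin_scale: "vlin F \<Longrightarrow> F (vscale c v) = vscale c (F v)"
  by (simp_all add: vlin_def)

lemma vlin_zero: "vlin F \<Longrightarrow> F 0 = 0"
  using vlin_scale[of F 0 0] by simp

lemma vlin_minus: "vlin F \<Longrightarrow> F (- v) = - F v"
  using vlin_scale[of F "-1" v] by simp

lemma vlin_diff: "vlin F \<Longrightarrow> F (v - w) = F v - F w"
  using vlin_add[of F v "- w"] vlin_minus[of F w] by simp

lemma vlin_sum: "vlin F \<Longrightarrow> F (\<Sum>x\<in>S. f x) = (\<Sum>x\<in>S. F (f x))"
  by (induction S rule: infinite_finite_induct) (auto simp: vlin_add vlin_zero)

lemmas vlin_rules = vlin_add vlin_scale vlin_zero vlin_minus vlin_diff vlin_sum

lemma vlin_comp: "vlin F \<Longrightarrow> vlin F' \<Longrightarrow> vlin (\<lambda>v. F (F' v))"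
  by (simp add: vlin_def)

text \<open>A map between function spaces is \<open>tlin I\<close> if it is linear and only sees the coordinates in
  \<open>I\<close>. Such maps satisfy their linearity laws without side conditions.\<close>

definition tlin :: "'i set \<Rightarrow> (('i \<Rightarrow> 'k::field) \<Rightarrow> ('j \<Rightarrow> 'k)) \<Rightarrow> bool" where
  "tlin I F \<longleftrightarrow> (\<forall>v. F v = (\<Sum>i\<in>I. vscale (v i) (F (bvec i))))"

lemma tlinD: "tlin I F \<Longrightarrow> F v = (\<Sum>i\<in>I. vscale (v i) (F (bvec i)))"
  unfolding tlin_def by blast

lemma vlin_linext: "vlin (linext I f)"
  by (simp add: vlin_def linext_sum fv.scale_left_distrib sum.distrib fv.scale_sum_right)

lemma linext_bvec: "finite I \<Longrightarrow> i \<in> I \<Longrightarrow> linext I f (bvec i) = f i"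
  by (auto simp: linext_def bvec_def fun_eq_iff if_distrib[of "\<lambda>c. c * _"] cong: if_cong)

lemma tlin_linext: "finite I \<Longrightarrow> tlin I (linext I f)"
  by (simp add: tlin_def linext_bvec) (simp add: linext_sum)

lemma tlin_eq_linext: "tlin I F \<Longrightarrow> F = linext I (\<lambda>i. F (bvec i))"
  by (rule ext) (simp add: linext_sum tlinD[symmetric])

lemma tlin_vlin: "tlin I F \<Longrightarrow> vlin F"
  using vlin_linext[of I "\<lambda>i. F (bvec i)"] by (simp add: tlin_eq_linext[symmetric])

lemma tlin_comp: "vlin F \<Longrightarrow> tlin I F' \<Longrightarrow> tlin I (\<lambda>v. F (F' v))"
  unfolding tlin_def
proof
  fix v
  assume F: "vlin F" and F': "\<forall>v. F' v = (\<Sum>i\<in>I. vscale (v i) (F' (bvec i)))"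
  have "F (F' v) = F (\<Sum>i\<in>I. vscale (v i) (F' (bvec i)))" using F' by metis
  then show "F (F' v) = (\<Sum>i\<in>I. vscale (v i) (F (F' (bvec i))))"
    by (simp add: vlin_sum[OF F] vlin_scale[OF F])
qed

lemma tlin_add: "tlin I F \<Longrightarrow> tlin I F' \<Longrightarrow> tlin I (\<lambda>v. F v + F' v)"
  by (subst tlin_def) (simp add: fv.scale_right_distrib sum.distrib tlinD[symmetric])

lemma tlin_scale: "tlin I F \<Longrightarrow> tlin I (\<lambda>v. vscale c (F v))"
  by (intro tlin_comp[where F="vscale c"]) (simp_all add: vlin_def fv.scale_right_distrib mult.commute)

lemma tlin_minus: "tlin I F \<Longrightarrow> tlin I (\<lambda>v. - F v)"
  using tlin_scale[of I F "-1"] by simp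

lemma tlin_diff: "tlin I F \<Longrightarrow> tlin I F' \<Longrightarrow> tlin I (\<lambda>v. F v - F' v)"
  using tlin_add[OF _ tlin_minus] by simp

lemma tlin_zero: "tlin I (\<lambda>v. 0)"
  unfolding tlin_def by simp

lemma tlin_sum: "(\<And>x. x \<in> S \<Longrightarrow> tlin I (F x)) \<Longrightarrow> tlin I (\<lambda>v. \<Sum>x\<in>S. F x v)"
  by (induction S rule: infinite_finite_induct) (auto simp: tlin_zero intro: tlin_add)

lemmas tlin_intros = tlin_add tlin_scale tlin_minus tlin_diff tlin_zero tlin_sum

lemma tlin_ext:
  assumes "tlin I F" "tlin I F'" "\<And>i. i \<in> I \<Longrightarrow> F (bvec i) = F' (bvec i)"
  shows "F v = F' v"
  using assms tlinD[of I F v] tlinD[of I F' v] by simp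

definition crop :: "'i set \<Rightarrow> ('i \<Rightarrow> 'k::field) \<Rightarrow> 'i \<Rightarrow> 'k" where
  "crop I v = (\<lambda>i. if i \<in> I then v i else 0)"

lemma crop_vspace [simp]: "crop I v \<in> vspace I"
  by (simp add: crop_def vspace_def)

lemma crop_id [simp]: "v \<in> vspace I \<Longrightarrow> crop I v = v"
  by (auto simp: crop_def vspace_def)

lemma vspace_expand: "finite I \<Longrightarrow> crop I v = (\<Sum>i\<in>I. vscale (v i) (bvec i))"
  by (simp add: crop_def fun_eq_iff sum_fun_apply bvec_def if_distrib cong: if_cong)

lemma tlin_crop: "finite I \<Longrightarrow> tlin I (crop I)"
  unfolding tlin_def
proof
  fix v :: "'a \<Rightarrow> 'b" assume I: "finite I"
  have "(\<Sum>i\<in>I. vscale (v i) (crop I (bvec i))) = (\<Sum>i\<in>I. vscale (v i) (bvec i))"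
    by (rule sum.cong) auto
  then show "crop I v = (\<Sum>i\<in>I. vscale (v i) (crop I (bvec i)))"
    using vspace_expand[OF I, of v] by metis
qed

lemma tlin_crop_arg:
  assumes "tlin I F" shows "F (crop I v) = F v"
  using tlinD[OF assms, of v] tlinD[OF assms, of "crop I v"] by (simp add: crop_def)

lemma tlin_cropI:
  assumes "finite I"
    and "\<And>v w. v \<in> vspace I \<Longrightarrow> w \<in> vspace I \<Longrightarrow> F (v + w) = F v + F w"
    and "\<And>c v. v \<in> vspace I \<Longrightarrow> F (vscale c v) = vscale c (F v)"
  shows "tlin I (\<lambda>v. F (crop I v))"
proof -
  have l: "vlin (\<lambda>v. F (crop I v))"
    using assms(2,3) tlin_vlin[OF tlin_crop[OF assms(1), where ?'b='b]] unfolding vlin_def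
    by (metis crop_vspace)
  have "tlin I (\<lambda>v. F (crop I (crop I v)))"
    by (rule tlin_comp[OF l tlin_crop[OF assms(1)]])
  then show ?thesis by simp
qed

lemma tlin_ext_prod:
  assumes "tlin (I \<times> J) F" "tlin (I \<times> J) F'"
    "\<And>i j. i \<in> I \<Longrightarrow> j \<in> J \<Longrightarrow> F (tens (bvec i) (bvec j)) = F' (tens (bvec i) (bvec j))"
  shows "F v = F' v"
  using tlin_ext[OF assms(1,2)] assms(3) by (auto simp: tens_bvec)

lemma tlin_ext_prod_fun:
  assumes "tlin (I \<times> J) F" "tlin (I \<times> J) F'"
    "\<And>i j. i \<in> I \<Longrightarrow> j \<in> J \<Longrightarrow> F (tens (bvec i) (bvec j)) = F' (tens (bvec i) (bvec j))"
  shows "F = F'"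
  using tlin_ext_prod[OF assms] by blast

lemma crop_tens: "crop (I \<times> J) (tens a b) = tens (crop I a) (crop J b)"
  by (auto simp: crop_def tens_def fun_eq_iff)

text \<open>The Sweedler-type sums in the definitions are instances of the left-hand side with a bilinear \<open>F\<close>.\<close>

lemma linext_tens:
  assumes "finite I" "finite J" "\<And>b. tlin I (\<lambda>a. F a b)" "\<And>a. tlin J (F a)"
  shows "linext (I \<times> J) (\<lambda>(i, j). F (bvec i) (bvec j)) (tens a b) = F a b"
proof -
  have "F a b = (\<Sum>i\<in>I. vscale (a i) (F (bvec i) b))"
    by (rule tlinD[OF assms(3)])
  also have "\<dots> = (\<Sum>i\<in>I. vscale (a i) (\<Sum>j\<in>J. vscale (b j) (F (bvec i) (bvec j))))"
    using tlinD[OF assms(4)] by metis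
  also have "\<dots> = linext (I \<times> J) (\<lambda>(i, j). F (bvec i) (bvec j)) (tens a b)"
    by (simp add: linext_sum fv.scale_sum_right sum.cartesian_product tens_def case_prod_beta)
  finally show ?thesis by simp
qed

lemma vspace_span:
  assumes f: "finite I" shows "(vspace I :: ('a \<Rightarrow> 'b::field) set) = fv.span (bvec ` I)"
proof
  show "(vspace I :: ('a \<Rightarrow> 'b) set) \<subseteq> fv.span (bvec ` I)"
  proof
    fix v :: "'a \<Rightarrow> 'b" assume v: "v \<in> vspace I"
    then have "v = (\<Sum>i\<in>I. vscale (v i) (bvec i))" using vspace_expand[OF f, of v] by (metis crop_id)
    also have "\<dots> \<in> fv.span (bvec ` I)"
      by (intro fv.span_sum fv.span_scale fv.span_base) auto
    finally show "v \<in> fv.span (bvec ` I)" .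
  qed
  show "fv.span (bvec ` I) \<subseteq> (vspace I :: ('a \<Rightarrow> 'b) set)"
    by (rule fv.span_minimal) (auto simp: fv.subspace_def)
qed

lemma inj_bvec: "inj (bvec :: 'i \<Rightarrow> 'i \<Rightarrow> 'k::field)"
  by (rule injI) (auto simp: bvec_def fun_eq_iff split: if_splits)

lemma bvec_independent:
  assumes f: "finite I" shows "fv.independent ((bvec :: 'i \<Rightarrow> 'i \<Rightarrow> 'k::field) ` I)"
proof (rule fv.independent_if_scalars_zero)
  show "finite (bvec ` I)" using f by simp
  fix c :: "('i \<Rightarrow> 'k) \<Rightarrow> 'k" and x :: "'i \<Rightarrow> 'k"
  assume s: "(\<Sum>x\<in>bvec ` I. vscale (c x) x) = 0" and x: "x \<in> bvec ` I"
  from x obtain i where i: "i \<in> I" "x = bvec i" by auto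
  have "(\<Sum>x\<in>bvec ` I. vscale (c x) x) i = (\<Sum>i\<in>I. vscale (c (bvec i)) (bvec i)) i"
    using inj_bvec by (subst sum.reindex) (auto intro: inj_on_subset)
  also have "(\<Sum>i\<in>I. vscale (c (bvec i)) (bvec i)) i = (\<Sum>j\<in>I. if j = i then c (bvec j) else 0)"
    by (auto simp: sum_fun_apply bvec_def intro!: sum.cong)
  also have "\<dots> = c (bvec i)" using f i by simp
  finally show "c x = 0" using s i by simp
qed

text \<open>The dimension count used throughout: injective linear maps between spaces of the same
  dimension are onto.\<close>

lemma inj_imp_surj_vspace:
  fixes F :: "('i \<Rightarrow> 'k::field) \<Rightarrow> 'j \<Rightarrow> 'k"
  assumes I: "finite I" and J: "finite J" "card I = card J" and F: "vlin F"
    and FV: "\<And>v. v \<in> vspace I \<Longrightarrow> F v \<in> vspace J"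
    and inj: "\<And>v. v \<in> vspace I \<Longrightarrow> F v = 0 \<Longrightarrow> v = 0"
  shows "bij_betw F (vspace I) (vspace J)"
proof -
  have lin: "Vector_Spaces.linear vscale vscale F"
    using F by (simp add: Vector_Spaces.linear_iff vlin_def fv.vector_space_axioms)
  have injon: "inj_on F (vspace I)"
  proof (rule inj_onI)
    fix v w assume "v \<in> vspace I" "w \<in> vspace I" "F v = F w"
    then have "v - w = 0" by (intro inj) (auto simp: vlin_diff[OF F])
    then show "v = w" by simp
  qed
  interpret P: vector_space_pair "vscale :: 'k \<Rightarrow> ('i \<Rightarrow> 'k) \<Rightarrow> _" "vscale :: 'k \<Rightarrow> ('j \<Rightarrow> 'k) \<Rightarrow> _" ..
  let ?B = "F ` bvec ` I"
  have B: "fv.independent ?B"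
    using P.linear_independent_injective_image[OF lin bvec_independent[OF I]]
      injon unfolding vspace_span[OF I] by blast
  have cB: "card ?B = card J"
  proof -
    have "inj_on F (bvec ` I)" using injon by (rule inj_on_subset) auto
    then show ?thesis using J card_image[OF inj_on_subset[OF inj_bvec]] by (metis card_image subset_UNIV)
  qed
  have spB: "fv.span ?B = F ` vspace I"
    using P.linear_span_image[OF lin] vspace_span[OF I] by metis
  have "vspace J \<subseteq> fv.span ?B"
  proof
    fix y :: "'j \<Rightarrow> 'k" assume y: "y \<in> vspace J"
    show "y \<in> fv.span ?B"
    proof (rule ccontr)
      assume n: "y \<notin> fv.span ?B"
      then have ind: "fv.independent (insert y ?B)"
        using B by (rule fv.independent_insertI)
      have "insert y ?B \<subseteq> fv.span (bvec ` J)"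
        using y FV unfolding vspace_span[OF J(1), symmetric] by auto
      then have "card (insert y ?B) \<le> card (bvec ` J :: ('j \<Rightarrow> 'k) set)"
        using fv.independent_span_bound[OF _ ind] J by blast
      also have "\<dots> \<le> card J" using J by (simp add: card_image_le)
      finally have "card (insert y ?B) \<le> card J" .
      moreover have "y \<notin> ?B" "finite ?B" using n fv.span_base[of y ?B] I by auto
      ultimately show False using cB by simp
    qed
  qed
  then have "F ` vspace I = vspace J" using spB FV by auto
  then show ?thesis using injon by (simp add: bij_betw_def)
qed

text \<open>Pointwise multiplication of functions has its own numerals; arithmetic normalisation of \<open>v + v\<close>
  produces them.\<close>

lemma numeral_times_fun [simp]: "numeral w * (v :: 'i \<Rightarrow> 'k::field) = vscale (numeral w) v"
  by (simp add: fun_eq_iff)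

text \<open>The pointwise rules are kept out of the simplifier: linear-algebra identities are rewritten with
  the vector space operations first, and compared coordinatewise only as a last resort.\<close>

lemmas vec_apply = plus_fun_apply zero_fun_apply uminus_apply minus_apply vscale_apply sum_fun_apply

declare plus_fun_apply [simp del] zero_fun_apply [simp del] vscale_apply [simp del]
  uminus_apply [simp del] minus_apply [simp del]

section \<open>Algebras with a group action\<close>

abbreviation V :: "('i, 'k::field, 'x) falg_scheme \<Rightarrow> ('i \<Rightarrow> 'k) set" where
  "V A \<equiv> vspace (basis A)"

abbreviation ac :: "('i, 'k::field, 'g) hmalg \<Rightarrow> 'g \<Rightarrow> ('i \<Rightarrow> 'k) \<Rightarrow> 'i \<Rightarrow> 'k" where
  "ac A g \<equiv> act A (bvec g)"

lemma ring_of_simps [simp]: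
  "carrier (ring_of A) = V A" "monoid.mult (ring_of A) = amul A" "one (ring_of A) = aone A"
  "ring.zero (ring_of A) = 0" "add (ring_of A) = (+)"
  by (simp_all add: ring_of_def zero_fun_eq vadd_eq_plus fun_eq_iff vec_apply)

lemma fd_algebra_iff:
  "fd_algebra A \<longleftrightarrow> finite (basis A) \<and> aone A \<in> V A
     \<and> (\<forall>a\<in>V A. \<forall>b\<in>V A. amul A a b \<in> V A)
     \<and> (\<forall>a\<in>V A. amul A (aone A) a = a \<and> amul A a (aone A) = a)
     \<and> (\<forall>a\<in>V A. \<forall>b\<in>V A. \<forall>c\<in>V A. amul A (amul A a b) c = amul A a (amul A b c)
          \<and> amul A (a + b) c = amul A a c + amul A b c \<and> amul A c (a + b) = amul A c a + amul A c b)
     \<and> (\<forall>c. \<forall>v\<in>V A. \<forall>w\<in>V A.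
          amul A (vscale c v) w = vscale c (amul A v w)
        \<and> amul A v (vscale c w) = vscale c (amul A v w))" (is "?L \<longleftrightarrow> ?R")
proof
  assume ?L
  then have L: "finite (basis A)" "ring (ring_of A)" "\<forall>c. \<forall>v\<in>V A. \<forall>w\<in>V A.
          amul A (vscale c v) w = vscale c (amul A v w)
        \<and> amul A v (vscale c w) = vscale c (amul A v w)"
    unfolding fd_algebra_def by - (erule conjunct1, erule conjunct2[THEN conjunct1], erule conjunct2[THEN conjunct2])
  interpret ring "ring_of A" by (rule L)
  note r = m_closed one_closed l_one r_one m_assoc l_distr r_distr
  show ?R
    by (intro conjI ballI L) (simp_all only: r[unfolded ring_of_simps])
next
  assume R: ?R
  have "ring (ring_of A)"
  proof (rule ringI)
    show "abelian_group (ring_of A)"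
    proof (rule abelian_groupI)
      fix x assume "x \<in> carrier (ring_of A)"
      then show "\<exists>y\<in>carrier (ring_of A). y \<oplus>\<^bsub>ring_of A\<^esub> x = \<zero>\<^bsub>ring_of A\<^esub>"
        by (intro bexI[of _ "- x"]) auto
    qed (auto simp: algebra_simps)
    show "monoid (ring_of A)"
      by (rule monoidI) (use R in auto)
  qed (use R in auto)
  then show ?L using R by (simp add: fd_algebra_def)
qed

text \<open>The third parameter fixes the field of scalars.\<close>

locale central_involution = group G for G :: "('g, 'm) monoid_scheme" (structure) +
  fixes u :: 'g and K :: "'k::field itself"
  assumes fin: "finite (carrier G)" and u_closed [simp]: "u \<in> carrier G"
    and u_central: "g \<in> carrier G \<Longrightarrow> u \<otimes> g = g \<otimes> u"
    and u_sq [simp]: "u \<otimes> u = \<one>" and u_ne: "u \<noteq> \<one>" and two: "(2::'k) \<noteq> 0"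
begin

abbreviation H :: "('g, 'k) hopf" where "H \<equiv> group_alg G"
abbreviation R :: "'g \<times> 'g \<Rightarrow> 'k" where "R \<equiv> R_mat G u"

lemma basis_H [simp]: "basis H = carrier G"
  by (simp add: group_alg_def)

lemma fin2: "finite (carrier G \<times> carrier G)"
  using fin by simp

text \<open>Half the sum over the four corners is the sign rule: on eigenvectors of \<open>u\<close> with signs \<open>(-1)\<^sup>d\<close>
  and \<open>(-1)\<^sup>e\<close> it evaluates to \<open>(-1)\<^bsup>d e\<^esup>\<close>.\<close>

lemma linext_R:
  "linext (carrier G \<times> carrier G) (\<lambda>(p, q). F p q) R
     = vscale (1 / 2) (F \<one> \<one> + F \<one> u + F u \<one> - F u u)"
proof -
  have "R = vscale (1 / 2) (bvec (\<one>, \<one>) + bvec (\<one>, u) + bvec (u, \<one>) - bvec (u, u))"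
    by (simp add: R_mat_def fun_eq_iff tens_bvec vec_apply)
  then show ?thesis
    by (simp add: vlin_rules[OF vlin_linext] linext_bvec[OF fin2])
qed

lemma linext_comult:
  "linext (carrier G \<times> carrier G) (\<lambda>(p, q). F p q) (comult H h)
     = (\<Sum>g\<in>carrier G. vscale (h g) (F g g))"
proof -
  have "comult H h = (\<Sum>g\<in>carrier G. vscale (h g) (bvec (g, g)))"
    by (simp add: group_alg_def linext_sum tens_bvec)
  then show ?thesis
    by (simp add: vlin_rules[OF vlin_linext] linext_bvec[OF fin2])
qed

lemma amul_H: "g \<in> carrier G \<Longrightarrow> h \<in> carrier G \<Longrightarrow> amul H (bvec g) (bvec h) = bvec (g \<otimes> h)"
  by (simp add: group_alg_def linext_bvec[OF fin])

lemma aone_H: "aone H = bvec \<one>"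
  by (simp add: group_alg_def)

lemma counit_H: "counit H h = (\<Sum>g\<in>carrier G. h g)"
  by (simp add: group_alg_def)

lemma antipode_H: "g \<in> carrier G \<Longrightarrow> antipode H (bvec g) = bvec (inv g)"
  by (simp add: group_alg_def linext_bvec[OF fin])

lemma sum_bvec: "g \<in> carrier G \<Longrightarrow> (\<Sum>x\<in>carrier G. vscale (bvec g x) (f x)) = f g"
  using linext_bvec[OF fin, of g f] by (simp add: linext_sum)

lemma counit_bvec: "g \<in> carrier G \<Longrightarrow> counit H (bvec g) = 1"
  using fin by (simp add: counit_H bvec_def)

text \<open>The algebras used in the proofs: \<open>G\<close>-algebras whose operations are linear in each argument
  and see only the coordinates in the basis, so that their laws hold without membership conditions.\<close>

definition galg :: "('i, 'k, 'g) hmalg \<Rightarrow> bool" where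
  "galg A \<longleftrightarrow> finite (basis A) \<and> (\<forall>a b. amul A a b \<in> V A)
     \<and> (\<forall>a. tlin (basis A) (amul A a)) \<and> (\<forall>b. tlin (basis A) (\<lambda>a. amul A a b))
     \<and> (\<forall>a b c. amul A (amul A a b) c = amul A a (amul A b c))
     \<and> aone A \<in> V A \<and> (\<forall>a\<in>V A. amul A (aone A) a = a \<and> amul A a (aone A) = a)
     \<and> (\<forall>h v. act A h v = (\<Sum>g\<in>carrier G. vscale (h g) (ac A g v)))
     \<and> (\<forall>g\<in>carrier G. tlin (basis A) (ac A g) \<and> (\<forall>v. ac A g v \<in> V A)
          \<and> (\<forall>a b. ac A g (amul A a b) = amul A (ac A g a) (ac A g b))
          \<and> ac A g (aone A) = aone A
          \<and> (\<forall>h\<in>carrier G. \<forall>v. ac A (g \<otimes> h) v = ac A g (ac A h v)))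
     \<and> (\<forall>v\<in>V A. ac A \<one> v = v)"

lemma galgI:
  assumes "finite (basis A)" "\<And>a b. amul A a b \<in> V A" "\<And>a. tlin (basis A) (amul A a)"
    "\<And>b. tlin (basis A) (\<lambda>a. amul A a b)"
    "\<And>a b c. amul A (amul A a b) c = amul A a (amul A b c)" "aone A \<in> V A"
    "\<And>a. a \<in> V A \<Longrightarrow> amul A (aone A) a = a" "\<And>a. a \<in> V A \<Longrightarrow> amul A a (aone A) = a"
    "\<And>h v. act A h v = (\<Sum>g\<in>carrier G. vscale (h g) (ac A g v))"
    "\<And>g. g \<in> carrier G \<Longrightarrow> tlin (basis A) (ac A g)" "\<And>g v. g \<in> carrier G \<Longrightarrow> ac A g v \<in> V A"
    "\<And>g a b. g \<in> carrier G \<Longrightarrow> ac A g (amul A a b) = amul A (ac A g a) (ac A g b)"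
    "\<And>g. g \<in> carrier G \<Longrightarrow> ac A g (aone A) = aone A"
    "\<And>g h v. g \<in> carrier G \<Longrightarrow> h \<in> carrier G \<Longrightarrow> ac A (g \<otimes> h) v = ac A g (ac A h v)"
    "\<And>v. v \<in> V A \<Longrightarrow> ac A \<one> v = v"
  shows "galg A"
  unfolding galg_def by (intro conjI allI ballI; (rule assms; assumption)+)

lemma galgD:
  assumes "galg A"
  shows "finite (basis A)" "amul A a b \<in> V A" "tlin (basis A) (amul A a)"
    "tlin (basis A) (\<lambda>a. amul A a b)"
    "amul A (amul A a b) c = amul A a (amul A b c)" "aone A \<in> V A"
    "a \<in> V A \<Longrightarrow> amul A (aone A) a = a" "a \<in> V A \<Longrightarrow> amul A a (aone A) = a"
    "act A h a = (\<Sum>g\<in>carrier G. vscale (h g) (ac A g a))"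
    "g \<in> carrier G \<Longrightarrow> tlin (basis A) (ac A g)" "g \<in> carrier G \<Longrightarrow> ac A g a \<in> V A"
    "g \<in> carrier G \<Longrightarrow> ac A g (amul A a b) = amul A (ac A g a) (ac A g b)"
    "g \<in> carrier G \<Longrightarrow> ac A g (aone A) = aone A"
    "g \<in> carrier G \<Longrightarrow> g' \<in> carrier G \<Longrightarrow> ac A g (ac A g' a) = ac A (g \<otimes> g') a"
    "a \<in> V A \<Longrightarrow> ac A \<one> a = a"
proof -
  note c1 = assms[unfolded galg_def]
  note c2 = c1[THEN conjunct2] note c3 = c2[THEN conjunct2] note c4 = c3[THEN conjunct2]
  note c5 = c4[THEN conjunct2] note c6 = c5[THEN conjunct2] note c7 = c6[THEN conjunct2]
  note c8 = c7[THEN conjunct2] note c9 = c8[THEN conjunct2]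
  show "finite (basis A)" by (rule c1[THEN conjunct1])
  show "amul A a b \<in> V A" by (rule c2[THEN conjunct1, rule_format])
  show "tlin (basis A) (amul A a)" by (rule c3[THEN conjunct1, rule_format])
  show "tlin (basis A) (\<lambda>a. amul A a b)" by (rule c4[THEN conjunct1, rule_format])
  show "amul A (amul A a b) c = amul A a (amul A b c)" by (rule c5[THEN conjunct1, rule_format])
  show "aone A \<in> V A" by (rule c6[THEN conjunct1])
  show "a \<in> V A \<Longrightarrow> amul A (aone A) a = a" by (rule c7[THEN conjunct1, THEN bspec, THEN conjunct1])
  show "a \<in> V A \<Longrightarrow> amul A a (aone A) = a" by (rule c7[THEN conjunct1, THEN bspec, THEN conjunct2])
  show "act A h a = (\<Sum>g\<in>carrier G. vscale (h g) (ac A g a))" by (rule c8[THEN conjunct1, rule_format])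
  { assume g: "g \<in> carrier G"
    note d1 = c9[THEN conjunct1, THEN bspec, OF g] note d2 = d1[THEN conjunct2]
    note d3 = d2[THEN conjunct2] note d4 = d3[THEN conjunct2]
    show "tlin (basis A) (ac A g)" by (rule d1[THEN conjunct1])
    show "ac A g a \<in> V A" by (rule d2[THEN conjunct1, rule_format])
    show "ac A g (amul A a b) = amul A (ac A g a) (ac A g b)" by (rule d3[THEN conjunct1, rule_format])
    show "ac A g (aone A) = aone A" by (rule d4[THEN conjunct1])
    show "g' \<in> carrier G \<Longrightarrow> ac A g (ac A g' a) = ac A (g \<otimes> g') a"
      by (rule d4[THEN conjunct2, rule_format, symmetric]) }
  show "a \<in> V A \<Longrightarrow> ac A \<one> a = a" by (rule c9[THEN conjunct2, THEN bspec])
qed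

lemma galg_simps:
  assumes A: "galg A"
  shows "amul A (a + b) c = amul A a c + amul A b c" "amul A c (a + b) = amul A c a + amul A c b"
    "amul A (a - b) c = amul A a c - amul A b c" "amul A c (a - b) = amul A c a - amul A c b"
    "amul A (- a) c = - amul A a c" "amul A c (- a) = - amul A c a"
    "amul A (vscale r a) c = vscale r (amul A a c)" "amul A c (vscale r a) = vscale r (amul A c a)"
    "amul A 0 c = 0" "amul A c 0 = 0"
    "amul A (crop (basis A) a) c = amul A a c" "amul A c (crop (basis A) a) = amul A c a"
    "amul A (amul A a b) c = amul A a (amul A b c)"
    "amul A (aone A) a = crop (basis A) a" "amul A a (aone A) = crop (basis A) a"
    "g \<in> carrier G \<Longrightarrow> ac A g (a + b) = ac A g a + ac A g b"
    "g \<in> carrier G \<Longrightarrow> ac A g (a - b) = ac A g a - ac A g b"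
    "g \<in> carrier G \<Longrightarrow> ac A g (- a) = - ac A g a"
    "g \<in> carrier G \<Longrightarrow> ac A g (vscale r a) = vscale r (ac A g a)"
    "g \<in> carrier G \<Longrightarrow> ac A g 0 = 0"
    "g \<in> carrier G \<Longrightarrow> ac A g (crop (basis A) a) = ac A g a"
    "g \<in> carrier G \<Longrightarrow> ac A g (amul A a b) = amul A (ac A g a) (ac A g b)"
    "g \<in> carrier G \<Longrightarrow> ac A g (aone A) = aone A"
    "g \<in> carrier G \<Longrightarrow> g' \<in> carrier G \<Longrightarrow> ac A g (ac A g' a) = ac A (g \<otimes> g') a"
    "ac A \<one> a = crop (basis A) a"
proof -
  note L = tlin_vlin[OF galgD(4)[OF A]] and R = tlin_vlin[OF galgD(3)[OF A]]
    and C = tlin_vlin[OF galgD(10)[OF A]]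
  note [simp] = vlin_rules[OF L] vlin_rules[OF R] vlin_rules[OF C]
  show "amul A (a + b) c = amul A a c + amul A b c" "amul A c (a + b) = amul A c a + amul A c b"
    "amul A (a - b) c = amul A a c - amul A b c" "amul A c (a - b) = amul A c a - amul A c b"
    "amul A (- a) c = - amul A a c" "amul A c (- a) = - amul A c a"
    "amul A (vscale r a) c = vscale r (amul A a c)" "amul A c (vscale r a) = vscale r (amul A c a)"
    "amul A 0 c = 0" "amul A c 0 = 0" by simp_all
  show l: "amul A (crop (basis A) a) c = amul A a c" and r: "amul A c (crop (basis A) a) = amul A c a" for a c
    using tlin_crop_arg[OF galgD(3)[OF A]] tlin_crop_arg[OF galgD(4)[OF A]] by auto
  show "amul A (amul A a b) c = amul A a (amul A b c)" by (rule galgD[OF A])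
  show "amul A (aone A) a = crop (basis A) a" "amul A a (aone A) = crop (basis A) a"
    using galgD(7,8)[OF A, of "crop (basis A) a"] by (simp_all add: l r)
  show "g \<in> carrier G \<Longrightarrow> ac A g (a + b) = ac A g a + ac A g b"
    "g \<in> carrier G \<Longrightarrow> ac A g (a - b) = ac A g a - ac A g b"
    "g \<in> carrier G \<Longrightarrow> ac A g (- a) = - ac A g a"
    "g \<in> carrier G \<Longrightarrow> ac A g (vscale r a) = vscale r (ac A g a)"
    "g \<in> carrier G \<Longrightarrow> ac A g 0 = 0" by simp_all
  show c: "g \<in> carrier G \<Longrightarrow> ac A g (crop (basis A) a) = ac A g a" for g
    using tlin_crop_arg[OF galgD(10)[OF A]] by auto
  show "g \<in> carrier G \<Longrightarrow> ac A g (amul A a b) = amul A (ac A g a) (ac A g b)"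
    "g \<in> carrier G \<Longrightarrow> ac A g (aone A) = aone A"
    "g \<in> carrier G \<Longrightarrow> g' \<in> carrier G \<Longrightarrow> ac A g (ac A g' a) = ac A (g \<otimes> g') a"
    by (rule galgD(12)[OF A], assumption, rule galgD(13)[OF A], assumption, rule galgD(14)[OF A])
  show "ac A \<one> a = crop (basis A) a"
    using galgD(15)[OF A, of "crop (basis A) a"] c[of \<one>] by simp
qed

lemma galg_sum:
  assumes A: "galg A"
  shows "amul A (\<Sum>x\<in>S. f x) c = (\<Sum>x\<in>S. amul A (f x) c)" "amul A c (\<Sum>x\<in>S. f x) = (\<Sum>x\<in>S. amul A c (f x))"
    "g \<in> carrier G \<Longrightarrow> ac A g (\<Sum>x\<in>S. f x) = (\<Sum>x\<in>S. ac A g (f x))"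
  using vlin_sum[OF tlin_vlin[OF galgD(4)[OF A]]] vlin_sum[OF tlin_vlin[OF galgD(3)[OF A]]]
    vlin_sum[OF tlin_vlin[OF galgD(10)[OF A]]] by auto

lemma galg_closed [simp]:
  assumes "galg A" shows "amul A a b \<in> V A" "aone A \<in> V A" "g \<in> carrier G \<Longrightarrow> ac A g a \<in> V A"
  using galgD(2,6,11)[OF assms] by auto

text \<open>Group-like elements suffice: the action of \<open>k[G]\<close> is the linear extension of that of \<open>G\<close>, and the
  coproduct of \<open>k[G]\<close> is diagonal on \<open>G\<close>.\<close>

lemma galg_hmodule_algebra:
  assumes A: "galg A" shows "hmodule_algebra H A"
proof -
  note [simp] = galg_simps[OF A]
  have "fd_algebra A"
    unfolding fd_algebra_iff using galgD(1)[OF A] A by auto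
  moreover have "hmodule H \<lparr>mbasis = basis A, mact = act A\<rparr>"
  proof -
    have ax: "act A h v = linext (carrier G) (\<lambda>g. ac A g v) h" for h v
      by (simp only: linext_sum galgD(9)[OF A, of h v])
    have aV: "act A h v \<in> V A" for h v
      using A by (subst ax) (simp add: linext_sum)
    have lv: "vlin (\<lambda>h. act A h v)" for v
    proof -
      have "(\<lambda>h. act A h v) = linext (carrier G) (\<lambda>g. ac A g v)" by (rule ext) (rule ax)
      then show ?thesis by (rule ssubst) (rule vlin_linext)
    qed
    have la: "vlin (act A h)" for h
    proof -
      have "act A h = (\<lambda>v. \<Sum>g\<in>carrier G. vscale (h g) (ac A g v))" by (rule ext) (rule galgD(9)[OF A])
      then show ?thesis
        by (rule ssubst) (rule vlinI, simp_all add: fv.scale_right_distrib sum.distrib fv.scale_sum_right mult.commute)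
    qed
    have 1: "linear_on (basis A) (basis A) (act A h)" for h
      by (auto simp: linear_on_def vadd_eq_plus vlin_rules[OF la] aV)
    have 2: "linear_on (carrier G) (basis A) (\<lambda>h. act A h v)" for v
      by (auto simp: linear_on_def vadd_eq_plus vlin_rules[OF lv] aV)
    have 3: "act A (amul H g h) v = act A g (act A h v)" for g h v
    proof -
      have "act A (amul H g h) v = (\<Sum>p\<in>carrier G. vscale (g p) (\<Sum>q\<in>carrier G. vscale (h q) (ac A (p \<otimes> q) v)))"
        by (simp add: group_alg_def linext_sum vlin_rules[OF lv])
      also have "\<dots> = act A g (act A h v)"
        by (subst ax[of g], subst ax[of h]) (simp add: linext_sum galg_sum[OF A])
      finally show ?thesis .
    qed
    have 4: "act A (aone H) v = v" if "v \<in> V A" for v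
      using galgD(15)[OF A that] by (simp add: aone_H)
    show ?thesis
      using 1 2 3 4 galgD(1)[OF A] by (simp add: hmodule_def)
  qed
  moreover have "act A h (amul A a b) =
      linext (basis H \<times> basis H) (\<lambda>(p, q). amul A (ac A p a) (ac A q b)) (comult H h)" for h a b
    unfolding basis_H linext_comult by (subst galgD(9)[OF A]) simp
  moreover have "act A h (aone A) = vscale (counit H h) (aone A)" for h
    by (subst galgD(9)[OF A]) (simp add: counit_H fv.scale_sum_left)
  ultimately show ?thesis unfolding hmodule_algebra_def by blast
qed

text \<open>The axioms of a module algebra constrain multiplication and action only on vectors supported on
  the basis. Cropping the arguments first gives a representative with good behaviour everywhere.\<close>

definition nrm :: "('i, 'k, 'g) hmalg \<Rightarrow> ('i, 'k, 'g) hmalg" where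
  "nrm A = A\<lparr>amul := \<lambda>a b. amul A (crop (basis A) a) (crop (basis A) b),
             act := \<lambda>h v. act A (crop (carrier G) h) (crop (basis A) v)\<rparr>"

lemma nrm_simps [simp]:
  "basis (nrm A) = basis A" "aone (nrm A) = aone A"
  by (simp_all add: nrm_def)

lemma nrm_amul: "a \<in> V A \<Longrightarrow> b \<in> V A \<Longrightarrow> amul (nrm A) a b = amul A a b"
  and nrm_ac: "g \<in> carrier G \<Longrightarrow> a \<in> V A \<Longrightarrow> ac (nrm A) g a = ac A g a"
  by (simp_all add: nrm_def)

lemma hmodule_algebraD:
  assumes "hmodule_algebra H A"
  shows "fd_algebra A" "h \<in> vspace (carrier G) \<Longrightarrow> a \<in> V A \<Longrightarrow> act A h a \<in> V A"
    "h \<in> vspace (carrier G) \<Longrightarrow> a \<in> V A \<Longrightarrow> b \<in> V A \<Longrightarrow> act A h (a + b) = act A h a + act A h b"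
    "h \<in> vspace (carrier G) \<Longrightarrow> a \<in> V A \<Longrightarrow> act A h (vscale c a) = vscale c (act A h a)"
    "h \<in> vspace (carrier G) \<Longrightarrow> h' \<in> vspace (carrier G) \<Longrightarrow> a \<in> V A \<Longrightarrow> act A (h + h') a = act A h a + act A h' a"
    "h \<in> vspace (carrier G) \<Longrightarrow> a \<in> V A \<Longrightarrow> act A (vscale c h) a = vscale c (act A h a)"
    "g \<in> carrier G \<Longrightarrow> g' \<in> carrier G \<Longrightarrow> a \<in> V A \<Longrightarrow> ac A (g \<otimes> g') a = ac A g (ac A g' a)"
    "a \<in> V A \<Longrightarrow> ac A \<one> a = a"
    "g \<in> carrier G \<Longrightarrow> a \<in> V A \<Longrightarrow> b \<in> V A \<Longrightarrow> ac A g (amul A a b) = amul A (ac A g a) (ac A g b)"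
    "g \<in> carrier G \<Longrightarrow> ac A g (aone A) = aone A"
proof -
  have M: "fd_algebra A" "hmodule H \<lparr>mbasis = basis A, mact = act A\<rparr>"
    and X: "\<And>h a b. h \<in> vspace (carrier G) \<Longrightarrow> a \<in> V A \<Longrightarrow> b \<in> V A \<Longrightarrow> act A h (amul A a b) =
      linext (basis H \<times> basis H) (\<lambda>(p, q). amul A (ac A p a) (ac A q b)) (comult H h)"
    and Y: "\<And>h. h \<in> vspace (carrier G) \<Longrightarrow> act A h (aone A) = vscale (counit H h) (aone A)"
    using assms unfolding hmodule_algebra_def basis_H by blast+
  note M2 = M(2)[unfolded hmodule_def linear_on_def hmod.simps basis_H vadd_eq_plus]
  show "fd_algebra A" by fact
  show "h \<in> vspace (carrier G) \<Longrightarrow> a \<in> V A \<Longrightarrow> act A h a \<in> V A"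
    "h \<in> vspace (carrier G) \<Longrightarrow> a \<in> V A \<Longrightarrow> b \<in> V A \<Longrightarrow> act A h (a + b) = act A h a + act A h b"
    "h \<in> vspace (carrier G) \<Longrightarrow> a \<in> V A \<Longrightarrow> act A h (vscale c a) = vscale c (act A h a)"
    "h \<in> vspace (carrier G) \<Longrightarrow> h' \<in> vspace (carrier G) \<Longrightarrow> a \<in> V A \<Longrightarrow> act A (h + h') a = act A h a + act A h' a"
    "h \<in> vspace (carrier G) \<Longrightarrow> a \<in> V A \<Longrightarrow> act A (vscale c h) a = vscale c (act A h a)"
    using M2 by blast+
  show "g \<in> carrier G \<Longrightarrow> g' \<in> carrier G \<Longrightarrow> a \<in> V A \<Longrightarrow> ac A (g \<otimes> g') a = ac A g (ac A g' a)"
    using M2 amul_H[of g g'] vspace_bvec by metis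
  show "a \<in> V A \<Longrightarrow> ac A \<one> a = a"
    using M2 unfolding aone_H by blast
  show "g \<in> carrier G \<Longrightarrow> a \<in> V A \<Longrightarrow> b \<in> V A \<Longrightarrow> ac A g (amul A a b) = amul A (ac A g a) (ac A g b)"
    using X[of "bvec g" a b] unfolding basis_H linext_comult by (simp add: sum_bvec)
  show "g \<in> carrier G \<Longrightarrow> ac A g (aone A) = aone A"
    using Y[of "bvec g"] by (simp add: counit_bvec)
qed

lemma galg_nrm:
  assumes "hmodule_algebra H A" shows "galg (nrm A)"
proof -
  note D = hmodule_algebraD[OF assms]
  note F = D(1)[unfolded fd_algebra_iff]
  have I: "finite (basis A)" using F by blast
  have am: "amul (nrm A) a b = amul A (crop (basis A) a) (crop (basis A) b)" for a b
    by (simp add: nrm_def)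
  have ah: "act (nrm A) h a = act A (crop (carrier G) h) (crop (basis A) a)" for h a
    by (simp add: nrm_def)
  have ag: "ac (nrm A) g a = ac A g (crop (basis A) a)" if "g \<in> carrier G" for g a
    using that by (simp add: nrm_def)
  show ?thesis
  proof (rule galgI)
    show "finite (basis (nrm A))" using I by simp
    show "amul (nrm A) a b \<in> V (nrm A)" for a b using F by (simp add: am)
    show "tlin (basis (nrm A)) (amul (nrm A) a)" for a
      using tlin_cropI[OF I, of "amul A (crop (basis A) a)"] F unfolding nrm_simps am by simp
    show "tlin (basis (nrm A)) (\<lambda>a. amul (nrm A) a b)" for b
      using tlin_cropI[OF I, of "\<lambda>a. amul A a (crop (basis A) b)"] F unfolding nrm_simps am by simp
    show "amul (nrm A) (amul (nrm A) a b) c = amul (nrm A) a (amul (nrm A) b c)" for a b c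
      using F by (simp add: am)
    show "aone (nrm A) \<in> V (nrm A)" using F by simp
    show "amul (nrm A) (aone (nrm A)) a = a" "amul (nrm A) a (aone (nrm A)) = a" if "a \<in> V (nrm A)" for a
      using F that by (simp_all add: am)
    show "act (nrm A) h v = (\<Sum>g\<in>carrier G. vscale (h g) (ac (nrm A) g v))" for h v
    proof -
      have "tlin (carrier G) (\<lambda>h. act A (crop (carrier G) h) (crop (basis A) v))"
        using tlin_cropI[OF fin, of "\<lambda>h. act A h (crop (basis A) v)"] D(5,6) by simp
      from tlinD[OF this, of h] show ?thesis by (simp add: ah)
    qed
    fix g assume g: "g \<in> carrier G"
    show "tlin (basis (nrm A)) (ac (nrm A) g)"
      using tlin_cropI[OF I, of "ac A g"] D(3,4) g by (simp add: ag[OF g, abs_def])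
    show "ac (nrm A) g v \<in> V (nrm A)" for v using D(2) g by (simp add: ag)
    show "ac (nrm A) g (amul (nrm A) a b) = amul (nrm A) (ac (nrm A) g a) (ac (nrm A) g b)" for a b
      using D(2,9) g F by (simp add: ag am)
    show "ac (nrm A) g (aone (nrm A)) = aone (nrm A)" using D(10) g F by (simp add: ag)
    show "ac (nrm A) (g \<otimes> h) v = ac (nrm A) g (ac (nrm A) h v)" if "h \<in> carrier G" for h v
      using D(2,7) g that by (simp add: ag)
  next
    show "ac (nrm A) \<one> v = v" if "v \<in> V (nrm A)" for v using that D(8) by (simp add: ag)
  qed
qed

section \<open>Equivariant homomorphisms\<close>

definition ghom :: "('i, 'k, 'g) hmalg \<Rightarrow> ('j, 'k, 'g) hmalg \<Rightarrow> (('i \<Rightarrow> 'k) \<Rightarrow> 'j \<Rightarrow> 'k) \<Rightarrow> bool" where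
  "ghom A B f \<longleftrightarrow> tlin (basis A) f \<and> (\<forall>v. f v \<in> V B) \<and> f (aone A) = aone B
     \<and> (\<forall>a b. f (amul A a b) = amul B (f a) (f b))
     \<and> (\<forall>g\<in>carrier G. \<forall>a. f (ac A g a) = ac B g (f a))"

lemma ghomI:
  assumes "tlin (basis A) f" "\<And>v. f v \<in> V B" "f (aone A) = aone B"
    "\<And>a b. f (amul A a b) = amul B (f a) (f b)"
    "\<And>g a. g \<in> carrier G \<Longrightarrow> f (ac A g a) = ac B g (f a)"
  shows "ghom A B f"
  using assms unfolding ghom_def by blast

lemma ghomD:
  assumes "ghom A B f"
  shows "tlin (basis A) f" "f v \<in> V B" "f (aone A) = aone B"
    "f (amul A a b) = amul B (f a) (f b)"
    "g \<in> carrier G \<Longrightarrow> f (ac A g a) = ac B g (f a)" "vlin f"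
    "f (crop (basis A) a) = f a"
  using assms tlin_vlin[of "basis A" f] tlin_crop_arg[of "basis A" f] unfolding ghom_def by blast+

lemma ghom_act:
  assumes "ghom A B f" "galg A" "galg B"
  shows "f (act A h a) = act B h (f a)"
proof -
  have "f (act A h a) = f (\<Sum>g\<in>carrier G. vscale (h g) (ac A g a))"
    using galgD(9)[OF assms(2), of h a] by (rule arg_cong)
  also have "\<dots> = (\<Sum>g\<in>carrier G. vscale (h g) (ac B g (f a)))"
    using assms(1) by (simp add: vlin_sum[OF ghomD(6)] vlin_scale[OF ghomD(6)] ghomD(5))
  also have "\<dots> = act B h (f a)"
    using galgD(9)[OF assms(3), of h "f a"] by simp
  finally show ?thesis .
qed

definition giso :: "('i, 'k, 'g) hmalg \<Rightarrow> ('j, 'k, 'g) hmalg \<Rightarrow> bool" where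
  "giso A B \<longleftrightarrow> (\<exists>f. ghom A B f \<and> bij_betw f (V A) (V B))"

lemma ghom_comp:
  assumes "ghom A B f" "ghom B C h" shows "ghom A C (\<lambda>v. h (f v))"
  by (rule ghomI) (simp_all add: ghomD[OF assms(1)] ghomD[OF assms(2)] tlin_comp)

lemma ghom_crop: "galg A \<Longrightarrow> ghom A A (crop (basis A))"
  by (rule ghomI) (auto simp: galg_simps tlin_crop galgD(1))

lemma giso_refl: "galg A \<Longrightarrow> giso A A"
  unfolding giso_def
  by (rule exI[of _ "crop (basis A)"]) (auto simp: ghom_crop bij_betw_def inj_on_def image_iff)

lemma giso_trans:
  assumes "giso A B" "giso B C" shows "giso A C"
proof -
  from assms obtain f h where fh: "ghom A B f" "bij_betw f (V A) (V B)" "ghom B C h" "bij_betw h (V B) (V C)"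
    unfolding giso_def by blast
  have "bij_betw (\<lambda>v. h (f v)) (V A) (V C)"
    using bij_betw_trans[OF fh(2,4)] by (simp add: comp_def)
  with ghom_comp[OF fh(1,3)] show ?thesis unfolding giso_def by blast
qed

lemma giso_sym:
  assumes "giso A B" "galg A" "galg B" shows "giso B A"
proof -
  from assms(1) obtain f where f: "ghom A B f" and b: "bij_betw f (V A) (V B)"
    by (auto simp: giso_def)
  let ?i = "inv_into (V A) f"
  let ?h = "\<lambda>v. ?i (crop (basis B) v)"
  note D = ghomD[OF f]
  have bi: "bij_betw ?i (V B) (V A)" using b by (rule bij_betw_inv_into)
  have iV: "?i v \<in> V A" if "v \<in> V B" for v using bij_betw_apply[OF bi that] .
  have fi: "f (?i v) = v" if "v \<in> V B" for v using bij_betw_inv_into_right[OF b that] .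
  have "inj_on f (V A)" using b by (simp add: bij_betw_def)
  then have eq: "?i v = a" if "a \<in> V A" "f a = v" for a v
    using that by (metis inv_into_f_f)
  have fh: "f (?h v) = crop (basis B) v" for v using fi by simp
  have hV: "?h v \<in> V A" for v using iV by simp
  have "ghom B A ?h"
  proof (rule ghomI)
    show "tlin (basis B) ?h"
    proof (rule tlin_cropI)
      show "finite (basis B)" using assms(3) galgD(1) by blast
      show "?i (v + w) = ?i v + ?i w" if "v \<in> V B" "w \<in> V B" for v w
        using that by (intro eq) (auto simp: iV fi vlin_add[OF D(6)])
      show "?i (vscale c v) = vscale c (?i v)" if "v \<in> V B" for c v
        using that by (intro eq) (auto simp: iV fi vlin_scale[OF D(6)])
    qed
    show "?h v \<in> V A" for v by (rule hV)
    show "?h (aone B) = aone A" using assms by (intro eq) (simp_all add: D(3))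
    show "?h (amul B a b) = amul A (?h a) (?h b)" for a b
      using assms by (intro eq) (simp_all add: D(4) fi galg_simps)
    show "?h (ac B g a) = ac A g (?h a)" if "g \<in> carrier G" for g a
      using assms that by (intro eq) (simp_all add: D(5) fi galg_simps)
  qed
  moreover have "bij_betw ?h (V B) (V A)"
    using bi by (rule bij_betw_cong[THEN iffD1, rotated]) simp
  ultimately show ?thesis unfolding giso_def by blast
qed

lemma giso_hma_iso:
  assumes "giso A B" "galg A" "galg B" shows "hma_iso H A B (SOME f. ghom A B f \<and> bij_betw f (V A) (V B))"
proof -
  from assms(1) have "\<exists>f. ghom A B f \<and> bij_betw f (V A) (V B)" by (simp add: giso_def)
  then show ?thesis
  proof (rule someI2_ex)
    fix f assume f: "ghom A B f \<and> bij_betw f (V A) (V B)"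
    then have f: "ghom A B f" "bij_betw f (V A) (V B)" by auto
    show "hma_iso H A B f"
      unfolding hma_iso_def alg_iso_def ring_iso_def ring_hom_def
      using f ghomD[OF f(1)] ghom_act[OF f(1) assms(2,3)] by (auto simp: vlin_rules)
  qed
qed

lemma giso_iff:
  assumes "galg A" "galg B" shows "giso A B \<longleftrightarrow> (\<exists>f. hma_iso H A B f)"
proof
  assume "\<exists>f. hma_iso H A B f"
  then obtain f where f: "hma_iso H A B f" ..
  then have r: "f \<in> ring_iso (ring_of A) (ring_of B)"
    and s: "\<And>c v. v \<in> V A \<Longrightarrow> f (vscale c v) = vscale c (f v)"
    and a: "\<And>g v. g \<in> carrier G \<Longrightarrow> v \<in> V A \<Longrightarrow> f (ac A g v) = ac B g (f v)"
    unfolding hma_iso_def alg_iso_def by auto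
  have bij: "bij_betw f (V A) (V B)" using r by (simp add: ring_iso_def)
  have fV: "f v \<in> V B" if "v \<in> V A" for v using bij that by (rule bij_betw_apply)
  have rh: "f (v + w) = f v + f w" "f (amul A v w) = amul B (f v) (f w)" "f (aone A) = aone B"
    if "v \<in> V A" "w \<in> V A" for v w
    using r that by (auto simp: ring_iso_def ring_hom_def)
  have "ghom A B (\<lambda>v. f (crop (basis A) v))"
  proof (rule ghomI)
    show "tlin (basis A) (\<lambda>v. f (crop (basis A) v))"
      using assms rh s by (intro tlin_cropI) (auto simp: galgD(1))
    show "f (crop (basis A) (amul A a b)) = amul B (f (crop (basis A) a)) (f (crop (basis A) b))" for a b
      using rh(2)[of "crop (basis A) a" "crop (basis A) b"] assms by (simp add: galg_simps)
    show "f (crop (basis A) (ac A g v)) = ac B g (f (crop (basis A) v))" if "g \<in> carrier G" for g v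
      using a[OF that, of "crop (basis A) v"] assms that by (simp add: galg_simps)
  qed (use assms rh[of 0 0] fV in auto)
  moreover have "bij_betw (\<lambda>v. f (crop (basis A) v)) (V A) (V B)"
    using bij by (rule bij_betw_cong[THEN iffD1, rotated]) simp
  ultimately show "giso A B" unfolding giso_def by blast
qed (use giso_hma_iso[OF _ assms] in blast)

end

section \<open>Central simple algebras and inner automorphisms\<close>

text \<open>The multiplication ring of \<open>A\<close>: everything generated by left and right multiplications under
  composition and sums. Its orbits are the two-sided ideals, so over a simple algebra it acts
  irreducibly on \<open>A\<close>, with the centre as commutant.\<close>

inductive_set mops :: "('i, 'k::field, 'x) falg_scheme \<Rightarrow> (('i \<Rightarrow> 'k) \<Rightarrow> 'i \<Rightarrow> 'k) set"
  for A :: "('i, 'k, 'x) falg_scheme" where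
  left: "a \<in> V A \<Longrightarrow> amul A a \<in> mops A"
| right: "a \<in> V A \<Longrightarrow> (\<lambda>x. amul A x a) \<in> mops A"
| comp: "S \<in> mops A \<Longrightarrow> T \<in> mops A \<Longrightarrow> (\<lambda>x. S (T x)) \<in> mops A"
| plus: "S \<in> mops A \<Longrightarrow> T \<in> mops A \<Longrightarrow> (\<lambda>x. S x + T x) \<in> mops A"

text \<open>Two-sided ideals without the ring structure of \<open>ring_of\<close>.\<close>

definition idl :: "('i, 'k::field, 'x) falg_scheme \<Rightarrow> ('i \<Rightarrow> 'k) set \<Rightarrow> bool" where
  "idl A J \<longleftrightarrow> J \<subseteq> V A \<and> 0 \<in> J \<and> (\<forall>x\<in>J. \<forall>y\<in>J. x + y \<in> J)
     \<and> (\<forall>x\<in>J. \<forall>a\<in>V A. amul A a x \<in> J \<and> amul A x a \<in> J)"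

lemma vlin_span_zero:
  assumes "vlin T" "\<And>x. x \<in> S \<Longrightarrow> T x = 0" "y \<in> fv.span S" shows "T y = 0"
proof -
  have "fv.span S \<subseteq> {y. T y = 0}"
    by (rule fv.span_minimal) (use assms(1,2) in \<open>auto simp: fv.subspace_def vlin_rules\<close>)
  then show ?thesis using assms(3) by blast
qed

context central_involution begin

lemma galg_fd: "galg A \<Longrightarrow> fd_algebra A"
  using galg_hmodule_algebra unfolding hmodule_algebra_def by blast

lemma ideal_iff_idl:
  assumes A: "fd_algebra A" shows "ideal J (ring_of A) \<longleftrightarrow> idl A J"
proof
  interpret ring "ring_of A" using A by (simp add: fd_algebra_def)
  assume "ideal J (ring_of A)"
  then interpret I: ideal J "ring_of A" .
  show "idl A J"
    using I.a_closed I.zero_closed I.I_l_closed I.I_r_closed I.a_subset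
    by (simp add: idl_def)
next
  interpret ring "ring_of A" using A by (simp add: fd_algebra_def)
  assume J: "idl A J"
  note D = A[unfolded fd_algebra_iff]
  have m: "- x \<in> J" if "x \<in> J" for x
  proof -
    have x: "x \<in> V A" and one: "aone A \<in> V A" using J that D by (auto simp: idl_def)
    have "amul A (vscale (- 1) (aone A)) x \<in> J" using J that one by (simp add: idl_def)
    moreover have "amul A (vscale (- 1) (aone A)) x = - x"
      using D x one by (metis fv.scale_minus_left fv.scale_one)
    ultimately show ?thesis by simp
  qed
  have "subgroup J (add_monoid (ring_of A))"
  proof (rule add.subgroupI)
    fix x assume x: "x \<in> J"
    then have "\<ominus>\<^bsub>ring_of A\<^esub> x = - x"
      using J by (intro minus_equality) (auto simp: idl_def)
    then show "\<ominus>\<^bsub>ring_of A\<^esub> x \<in> J" using m[OF x] by simp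
  qed (use J in \<open>auto simp: idl_def\<close>)
  then show "ideal J (ring_of A)"
    by (rule idealI[OF ring_axioms]) (use J in \<open>auto simp: idl_def\<close>)
qed

definition cs :: "('i, 'k, 'g) hmalg \<Rightarrow> bool" where
  "cs A \<longleftrightarrow> galg A \<and> basis A \<noteq> {}
     \<and> (\<forall>z\<in>V A. (\<forall>v\<in>V A. amul A z v = amul A v z) \<longrightarrow> (\<exists>c. z = vscale c (aone A)))
     \<and> (\<forall>J. idl A J \<longrightarrow> J = {0} \<or> J = V A)"

lemma cs_iff:
  assumes A: "galg A" shows "central_simple A \<longleftrightarrow> cs A"
proof -
  have "{vscale c (aone A) | c. True} \<subseteq> {z \<in> V A. \<forall>v\<in>V A. amul A z v = amul A v z}"
    using A by (auto simp: galg_simps[OF A])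
  moreover have "fd_algebra A" using A by (rule galg_fd)
  ultimately show ?thesis
    unfolding central_simple_def cs_def ideal_iff_idl[OF galg_fd[OF A]] zero_fun_eq using A by blast
qed

lemma cs_galg [simp]: "cs A \<Longrightarrow> galg A"
  and cs_nonempty: "cs A \<Longrightarrow> basis A \<noteq> {}"
  and cs_center: "cs A \<Longrightarrow> z \<in> V A \<Longrightarrow> (\<And>v. v \<in> V A \<Longrightarrow> amul A z v = amul A v z) \<Longrightarrow> \<exists>c. z = vscale c (aone A)"
  and cs_idl: "cs A \<Longrightarrow> idl A J \<Longrightarrow> x \<in> J \<Longrightarrow> x \<noteq> 0 \<Longrightarrow> J = V A"
  unfolding cs_def by blast+

lemma bvec_nonzero: "bvec i \<noteq> (0 :: 'i \<Rightarrow> 'k)"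
proof
  assume "bvec i = (0 :: 'i \<Rightarrow> 'k)"
  then have "bvec i i = (0 :: 'i \<Rightarrow> 'k) i" by simp
  then show False by (simp add: vec_apply)
qed

lemma galg_one_nonzero:
  assumes "galg A" "basis A \<noteq> {}" shows "aone A \<noteq> 0"
proof
  assume z: "aone A = 0"
  from assms(2) obtain i where i: "i \<in> basis A" by blast
  have "amul A (aone A) (bvec i) = bvec i" using i by (simp add: galg_simps[OF assms(1)])
  then show False using z by (simp add: galg_simps[OF assms(1)] bvec_nonzero[symmetric])
qed

lemma cs_one_nonzero: "cs A \<Longrightarrow> aone A \<noteq> 0"
  by (simp add: galg_one_nonzero cs_nonempty)

lemma mops_tlin:
  assumes A: "galg A" and T: "T \<in> mops A" shows "tlin (basis A) T" "T v \<in> V A"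
proof -
  have "tlin (basis A) T \<and> (\<forall>v. T v \<in> V A)"
    using T by induction (auto simp: A galgD(3,4)[OF A] tlin_add tlin_comp tlin_vlin)
  then show "tlin (basis A) T" "T v \<in> V A" by auto
qed

lemma mops_diff:
  assumes A: "galg A" and S: "S \<in> mops A" and T: "T \<in> mops A"
  shows "(\<lambda>x. S x - T x) \<in> mops A"
proof -
  have "(\<lambda>x. S x + amul A (- aone A) (T x)) \<in> mops A"
    by (rule mops.plus[OF S mops.comp[OF mops.left T]]) (use A in simp)
  moreover have "(\<lambda>x. S x + amul A (- aone A) (T x)) = (\<lambda>x. S x - T x)"
    using mops_tlin(2)[OF A T] by (simp add: galg_simps[OF A])
  ultimately show ?thesis by simp
qed

lemma mops_idl:
  assumes A: "galg A" and x: "x \<in> V A" shows "idl A {T x | T. T \<in> mops A}"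
  unfolding idl_def
proof (intro conjI ballI)
  show "{T x | T. T \<in> mops A} \<subseteq> V A" using mops_tlin(2)[OF A] by auto
  have "amul A 0 \<in> mops A" by (rule mops.left) simp
  moreover have "amul A 0 x = 0" by (simp add: galg_simps[OF A])
  ultimately show "0 \<in> {T x | T. T \<in> mops A}" by (intro CollectI exI[of _ "amul A 0"]) simp
  fix y a assume y: "y \<in> {T x | T. T \<in> mops A}" and a: "a \<in> V A"
  then obtain T where T: "T \<in> mops A" "y = T x" by blast
  show "amul A a y \<in> {T x | T. T \<in> mops A}"
    using mops.comp[OF mops.left[OF a] T(1)] T(2) by (intro CollectI exI[of _ "\<lambda>x. amul A a (T x)"]) simp
  show "amul A y a \<in> {T x | T. T \<in> mops A}"
    using mops.comp[OF mops.right[OF a] T(1)] T(2) by (intro CollectI exI[of _ "\<lambda>x. amul A (T x) a"]) simp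
next
  fix y z assume "y \<in> {T x | T. T \<in> mops A}" "z \<in> {T x | T. T \<in> mops A}"
  then obtain S T where "S \<in> mops A" "T \<in> mops A" "y = S x" "z = T x" by blast
  then show "y + z \<in> {T x | T. T \<in> mops A}"
    by (intro CollectI exI[of _ "\<lambda>x. S x + T x"]) (simp add: mops.plus)
qed

lemma mops_transitive:
  assumes "cs A" "x \<in> V A" "x \<noteq> 0" "y \<in> V A" shows "\<exists>T\<in>mops A. T x = y"
proof -
  have A: "galg A" using assms by simp
  have "amul A (aone A) x = x" "amul A (aone A) \<in> mops A"
    using assms(2) A by (auto simp: galg_simps[OF A] intro: mops.left)
  then have "x \<in> {T x | T. T \<in> mops A}" by (intro CollectI exI[of _ "amul A (aone A)"]) simp
  then have "{T x | T. T \<in> mops A} = V A"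
    using cs_idl[OF assms(1) mops_idl[OF A assms(2)]] assms(3) by blast
  then have "y \<in> {T x | T. T \<in> mops A}" using assms(4) by simp
  then show ?thesis by blast
qed

text \<open>The density theorem for the multiplication ring. If every operator killing \<open>S\<close> and \<open>x\<close> also
  killed \<open>e\<close>, then \<open>T x \<mapsto> T e\<close>, for \<open>T\<close> killing \<open>S\<close>, would commute with all multiplications, hence be
  multiplication by a central element, that is by a scalar \<open>c\<close>. Every \<open>T\<close> killing \<open>S\<close> would then kill
  \<open>e - c x\<close>, against the induction hypothesis.\<close>

lemma mops_separate:
  assumes cA: "cs A" and "finite S" "S \<subseteq> V A" "e \<in> V A" "e \<notin> fv.span S"
  shows "\<exists>T\<in>mops A. T e \<noteq> 0 \<and> (\<forall>x\<in>S. T x = 0)"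
  using assms(2-)
proof (induction S arbitrary: e rule: finite_induct)
  case empty
  have "amul A (aone A) e = e" using empty(2) cA by (simp add: galg_simps)
  then show ?case using empty cA by (intro bexI[of _ "amul A (aone A)"]) (auto intro: mops.left)
next
  case (insert x S)
  have A: "galg A" using cA by simp
  note [simp] = galg_simps[OF A]
  have eS: "e \<notin> fv.span S" using insert.prems(3) fv.span_mono[of S "insert x S"] by blast
  show ?case
  proof (cases "x \<in> fv.span S")
    case True
    from insert.IH[OF _ _ eS] insert.prems obtain T where T: "T \<in> mops A" "T e \<noteq> 0" "\<forall>x\<in>S. T x = 0" by auto
    have "T x = 0"
      by (rule vlin_span_zero[OF tlin_vlin[OF mops_tlin(1)[OF A T(1)]] _ True]) (use T(3) in blast)
    with T show ?thesis by auto
  next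
    case False
    have xV: "x \<in> V A" and eV: "e \<in> V A" and SV: "S \<subseteq> V A" using insert.prems by auto
    show ?thesis
    proof (rule ccontr)
      assume n: "\<not> ?thesis"
      then have *: "T e = 0" if "T \<in> mops A" "\<forall>y\<in>S. T y = 0" "T x = 0" for T
        using that by auto
      from insert.IH[OF SV xV False] obtain T0 where T0: "T0 \<in> mops A" "T0 x \<noteq> 0" "\<forall>y\<in>S. T0 y = 0" by auto
      from mops_transitive[OF cA mops_tlin(2)[OF A T0(1)] T0(2), of "aone A"] A
      obtain P where P: "P \<in> mops A" "P (T0 x) = aone A" by auto
      define T1 where "T1 = (\<lambda>v. P (T0 v))"
      have P0: "P 0 = 0" by (rule vlin_zero[OF tlin_vlin[OF mops_tlin(1)[OF A P(1)]]])
      have T1: "T1 \<in> mops A" "T1 x = aone A" "\<forall>y\<in>S. T1 y = 0"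
        unfolding T1_def using T0(3) P(2) P0 mops.comp[OF P(1) T0(1)] by auto
      \<comment> \<open>\<open>T1\<close> takes \<open>x\<close> to \<open>1\<close>, so \<open>z\<close> is the multiplier: \<open>T e = T(x) z = z T(x)\<close> whenever \<open>T\<close> kills \<open>S\<close>.\<close>
      define z where "z = T1 e"
      have zV: "z \<in> V A" by (simp add: z_def mops_tlin(2)[OF A T1(1)])
      have L: "T e = amul A (T x) z" and R: "T e = amul A z (T x)"
        if T: "T \<in> mops A" "\<forall>y\<in>S. T y = 0" for T
      proof -
        have V: "T v \<in> V A" for v by (rule mops_tlin(2)[OF A T(1)])
        have "(\<lambda>v. T v - amul A (T x) (T1 v)) \<in> mops A"
          by (rule mops_diff[OF A T(1) mops.comp[OF mops.left[OF V] T1(1)]])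
        from *[OF this] show "T e = amul A (T x) z"
          using T T1 V by (auto simp: z_def)
        have "(\<lambda>v. T v - amul A (T1 v) (T x)) \<in> mops A"
          by (rule mops_diff[OF A T(1) mops.comp[OF mops.right[OF V] T1(1)]])
        from *[OF this] show "T e = amul A z (T x)"
          using T T1 V by (auto simp: z_def)
      qed
      have "amul A z a = amul A a z" if a: "a \<in> V A" for a
      proof -
        have "(\<lambda>v. amul A a (T1 v)) \<in> mops A" by (rule mops.comp[OF mops.left[OF a] T1(1)])
        from L[OF this] R[OF this] show ?thesis using T1 a by simp
      qed
      from cs_center[OF cA zV this] obtain c where c: "z = vscale c (aone A)" by blast
      define e' where "e' = e - vscale c x"
      have e'V: "e' \<in> V A" using eV xV by (simp add: e'_def)
      have "e' \<notin> fv.span S"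
      proof
        assume "e' \<in> fv.span S"
        then have "e' + vscale c x \<in> fv.span (insert x S)"
          by (intro fv.span_add fv.span_scale) (auto intro: fv.span_base fv.span_mono[THEN subsetD])
        then show False using insert.prems(3) by (simp add: e'_def)
      qed
      from insert.IH[OF SV e'V this] obtain T where T: "T \<in> mops A" "T e' \<noteq> 0" "\<forall>y\<in>S. T y = 0" by auto
      have "T e = vscale c (T x)" using L[OF T(1,3)] mops_tlin(2)[OF A T(1)] by (simp add: c)
      then have "T e' = 0"
        using tlin_vlin[OF mops_tlin(1)[OF A T(1)]] by (simp add: e'_def vlin_rules)
      then show False using T by simp
    qed
  qed
qed

lemma mops_coordinate:
  assumes cA: "cs A" and i: "i \<in> basis A"
  shows "\<exists>T\<in>mops A. \<forall>j\<in>basis A. T (bvec j) = (if j = i then aone A else 0)"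
proof -
  have A: "galg A" using cA by simp
  let ?S = "bvec ` (basis A - {i}) :: ('a \<Rightarrow> 'k) set"
  have "bvec i \<notin> fv.span ?S"
  proof
    have "fv.span ?S \<subseteq> {v. v i = 0}"
      by (rule fv.span_minimal) (auto simp: fv.subspace_def vec_apply bvec_def)
    moreover assume "bvec i \<in> fv.span ?S"
    ultimately show False by auto
  qed
  moreover have "finite ?S" "?S \<subseteq> V A" "bvec i \<in> V A" using galgD(1)[OF A] i by auto
  ultimately obtain T where T: "T \<in> mops A" "T (bvec i) \<noteq> 0" "\<forall>x\<in>?S. T x = 0"
    using mops_separate[OF cA, of ?S "bvec i"] by blast
  from mops_transitive[OF cA mops_tlin(2)[OF A T(1)] T(2), of "aone A"] A
  obtain P where P: "P \<in> mops A" "P (T (bvec i)) = aone A" by auto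
  have P0: "P 0 = 0" by (rule vlin_zero[OF tlin_vlin[OF mops_tlin(1)[OF A P(1)]]])
  show ?thesis
    using T P P0 by (intro bexI[OF _ mops.comp[OF P(1) T(1)]]) auto
qed

text \<open>The set of families \<open>f\<close> with \<open>\<Sum> c\<^sub>i x f\<^sub>i = 0\<close> for all \<open>x\<close> is stable under applying a multiplication
  operator to each member. Starting from the basis, a coordinate operator isolates the single term
  \<open>c\<^sub>i\<close>.\<close>

lemma two_sided_form_inj:
  assumes cA: "cs A" and c: "\<And>i. c i \<in> V A"
    and z: "\<And>x. x \<in> V A \<Longrightarrow> (\<Sum>i\<in>basis A. amul A (c i) (amul A x (bvec i))) = 0"
    and i: "i \<in> basis A"
  shows "c i = 0"
proof -
  have A: "galg A" using cA by simp
  note [simp] = galg_simps[OF A]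
  have *: "\<forall>f. (\<forall>x\<in>V A. (\<Sum>i\<in>basis A. amul A (c i) (amul A x (f i))) = 0)
      \<longrightarrow> (\<forall>x\<in>V A. (\<Sum>i\<in>basis A. amul A (c i) (amul A x (T (f i)))) = 0)" if "T \<in> mops A" for T
    using that
  proof induction
    case (left a)
    show ?case
    proof (intro allI impI ballI)
      fix f x assume h: "\<forall>x\<in>V A. (\<Sum>i\<in>basis A. amul A (c i) (amul A x (f i))) = 0" and "x \<in> V A"
      have "(\<Sum>i\<in>basis A. amul A (c i) (amul A (amul A x a) (f i))) = 0"
        by (rule h[THEN bspec]) (use A in simp)
      then show "(\<Sum>i\<in>basis A. amul A (c i) (amul A x (amul A a (f i)))) = 0" by simp
    qed
  next
    case (right a)
    show ?case
    proof (intro allI impI ballI)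
      fix f x assume "\<forall>x\<in>V A. (\<Sum>i\<in>basis A. amul A (c i) (amul A x (f i))) = 0" and "x \<in> V A"
      then have "amul A (\<Sum>i\<in>basis A. amul A (c i) (amul A x (f i))) a = 0" by simp
      then show "(\<Sum>i\<in>basis A. amul A (c i) (amul A x (amul A (f i) a))) = 0"
        by (simp add: galg_sum[OF A])
    qed
  next
    case (plus S T)
    show ?case
    proof (intro allI impI ballI)
      fix f x assume h: "\<forall>x\<in>V A. (\<Sum>i\<in>basis A. amul A (c i) (amul A x (f i))) = 0" and x: "x \<in> V A"
      note plus.IH(1)[THEN spec[of _ f], THEN mp, OF h, THEN bspec, OF x]
        plus.IH(2)[THEN spec[of _ f], THEN mp, OF h, THEN bspec, OF x]
      then show "(\<Sum>i\<in>basis A. amul A (c i) (amul A x (S (f i) + T (f i)))) = 0"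
        by (simp add: sum.distrib)
    qed
  next
    case (comp S T)
    show ?case
    proof (intro allI impI)
      fix f assume "\<forall>x\<in>V A. (\<Sum>i\<in>basis A. amul A (c i) (amul A x (f i))) = 0"
      then have "\<forall>x\<in>V A. (\<Sum>i\<in>basis A. amul A (c i) (amul A x (T (f i)))) = 0"
        by (rule comp.IH(2)[THEN spec[of _ f], THEN mp])
      then show "\<forall>x\<in>V A. (\<Sum>i\<in>basis A. amul A (c i) (amul A x (S (T (f i))))) = 0"
        by (rule comp.IH(1)[THEN spec[of _ "\<lambda>i. T (f i)"], THEN mp])
    qed
  qed
  from mops_coordinate[OF cA i] obtain T where T: "T \<in> mops A"
    "\<forall>j\<in>basis A. T (bvec j) = (if j = i then aone A else 0)" by blast
  have "(\<Sum>j\<in>basis A. amul A (c j) (amul A (aone A) (T (bvec j)))) = 0"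
    by (rule *[OF T(1), THEN spec[of _ bvec], THEN mp, THEN bspec]) (use z A in auto)
  moreover have "(\<Sum>j\<in>basis A. amul A (c j) (amul A (aone A) (T (bvec j))))
      = (\<Sum>j\<in>basis A. if j = i then c j else 0)"
    using T(2) c A by (intro sum.cong) auto
  ultimately show ?thesis using i galgD(1)[OF A] by simp
qed

text \<open>The maps \<open>x \<mapsto> \<Sum> a\<^sub>i x b\<^sub>i\<close> with \<open>b\<^sub>i\<close> running over the basis, so that over a central simple
  algebra the coefficients \<open>a\<^sub>i\<close> are unique by the preceding lemma.\<close>

definition two_sided :: "('i, 'k, 'g) hmalg \<Rightarrow> (('i \<Rightarrow> 'k) \<Rightarrow> 'i \<Rightarrow> 'k) \<Rightarrow> bool" where
  "two_sided A T \<longleftrightarrow> (\<exists>a. (\<forall>i. a i \<in> V A) \<and> (\<forall>x. T x = (\<Sum>i\<in>basis A. amul A (a i) (amul A x (bvec i)))))"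

lemma two_sided_pair:
  assumes A: "galg A" and pq: "p \<in> V A" "q \<in> V A" shows "two_sided A (\<lambda>x. amul A p (amul A x q))"
proof -
  have "amul A p (amul A x q) = (\<Sum>i\<in>basis A. amul A (vscale (q i) p) (amul A x (bvec i)))" for x
    by (subst tlinD[OF galgD(3)[OF A, of x], of q]) (simp add: galg_simps[OF A] galg_sum[OF A])
  then show ?thesis using pq unfolding two_sided_def by (intro exI[of _ "\<lambda>i. vscale (q i) p"]) simp
qed

lemma two_sided_add:
  assumes A: "galg A" and "two_sided A S" "two_sided A T" shows "two_sided A (\<lambda>x. S x + T x)"
proof -
  from assms(2) obtain s where "\<forall>i. s i \<in> V A" "\<forall>x. S x = (\<Sum>i\<in>basis A. amul A (s i) (amul A x (bvec i)))"
    unfolding two_sided_def by (elim exE conjE)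
  moreover from assms(3) obtain t where "\<forall>i. t i \<in> V A" "\<forall>x. T x = (\<Sum>i\<in>basis A. amul A (t i) (amul A x (bvec i)))"
    unfolding two_sided_def by (elim exE conjE)
  ultimately show ?thesis unfolding two_sided_def
    by (intro exI[of _ "\<lambda>i. s i + t i"]) (simp add: galg_simps[OF A] sum.distrib)
qed

lemma two_sided_sum:
  assumes A: "galg A" and "\<And>n. n \<in> N \<Longrightarrow> two_sided A (F n)" shows "two_sided A (\<lambda>x. \<Sum>n\<in>N. F n x)"
  using assms(2)
proof (induction N rule: infinite_finite_induct)
  case (insert n N)
  then show ?case using two_sided_add[OF A, of "F n" "\<lambda>x. \<Sum>n\<in>N. F n x"] by simp
qed (auto simp: two_sided_def galg_simps[OF A] intro!: exI[of _ "\<lambda>_. 0"])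

lemma mops_two_sided:
  assumes A: "galg A" and T: "T \<in> mops A" shows "two_sided A T"
  using T
proof induction
  case (left a)
  from two_sided_pair[OF A left, of "aone A"] A show ?case
    by (simp add: galg_simps[OF A] )
next
  case (right a)
  from two_sided_pair[OF A _ right, of "aone A"] A show ?case
    by (simp add: galg_simps[OF A])
next
  case (plus S T)
  then show ?case using two_sided_add[OF A] by simp
next
  case (comp S T)
  from comp.IH(1) obtain s where s: "\<forall>i. s i \<in> V A" "\<forall>x. S x = (\<Sum>i\<in>basis A. amul A (s i) (amul A x (bvec i)))"
    unfolding two_sided_def by (elim exE conjE)
  from comp.IH(2) obtain t where t: "\<forall>i. t i \<in> V A" "\<forall>x. T x = (\<Sum>i\<in>basis A. amul A (t i) (amul A x (bvec i)))"
    unfolding two_sided_def by (elim exE conjE)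
  have "S (T x) = (\<Sum>i\<in>basis A. \<Sum>j\<in>basis A.
      amul A (amul A (s i) (t j)) (amul A x (amul A (bvec j) (bvec i))))" for x
    by (simp only: s(2) t(2) galg_sum[OF A] galg_simps[OF A])
  then show ?case
    using A by (simp only:) (intro two_sided_sum[OF A] two_sided_pair[OF A]; simp)
qed

text \<open>Coordinate operators show that every linear endomorphism of \<open>A\<close> has the form \<open>x \<mapsto> \<Sum> a\<^sub>i x b\<^sub>i\<close> with
  \<open>b\<^sub>i\<close> in the basis. Comparing coefficients in \<open>\<phi>(b x) = \<phi>(b) \<phi>(x)\<close> gives \<open>a\<^sub>i b = \<phi>(b) a\<^sub>i\<close>, and some
  \<open>a\<^sub>i\<close> is nonzero because \<open>\<phi>(1) = 1\<close>.\<close>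

theorem skolem_noether:
  assumes cA: "cs A" and phi: "tlin (basis A) \<phi>" "\<And>v. \<phi> v \<in> V A" "\<phi> (aone A) = aone A"
    "\<And>a b. \<phi> (amul A a b) = amul A (\<phi> a) (\<phi> b)"
  shows "\<exists>x\<in>V A. x \<noteq> 0 \<and> (\<forall>a. amul A x a = amul A (\<phi> a) x)"
proof -
  have A: "galg A" using cA by simp
  note [simp] = galg_simps[OF A]
  obtain E where E: "E i \<in> mops A" "\<forall>j\<in>basis A. E i (bvec j) = (if j = i then aone A else 0)"
    if "i \<in> basis A" for i
    using mops_coordinate[OF cA] by metis
  have "\<phi> = (\<lambda>v. \<Sum>i\<in>basis A. amul A (\<phi> (bvec i)) (E i v))"
  proof (rule ext, rule tlin_ext[OF phi(1)])
    show "tlin (basis A) (\<lambda>v. \<Sum>i\<in>basis A. amul A (\<phi> (bvec i)) (E i v))"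
      by (intro tlin_sum tlin_comp[OF tlin_vlin[OF galgD(3)[OF A]] mops_tlin(1)[OF A E(1)]])
    fix j assume j: "j \<in> basis A"
    have "(\<Sum>i\<in>basis A. amul A (\<phi> (bvec i)) (E i (bvec j))) = (\<Sum>i\<in>basis A. if i = j then \<phi> (bvec i) else 0)"
      using j E(2) phi(2) by (intro sum.cong) auto
    then show "\<phi> (bvec j) = (\<Sum>i\<in>basis A. amul A (\<phi> (bvec i)) (E i (bvec j)))"
      using j galgD(1)[OF A] by simp
  qed
  moreover have "two_sided A (\<lambda>v. \<Sum>i\<in>basis A. amul A (\<phi> (bvec i)) (E i v))"
    by (rule two_sided_sum[OF A], rule mops_two_sided[OF A], rule mops.comp[OF mops.left[OF phi(2)] E(1)])
  ultimately have "two_sided A \<phi>" by simp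
  then obtain a where a: "\<And>i. a i \<in> V A" "\<And>x. \<phi> x = (\<Sum>i\<in>basis A. amul A (a i) (amul A x (bvec i)))"
    unfolding two_sided_def by (elim exE conjE) blast
  have comm: "amul A (a i) b = amul A (\<phi> b) (a i)" if i: "i \<in> basis A" for i b
  proof -
    have "amul A (a i) b - amul A (\<phi> b) (a i) = 0"
    proof (rule two_sided_form_inj[OF cA _ _ i])
      fix y
      have "(\<Sum>i\<in>basis A. amul A (amul A (a i) b - amul A (\<phi> b) (a i)) (amul A y (bvec i)))
        = \<phi> (amul A b y) - amul A (\<phi> b) (\<phi> y)"
        by (subst (2 3) a(2)) (simp add: sum_subtractf galg_sum[OF A])
      then show "(\<Sum>i\<in>basis A. amul A (amul A (a i) b - amul A (\<phi> b) (a i)) (amul A y (bvec i))) = 0"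
        by (simp add: phi(4))
    qed (use A in simp)
    then show ?thesis by simp
  qed
  have "\<exists>i\<in>basis A. a i \<noteq> 0"
  proof (rule ccontr)
    assume "\<not> ?thesis"
    then have "\<phi> (aone A) = 0" by (subst a(2)) simp
    then show False using phi(3) cs_one_nonzero[OF cA] by simp
  qed
  then show ?thesis using comm a(1) by blast
qed

text \<open>The one-sided ideals \<open>x A\<close> and \<open>A x\<close> are two-sided by the commutation rule, so both are all of \<open>A\<close>.\<close>

lemma normalizing_unit:
  assumes cA: "cs A" and x: "x \<in> V A" "x \<noteq> 0" and c: "\<And>a. a \<in> V A \<Longrightarrow> amul A x a = amul A (\<phi> a) x"
    and onto: "\<And>b. b \<in> V A \<Longrightarrow> \<exists>a\<in>V A. \<phi> a = b" and V: "\<And>a. a \<in> V A \<Longrightarrow> \<phi> a \<in> V A"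
  shows "\<exists>y\<in>V A. amul A x y = aone A \<and> amul A y x = aone A"
proof -
  have A: "galg A" using cA by simp
  note [simp] = galg_simps[OF A]
  have "idl A {amul A x a | a. a \<in> V A}"
    unfolding idl_def
  proof (intro conjI ballI)
    show "0 \<in> {amul A x a | a. a \<in> V A}" by (intro CollectI exI[of _ 0]) simp
    fix y b assume "y \<in> {amul A x a | a. a \<in> V A}" and b: "b \<in> V A"
    then obtain a where a: "y = amul A x a" "a \<in> V A" by blast
    show "amul A y b \<in> {amul A x a | a. a \<in> V A}"
      using a A by (intro CollectI exI[of _ "amul A a b"]) simp
    obtain b' where b': "b' \<in> V A" "\<phi> b' = b" using onto b by blast
    have "amul A b y = amul A (amul A (\<phi> b') x) a" using a b' by simp
    also have "\<dots> = amul A (amul A x b') a" using c b' by simp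
    finally show "amul A b y \<in> {amul A x a | a. a \<in> V A}"
      using a A b' by (intro CollectI exI[of _ "amul A b' a"]) simp
  next
    fix y z assume "y \<in> {amul A x a | a. a \<in> V A}" "z \<in> {amul A x a | a. a \<in> V A}"
    then obtain a b where "y = amul A x a" "z = amul A x b" "a \<in> V A" "b \<in> V A" by blast
    then show "y + z \<in> {amul A x a | a. a \<in> V A}" by (intro CollectI exI[of _ "a + b"]) simp
  qed (use A in auto)
  moreover have "x \<in> {amul A x a | a. a \<in> V A}"
    using x A by (intro CollectI exI[of _ "aone A"]) simp
  ultimately have "aone A \<in> {amul A x a | a. a \<in> V A}"
    using cs_idl[OF cA _ _ x(2)] A galg_closed(2)[OF A] by blast
  then obtain y where y: "y \<in> V A" "amul A x y = aone A" by auto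
  have "idl A {amul A a x | a. a \<in> V A}"
    unfolding idl_def
  proof (intro conjI ballI)
    show "0 \<in> {amul A a x | a. a \<in> V A}" by (intro CollectI exI[of _ 0]) simp
    fix y b assume "y \<in> {amul A a x | a. a \<in> V A}" and b: "b \<in> V A"
    then obtain a where a: "y = amul A a x" "a \<in> V A" by blast
    show "amul A b y \<in> {amul A a x | a. a \<in> V A}"
      using a A by (intro CollectI exI[of _ "amul A b a"]) simp
    show "amul A y b \<in> {amul A a x | a. a \<in> V A}"
      using a A c[OF b] V[OF b] by (intro CollectI exI[of _ "amul A a (\<phi> b)"]) simp
  next
    fix y z assume "y \<in> {amul A a x | a. a \<in> V A}" "z \<in> {amul A a x | a. a \<in> V A}"
    then obtain a b where "y = amul A a x" "z = amul A b x" "a \<in> V A" "b \<in> V A" by blast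
    then show "y + z \<in> {amul A a x | a. a \<in> V A}" by (intro CollectI exI[of _ "a + b"]) simp
  qed (use A in auto)
  moreover have "x \<in> {amul A a x | a. a \<in> V A}"
    using x A by (intro CollectI exI[of _ "aone A"]) simp
  ultimately have "aone A \<in> {amul A a x | a. a \<in> V A}"
    using cs_idl[OF cA _ _ x(2)] A galg_closed(2)[OF A] by blast
  then obtain y' where y': "y' \<in> V A" "amul A y' x = aone A" by auto
  have "y' = amul A y' (amul A x y)" using y y' by simp
  also have "\<dots> = amul A (amul A y' x) y" by simp
  also have "\<dots> = y" using y y' by (simp del: galg_simps(13))
  finally show ?thesis using y y' by blast
qed

lemma ac_onto: "galg A \<Longrightarrow> g \<in> carrier G \<Longrightarrow> b \<in> V A \<Longrightarrow> \<exists>a\<in>V A. ac A g a = b"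
  by (intro bexI[of _ "ac A (inv g) b"]) (simp_all add: galg_simps)

lemma implementing_unit:
  assumes cA: "cs A" and "g \<in> carrier G" "x \<in> V A" "x \<noteq> 0" "\<And>a. amul A x a = amul A (ac A g a) x"
  shows "\<exists>y\<in>V A. amul A x y = aone A \<and> amul A y x = aone A"
  by (rule normalizing_unit[OF cA assms(3,4), of "ac A g"]) (use assms ac_onto[OF cs_galg[OF cA] assms(2)] in auto)

lemma action_inner:
  assumes cA: "cs A" and g: "g \<in> carrier G"
  shows "\<exists>x\<in>V A. \<exists>y\<in>V A. amul A x y = aone A \<and> amul A y x = aone A \<and> (\<forall>a. amul A x a = amul A (ac A g a) x)"
proof -
  have A: "galg A" using cA by simp
  have "\<exists>x\<in>V A. x \<noteq> 0 \<and> (\<forall>a. amul A x a = amul A (ac A g a) x)"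
    by (rule skolem_noether[OF cA]) (use A g in \<open>auto simp: galg_simps galgD(10)\<close>)
  then obtain x where x: "x \<in> V A" "x \<noteq> 0" "\<And>a. amul A x a = amul A (ac A g a) x" by blast
  from implementing_unit[OF cA g x] show ?thesis using x by blast
qed

lemma four: "(4::'k) \<noteq> 0"
proof -
  have "(4::'k) = 2 * 2" by simp
  then show ?thesis using two by (metis mult_eq_0_iff)
qed

text \<open>Identities with the factor \<open>1/2\<close> from \<open>R\<^sub>u\<close> are checked coordinatewise; applying the braiding twice
  produces the factor \<open>1/4\<close>.\<close>

lemmas lincomb = vec_apply field_simps two four

section \<open>The braided product\<close>

abbreviation bp :: "('i, 'k, 'g) hmalg \<Rightarrow> ('j, 'k, 'g) hmalg \<Rightarrow> ('i \<times> 'j, 'k, 'g) hmalg" where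
  "bp A B \<equiv> braided_prod H R A B"

lemma bp_basis [simp]: "basis (bp A B) = basis A \<times> basis B"
  and bp_one [simp]: "aone (bp A B) = tens (aone A) (aone B)"
  by (simp_all add: braided_prod_def)

lemma tlin_tens_left: "tlin I F \<Longrightarrow> tlin I (\<lambda>a. tens (F a) x)"
  by (rule tlin_comp[of "\<lambda>v. tens v x"]) (simp add: vlin_def tens_simps)

lemma tlin_tens_right: "tlin I F \<Longrightarrow> tlin I (\<lambda>a. tens x (F a))"
  by (rule tlin_comp[of "\<lambda>v. tens x v"]) (simp add: vlin_def tens_simps)

lemma galg_tlin:
  assumes A: "galg A"
  shows "tlin I F \<Longrightarrow> tlin I (\<lambda>x. amul A a (F x))" "tlin I F \<Longrightarrow> tlin I (\<lambda>x. amul A (F x) a)"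
    "g \<in> carrier G \<Longrightarrow> tlin I F \<Longrightarrow> tlin I (\<lambda>x. ac A g (F x))"
    "tlin (basis A) (amul A a)" "tlin (basis A) (\<lambda>x. amul A x a)"
    "g \<in> carrier G \<Longrightarrow> tlin (basis A) (ac A g)" "tlin (basis A) (crop (basis A))"
  using tlin_comp[OF tlin_vlin[OF galgD(3)[OF A]], of I F a]
    tlin_comp[OF tlin_vlin[OF galgD(4)[OF A]], of I F a]
    tlin_comp[OF tlin_vlin[OF galgD(10)[OF A]], of g I F]
    galgD(3,4,10)[OF A] tlin_crop[OF galgD(1)[OF A]] by auto

lemma bp_mul:
  assumes A: "galg A" and B: "galg B"
  shows "amul (bp A B) (tens a x) (tens b y) = vscale (1 / 2)
    (tens (amul A a b) (amul B x y) + tens (amul A a (ac A u b)) (amul B x y)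
     + tens (amul A a b) (amul B (ac B u x) y) - tens (amul A a (ac A u b)) (amul B (ac B u x) y))"
proof -
  let ?F = "\<lambda>a x b y. vscale (1 / 2)
    (tens (amul A a b) (amul B x y) + tens (amul A a (ac A u b)) (amul B x y)
     + tens (amul A a b) (amul B (ac B u x) y) - tens (amul A a (ac A u b)) (amul B (ac B u x) y))"
  have r: "linext (carrier G \<times> carrier G) (\<lambda>(p, q).
      tens (amul A a (ac A q b)) (amul B (ac B p x) y)) R = ?F a x b y" for a x b y
    unfolding linext_R by (simp add: galg_simps[OF A] galg_simps[OF B])
  note fi = galgD(1)[OF A] galgD(1)[OF B]
  have "amul (bp A B) (tens a x) (tens b y) =
    linext (basis A \<times> basis B) (\<lambda>(i, j). linext (basis A \<times> basis B) (\<lambda>(i', j').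
      ?F (bvec i) (bvec j) (bvec i') (bvec j')) (tens b y)) (tens a x)"
    unfolding braided_prod_def by (simp add: r)
  also have "\<dots> = linext (basis A \<times> basis B) (\<lambda>(i, j). ?F (bvec i) (bvec j) b y) (tens a x)"
    by (subst linext_tens[OF fi])
      (intro tlin_intros tlin_tens_left tlin_tens_right galg_tlin[OF A] galg_tlin[OF B] u_closed refl)+
  also have "\<dots> = ?F a x b y"
    by (subst linext_tens[OF fi])
      (intro tlin_intros tlin_tens_left tlin_tens_right galg_tlin[OF A] galg_tlin[OF B] u_closed refl)+
  finally show ?thesis .
qed

lemma bp_tlin_left:
  assumes "galg A" "galg B" shows "tlin (basis A \<times> basis B) (\<lambda>s. amul (bp A B) s t)"
  unfolding braided_prod_def using galgD(1)[OF assms(1)] galgD(1)[OF assms(2)]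
  by (simp add: tlin_linext)

lemma bp_tlin_right:
  assumes "galg A" "galg B" shows "tlin (basis A \<times> basis B) (amul (bp A B) s)"
  unfolding braided_prod_def using galgD(1)[OF assms(1)] galgD(1)[OF assms(2)]
  by (simp add: linext_sum[of _ _ s]) (intro tlin_sum tlin_scale; auto intro: tlin_linext)

lemma bp_act:
  assumes A: "galg A" and B: "galg B"
  shows "act (bp A B) h s = (\<Sum>g\<in>carrier G. vscale (h g)
    (linext (basis A \<times> basis B) (\<lambda>(i, j). tens (ac A g (bvec i)) (ac B g (bvec j))) s))"
proof -
  have "act (bp A B) h s = linext (basis A \<times> basis B) (\<lambda>(i, j). \<Sum>g\<in>carrier G.
      vscale (h g) (tens (ac A g (bvec i)) (ac B g (bvec j)))) s"
    by (simp add: braided_prod_def linext_comult)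
  also have "\<dots> = (\<Sum>x\<in>basis A \<times> basis B. \<Sum>g\<in>carrier G. vscale (h g) (vscale (s x)
      (case x of (i, j) \<Rightarrow> tens (ac A g (bvec i)) (ac B g (bvec j)))))"
    by (simp add: linext_sum fv.scale_sum_right case_prod_beta mult.commute)
  also have "\<dots> = (\<Sum>g\<in>carrier G. vscale (h g)
    (linext (basis A \<times> basis B) (\<lambda>(i, j). tens (ac A g (bvec i)) (ac B g (bvec j))) s))"
    by (subst sum.swap) (simp add: linext_sum fv.scale_sum_right)
  finally show ?thesis .
qed

lemma bp_ac_linext:
  assumes A: "galg A" and B: "galg B" and g: "g \<in> carrier G"
  shows "ac (bp A B) g = linext (basis A \<times> basis B) (\<lambda>(i, j). tens (ac A g (bvec i)) (ac B g (bvec j)))"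
  by (rule ext) (simp only: bp_act[OF A B] sum_bvec[OF g])

lemma bp_ac:
  assumes A: "galg A" and B: "galg B" and g: "g \<in> carrier G"
  shows "ac (bp A B) g (tens a x) = tens (ac A g a) (ac B g x)"
  unfolding bp_ac_linext[OF assms] using galgD(1)[OF A] galgD(1)[OF B]
  by (rule linext_tens) (intro tlin_tens_left tlin_tens_right galg_tlin[OF A] galg_tlin[OF B] g)+

lemma bp_tlin_ac:
  assumes A: "galg A" and B: "galg B" and g: "g \<in> carrier G"
  shows "tlin (basis A \<times> basis B) (ac (bp A B) g)"
  unfolding bp_ac_linext[OF assms] using galgD(1)[OF A] galgD(1)[OF B] by (simp add: tlin_linext)

lemma linext_closed: "(\<And>i. i \<in> I \<Longrightarrow> f i \<in> vspace J) \<Longrightarrow> linext I f v \<in> vspace J"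
  by (simp add: linext_sum)

lemma galg_bp:
  assumes A: "galg A" and B: "galg B" shows "galg (bp A B)"
proof -
  note [simp] = galg_simps[OF A] galg_simps[OF B]
  note mul = bp_mul[OF A B] and tl = bp_tlin_left[OF A B] and tr = bp_tlin_right[OF A B]
    and tact = bp_tlin_ac[OF A B] and acg = bp_ac[OF A B]
  note vl = vlin_rules[OF tlin_vlin[OF tl]] vlin_rules[OF tlin_vlin[OF tr]]
  let ?P = "bp A B"
  let ?K = "basis A \<times> basis B"
  have clL: "tlin ?K F \<Longrightarrow> tlin ?K (\<lambda>s. amul ?P (F s) t)" for F t
    by (rule tlin_comp[OF tlin_vlin[OF tl]])
  have clR: "tlin ?K F \<Longrightarrow> tlin ?K (\<lambda>s. amul ?P t (F s))" for F t
    by (rule tlin_comp[OF tlin_vlin[OF tr]])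
  have clA: "g \<in> carrier G \<Longrightarrow> tlin ?K F \<Longrightarrow> tlin ?K (\<lambda>s. ac ?P g (F s))" for F g
    by (rule tlin_comp[OF tlin_vlin[OF tact]])
  have K: "finite ?K" using galgD(1)[OF A] galgD(1)[OF B] by simp
  show ?thesis
  proof (rule galgI)
    show "finite (basis ?P)" using K by simp
    show "amul ?P a b \<in> V ?P" for a b
      unfolding braided_prod_def linext_R using A B
      by (auto simp: case_prod_beta intro!: linext_closed)
    show "tlin (basis ?P) (amul ?P a)" "tlin (basis ?P) (\<lambda>a. amul ?P a b)" for a b
      using tl tr by simp_all
    have 1: "amul ?P (amul ?P (tens a x) (tens b y)) (tens c z)
        = amul ?P (tens a x) (amul ?P (tens b y) (tens c z))" for a b c x y z
      unfolding mul vl tens_simps by (simp add: tens_simps mul vl) ((simp add: fun_eq_iff lincomb)?)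
    have 2: "amul ?P (amul ?P (tens a x) (tens b y)) r = amul ?P (tens a x) (amul ?P (tens b y) r)" for a b x y r
      by (rule tlin_ext_prod[of "basis A" "basis B"]) (use tr clR 1 in auto)
    have 3: "amul ?P (amul ?P (tens a x) t) r = amul ?P (tens a x) (amul ?P t r)" for a x t r
      by (rule tlin_ext_prod[of "basis A" "basis B" "\<lambda>t. amul ?P (amul ?P (tens a x) t) r"])
        (use tl tr clR clL 2 in auto)
    show "amul ?P (amul ?P s t) r = amul ?P s (amul ?P t r)" for s t r
      by (rule tlin_ext_prod[of "basis A" "basis B" "\<lambda>s. amul ?P (amul ?P s t) r"])
        (use tl tr clR clL 3 in auto)
    show "aone ?P \<in> V ?P" using A B by simp
    show "amul ?P (aone ?P) s = s" if "s \<in> V ?P" for s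
    proof -
      have "amul ?P (aone ?P) s = crop ?K s"
        by (rule tlin_ext_prod[of "basis A" "basis B"])
          (use tr tlin_crop[OF K] in \<open>auto simp: mul crop_tens fun_eq_iff lincomb\<close>)
      then show ?thesis using that by simp
    qed
    show "amul ?P s (aone ?P) = s" if "s \<in> V ?P" for s
    proof -
      have "amul ?P s (aone ?P) = crop ?K s"
        by (rule tlin_ext_prod[of "basis A" "basis B"])
          (use tl tlin_crop[OF K] in \<open>auto simp: mul crop_tens fun_eq_iff lincomb\<close>)
      then show ?thesis using that by simp
    qed
    show "act ?P h v = (\<Sum>g\<in>carrier G. vscale (h g) (ac ?P g v))" for h v
      by (subst bp_act[OF A B]) (simp add: bp_ac_linext[OF A B])
    fix g assume g: "g \<in> carrier G"
    show "tlin (basis ?P) (ac ?P g)" using tact[OF g] by simp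
    show "ac ?P g v \<in> V ?P" for v
      unfolding bp_ac_linext[OF A B g] using A B g by (auto intro!: linext_closed)
    have ug: "u \<otimes> g = g \<otimes> u" using g by (rule u_central)
    have 1: "ac ?P g (amul ?P (tens a x) (tens b y)) = amul ?P (ac ?P g (tens a x)) (ac ?P g (tens b y))" for a x b y
      by (simp add: mul vlin_rules[OF tlin_vlin[OF tact[OF g]]] acg g ug)
    have 2: "ac ?P g (amul ?P (tens a x) t) = amul ?P (ac ?P g (tens a x)) (ac ?P g t)" for a x t
      by (rule tlin_ext_prod[of "basis A" "basis B"]) (use tact[OF g] tr clR clA g 1 in auto)
    show "ac ?P g (amul ?P s t) = amul ?P (ac ?P g s) (ac ?P g t)" for s t
      by (rule tlin_ext_prod[of "basis A" "basis B" "\<lambda>s. ac ?P g (amul ?P s t)"])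
        (use tact[OF g] tr tl clR clL clA g 2 in auto)
    show "ac ?P g (aone ?P) = aone ?P" by (simp add: acg g)
    show "ac ?P (g \<otimes> h) v = ac ?P g (ac ?P h v)" if h: "h \<in> carrier G" for h v
      by (rule tlin_ext_prod[of "basis A" "basis B"]) (use tact clA g h in \<open>auto simp: acg\<close>)
  next
    show "ac ?P \<one> v = v" if "v \<in> V ?P" for v
    proof -
      have "ac ?P \<one> v = crop ?K v"
        by (rule tlin_ext_prod[of "basis A" "basis B"])
          (use tact tlin_crop[OF K] in \<open>auto simp: acg crop_tens\<close>)
      then show ?thesis using that by simp
    qed
  qed
qed

lemma bp_rules:
  assumes A: "galg A" and B: "galg B"
  shows "amul (bp A B) (tens a (aone B)) (tens b y) = tens (amul A a b) (crop (basis B) y)"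
    "amul (bp A B) (tens a x) (tens (aone A) y) = tens (crop (basis A) a) (amul B x y)"
    "amul (bp A B) (tens (aone A) x) (tens b y) = vscale (1 / 2)
      (tens (crop (basis A) b) (amul B x y) + tens (ac A u b) (amul B x y)
       + tens (crop (basis A) b) (amul B (ac B u x) y) - tens (ac A u b) (amul B (ac B u x) y))"
  by (use A B in \<open>simp_all add: bp_mul[OF A B] galg_simps[OF A] galg_simps[OF B]\<close>)
    ((simp_all add: fun_eq_iff lincomb)?)

lemma bp_in1:
  assumes A: "galg A" and B: "galg B" shows "ghom A (bp A B) (\<lambda>a. tens (crop (basis A) a) (aone B))"
proof (rule ghomI)
  show "tlin (basis A) (\<lambda>a. tens (crop (basis A) a) (aone B))"
    by (intro tlin_tens_left galg_tlin[OF A])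
qed (use A B in \<open>auto simp: bp_mul bp_ac galg_simps fun_eq_iff lincomb\<close>)

lemma bp_in2:
  assumes A: "galg A" and B: "galg B" shows "ghom B (bp A B) (\<lambda>x. tens (aone A) (crop (basis B) x))"
proof (rule ghomI)
  show "tlin (basis B) (\<lambda>a. tens (aone A) (crop (basis B) a))"
    by (intro tlin_tens_right galg_tlin[OF B])
qed (use A B in \<open>auto simp: bp_mul bp_ac galg_simps fun_eq_iff lincomb\<close>)

text \<open>The map out of the braided product that restricts to \<open>f\<close> and \<open>g\<close> on the two factors.\<close>

definition copair :: "('i, 'k, 'g) hmalg \<Rightarrow> ('j, 'k, 'g) hmalg \<Rightarrow> ('l, 'k, 'g) hmalg
    \<Rightarrow> (('i \<Rightarrow> 'k) \<Rightarrow> 'l \<Rightarrow> 'k) \<Rightarrow> (('j \<Rightarrow> 'k) \<Rightarrow> 'l \<Rightarrow> 'k) \<Rightarrow> ('i \<times> 'j \<Rightarrow> 'k) \<Rightarrow> 'l \<Rightarrow> 'k" where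
  "copair A B C f g = linext (basis A \<times> basis B) (\<lambda>(i, j). amul C (f (bvec i)) (g (bvec j)))"

text \<open>Written for arbitrary elements; on homogeneous ones it says \<open>y x = (-1)\<^bsup>|x| |y|\<^esup> x y\<close>.\<close>

definition supercommute :: "('i, 'k, 'g) hmalg \<Rightarrow> ('i \<Rightarrow> 'k) \<Rightarrow> ('i \<Rightarrow> 'k) \<Rightarrow> bool" where
  "supercommute C y x \<longleftrightarrow> amul C y x = vscale (1 / 2)
     (amul C x y + amul C (ac C u x) y + amul C x (ac C u y) - amul C (ac C u x) (ac C u y))"

lemma copair_tens:
  assumes "galg A" "galg B" "galg C" "ghom A C f" "ghom B C g"
  shows "copair A B C f g (tens a x) = amul C (f a) (g x)"
  unfolding copair_def using galgD(1)[OF assms(1)] galgD(1)[OF assms(2)]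
  by (rule linext_tens) (intro galg_tlin[OF assms(3)] ghomD(1)[OF assms(4)] ghomD(1)[OF assms(5)])+

text \<open>The universal property of the braided product. All isomorphisms between braided products below
  are obtained from it, bijectivity being a consequence of simplicity and dimension.\<close>

lemma copair_ghom:
  assumes A: "galg A" and B: "galg B" and C: "galg C" and f: "ghom A C f" and g: "ghom B C g"
    and sc: "\<And>a x. a \<in> V A \<Longrightarrow> x \<in> V B \<Longrightarrow> supercommute C (g x) (f a)"
  shows "ghom (bp A B) C (copair A B C f g)"
proof -
  note [simp] = galg_simps[OF A] galg_simps[OF B] galg_simps[OF C]
  note P = galg_bp[OF A B]
  note tens = copair_tens[OF A B C f g]
  note F = ghomD[OF f] and Gg = ghomD[OF g]
  let ?h = "copair A B C f g" and ?P = "bp A B" and ?K = "basis A \<times> basis B"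
  have K: "finite ?K" using galgD(1)[OF A] galgD(1)[OF B] by simp
  have tl: "tlin ?K ?h" unfolding copair_def using K by (rule tlin_linext)
  note vl = vlin_rules[OF tlin_vlin[OF tl]]
  have sc': "amul C (g x) (f a) = vscale (1 / 2)
      (amul C (f a) (g x) + amul C (f (ac A u a)) (g x) + amul C (f a) (g (ac B u x))
       - amul C (f (ac A u a)) (g (ac B u x)))" for a x
    using sc[of "crop (basis A) a" "crop (basis B) x"]
    by (simp add: supercommute_def F(7) Gg(7) F(5) Gg(5))
  have sc'': "amul C (g x) (amul C (f a) z) = vscale (1 / 2)
      (amul C (f a) (amul C (g x) z) + amul C (f (ac A u a)) (amul C (g x) z) + amul C (f a) (amul C (g (ac B u x)) z)
       - amul C (f (ac A u a)) (amul C (g (ac B u x)) z))" for a x z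
  proof -
    have "amul C (g x) (amul C (f a) z) = amul C (amul C (g x) (f a)) z" by simp
    also have "\<dots> = vscale (1 / 2)
      (amul C (f a) (amul C (g x) z) + amul C (f (ac A u a)) (amul C (g x) z) + amul C (f a) (amul C (g (ac B u x)) z)
       - amul C (f (ac A u a)) (amul C (g (ac B u x)) z))"
      by (subst sc') simp
    finally show ?thesis .
  qed
  show ?thesis
  proof (rule ghomI)
    show "tlin (basis ?P) ?h" using tl by simp
    show "?h v \<in> V C" for v unfolding copair_def using C by (auto intro!: linext_closed)
    show "?h (aone ?P) = aone C" using C by (simp add: tens F(3) Gg(3))
    have 1: "?h (amul ?P (tens a x) (tens b y)) = amul C (?h (tens a x)) (?h (tens b y))" for a x b y
      by (simp add: bp_mul[OF A B] vl tens F(4,5) Gg(4,5) sc'')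
    have 2: "?h (amul ?P (tens a x) t) = amul C (?h (tens a x)) (?h t)" for a x t
      by (rule tlin_ext_prod[of "basis A" "basis B"])
        (use tl 1 in \<open>auto intro!: tlin_comp[OF tlin_vlin[OF tl]] galg_tlin[OF C] bp_tlin_right[OF A B]\<close>)
    show "?h (amul ?P s t) = amul C (?h s) (?h t)" for s t
      by (rule tlin_ext_prod[of "basis A" "basis B" "\<lambda>s. ?h (amul ?P s t)"])
        (use tl 2 in \<open>auto intro!: tlin_comp[OF tlin_vlin[OF tl]] galg_tlin[OF C] bp_tlin_left[OF A B]\<close>)
    show "?h (ac ?P g' s) = ac C g' (?h s)" if g': "g' \<in> carrier G" for g' s
      by (rule tlin_ext_prod[of "basis A" "basis B" "\<lambda>s. ?h (ac ?P g' s)"])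
        (use tl g' in \<open>auto simp: bp_ac[OF A B] tens F(5) Gg(5)
           intro!: tlin_comp[OF tlin_vlin[OF tl]] galg_tlin[OF C] bp_tlin_ac[OF A B]\<close>)
  qed
qed

lemma bp_supercommute:
  assumes A: "galg A" and B: "galg B"
  shows "supercommute (bp A B) (tens (aone A) x) (tens a (aone B))"
  unfolding supercommute_def
  by (simp add: bp_mul[OF A B] bp_ac[OF A B] galg_simps[OF A] galg_simps[OF B])
     ((simp add: fun_eq_iff lincomb)?)

text \<open>On homogeneous elements the relation is visibly symmetric. The assumption covers the
  \<open>u\<close>-translates because these span the homogeneous components.\<close>

lemma supercommute_sym:
  assumes C: "galg C" and s: "\<And>a b. a \<in> {x, ac C u x} \<Longrightarrow> b \<in> {y, ac C u y} \<Longrightarrow> supercommute C b a"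
    and V: "x \<in> V C" "y \<in> V C"
  shows "supercommute C x y"
proof -
  have s': "supercommute C y x" "supercommute C (ac C u y) x" "supercommute C y (ac C u x)"
    "supercommute C (ac C u y) (ac C u x)" using s by blast+
  show ?thesis
    using s' V unfolding supercommute_def
    by (simp add: galg_simps[OF C]) ((simp add: fun_eq_iff lincomb)?)
qed

section \<open>Central simplicity of the braided product\<close>

lemma csI:
  assumes "galg A" "basis A \<noteq> {}"
    "\<And>z. z \<in> V A \<Longrightarrow> (\<And>v. v \<in> V A \<Longrightarrow> amul A z v = amul A v z) \<Longrightarrow> \<exists>c. z = vscale c (aone A)"
    "\<And>J x. idl A J \<Longrightarrow> x \<in> J \<Longrightarrow> x \<noteq> 0 \<Longrightarrow> aone A \<in> J"
  shows "cs A"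
  unfolding cs_def
proof (intro conjI assms(1,2) ballI impI allI)
  fix J assume J: "idl A J"
  show "J = {0} \<or> J = V A"
  proof (cases "\<exists>x\<in>J. x \<noteq> 0")
    case True
    then have "aone A \<in> J" using assms(4) J by blast
    have "v \<in> J" if v: "v \<in> V A" for v
    proof -
      have "amul A v (aone A) \<in> J" using J \<open>aone A \<in> J\<close> v unfolding idl_def by blast
      then show ?thesis using v by (simp add: galg_simps[OF assms(1)])
    qed
    then show ?thesis using J unfolding idl_def by blast
  qed (use J in \<open>auto simp: idl_def\<close>)
qed (use assms(3) in blast)

lemma idl_scale:
  assumes A: "galg A" and J: "idl A J" and x: "x \<in> J" shows "vscale c x \<in> J"
proof -
  have "amul A (vscale c (aone A)) x \<in> J" using J x A unfolding idl_def by simp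
  moreover have "amul A (vscale c (aone A)) x = vscale c x"
    using J x by (auto simp: galg_simps[OF A] idl_def)
  ultimately show ?thesis by simp
qed

lemma idl_diff:
  assumes A: "galg A" and J: "idl A J" and x: "x \<in> J" "y \<in> J" shows "x - y \<in> J"
proof -
  have "x + vscale (- 1) y \<in> J" using J x idl_scale[OF A J x(2)] unfolding idl_def by blast
  then show ?thesis by simp
qed

text \<open>A unit implementing \<open>u\<close> commutes with itself, so it is fixed by \<open>u\<close>.\<close>

lemma grading_unit:
  assumes cA: "cs A"
  obtains x y where "x \<in> V A" "y \<in> V A" "amul A x y = aone A" "amul A y x = aone A"
    "ac A u x = x" "ac A u y = y" "\<And>a. amul A x a = amul A (ac A u a) x"
    "\<And>a. amul A a y = amul A y (ac A u a)"
    "\<And>a. amul A x (amul A a y) = ac A u a"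
proof -
  have A: "galg A" using cA by simp
  note [simp] = galg_simps[OF A]
  from action_inner[OF cA u_closed] obtain x y where xy: "x \<in> V A" "y \<in> V A"
    "amul A x y = aone A" "amul A y x = aone A" and c: "\<forall>a. amul A x a = amul A (ac A u a) x" by blast
  have cj: "amul A x (amul A a y) = ac A u a" for a
  proof -
    have "amul A x (amul A a y) = amul A (amul A x a) y" by simp
    also have "\<dots> = amul A (amul A (ac A u a) x) y" using c by metis
    also have "\<dots> = ac A u a" using xy A by simp
    finally show ?thesis .
  qed
  have "ac A u x = amul A x (amul A x y)" using cj by simp
  then have ux: "ac A u x = x" using xy by simp
  have "ac A u y = amul A x (amul A y y)" using cj by simp
  also have "\<dots> = amul A (amul A x y) y" by (rule galgD(5)[OF A, symmetric])
  also have "\<dots> = y" using xy by (simp del: galg_simps(13))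
  finally have uy: "ac A u y = y" .
  have "amul A a y = amul A y (ac A u a)" for a
  proof -
    have "amul A y (ac A u a) = amul A y (amul A x (amul A a y))" by (simp add: cj)
    also have "\<dots> = amul A (amul A y x) (amul A a y)" by (rule galgD(5)[OF A, symmetric])
    finally show ?thesis using xy A by (simp del: galg_simps(13))
  qed
  with that[OF xy ux uy] c cj show thesis by blast
qed

text \<open>\<open>lift1\<close> and \<open>lift2\<close> apply an operator to one tensor factor, without signs.\<close>

definition lift1 :: "('i, 'k, 'g) hmalg \<Rightarrow> ('j, 'k, 'g) hmalg \<Rightarrow> (('i \<Rightarrow> 'k) \<Rightarrow> 'i \<Rightarrow> 'k)
    \<Rightarrow> ('i \<times> 'j \<Rightarrow> 'k) \<Rightarrow> 'i \<times> 'j \<Rightarrow> 'k" where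
  "lift1 A B T = linext (basis A \<times> basis B) (\<lambda>(i, j). tens (T (bvec i)) (bvec j))"

definition lift2 :: "('i, 'k, 'g) hmalg \<Rightarrow> ('j, 'k, 'g) hmalg \<Rightarrow> (('j \<Rightarrow> 'k) \<Rightarrow> 'j \<Rightarrow> 'k)
    \<Rightarrow> ('i \<times> 'j \<Rightarrow> 'k) \<Rightarrow> 'i \<times> 'j \<Rightarrow> 'k" where
  "lift2 A B T = linext (basis A \<times> basis B) (\<lambda>(i, j). tens (bvec i) (T (bvec j)))"

lemma lift_tens:
  assumes A: "galg A" and B: "galg B"
  shows "tlin (basis A) T \<Longrightarrow> lift1 A B T (tens a x) = tens (T a) (crop (basis B) x)"
    "tlin (basis B) S \<Longrightarrow> lift2 A B S (tens a x) = tens (crop (basis A) a) (S x)"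
proof -
  note fi = galgD(1)[OF A] galgD(1)[OF B]
  assume T: "tlin (basis A) T"
  have "lift1 A B T = linext (basis A \<times> basis B) (\<lambda>(i, j). tens (T (bvec i)) (crop (basis B) (bvec j)))"
    unfolding lift1_def linext_sum by (rule ext, rule sum.cong) auto
  then show "lift1 A B T (tens a x) = tens (T a) (crop (basis B) x)"
    by (simp only:) (rule linext_tens[OF fi]; intro tlin_tens_left tlin_tens_right T galg_tlin[OF B])
next
  note fi = galgD(1)[OF A] galgD(1)[OF B]
  assume S: "tlin (basis B) S"
  have "lift2 A B S = linext (basis A \<times> basis B) (\<lambda>(i, j). tens (crop (basis A) (bvec i)) (S (bvec j)))"
    unfolding lift2_def linext_sum by (rule ext, rule sum.cong) auto
  then show "lift2 A B S (tens a x) = tens (crop (basis A) a) (S x)"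
    by (simp only:) (rule linext_tens[OF fi]; intro tlin_tens_left tlin_tens_right S galg_tlin[OF A])
qed

lemma lift_tlin:
  assumes A: "galg A" and B: "galg B"
  shows "tlin (basis A \<times> basis B) (lift1 A B T)" "tlin (basis A \<times> basis B) (lift2 A B S)"
  unfolding lift1_def lift2_def using galgD(1)[OF A] galgD(1)[OF B] by (auto intro: tlin_linext)

text \<open>A unit of \<open>A\<close> implementing \<open>u\<close> is even, so it meets no sign in the braided product, and conjugation
  by it changes signs in the first factor only; likewise for \<open>B\<close>.\<close>

lemma lift_unit_identities:
  assumes cA: "cs A" and cB: "cs B"
  obtains x x' y y' where "x \<in> V (bp A B)" "x' \<in> V (bp A B)" "y \<in> V (bp A B)" "y' \<in> V (bp A B)"
    "amul (bp A B) x x' = aone (bp A B)" "amul (bp A B) y y' = aone (bp A B)"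
    "\<And>s. amul (bp A B) x (amul (bp A B) s x') = lift1 A B (ac A u) s"
    "\<And>s. amul (bp A B) y (amul (bp A B) s y') = lift2 A B (ac B u) s"
proof -
  have A: "galg A" and B: "galg B" using cA cB by auto
  note [simp] = galg_simps[OF A] galg_simps[OF B] bp_mul[OF A B] lift_tens[OF A B]
  from grading_unit[OF cA] obtain x x' where x: "x \<in> V A" "x' \<in> V A" "amul A x x' = aone A"
    "ac A u x = x" "ac A u x' = x'" "\<And>a. amul A x (amul A a x') = ac A u a" by metis
  from grading_unit[OF cB] obtain y y' where y: "y \<in> V B" "y' \<in> V B" "amul B y y' = aone B"
    "ac B u y = y" "ac B u y' = y'" "\<And>a. amul B y (amul B a y') = ac B u a" by metis
  note vl = vlin_rules[OF tlin_vlin[OF bp_tlin_left[OF A B]]] vlin_rules[OF tlin_vlin[OF bp_tlin_right[OF A B]]]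
  let ?P = "bp A B" let ?x = "tens x (aone B)" and ?x' = "tens x' (aone B)"
  let ?y = "tens (aone A) y" and ?y' = "tens (aone A) y'"
  have t: "tlin (basis A \<times> basis B) (\<lambda>s. amul ?P p (amul ?P s q))" for p q
    by (rule tlin_comp[OF tlin_vlin[OF bp_tlin_right[OF A B]] bp_tlin_left[OF A B]])
  show thesis
  proof (rule that[of ?x ?x' ?y ?y'])
    show "?x \<in> V ?P" "?x' \<in> V ?P" "?y \<in> V ?P" "?y' \<in> V ?P" using x y A B by simp_all
    show "amul ?P ?x ?x' = aone ?P" "amul ?P ?y ?y' = aone ?P"
      using x y A B by (simp_all) ((simp_all add: fun_eq_iff lincomb)?)
    show "amul ?P ?x (amul ?P s ?x') = lift1 A B (ac A u) s" for s
      by (rule tlin_ext_prod[of "basis A" "basis B", OF t lift_tlin(1)[OF A B]])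
        (use x A B in \<open>simp add: vl galg_tlin\<close>, use A B in \<open>simp add: fun_eq_iff lincomb\<close>)
    show "amul ?P ?y (amul ?P s ?y') = lift2 A B (ac B u) s" for s
      by (rule tlin_ext_prod[of "basis A" "basis B", OF t lift_tlin(2)[OF A B]])
        (use y A B in \<open>simp add: vl galg_tlin\<close>, use A B in \<open>simp add: fun_eq_iff lincomb\<close>)
  qed
qed

text \<open>Left multiplication in the first factor and right multiplication in the second are literally
  multiplications in the braided product. The other two acquire a sign depending on the degree of the
  factor that is passed, and the sign is undone by applying \<open>u\<close> to that factor.\<close>

lemma lift_left_right:
  assumes A: "galg A" and B: "galg B"
  shows "lift1 A B (amul A a) s = amul (bp A B) (tens a (aone B)) s"
    "lift2 A B (\<lambda>x. amul B x b) s = amul (bp A B) s (tens (aone A) b)"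
    "lift1 A B (\<lambda>x. amul A x a) s = vscale (1 / 2)
       (amul (bp A B) s (tens a (aone B)) + amul (bp A B) s (tens (ac A u a) (aone B))
        + lift2 A B (ac B u) (amul (bp A B) s (tens a (aone B)))
        - lift2 A B (ac B u) (amul (bp A B) s (tens (ac A u a) (aone B))))"
    "lift2 A B (amul B b) s = vscale (1 / 2)
       (amul (bp A B) (tens (aone A) b) s + amul (bp A B) (tens (aone A) (ac B u b)) s
        + lift1 A B (ac A u) (amul (bp A B) (tens (aone A) b) s)
        - lift1 A B (ac A u) (amul (bp A B) (tens (aone A) (ac B u b)) s))"
proof -
  note [simp] = galg_simps[OF A] galg_simps[OF B] bp_mul[OF A B] lift_tens[OF A B]
  note tl = bp_tlin_left[OF A B] bp_tlin_right[OF A B] lift_tlin[OF A B] galg_tlin[OF A] galg_tlin[OF B]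
  note vl = vlin_rules[OF tlin_vlin[OF lift_tlin(1)[OF A B]]] vlin_rules[OF tlin_vlin[OF lift_tlin(2)[OF A B]]]
  note ext = tlin_ext_prod[of "basis A" "basis B"]
  note cl = tlin_comp[OF tlin_vlin[OF lift_tlin(1)[OF A B]]] tlin_comp[OF tlin_vlin[OF lift_tlin(2)[OF A B]]]
  show "lift1 A B (amul A a) s = amul (bp A B) (tens a (aone B)) s"
    by (rule ext[OF tl(3) tl(2)]) (use A B in \<open>simp add: tl\<close>, (simp add: fun_eq_iff lincomb)?)
  show "lift2 A B (\<lambda>x. amul B x b) s = amul (bp A B) s (tens (aone A) b)"
    by (rule ext[OF tl(4) tl(1)]) (use A B in \<open>simp add: tl\<close>, (simp add: fun_eq_iff lincomb)?)
  have "lift1 A B (\<lambda>x. amul A x a) = (\<lambda>s. vscale (1 / 2)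
       (amul (bp A B) s (tens a (aone B)) + amul (bp A B) s (tens (ac A u a) (aone B))
        + lift2 A B (ac B u) (amul (bp A B) s (tens a (aone B)))
        - lift2 A B (ac B u) (amul (bp A B) s (tens (ac A u a) (aone B)))))"
  proof (rule tlin_ext_prod_fun[OF tl(3)])
    show "tlin (basis A \<times> basis B) (\<lambda>s. vscale (1 / 2)
       (amul (bp A B) s (tens a (aone B)) + amul (bp A B) s (tens (ac A u a) (aone B))
        + lift2 A B (ac B u) (amul (bp A B) s (tens a (aone B)))
        - lift2 A B (ac B u) (amul (bp A B) s (tens (ac A u a) (aone B)))))"
      by (rule tlin_scale, rule tlin_diff[OF tlin_add[OF tlin_add[OF tl(1) tl(1)] cl(2)[OF tl(1)]] cl(2)[OF tl(1)]])
  qed (use A B in \<open>simp add: tl vl\<close>, (simp add: fun_eq_iff lincomb)?)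
  then show "lift1 A B (\<lambda>x. amul A x a) s = vscale (1 / 2)
       (amul (bp A B) s (tens a (aone B)) + amul (bp A B) s (tens (ac A u a) (aone B))
        + lift2 A B (ac B u) (amul (bp A B) s (tens a (aone B)))
        - lift2 A B (ac B u) (amul (bp A B) s (tens (ac A u a) (aone B))))"
    by (rule fun_cong)
  have "lift2 A B (amul B b) = (\<lambda>s. vscale (1 / 2)
       (amul (bp A B) (tens (aone A) b) s + amul (bp A B) (tens (aone A) (ac B u b)) s
        + lift1 A B (ac A u) (amul (bp A B) (tens (aone A) b) s)
        - lift1 A B (ac A u) (amul (bp A B) (tens (aone A) (ac B u b)) s)))"
  proof (rule tlin_ext_prod_fun[OF tl(4)])
    show "tlin (basis A \<times> basis B) (\<lambda>s. vscale (1 / 2)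
       (amul (bp A B) (tens (aone A) b) s + amul (bp A B) (tens (aone A) (ac B u b)) s
        + lift1 A B (ac A u) (amul (bp A B) (tens (aone A) b) s)
        - lift1 A B (ac A u) (amul (bp A B) (tens (aone A) (ac B u b)) s)))"
      by (rule tlin_scale, rule tlin_diff[OF tlin_add[OF tlin_add[OF tl(2) tl(2)] cl(1)[OF tl(2)]] cl(1)[OF tl(2)]])
  qed (use A B in \<open>simp add: tl vl\<close>, (simp add: fun_eq_iff lincomb)?)
  then show "lift2 A B (amul B b) s = vscale (1 / 2)
       (amul (bp A B) (tens (aone A) b) s + amul (bp A B) (tens (aone A) (ac B u b)) s
        + lift1 A B (ac A u) (amul (bp A B) (tens (aone A) b) s)
        - lift1 A B (ac A u) (amul (bp A B) (tens (aone A) (ac B u b)) s))"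
    by (rule fun_cong)
qed

lemma lift_comp_add:
  assumes A: "galg A" and B: "galg B"
  shows "tlin (basis A) S \<Longrightarrow> tlin (basis A) T \<Longrightarrow> lift1 A B (\<lambda>x. S (T x)) s = lift1 A B S (lift1 A B T s)"
    "tlin (basis A) S \<Longrightarrow> tlin (basis A) T \<Longrightarrow> lift1 A B (\<lambda>x. S x + T x) s = lift1 A B S s + lift1 A B T s"
    "tlin (basis B) S' \<Longrightarrow> tlin (basis B) T' \<Longrightarrow> lift2 A B (\<lambda>x. S' (T' x)) s = lift2 A B S' (lift2 A B T' s)"
    "tlin (basis B) S' \<Longrightarrow> tlin (basis B) T' \<Longrightarrow> lift2 A B (\<lambda>x. S' x + T' x) s = lift2 A B S' s + lift2 A B T' s"
proof -
  note tl = lift_tlin[OF A B]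
  note cl = tlin_comp[OF tlin_vlin[OF lift_tlin(1)[OF A B]]] tlin_comp[OF tlin_vlin[OF lift_tlin(2)[OF A B]]]
  note ext = tlin_ext_prod[of "basis A" "basis B"]
  { assume ST: "tlin (basis A) S" "tlin (basis A) T"
    have c: "tlin (basis A) (\<lambda>x. S (T x))" "tlin (basis A) (\<lambda>x. S x + T x)"
      using ST tlin_comp[OF tlin_vlin[OF ST(1)] ST(2)] tlin_add by auto
    show "lift1 A B (\<lambda>x. S (T x)) s = lift1 A B S (lift1 A B T s)"
      by (rule ext[OF tl(1) cl(1)[OF tl(1)]]) (simp add: lift_tens[OF A B] c ST)
    show "lift1 A B (\<lambda>x. S x + T x) s = lift1 A B S s + lift1 A B T s"
      by (rule ext[OF tl(1) tlin_add[OF tl(1) tl(1)]]) (simp add: lift_tens[OF A B] c ST tens_simps) }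
  { assume ST: "tlin (basis B) S'" "tlin (basis B) T'"
    have c: "tlin (basis B) (\<lambda>x. S' (T' x))" "tlin (basis B) (\<lambda>x. S' x + T' x)"
      using ST tlin_comp[OF tlin_vlin[OF ST(1)] ST(2)] tlin_add by auto
    show "lift2 A B (\<lambda>x. S' (T' x)) s = lift2 A B S' (lift2 A B T' s)"
      by (rule ext[OF tl(2) cl(2)[OF tl(2)]]) (simp add: lift_tens[OF A B] c ST)
    show "lift2 A B (\<lambda>x. S' x + T' x) s = lift2 A B S' s + lift2 A B T' s"
      by (rule ext[OF tl(2) tlin_add[OF tl(2) tl(2)]]) (simp add: lift_tens[OF A B] c ST tens_simps) }
qed

text \<open>A two-sided ideal is stable under applying \<open>u\<close> to a single factor, because that is conjugation
  by a unit. By the preceding identities it is then stable under the unbraided multiplications as well,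
  so every ideal of \<open>A \<sharp> B\<close> is an ideal of the ordinary tensor product.\<close>

lemma bp_ideal_lift:
  assumes cA: "cs A" and cB: "cs B" and J: "idl (bp A B) J"
  shows "T \<in> mops A \<Longrightarrow> s \<in> J \<Longrightarrow> lift1 A B T s \<in> J"
    "T' \<in> mops B \<Longrightarrow> s \<in> J \<Longrightarrow> lift2 A B T' s \<in> J"
proof -
  have A: "galg A" and B: "galg B" using cA cB by auto
  let ?P = "bp A B"
  note P = galg_bp[OF A B]
  have Jm: "amul ?P a s \<in> J" "amul ?P s a \<in> J" if "s \<in> J" for a s
  proof -
    have "amul ?P (crop (basis ?P) a) s \<in> J" "amul ?P s (crop (basis ?P) a) \<in> J"
      using J that crop_vspace unfolding idl_def by blast+
    then show "amul ?P a s \<in> J" "amul ?P s a \<in> J" by (simp_all only: galg_simps[OF P])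
  qed
  have Ja: "s + t \<in> J" if "s \<in> J" "t \<in> J" for s t using J that unfolding idl_def by blast
  note Js = idl_scale[OF P J] and Jd = idl_diff[OF P J]
  from lift_unit_identities[OF cA cB]
  have U: "lift1 A B (ac A u) s \<in> J" "lift2 A B (ac B u) s \<in> J" if "s \<in> J" for s
    using Jm that by metis+
  show "T \<in> mops A \<Longrightarrow> s \<in> J \<Longrightarrow> lift1 A B T s \<in> J"
  proof (induction arbitrary: s rule: mops.induct)
    case (left a) then show ?case by (simp add: lift_left_right[OF A B] Jm)
  next
    case (right a) then show ?case
      unfolding lift_left_right(3)[OF A B] by (intro Js Ja Jd U Jm) auto
  next
    case (comp S T) then show ?case by (simp add: lift_comp_add[OF A B] mops_tlin[OF A])
  next
    case (plus S T) then show ?case by (simp add: lift_comp_add[OF A B] mops_tlin[OF A] Ja)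
  qed
  show "T' \<in> mops B \<Longrightarrow> s \<in> J \<Longrightarrow> lift2 A B T' s \<in> J"
  proof (induction arbitrary: s rule: mops.induct)
    case (right a) then show ?case by (simp add: lift_left_right[OF A B] Jm)
  next
    case (left a) then show ?case
      unfolding lift_left_right(4)[OF A B] by (intro Js Ja Jd U Jm) auto
  next
    case (comp S T) then show ?case by (simp add: lift_comp_add[OF A B] mops_tlin[OF B])
  next
    case (plus S T) then show ?case by (simp add: lift_comp_add[OF A B] mops_tlin[OF B] Ja)
  qed
qed

lemma lift1_slice:
  assumes A: "galg A" and B: "galg B" and T: "tlin (basis A) T" and j: "j \<in> basis B"
  shows "lift1 A B T s (i, j) = T (\<lambda>i. s (i, j)) i"
proof -
  have "lift1 A B T s (i, j) = (\<Sum>i'\<in>basis A. \<Sum>j'\<in>basis B. s (i', j') * (T (bvec i') i * (if j = j' then 1 else 0)))"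
    by (simp add: lift1_def linext_def sum.cartesian_product case_prod_beta tens_def bvec_def)
  also have "\<dots> = (\<Sum>i'\<in>basis A. s (i', j) * T (bvec i') i)"
    using j galgD(1)[OF B] by (simp add: if_distrib cong: if_cong)
  also have "\<dots> = T (\<lambda>i. s (i, j)) i"
    by (subst tlinD[OF T, of "\<lambda>i. s (i, j)"]) (simp add: vec_apply)
  finally show ?thesis .
qed

text \<open>Ideals are handled by coordinate operators in both factors. A central element is fixed by
  \<open>u\<close> in each factor, so it commutes with \<open>A\<close> without signs: its slices are central in \<open>A\<close>, hence it is
  \<open>1 \<otimes> c\<close> with \<open>c\<close> central in \<open>B\<close>.\<close>

theorem cs_bp:
  assumes cA: "cs A" and cB: "cs B" shows "cs (bp A B)"
proof (rule csI)
  have A: "galg A" and B: "galg B" using cA cB by auto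
  let ?P = "bp A B"
  show P: "galg ?P" using galg_bp[OF A B] .
  show "basis ?P \<noteq> {}" using cs_nonempty[OF cA] cs_nonempty[OF cB] by simp
  note fi = galgD(1)[OF A] galgD(1)[OF B]
  { fix J s assume J: "idl ?P J" and s: "s \<in> J" "s \<noteq> 0"
    have "\<exists>i0\<in>basis A. \<exists>j0\<in>basis B. s (i0, j0) \<noteq> 0"
    proof (rule ccontr)
      assume n: "\<not> ?thesis"
      have "s \<in> V ?P" using J s unfolding idl_def by blast
      then have "s = 0" using n by (auto simp: vspace_def fun_eq_iff vec_apply)
      then show False using s by simp
    qed
    then obtain i0 j0 where ij: "i0 \<in> basis A" "j0 \<in> basis B" "s (i0, j0) \<noteq> 0" by blast
    from mops_coordinate[OF cA ij(1)] obtain T where T: "T \<in> mops A"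
      "\<forall>j\<in>basis A. T (bvec j) = (if j = i0 then aone A else 0)" by blast
    from mops_coordinate[OF cB ij(2)] obtain S where S: "S \<in> mops B"
      "\<forall>j\<in>basis B. S (bvec j) = (if j = j0 then aone B else 0)" by blast
    have tT: "tlin (basis A) T" and tS: "tlin (basis B) S" using T S mops_tlin A B by blast+
    have "lift2 A B S (lift1 A B T s) = (\<Sum>x\<in>basis A \<times> basis B. vscale (s x) (tens (T (bvec (fst x))) (S (bvec (snd x)))))"
    proof -
      have "lift2 A B S (lift1 A B T s) = (\<Sum>x\<in>basis A \<times> basis B. vscale (s x)
          (lift2 A B S (tens (T (bvec (fst x))) (bvec (snd x)))))"
        unfolding lift1_def linext_sum
        by (simp add: vlin_rules[OF tlin_vlin[OF lift_tlin(2)[OF A B]]] case_prod_beta)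
      also have "\<dots> = (\<Sum>x\<in>basis A \<times> basis B. vscale (s x) (tens (T (bvec (fst x))) (S (bvec (snd x)))))"
        using mops_tlin(2)[OF A T(1)] by (simp add: lift_tens(2)[OF A B tS])
      finally show ?thesis .
    qed
    also have "\<dots> = (\<Sum>x\<in>basis A \<times> basis B. if x = (i0, j0) then vscale (s x) (aone ?P) else 0)"
      using T(2) S(2) by (intro sum.cong) (auto simp: tens_simps)
    also have "\<dots> = vscale (s (i0, j0)) (aone ?P)" using fi ij by simp
    finally have "vscale (s (i0, j0)) (aone ?P) \<in> J"
      using bp_ideal_lift[OF cA cB J] T(1) S(1) s(1) by metis
    from idl_scale[OF P J this, of "inverse (s (i0, j0))"] ij(3)
    show "aone ?P \<in> J" by simp }
  { fix z assume zV: "z \<in> V ?P" and z: "\<And>v. v \<in> V ?P \<Longrightarrow> amul ?P z v = amul ?P v z"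
    have z': "amul ?P z v = amul ?P v z" for v
      using z[of "crop (basis ?P) v"] by (simp only: crop_vspace galg_simps[OF P] simp_thms)
    have cz: "amul ?P x (amul ?P z x') = z" if "amul ?P x x' = aone ?P" for x x'
    proof -
      have "amul ?P x (amul ?P z x') = amul ?P (amul ?P x x') z"
        by (simp only: z' galg_simps(13)[OF P])
      also have "\<dots> = z" using that zV by (simp only: galg_simps[OF P] crop_id)
      finally show ?thesis .
    qed
    from lift_unit_identities[OF cA cB] cz
    have ev: "lift1 A B (ac A u) z = z" "lift2 A B (ac B u) z = z" by metis+
    \<comment> \<open>Being central, \<open>z\<close> is fixed by \<open>u\<close> in each factor; hence its products with elements of \<open>A\<close> are fixed by \<open>u\<close> in the second factor.\<close>
    have evm: "lift2 A B (ac B u) (amul ?P z (tens a (aone B))) = amul ?P z (tens a (aone B))" for a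
    proof -
      have "amul ?P z (tens a (aone B)) = lift1 A B (amul A a) z"
        by (simp only: z' lift_left_right(1)[OF A B])
      moreover have "(\<lambda>t. lift2 A B (ac B u) (lift1 A B (amul A a) t)) = (\<lambda>t. lift1 A B (amul A a) (lift2 A B (ac B u) t))"
      proof (rule tlin_ext_prod_fun)
        note l = lift_tlin[OF A B]
        show "tlin (basis A \<times> basis B) (\<lambda>t. lift2 A B (ac B u) (lift1 A B (amul A a) t))"
          "tlin (basis A \<times> basis B) (\<lambda>t. lift1 A B (amul A a) (lift2 A B (ac B u) t))"
          by (rule tlin_comp[OF tlin_vlin[OF l(2)] l(1)], rule tlin_comp[OF tlin_vlin[OF l(1)] l(2)])
      qed (use A B in \<open>simp add: lift_tens galg_tlin galg_simps\<close>)
      ultimately show ?thesis using ev by metis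
    qed
    have c1: "lift1 A B (\<lambda>x. amul A x a) z = lift1 A B (amul A a) z" for a
      unfolding lift_left_right(3)[OF A B] evm
      unfolding lift_left_right(1)[OF A B] z' by (simp add: fun_eq_iff lincomb)
    have "\<exists>c. \<forall>i\<in>basis A. z (i, j) = c * aone A i" if j: "j \<in> basis B" for j
    proof -
      let ?z = "\<lambda>i. z (i, j)"
      have zj: "?z \<in> V A" using zV by (auto simp: vspace_def)
      have "amul A ?z a = amul A a ?z" for a
      proof
        fix i
        show "amul A ?z a i = amul A a ?z i"
          using fun_cong[OF c1[of a], of "(i, j)"]
          by (simp add: lift1_slice[OF A B _ j] galg_tlin[OF A])
      qed
      from cs_center[OF cA zj this] obtain c where "?z = vscale c (aone A)" by blast
      then show ?thesis by (metis vec_apply(5))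
    qed
    then obtain c0 where c0: "\<And>i j. i \<in> basis A \<Longrightarrow> j \<in> basis B \<Longrightarrow> z (i, j) = c0 j * aone A i" by metis
    define c where "c = crop (basis B) c0"
    have zc: "z = tens (aone A) c"
    proof -
      have "z (i, j) = tens (aone A) c (i, j)" for i j
        using zV galg_closed(2)[OF A] c0[of i j]
        by (cases "i \<in> basis A") (auto simp: tens_def c_def crop_def vspace_def mult.commute)
      then show ?thesis by (simp add: fun_eq_iff)
    qed
    have cV: "c \<in> V B" by (simp add: c_def)
    have comm: "amul B c b = amul B b c" for b
    proof -
      have "amul ?P z (tens (aone A) b) = tens (aone A) (amul B c b)"
        using A by (simp add: zc bp_rules[OF A B])
      moreover have "amul ?P (tens (aone A) b) z = tens (aone A) (amul B b c)"
        using A by (simp add: zc bp_rules[OF A B])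
      ultimately have eq: "tens (aone A) (amul B c b) = tens (aone A) (amul B b c)" using z' by simp
      from cs_one_nonzero[OF cA] obtain i where i: "aone A i \<noteq> 0" by (auto simp: fun_eq_iff vec_apply)
      show ?thesis
      proof
        fix j show "amul B c b j = amul B b c j" using fun_cong[OF eq, of "(i, j)"] i by (simp add: tens_def)
      qed
    qed
    from cs_center[OF cB cV comm] obtain k where "c = vscale k (aone B)" by blast
    then have "z = vscale k (aone ?P)" by (simp add: zc tens_simps)
    then show "\<exists>c. z = vscale c (aone ?P)" by blast }
qed

end

section \<open>Matrices\<close>

text \<open>Cropped to \<open>I \<times> I\<close>, unlike the product of \<open>End_alg\<close>.\<close>

definition mm :: "'i set \<Rightarrow> ('i \<times> 'i \<Rightarrow> 'k::field) \<Rightarrow> ('i \<times> 'i \<Rightarrow> 'k) \<Rightarrow> 'i \<times> 'i \<Rightarrow> 'k" where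
  "mm I S T = (\<lambda>(i, j). if i \<in> I \<and> j \<in> I then \<Sum>l\<in>I. S (i, l) * T (l, j) else 0)"

abbreviation idm :: "'i set \<Rightarrow> 'i \<times> 'i \<Rightarrow> 'k::field" where
  "idm I \<equiv> mat_of I (\<lambda>v. v)"

lemma mm_vspace [simp]: "mm I S T \<in> vspace (I \<times> I)"
  by (auto simp: mm_def vspace_def)

lemma mat_of_vspace [simp]: "mat_of I f \<in> vspace (I \<times> I)"
  by (auto simp: mat_of_def vspace_def)

lemma mm_add: "mm I (S + S') T = mm I S T + mm I S' T" "mm I T (S + S') = mm I T S + mm I T S'"
  and mm_scale: "mm I (vscale c S) T = vscale c (mm I S T)" "mm I T (vscale c S) = vscale c (mm I T S)"
  by (auto simp: mm_def fun_eq_iff vec_apply sum.distrib sum_distrib_left algebra_simps)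

lemma mm_vlin: "vlin (mm I S)" "vlin (\<lambda>S. mm I S T)"
  by (simp_all add: vlin_def mm_add mm_scale)

lemma mm_rules:
  "mm I (S - S') T = mm I S T - mm I S' T" "mm I T (S - S') = mm I T S - mm I T S'"
  "mm I (- S) T = - mm I S T" "mm I T (- S) = - mm I T S" "mm I 0 T = 0" "mm I T 0 = 0"
  by (rule vlin_diff[OF mm_vlin(2)], rule vlin_diff[OF mm_vlin(1)], rule vlin_minus[OF mm_vlin(2)],
      rule vlin_minus[OF mm_vlin(1)], rule vlin_zero[OF mm_vlin(2)], rule vlin_zero[OF mm_vlin(1)])

lemma mm_crop: "mm I (crop (I \<times> I) S) T = mm I S T" "mm I S (crop (I \<times> I) T) = mm I S T"
  by (auto simp: mm_def crop_def fun_eq_iff)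

lemma mm_tlin:
  assumes "finite I" shows "tlin (I \<times> I) (mm I S)" "tlin (I \<times> I) (\<lambda>S. mm I S T)"
  using tlin_cropI[of "I \<times> I" "mm I S"] tlin_cropI[of "I \<times> I" "\<lambda>S. mm I S T"] assms
  by (simp_all add: mm_add mm_scale mm_crop)

lemma mm_assoc: "mm I (mm I S T) U = mm I S (mm I T U)"
proof -
  have "(\<Sum>l\<in>I. (\<Sum>m\<in>I. S (i, m) * T (m, l)) * U (l, j)) = (\<Sum>m\<in>I. S (i, m) * (\<Sum>l\<in>I. T (m, l) * U (l, j)))" for i j
    by (simp add: sum_distrib_left sum_distrib_right mult.assoc) (rule sum.swap)
  then show ?thesis by (auto simp: mm_def fun_eq_iff)
qed

lemma mm_idm:
  assumes "finite I" shows "mm I (idm I) S = crop (I \<times> I) S" "mm I S (idm I) = crop (I \<times> I) S"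
  using assms by (auto simp: mm_def crop_def fun_eq_iff mat_of_def bvec_def if_distrib[of "\<lambda>c. c * _"] if_distrib[of "\<lambda>c. _ * c"] cong: if_cong)

lemma mm_mat_of:
  assumes "finite I" "tlin I S" "\<And>v. T v \<in> vspace I"
  shows "mm I (mat_of I S) (mat_of I T) = mat_of I (\<lambda>v. S (T v))"
proof -
  have "(\<Sum>l\<in>I. S (bvec l) i * T (bvec j) l) = S (T (bvec j)) i" if "i \<in> I" "j \<in> I" for i j
    by (subst tlinD[OF assms(2), of "T (bvec j)"]) (simp add: vec_apply mult.commute)
  then show ?thesis by (auto simp: mm_def mat_of_def fun_eq_iff)
qed

lemma mat_app_tlin: "finite I \<Longrightarrow> tlin I (mat_app I S)"
proof -
  assume f: "finite I"
  have "mat_app I S v = linext I (\<lambda>j i. S (i, j)) v" for v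
    by (simp add: mat_app_def linext_def mult.commute)
  then have "mat_app I S = linext I (\<lambda>j i. S (i, j))" by blast
  then show ?thesis using tlin_linext[OF f] by metis
qed

lemma mat_app_bvec: "finite I \<Longrightarrow> j \<in> I \<Longrightarrow> mat_app I S (bvec j) = (\<lambda>i. S (i, j))"
  by (simp add: mat_app_def bvec_def if_distrib[of "\<lambda>c. _ * c"] cong: if_cong)

lemma mat_of_mat_app: "finite I \<Longrightarrow> mat_of I (mat_app I S) = crop (I \<times> I) S"
  by (auto simp: mat_of_def crop_def fun_eq_iff mat_app_bvec)

lemma mat_app_vspace: "S \<in> vspace (I \<times> I) \<Longrightarrow> mat_app I S v \<in> vspace I"
  by (auto simp: mat_app_def vspace_def intro!: sum.neutral)

lemma mat_app_mat_of:
  assumes "tlin I S" "\<And>v. S v \<in> vspace I" shows "mat_app I (mat_of I S) v = S v"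
proof
  fix i
  show "mat_app I (mat_of I S) v i = S v i"
    using assms(2) by (subst tlinD[OF assms(1), of v]) (auto simp: mat_app_def mat_of_def vec_apply mult.commute vspace_def intro!: sum.cong)
qed

lemma mat_of_scale: "mat_of I (\<lambda>v. vscale c (S v)) = vscale c (mat_of I S)"
  by (auto simp: mat_of_def fun_eq_iff vec_apply)

lemma mat_of_sum: "mat_of I (\<lambda>v. \<Sum>x\<in>N. F x v) = (\<Sum>x\<in>N. mat_of I (F x))"
  by (auto simp: mat_of_def fun_eq_iff vec_apply)

lemma mat_of_cong: "(\<And>v. v \<in> vspace I \<Longrightarrow> S v = T v) \<Longrightarrow> mat_of I S = mat_of I T"
  by (auto simp: mat_of_def fun_eq_iff)

context central_involution begin

text \<open>The matrix algebra on which \<open>g\<close> acts by \<open>T \<mapsto> w(g) T w'(g)\<close>. Keeping \<open>w\<close> and \<open>w'\<close> separate covers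
  projective representations, where \<open>w'(g)\<close> is only a multiple of \<open>w(inv g)\<close>.\<close>

definition matalg :: "'i set \<Rightarrow> ('g \<Rightarrow> 'i \<times> 'i \<Rightarrow> 'k) \<Rightarrow> ('g \<Rightarrow> 'i \<times> 'i \<Rightarrow> 'k) \<Rightarrow> ('i \<times> 'i, 'k, 'g) hmalg" where
  "matalg I w w' = \<lparr>basis = I \<times> I, amul = mm I, aone = idm I,
     act = \<lambda>h T. \<Sum>g\<in>carrier G. vscale (h g) (mm I (w g) (mm I T (w' g)))\<rparr>"

lemma matalg_simps [simp]:
  "basis (matalg I w w') = I \<times> I" "amul (matalg I w w') = mm I" "aone (matalg I w w') = idm I"
  "g \<in> carrier G \<Longrightarrow> ac (matalg I w w') g T = mm I (w g) (mm I T (w' g))"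
  by (simp_all add: matalg_def sum_bvec)

lemma galg_matalg:
  assumes I: "finite I"
    and inv: "\<And>g. g \<in> carrier G \<Longrightarrow> mm I (w' g) (w g) = idm I" "\<And>g. g \<in> carrier G \<Longrightarrow> mm I (w g) (w' g) = idm I"
    and one: "\<And>T. T \<in> vspace (I \<times> I) \<Longrightarrow> mm I (w \<one>) (mm I T (w' \<one>)) = T"
    and mult: "\<And>g h T. g \<in> carrier G \<Longrightarrow> h \<in> carrier G \<Longrightarrow>
      mm I (w (g \<otimes> h)) (mm I T (w' (g \<otimes> h))) = mm I (w g) (mm I (mm I (w h) (mm I T (w' h))) (w' g))"
  shows "galg (matalg I w w')"
proof (rule galgI; (simp add: I mm_tlin mm_assoc mm_idm mm_rules one)?)
  show "act (matalg I w w') h v = (\<Sum>g\<in>carrier G. vscale (h g) (mm I (w g) (mm I v (w' g))))" for h v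
    by (simp add: matalg_def)
  fix g assume g: "g \<in> carrier G"
  have "tlin (I \<times> I) (\<lambda>T. mm I (w g) (mm I T (w' g)))"
    by (rule tlin_comp[OF mm_vlin(1) mm_tlin(2)[OF I]])
  then show "tlin (I \<times> I) (ac (matalg I w w') g)"
    using g matalg_simps(4)[of g I w w'] by presburger
  show "mm I (w g) (mm I a (mm I b (w' g))) = mm I (w g) (mm I a (mm I (w' g) (mm I (w g) (mm I b (w' g)))))" for a b
  proof -
    have "mm I (w' g) (mm I (w g) (mm I b (w' g))) = mm I (mm I (w' g) (w g)) (mm I b (w' g))"
      by (simp only: mm_assoc)
    then show ?thesis using g by (simp add: inv mm_idm I)
  qed
  show "mm I (w g) (crop (I \<times> I) (w' g)) = idm I" using g by (simp add: mm_crop inv)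
  show "mm I (w (g \<otimes> h)) (mm I v (w' (g \<otimes> h))) = mm I (w g) (mm I (w h) (mm I v (mm I (w' h) (w' g))))"
    if "h \<in> carrier G" for h v using mult[OF g that] by (simp add: mm_assoc)
qed

text \<open>Matrix units extract single entries; simplicity and the determination of the centre rest on this.\<close>

lemma mm_unit_sandwich:
  assumes I: "finite I" and m: "a \<in> I" "b \<in> I" "c \<in> I" "d \<in> I"
  shows "mm I (bvec (a, b)) (mm I S (bvec (c, d))) = vscale (S (b, c)) (bvec (a, d))"
proof -
  have 1: "mm I S (bvec (c, d)) = (\<lambda>(i, j). if i \<in> I \<and> j = d then S (i, c) else 0)" for S
  proof -
    have "(\<Sum>l\<in>I. S (i, l) * bvec (c, d) (l, j)) = (\<Sum>l\<in>I. if l = c then (if j = d then S (i, l) else 0) else 0)" for i j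
      by (auto simp: bvec_def intro!: sum.cong)
    then show ?thesis using I m by (auto simp: mm_def fun_eq_iff)
  qed
  have 2: "mm I (bvec (a, b)) T = (\<lambda>(i, j). if i = a \<and> j \<in> I then T (b, j) else 0)" for T
  proof -
    have "(\<Sum>l\<in>I. bvec (a, b) (i, l) * T (l, j)) = (\<Sum>l\<in>I. if l = b then (if i = a then T (l, j) else 0) else 0)" for i j
      by (auto simp: bvec_def intro!: sum.cong)
    then show ?thesis using I m by (auto simp: mm_def fun_eq_iff)
  qed
  show ?thesis unfolding 1 2 using m by (auto simp: fun_eq_iff vec_apply bvec_def)
qed

lemma cs_matalg:
  assumes M: "galg (matalg I w w')" and I: "finite I" "I \<noteq> {}"
  shows "cs (matalg I w w')"
proof (rule csI[OF M])
  show "basis (matalg I w w') \<noteq> {}" using I by simp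
  have idm: "idm I = (\<Sum>a\<in>I. bvec (a, a) :: _ \<Rightarrow> 'k)"
  proof -
    have "idm I (i, j) = (\<Sum>a\<in>I. bvec (a, a) :: _ \<Rightarrow> 'k) (i, j)" for i j
    proof -
      have "(\<Sum>a\<in>I. bvec (a, a) :: _ \<Rightarrow> 'k) (i, j) = (\<Sum>a\<in>I. if a = i then (if i = j then 1 else 0) else 0)"
        unfolding sum_fun_apply by (cases "i = j") (auto simp: bvec_def intro!: sum.cong sum.neutral)
      then show ?thesis using I by (cases "i = j") (auto simp: mat_of_def bvec_def intro!: sum.neutral)
    qed
    then show ?thesis by (simp add: fun_eq_iff)
  qed
  { fix J x assume J: "idl (matalg I w w') J" and x: "x \<in> J" "x \<noteq> 0"
    have "x \<in> vspace (I \<times> I)" using J x unfolding idl_def by auto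
    with x(2) obtain b c where bc: "b \<in> I" "c \<in> I" "x (b, c) \<noteq> 0"
      by (auto simp: vspace_def fun_eq_iff vec_apply)
    have Jm: "mm I a (mm I x b) \<in> J" if "a \<in> vspace (I \<times> I)" "b \<in> vspace (I \<times> I)" for a b
      using J x that unfolding idl_def matalg_simps by blast
    have b: "bvec (a, a) \<in> J" if a: "a \<in> I" for a
    proof -
      have "vscale (x (b, c)) (bvec (a, a)) \<in> J"
        using Jm[of "bvec (a, b)" "bvec (c, a)"] mm_unit_sandwich[OF I(1) a bc(1,2) a, of x] a bc by simp
      from idl_scale[OF M J this, of "inverse (x (b, c))"] show ?thesis using bc by simp
    qed
    have s: "0 \<in> J" "\<And>x y. x \<in> J \<Longrightarrow> y \<in> J \<Longrightarrow> x + y \<in> J" using J unfolding idl_def by blast+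
    have sum: "(\<Sum>a\<in>K. bvec (a, a)) \<in> J" if "finite K" "K \<subseteq> I" for K
      using that by (induction K rule: finite_induct) (auto simp: b s)
    from sum[OF I(1)] show "aone (matalg I w w') \<in> J" by (simp add: idm) }
  { fix z assume zV: "z \<in> V (matalg I w w')" and z: "\<And>v. v \<in> V (matalg I w w') \<Longrightarrow> amul (matalg I w w') z v = amul (matalg I w w') v z"
    from I obtain o1 where o: "o1 \<in> I" by blast
    have *: "vscale (z (b, c)) (bvec (a, d)) = (if b = c then vscale (z (o1, o1)) (bvec (a, d)) else 0)"
      if m: "a \<in> I" "b \<in> I" "c \<in> I" "d \<in> I" for a b c d
    proof -
      have i1: "mm I (bvec (b, b)) z = mm I z (bvec (b, b))" if "b \<in> I" for b using z[of "bvec (b, b)"] that by simp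
      have e: "mm I (bvec (a, b)) (mm I z (bvec (c, d))) = mm I (mm I (bvec (a, b)) (bvec (c, d))) z"
        if m: "a \<in> I" "b \<in> I" "c \<in> I" "d \<in> I" for a b c d
        using z[of "bvec (c, d)"] m by (simp add: mm_assoc)
      have u: "mm I (bvec (a, b)) (bvec (c, d)) = (if b = c then bvec (a, d) else (0 :: _ \<Rightarrow> 'k))"
        if m: "a \<in> I" "b \<in> I" "c \<in> I" "d \<in> I" for a b c d
      proof -
        have "idm I (b, c) = (if b = c then 1 else (0::'k))" using m by (auto simp: mat_of_def bvec_def)
        then show ?thesis
          using mm_unit_sandwich[OF I(1) m, of "idm I :: _ \<Rightarrow> 'k"] m by (simp add: mm_idm I split: if_splits)
      qed
      have "vscale (z (b, c)) (bvec (a, d)) = (if b = c then mm I (bvec (a, d)) z else 0)"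
        using e[OF m] u[OF m] mm_unit_sandwich[OF I(1) m, of z] by (simp add: mm_rules)
      moreover have "mm I (bvec (a, d)) z = vscale (z (o1, o1)) (bvec (a, d))"
        using e[OF m(1) o o m(4)] u[OF m(1) o o m(4)] mm_unit_sandwich[OF I(1) m(1) o o m(4), of z] by simp
      ultimately show ?thesis by simp
    qed
    have "z (b, c) = (if b = c then z (o1, o1) else 0)" if m: "b \<in> I" "c \<in> I" for b c
      using fun_cong[OF *[OF o m o], of "(o1, o1)"] by (auto simp: vec_apply split: if_splits)
    then have "z = vscale (z (o1, o1)) (idm I)"
      using zV by (auto simp: fun_eq_iff vec_apply mat_of_def bvec_def vspace_def)
    then show "\<exists>c. z = vscale c (aone (matalg I w w'))" by auto }
qed

section \<open>Representations\<close>

text \<open>A representation of \<open>G\<close> by matrices, on a nonzero space.\<close>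

definition grep :: "'i set \<Rightarrow> ('g \<Rightarrow> 'i \<times> 'i \<Rightarrow> 'k) \<Rightarrow> bool" where
  "grep I w \<longleftrightarrow> finite I \<and> I \<noteq> {} \<and> (\<forall>g\<in>carrier G. w g \<in> vspace (I \<times> I))
     \<and> (\<forall>g\<in>carrier G. \<forall>h\<in>carrier G. mm I (w g) (w h) = w (g \<otimes> h)) \<and> w \<one> = idm I"

abbreviation EndG :: "'i set \<Rightarrow> ('g \<Rightarrow> 'i \<times> 'i \<Rightarrow> 'k) \<Rightarrow> ('i \<times> 'i, 'k, 'g) hmalg" where
  "EndG I w \<equiv> matalg I w (\<lambda>g. w (inv g))"

lemma grepD:
  assumes "grep I w"
  shows "finite I" "I \<noteq> {}" "g \<in> carrier G \<Longrightarrow> w g \<in> vspace (I \<times> I)"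
    "g \<in> carrier G \<Longrightarrow> h \<in> carrier G \<Longrightarrow> mm I (w g) (w h) = w (g \<otimes> h)" "w \<one> = idm I"
  using assms unfolding grep_def by auto

lemma grep_assoc:
  assumes "grep I w" "g \<in> carrier G" "h \<in> carrier G"
  shows "mm I (w g) (mm I (w h) T) = mm I (w (g \<otimes> h)) T"
  using grepD(4)[OF assms] by (metis mm_assoc)

lemma galg_EndG:
  assumes w: "grep I w" shows "galg (EndG I w)"
proof (rule galg_matalg)
  show "mm I (w (g \<otimes> h)) (mm I T (w (inv (g \<otimes> h))))
    = mm I (w g) (mm I (mm I (w h) (mm I T (w (inv h)))) (w (inv g)))"
    if "g \<in> carrier G" "h \<in> carrier G" for g h T
    using that by (simp add: mm_assoc grepD(4)[OF w] grep_assoc[OF w] inv_mult_group)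
qed (use grepD[OF w] in \<open>simp_all add: mm_idm mm_crop\<close>)

lemma cs_EndG: "grep I w \<Longrightarrow> cs (EndG I w)"
  using cs_matalg[OF galg_EndG] grepD by blast

definition gmod :: "'i set \<Rightarrow> ('g \<Rightarrow> 'i \<times> 'i \<Rightarrow> 'k) \<Rightarrow> ('g, 'i, 'k) hmod" where
  "gmod I w = \<lparr>mbasis = I, mact = \<lambda>h v. \<Sum>g\<in>carrier G. vscale (h g) (mat_app I (w g) v)\<rparr>"

lemma mat_app_mm:
  assumes "finite I" "S \<in> vspace (I \<times> I)" "T \<in> vspace (I \<times> I)"
  shows "mat_app I (mm I S T) v = mat_app I S (mat_app I T v)"
proof -
  have "mm I S T = mat_of I (\<lambda>v. mat_app I S (mat_app I T v))"
    using mm_mat_of[OF assms(1) mat_app_tlin[OF assms(1)], of "mat_app I T" S] assms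
    by (simp add: mat_of_mat_app mat_app_vspace)
  then show ?thesis
    using mat_app_mat_of[of I "\<lambda>v. mat_app I S (mat_app I T v)" v] assms
    by (metis mat_app_vspace mat_app_tlin tlin_comp tlin_vlin)
qed

lemma hmodule_gmod:
  assumes w: "grep I w" shows "hmodule H (gmod I w)"
proof -
  note D = grepD[OF w]
  have vl: "vlin (mat_app I (w g))" for g using tlin_vlin[OF mat_app_tlin[OF D(1)]] .
  have V: "(\<Sum>g\<in>carrier G. vscale (h g) (mat_app I (w g) v)) \<in> vspace I" for h v
    using D(3) by (simp add: mat_app_vspace)
  have mult: "(\<Sum>x\<in>carrier G. vscale (amul H g h x) (mat_app I (w x) v))
     = (\<Sum>p\<in>carrier G. vscale (g p) (mat_app I (w p) (\<Sum>q\<in>carrier G. vscale (h q) (mat_app I (w q) v))))" for g h v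
  proof -
    have "(\<Sum>x\<in>carrier G. vscale (amul H g h x) (mat_app I (w x) v)) = linext (carrier G) (\<lambda>x. mat_app I (w x) v) (amul H g h)"
      by (simp add: linext_sum)
    also have "\<dots> = (\<Sum>p\<in>carrier G. vscale (g p) (\<Sum>q\<in>carrier G. vscale (h q) (mat_app I (w (p \<otimes> q)) v)))"
    proof -
      have "amul H g h = (\<Sum>p\<in>carrier G. vscale (g p) (\<Sum>q\<in>carrier G. vscale (h q) (bvec (p \<otimes> q))))"
        by (simp add: group_alg_def linext_sum)
      then show ?thesis by (simp add: vlin_rules[OF vlin_linext] linext_bvec[OF fin])
    qed
    also have "\<dots> = (\<Sum>p\<in>carrier G. vscale (g p) (mat_app I (w p) (\<Sum>q\<in>carrier G. vscale (h q) (mat_app I (w q) v))))"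
      using D by (simp add: vlin_rules[OF vl] mat_app_mm[symmetric])
    finally show ?thesis .
  qed
  have one: "(\<Sum>g\<in>carrier G. vscale (aone H g) (mat_app I (w g) v)) = v" if "v \<in> vspace I" for v
  proof -
    have "idm I = mat_of I (crop I)" by (rule mat_of_cong) simp
    then have "mat_app I (w \<one>) v = v"
      using that mat_app_mat_of[OF tlin_crop[OF D(1)], of v] D(5) crop_vspace crop_id by metis
    then show ?thesis by (simp add: aone_H sum_bvec)
  qed
  show ?thesis
    unfolding hmodule_def linear_on_def basis_H vadd_eq_plus
    using D(1) V mult one
    by (simp add: gmod_def vlin_rules[OF vl] fv.scale_left_distrib fv.scale_right_distrib sum.distrib
        fv.scale_sum_right mult.commute vec_apply(1,5))
qed

text \<open>Modules over \<open>k[G]\<close> and matrix representations correspond to each other, and so do their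
  endomorphism algebras.\<close>

lemma grep_hmodule:
  assumes M: "hmodule H M" "mbasis M \<noteq> {}"
  shows "grep (mbasis M) (\<lambda>g. mat_of (mbasis M) (mact M (bvec g)))"
    and "nrm (End_hma H M) = EndG (mbasis M) (\<lambda>g. mat_of (mbasis M) (mact M (bvec g)))"
proof -
  note D = M(1)[unfolded hmodule_def linear_on_def basis_H vadd_eq_plus]
  let ?I = "mbasis M"
  let ?T = "\<lambda>g v. mact M (bvec g) (crop ?I v)"
  let ?w = "\<lambda>g. mat_of ?I (mact M (bvec g))"
  have I: "finite ?I" using D by blast
  have c: "mat_of ?I (mact M (bvec g)) = mat_of ?I (?T g)" for g by (rule mat_of_cong) simp
  have aV: "mact M h v \<in> vspace ?I" if "h \<in> vspace (carrier G)" "v \<in> vspace ?I" for h v using D that by blast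
  have aA: "mact M h (v + v') = mact M h v + mact M h v'"
    if "h \<in> vspace (carrier G)" "v \<in> vspace ?I" "v' \<in> vspace ?I" for h v v' using D that by blast
  have aS: "mact M h (vscale c v) = vscale c (mact M h v)"
    if "h \<in> vspace (carrier G)" "v \<in> vspace ?I" for h c v using D that by blast
  have aM: "mact M (amul H h h') v = mact M h (mact M h' v)"
    if "h \<in> vspace (carrier G)" "h' \<in> vspace (carrier G)" "v \<in> vspace ?I" for h h' v using D that by blast
  have a1: "mact M (aone H) v = v" if "v \<in> vspace ?I" for v using D that by blast
  have T: "tlin ?I (?T g)" if "g \<in> carrier G" for g
    by (rule tlin_cropI[OF I]) (use that in \<open>simp_all add: aA aS\<close>)
  have TV: "?T g v \<in> vspace ?I" if "g \<in> carrier G" for g v using that by (simp add: aV)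
  have comp: "?T g (?T h v) = ?T (g \<otimes> h) v" if "g \<in> carrier G" "h \<in> carrier G" for g h v
    using aM[of "bvec g" "bvec h" "crop ?I v"] TV[OF that(2), of v] that by (simp add: amul_H)
  have one: "?T \<one> v = crop ?I v" for v
    using a1[of "crop ?I v"] by (simp add: aone_H)
  show w: "grep ?I ?w"
    unfolding grep_def c
  proof (intro conjI ballI I M(2))
    show "mat_of ?I (?T \<one>) = idm ?I" by (rule mat_of_cong) (use a1 in \<open>simp add: aone_H\<close>)
    fix g h assume g: "g \<in> carrier G" and h: "h \<in> carrier G"
    show "mm ?I (mat_of ?I (?T g)) (mat_of ?I (?T h)) = mat_of ?I (?T (g \<otimes> h))"
      using mm_mat_of[OF I T[OF g], of "?T h"] TV[OF h] comp[OF g h] by simp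
  qed simp
  have mul: "amul (nrm (End_hma H M)) = mm ?I"
  proof (intro ext)
    fix S T x
    show "amul (nrm (End_hma H M)) S T x = mm ?I S T x"
      by (cases x) (auto simp: nrm_def End_hma_def End_alg_def mm_def crop_def intro!: sum.cong sum.neutral)
  qed
  have act: "act (nrm (End_hma H M)) = (\<lambda>h T. \<Sum>g\<in>carrier G. vscale (h g) (mm ?I (?w g) (mm ?I T (?w (inv g)))))"
  proof (intro ext)
    fix h :: "'g \<Rightarrow> 'k" and T :: "_ \<Rightarrow> 'k" and x
    let ?h = "crop (carrier G) h" and ?C = "crop (?I \<times> ?I) T"
    have "act (nrm (End_hma H M)) h T = mat_of ?I (\<lambda>m. linext (carrier G \<times> carrier G)
        (\<lambda>(p, q). mact M (bvec p) (mat_app ?I ?C (mact M (antipode H (bvec q)) m)))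
        (comult H ?h))"
      by (simp add: nrm_def End_hma_def End_alg_def)
    also have "\<dots> = mat_of ?I (\<lambda>m. \<Sum>g\<in>carrier G. vscale (?h g) (mact M (bvec g) (mat_app ?I ?C (mact M (bvec (inv g)) m))))"
      unfolding linext_comult by (simp add: antipode_H)
    also have "\<dots> = mat_of ?I (\<lambda>m. \<Sum>g\<in>carrier G. vscale (?h g) (?T g (mat_app ?I ?C (?T (inv g) m))))"
      by (rule mat_of_cong) (simp add: mat_app_vspace)
    also have "\<dots> = (\<Sum>g\<in>carrier G. vscale (?h g) (mat_of ?I (\<lambda>m. ?T g (mat_app ?I ?C (?T (inv g) m)))))"
      unfolding mat_of_sum mat_of_scale ..
    also have "\<dots> = (\<Sum>g\<in>carrier G. vscale (h g) (mm ?I (?w g) (mm ?I T (?w (inv g)))))"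
    proof (rule sum.cong[OF refl])
      fix g assume g: "g \<in> carrier G"
      have "mm ?I T (?w (inv g)) = mm ?I (mat_of ?I (mat_app ?I ?C)) (mat_of ?I (?T (inv g)))"
        unfolding c mat_of_mat_app[OF I] by (simp add: mm_crop)
      also have "\<dots> = mat_of ?I (\<lambda>m. mat_app ?I ?C (?T (inv g) m))"
        by (rule mm_mat_of[OF I mat_app_tlin[OF I]]) (use TV g in simp)
      finally have "mm ?I (?w g) (mm ?I T (?w (inv g))) = mm ?I (mat_of ?I (?T g)) (mat_of ?I (\<lambda>m. mat_app ?I ?C (?T (inv g) m)))"
        unfolding c by simp
      also have "\<dots> = mat_of ?I (\<lambda>m. ?T g (mat_app ?I ?C (?T (inv g) m)))"
        by (rule mm_mat_of[OF I T[OF g]]) (simp add: mat_app_vspace)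
      finally show "vscale (?h g) (mat_of ?I (\<lambda>m. ?T g (mat_app ?I ?C (?T (inv g) m))))
          = vscale (h g) (mm ?I (?w g) (mm ?I T (?w (inv g))))"
        using g by (simp add: crop_def)
    qed
    finally show "act (nrm (End_hma H M)) h T x = (\<Sum>g\<in>carrier G. vscale (h g) (mm ?I (?w g) (mm ?I T (?w (inv g))))) x"
      by simp
  qed
  have "basis (nrm (End_hma H M)) = ?I \<times> ?I" "aone (nrm (End_hma H M)) = idm ?I"
    by (simp_all add: End_hma_def End_alg_def)
  then show "nrm (End_hma H M) = EndG ?I ?w"
    using mul act by (simp add: matalg_def)
qed

lemma nrm_End_gmod:
  assumes w: "grep I w" shows "nrm (End_hma H (gmod I w)) = EndG I w"
proof -
  have b: "mbasis (gmod I w) = I" by (simp add: gmod_def)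
  have "mat_of I (mact (gmod I w) (bvec g)) = w g" if "g \<in> carrier G" for g
    using that grepD[OF w] mat_of_mat_app[of I "w g"] by (simp add: gmod_def sum_bvec)
  then have "EndG I (\<lambda>g. mat_of I (mact (gmod I w) (bvec g))) = EndG I w"
    by (simp add: matalg_def)
  then show ?thesis using grep_hmodule(2)[OF hmodule_gmod[OF w]] grepD(2)[OF w] b by simp
qed

end

section \<open>The braided product up to isomorphism\<close>

lemma tlinI_crop:
  assumes "finite I" "vlin F" "\<And>v. F (crop I v) = F v" shows "tlin I F"
  using tlin_comp[OF assms(2) tlin_crop[OF assms(1)]] assms(3) by simp

text \<open>The Kronecker product, reindexed so that matrices on \<open>I\<close> and on \<open>J\<close> give a matrix on \<open>I \<times> J\<close>.\<close>

definition kron :: "('i \<times> 'i \<Rightarrow> 'k::field) \<Rightarrow> ('j \<times> 'j \<Rightarrow> 'k) \<Rightarrow> ('i \<times> 'j) \<times> ('i \<times> 'j) \<Rightarrow> 'k" where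
  "kron S T = (\<lambda>((i, j), (i', j')). S (i, i') * T (j, j'))"

lemma kron_simps:
  "kron (S + S') T = kron S T + kron S' T" "kron S (T + T') = kron S T + kron S T'"
  "kron (S - S') T = kron S T - kron S' T" "kron S (T - T') = kron S T - kron S T'"
  "kron (vscale c S) T = vscale c (kron S T)" "kron S (vscale c T) = vscale c (kron S T)"
  "kron 0 T = 0" "kron S 0 = 0"
  by (auto simp: kron_def fun_eq_iff vec_apply algebra_simps)

lemma kron_vspace [simp]:
  "S \<in> vspace (I \<times> I) \<Longrightarrow> T \<in> vspace (J \<times> J) \<Longrightarrow> kron S T \<in> vspace ((I \<times> J) \<times> (I \<times> J))"
  by (auto simp: kron_def vspace_def)

lemma mm_kron: "mm (I \<times> J) (kron S T) (kron S' T') = kron (mm I S S') (mm J T T')"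
proof -
  have "(\<Sum>x\<in>I \<times> J. kron S T ((i, j), x) * kron S' T' (x, (i', j'))) =
     (\<Sum>l\<in>I. S (i, l) * S' (l, i')) * (\<Sum>m\<in>J. T (j, m) * T' (m, j'))" for i j i' j'
    by (auto simp: sum_product sum.cartesian_product kron_def intro!: sum.cong)
  then show ?thesis by (auto simp: mm_def fun_eq_iff) (auto simp: kron_def)
qed

lemma kron_idm: "kron (idm I) (idm J) = idm (I \<times> J)"
  by (auto simp: kron_def mat_of_def bvec_def fun_eq_iff)

context central_involution begin

text \<open>The kernel is an ideal not containing \<open>1\<close>, so the map is injective.\<close>

lemma ghom_bij:
  assumes cA: "cs A" and B: "galg B" "basis B \<noteq> {}" and f: "ghom A B f"
    and card: "card (basis A) = card (basis B)"
  shows "bij_betw f (V A) (V B)"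
proof (rule inj_imp_surj_vspace[OF galgD(1)[OF cs_galg[OF cA]] galgD(1)[OF B(1)] card ghomD(6)[OF f]])
  note F = ghomD[OF f]
  show "f v \<in> V B" for v by (rule F)
  have J: "idl A {a \<in> V A. f a = 0}"
    using cs_galg[OF cA] unfolding idl_def by (auto simp: vlin_rules[OF F(6)] F(4) galg_simps[OF B(1)])
  fix v assume v: "v \<in> V A" "f v = 0"
  show "v = 0"
  proof (rule ccontr)
    assume "v \<noteq> 0"
    then have "{a \<in> V A. f a = 0} = V A" using cs_idl[OF cA J] v by blast
    then have "f (aone A) = 0" using cs_galg[OF cA] galg_closed(2) by blast
    then show False using F(3) galg_one_nonzero[OF B] by simp
  qed
qed

lemma ghom_giso:
  assumes "cs A" "galg B" "basis B \<noteq> {}" "ghom A B f" "card (basis A) = card (basis B)"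
  shows "giso A B"
  using ghom_bij[OF assms] assms(4) unfolding giso_def by blast

lemma giso_dim:
  assumes "giso A B" "finite (basis A)" "finite (basis B)" shows "card (basis A) = card (basis B)"
proof -
  from assms(1) obtain f where f: "ghom A B f" "bij_betw f (V A) (V B)" unfolding giso_def by blast
  have le: "card K \<le> card I"
    if "vlin F" "F ` vspace I = vspace K" "finite I" "finite K"
    for F :: "('a \<Rightarrow> 'k) \<Rightarrow> 'b \<Rightarrow> 'k" and I K
  proof -
    have "bvec ` K \<subseteq> F ` fv.span (bvec ` I)"
      unfolding vspace_span[OF that(3), symmetric] that(2) by auto
    also have "\<dots> \<subseteq> fv.span (F ` bvec ` I)"
    proof -
      have "fv.span (bvec ` I) \<subseteq> {v. F v \<in> fv.span (F ` bvec ` I)}"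
        using that(1) by (intro fv.span_minimal) (auto simp: fv.subspace_def vlin_rules intro: fv.span_base fv.span_add fv.span_scale fv.span_zero)
      then show ?thesis by blast
    qed
    finally have sub: "(bvec ` K :: ('b \<Rightarrow> 'k) set) \<subseteq> fv.span (F ` bvec ` I)" .
    have "card (bvec ` K :: ('b \<Rightarrow> 'k) set) \<le> card (F ` bvec ` I)"
      using fv.independent_span_bound[OF _ bvec_independent[OF that(4)] sub] that(3) by simp
    moreover have "card (bvec ` K :: ('b \<Rightarrow> 'k) set) = card K"
      by (rule card_image) (rule inj_on_subset[OF inj_bvec], simp)
    moreover have "card (F ` bvec ` I) \<le> card I"
      using that(3) by (metis card_image_le finite_imageI le_trans)
    ultimately show ?thesis by simp
  qed
  have "inj_on f (V A)" using f by (simp add: bij_betw_def)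
  have "card (basis B) \<le> card (basis A)"
    using le[OF ghomD(6)[OF f(1)] _ assms(2,3)] f(2) by (simp add: bij_betw_def)
  moreover have "card (basis A) \<le> card (basis B)"
  proof -
    have lin: "Vector_Spaces.linear vscale vscale f"
      using ghomD(6)[OF f(1)] by (simp add: Vector_Spaces.linear_iff vlin_def fv.vector_space_axioms)
    interpret P: vector_space_pair "vscale :: 'k \<Rightarrow> ('a \<Rightarrow> 'k) \<Rightarrow> _" "vscale :: 'k \<Rightarrow> ('b \<Rightarrow> 'k) \<Rightarrow> _" ..
    have ind: "fv.independent (f ` bvec ` basis A)"
      using P.linear_independent_injective_image[OF lin bvec_independent[OF assms(2)]] \<open>inj_on f (V A)\<close>
      unfolding vspace_span[OF assms(2)] by blast
    have "f ` bvec ` basis A \<subseteq> fv.span (bvec ` basis B)"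
      unfolding vspace_span[OF assms(3), symmetric] using ghomD(2)[OF f(1)] by blast
    from fv.independent_span_bound[OF _ ind this] assms(3)
    have "card (f ` bvec ` basis A) \<le> card (bvec ` basis B :: ('b \<Rightarrow> 'k) set)" by blast
    moreover have "card (f ` bvec ` basis A) = card (basis A)"
    proof -
      have "inj_on f (bvec ` basis A)" using \<open>inj_on f (V A)\<close> by (rule inj_on_subset) auto
      then have "card (f ` bvec ` basis A) = card (bvec ` basis A :: ('a \<Rightarrow> 'k) set)" by (rule card_image)
      also have "\<dots> = card (basis A)" by (rule card_image) (rule inj_on_subset[OF inj_bvec], simp)
      finally show ?thesis .
    qed
    moreover have "card (bvec ` basis B :: ('b \<Rightarrow> 'k) set) \<le> card (basis B)" using assms(3) by (rule card_image_le)
    ultimately show ?thesis by simp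
  qed
  ultimately show ?thesis by simp
qed

text \<open>In \<open>B \<sharp> A\<close> the two factors supercommute in either order, so the universal property of \<open>A \<sharp> B\<close> applies.\<close>

lemma bp_comm:
  assumes cA: "cs A" and cB: "cs B" shows "giso (bp A B) (bp B A)"
proof (rule ghom_giso[OF cs_bp[OF cA cB]])
  have A: "galg A" and B: "galg B" using cA cB by auto
  let ?f = "\<lambda>a. tens (aone B) (crop (basis A) a)" and ?g = "\<lambda>x. tens (crop (basis B) x) (aone A)"
  show "ghom (bp A B) (bp B A) (copair A B (bp B A) ?f ?g)"
  proof (rule copair_ghom[OF A B galg_bp[OF B A] bp_in2[OF B A] bp_in1[OF B A]])
    fix a x assume "a \<in> V A" "x \<in> V B"
    show "supercommute (bp B A) (?g x) (?f a)"
    proof (rule supercommute_sym[OF galg_bp[OF B A]])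
      fix p q assume "p \<in> {?g x, ac (bp B A) u (?g x)}" "q \<in> {?f a, ac (bp B A) u (?f a)}"
      moreover have "ac (bp B A) u (?g x) = tens (ac B u x) (aone A)" "ac (bp B A) u (?f a) = tens (aone B) (ac A u a)"
        using A B by (simp_all add: bp_ac galg_simps)
      ultimately obtain p' q' where "p = tens p' (aone A)" "q = tens (aone B) q'" by auto
      then show "supercommute (bp B A) q p" by (simp add: bp_supercommute[OF B A])
    qed (use A B in simp_all)
  qed
qed (use assms in \<open>auto simp: galg_bp cs_nonempty mult.commute card_cartesian_product\<close>)

lemma bp_cong:
  assumes cA: "cs A" and cB: "cs B" and cA': "cs A'" and cB': "cs B'"
    and iA: "giso A A'" and iB: "giso B B'"
  shows "giso (bp A B) (bp A' B')"
proof -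
  have A: "galg A" "galg A'" and B: "galg B" "galg B'" using assms by auto
  from iA obtain f where f: "ghom A A' f" "bij_betw f (V A) (V A')" unfolding giso_def by blast
  from iB obtain g where g: "ghom B B' g" "bij_betw g (V B) (V B')" unfolding giso_def by blast
  let ?f = "\<lambda>a. tens (crop (basis A') (f a)) (aone B')" and ?g = "\<lambda>x. tens (aone A') (crop (basis B') (g x))"
  have "ghom (bp A B) (bp A' B') (copair A B (bp A' B') ?f ?g)"
    by (rule copair_ghom[OF A(1) B(1) galg_bp[OF A(2) B(2)] ghom_comp[OF f(1) bp_in1[OF A(2) B(2)]]
        ghom_comp[OF g(1) bp_in2[OF A(2) B(2)]]]) (rule bp_supercommute[OF A(2) B(2)])
  moreover have "bij_betw (copair A B (bp A' B') ?f ?g) (V (bp A B)) (V (bp A' B'))"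
  proof -
    have "card (basis A) = card (basis A')" "card (basis B) = card (basis B')"
      using giso_dim[OF iA] giso_dim[OF iB] A B by (auto simp: galgD(1))
    then show ?thesis using calculation
      by (intro ghom_bij[OF cs_bp[OF cA cB]]) (use A B cA' cB' in \<open>auto simp: galg_bp cs_nonempty card_cartesian_product\<close>)
  qed
  ultimately show ?thesis unfolding giso_def by blast
qed

lemma bp_assoc:
  assumes cA: "cs A" and cB: "cs B" and cC: "cs C"
  shows "giso (bp A (bp B C)) (bp (bp A B) C)"
proof (rule ghom_giso[OF cs_bp[OF cA cs_bp[OF cB cC]]])
  have A: "galg A" and B: "galg B" and C: "galg C" using assms by auto
  note AB = galg_bp[OF A B] and BC = galg_bp[OF B C]
  let ?X = "bp (bp A B) C"
  note X = galg_bp[OF AB C]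
  have [simp]: "crop (basis A) (aone A) = aone A" "crop (basis B) (aone B) = aone B" "crop (basis C) (aone C) = aone C"
    using A B C by auto
  let ?f = "\<lambda>a. tens (tens (crop (basis A) a) (aone B)) (aone C)"
  let ?g1 = "\<lambda>b. tens (tens (aone A) (crop (basis B) b)) (aone C)"
  let ?g2 = "\<lambda>c. tens (tens (aone A) (aone B)) (crop (basis C) c)"
  have f: "ghom A ?X ?f" and g1: "ghom B ?X ?g1"
    using ghom_comp[OF bp_in1[OF A B] bp_in1[OF AB C]] ghom_comp[OF bp_in2[OF A B] bp_in1[OF AB C]]
    by (simp_all add: crop_tens)
  have g2: "ghom C ?X ?g2" using bp_in2[OF AB C] by simp
  let ?g = "copair B C ?X ?g1 ?g2"
  have g: "ghom (bp B C) ?X ?g"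
    by (rule copair_ghom[OF B C X g1 g2]) (use bp_supercommute[OF AB C] in simp)
  show "ghom (bp A (bp B C)) ?X (copair A (bp B C) ?X ?f ?g)"
  proof (rule copair_ghom[OF A BC X f g])
    fix a t assume "a \<in> V A"
    note Gt = copair_tens[OF B C X g1 g2]
    note vl = vlin_rules[OF tlin_vlin[OF bp_tlin_left[OF AB C]]] vlin_rules[OF tlin_vlin[OF bp_tlin_right[OF AB C]]]
    note tg = ghomD(1)[OF g, unfolded bp_basis] and vg = ghomD(6)[OF g]
    have "(\<lambda>t. amul ?X (?g t) (?f a)) = (\<lambda>t. vscale (1 / 2)
     (amul ?X (?f a) (?g t) + amul ?X (ac ?X u (?f a)) (?g t) + amul ?X (?f a) (ac ?X u (?g t)) - amul ?X (ac ?X u (?f a)) (ac ?X u (?g t))))"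
    proof (rule tlin_ext_prod_fun)
      have 1: "tlin (basis B \<times> basis C) (\<lambda>t. amul ?X p (?g t))" "tlin (basis B \<times> basis C) (\<lambda>t. amul ?X (?g t) p)"
        "tlin (basis B \<times> basis C) (\<lambda>t. amul ?X p (ac ?X u (?g t)))" for p
        by (intro galg_tlin[OF X] tg u_closed)+
      show "tlin (basis B \<times> basis C) (\<lambda>t. amul ?X (?g t) (?f a))"
        "tlin (basis B \<times> basis C) (\<lambda>t. vscale (1 / 2)
         (amul ?X (?f a) (?g t) + amul ?X (ac ?X u (?f a)) (?g t) + amul ?X (?f a) (ac ?X u (?g t)) - amul ?X (ac ?X u (?f a)) (ac ?X u (?g t))))"
        by (rule 1, intro tlin_intros 1)
      fix i j
      show "amul ?X (?g (tens (bvec i) (bvec j))) (?f a) = vscale (1 / 2)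
         (amul ?X (?f a) (?g (tens (bvec i) (bvec j))) + amul ?X (ac ?X u (?f a)) (?g (tens (bvec i) (bvec j)))
          + amul ?X (?f a) (ac ?X u (?g (tens (bvec i) (bvec j)))) - amul ?X (ac ?X u (?f a)) (ac ?X u (?g (tens (bvec i) (bvec j)))))"
        using A B C
        by (simp add: Gt bp_mul[OF AB C] bp_mul[OF A B] bp_ac[OF AB C] bp_ac[OF A B] tens_simps
            galg_simps[OF A] galg_simps[OF B] galg_simps[OF C] galg_simps[OF AB] vlin_rules[OF tlin_vlin[OF bp_tlin_ac[OF AB C u_closed]]] crop_tens)
          ((simp add: fun_eq_iff lincomb)?)
    qed
    then show "supercommute ?X (?g t) (?f a)" unfolding supercommute_def by (rule fun_cong)
  qed
  show "card (basis (bp A (bp B C))) = card (basis ?X)" by (simp add: card_cartesian_product)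
  show "galg ?X" by (rule X)
  show "basis ?X \<noteq> {}" using assms by (simp add: cs_nonempty)
qed

lemma base_simps [simp]:
  "basis (base_hma H) = UNIV" "amul (base_hma H) = (\<lambda>v w x. v x * w x)" "aone (base_hma H) = (\<lambda>_. 1)"
  "act (base_hma H) h = vscale (counit H h)"
  by (simp_all add: base_hma_def)

lemma tlin_unit: "vlin F \<Longrightarrow> tlin UNIV (F :: (unit \<Rightarrow> 'k) \<Rightarrow> 'j \<Rightarrow> 'k)"
  by (rule tlinI_crop) (auto simp: vspace_def)

lemma galg_base: "galg (base_hma H)"
proof (rule galgI)
  fix h :: "'g \<Rightarrow> 'k" and v :: "unit \<Rightarrow> 'k"
  have "(\<Sum>g\<in>carrier G. vscale (h g) (ac (base_hma H) g v)) = (\<Sum>g\<in>carrier G. vscale (h g) v)"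
    by (rule sum.cong) (simp_all add: counit_bvec)
  then show "act (base_hma H) h v = (\<Sum>g\<in>carrier G. vscale (h g) (ac (base_hma H) g v))"
    by (simp add: counit_H fv.scale_sum_left)
next
  fix a :: "unit \<Rightarrow> 'k"
  show "tlin (basis (base_hma H)) (amul (base_hma H) a)"
    "tlin (basis (base_hma H)) (\<lambda>b. amul (base_hma H) b a)"
    unfolding base_simps by (rule tlin_unit; simp add: vlin_def fun_eq_iff vec_apply algebra_simps)+
next
  fix g assume "g \<in> carrier G"
  show "tlin (basis (base_hma H)) (ac (base_hma H) g)"
    unfolding base_simps by (rule tlin_unit) (simp add: vlin_def fv.scale_right_distrib mult.commute)
qed (auto simp: vspace_def counit_bvec)

text \<open>The base field is modelled as the functions on the unit type.\<close>

lemma base_unit_vec: "(a :: unit \<Rightarrow> 'k) = vscale (a ()) (\<lambda>_. 1)"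
  by (auto simp: fun_eq_iff vec_apply)

lemma cs_base: "cs (base_hma H)"
proof (rule csI[OF galg_base])
  show "\<exists>c. z = vscale c (aone (base_hma H))" for z :: "unit \<Rightarrow> 'k"
    using base_unit_vec[of z] by auto
  fix J x assume J: "idl (base_hma H) J" and x: "x \<in> J" "x \<noteq> 0"
  have "x () \<noteq> 0" using x(2) by (auto simp: fun_eq_iff vec_apply)
  then have "vscale (inverse (x ())) x = aone (base_hma H)" by (auto simp: fun_eq_iff vec_apply)
  then show "aone (base_hma H) \<in> J" using idl_scale[OF galg_base J x(1)] by metis
qed simp

lemma bp_base:
  assumes cA: "cs A" shows "giso (bp (base_hma H) A) A"
proof (rule ghom_giso[OF cs_bp[OF cs_base cA]])
  have A: "galg A" using cA by simp
  let ?f = "\<lambda>c :: unit \<Rightarrow> 'k. vscale (c ()) (aone A)"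
  have f: "ghom (base_hma H) A ?f"
    by (rule ghomI) (use A in \<open>auto simp: tlin_def galg_simps vec_apply fun_eq_iff counit_bvec UNIV_unit\<close>)
  show "ghom (bp (base_hma H) A) A (copair (base_hma H) A A ?f (crop (basis A)))"
    by (rule copair_ghom[OF galg_base A A f ghom_crop[OF A]])
      (use A in \<open>simp add: supercommute_def galg_simps\<close>, (simp add: fun_eq_iff lincomb)?)
qed (use cA in \<open>auto simp: cs_nonempty card_cartesian_product\<close>)

lemma grep_kron:
  assumes w: "grep I w" and v: "grep J v" shows "grep (I \<times> J) (\<lambda>g. kron (w g) (v g))"
  using grepD[OF w] grepD[OF v] unfolding grep_def by (auto simp: mm_kron kron_idm)

lemma inv_u [simp]: "inv u = u"
  using inv_equality[of u u] by simp

text \<open>On the odd part of the second factor the Kronecker product must be corrected by \<open>w(u)\<close>, which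
  commutes with even and anticommutes with odd matrices; this produces the sign rule.\<close>

lemma EndG_tensor:
  assumes w: "grep I w" and v: "grep J v"
  shows "giso (bp (EndG I w) (EndG J v)) (EndG (I \<times> J) (\<lambda>g. kron (w g) (v g)))"
proof (rule ghom_giso[OF cs_bp[OF cs_EndG[OF w] cs_EndG[OF v]]])
  define M where "M = EndG I w"
  define N where "N = EndG J v"
  define Q where "Q = EndG (I \<times> J) (\<lambda>g. kron (w g) (v g))"
  have gM: "galg M" and gN: "galg N" and gQ: "galg Q"
    unfolding M_def N_def Q_def using galg_EndG w v grep_kron by blast+
  have bM: "basis M = I \<times> I" "aone M = idm I" and bN: "basis N = J \<times> J" "aone N = idm J"
    and bQ: "basis Q = (I \<times> J) \<times> (I \<times> J)" "aone Q = kron (aone M) (aone N)"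
    by (simp_all add: M_def N_def Q_def kron_idm)
  have km: "amul Q (kron S T) (kron S' T') = kron (amul M S S') (amul N T T')" for S S' T T'
    by (simp add: M_def N_def Q_def mm_kron)
  have ka: "ac Q g (kron S T) = kron (ac M g S) (ac N g T)" if "g \<in> carrier G" for g S T
    using that by (simp add: M_def N_def Q_def mm_kron)
  have kV: "kron S T \<in> V Q" if "S \<in> V M" "T \<in> V N" for S T using that by (simp add: bQ bM bN)
  have wV: "w u \<in> V M" using grepD(3)[OF w] by (simp add: bM)
  have ww: "amul M (w u) (w u) = aone M" using grepD(4)[OF w, of u u] grepD(5)[OF w] by (simp add: M_def)
  have ww': "amul M (w u) (amul M (w u) S) = crop (basis M) S" for S
    using ww galg_simps(13,14)[OF gM] by metis
  have wg: "ac M g (w u) = w u" if g: "g \<in> carrier G" for g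
  proof -
    have "mm I (w g) (mm I (w u) (w (inv g))) = w (g \<otimes> (u \<otimes> inv g))" using g by (simp add: grepD(4)[OF w])
    also have "g \<otimes> (u \<otimes> inv g) = u" using g u_central[of "inv g"] by (simp add: m_assoc[symmetric])
    finally show ?thesis using g by (simp add: M_def)
  qed
  have uS: "ac M u S = amul M (w u) (amul M S (w u))" for S by (simp add: M_def)
  have uSw: "amul M (ac M u S) (w u) = amul M (w u) S" for S
    by (simp add: uS galg_simps[OF gM] ww)
  have tM: "tlin (basis M) (\<lambda>S. kron (F S) T)" if "tlin (basis M) F" for F T
    by (rule tlin_comp[OF _ that]) (simp add: vlin_def kron_simps)
  have tN: "tlin (basis N) (\<lambda>T. kron S (F T))" if "tlin (basis N) F" for F S
    by (rule tlin_comp[OF _ that]) (simp add: vlin_def kron_simps)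
  let ?f = "\<lambda>S. kron (crop (basis M) S) (aone N)"
  \<comment> \<open>Here \<open>T\<^sub>0 + T\<^sub>1\<close>, with \<open>T\<^sub>0\<close> even and \<open>T\<^sub>1\<close> odd, goes to \<open>1 \<otimes> T\<^sub>0 + w(u) \<otimes> T\<^sub>1\<close>.\<close>
  let ?g = "\<lambda>T. vscale (1 / 2) (kron (aone M) (crop (basis N) T + ac N u T) + kron (w u) (crop (basis N) T - ac N u T))"
  note [simp] = galg_simps[OF gM] galg_simps[OF gN] galg_simps[OF gQ]
  have f: "ghom M Q ?f"
    by (rule ghomI) (use gM gN in \<open>auto simp: km ka bQ(2) intro!: tM galg_tlin kV\<close>)
  have g: "ghom N Q ?g"
  proof (rule ghomI)
    show "tlin (basis N) ?g" by (intro tlin_intros tN galg_tlin[OF gN] u_closed)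
    show "?g T \<in> V Q" for T using gM gN wV by (intro vspace_scale vspace_add kV) auto
    show "?g (aone N) = aone Q" using gN by (simp add: bQ(2) kron_simps) ((simp add: fun_eq_iff lincomb)?)
    show "?g (amul N S T) = amul Q (?g S) (?g T)" for S T
      using gM gN wV by (simp add: km kron_simps ww) ((simp add: fun_eq_iff lincomb)?)
    show "?g (ac N g T) = ac Q g (?g T)" if "g \<in> carrier G" for g T
      using gM gN that by (simp add: ka wg kron_simps u_central)
  qed
  have "ghom (bp M N) Q (copair M N Q ?f ?g)"
  proof (rule copair_ghom[OF gM gN gQ f g])
    fix S T assume "S \<in> V M" "T \<in> V N"
    then show "supercommute Q (?g T) (?f S)"
      unfolding supercommute_def ghomD(5)[OF f u_closed, symmetric] ghomD(5)[OF g u_closed, symmetric]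
      using gM gN wV by (simp add: km kron_simps uSw) ((simp add: fun_eq_iff lincomb)?)
  qed
  then show "ghom (bp (EndG I w) (EndG J v)) (EndG (I \<times> J) (\<lambda>g. kron (w g) (v g))) (copair M N Q ?f ?g)"
    unfolding M_def N_def Q_def .
  show "galg (EndG (I \<times> J) (\<lambda>g. kron (w g) (v g)))" using gQ unfolding Q_def .
qed (use grepD(2)[OF w] grepD(2)[OF v] in \<open>auto simp: card_cartesian_product\<close>)

section \<open>Opposite algebras\<close>

lemma op_simps [simp]:
  "basis (op_alg A) = basis A" "amul (op_alg A) a b = amul A b a" "aone (op_alg A) = aone A"
  "act (op_alg A) = act (A :: ('i, 'k, 'g) hmalg)"
  by (simp_all add: op_alg_def)

lemma galg_op:
  assumes A: "galg A" shows "galg (op_alg A)"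
proof (rule galgI; (simp only: op_simps)?)
  have "amul (op_alg A) a = (\<lambda>b. amul A b a)" for a by (rule ext) simp
  then show "tlin (basis A) (amul (op_alg A) a)" for a using galgD(4)[OF A] by simp
  show "act A h v = (\<Sum>g\<in>carrier G. vscale (h g) (ac A g v))" for h v by (rule galgD(9)[OF A])
qed (use A in \<open>simp_all add: galg_simps galgD(1) galgD(3) galgD(10)\<close>)

lemma idl_op: "galg A \<Longrightarrow> idl (op_alg A) J = idl A J"
  by (auto simp: idl_def)

lemma cs_op:
  assumes cA: "cs A" shows "cs (op_alg A)"
proof (rule csI[OF galg_op[OF cs_galg[OF cA]]])
  show "basis (op_alg A) \<noteq> {}" using cs_nonempty[OF cA] by simp
  show "\<exists>c. z = vscale c (aone (op_alg A))"
    if "z \<in> V (op_alg A)" "\<And>v. v \<in> V (op_alg A) \<Longrightarrow> amul (op_alg A) z v = amul (op_alg A) v z" for z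
    using cs_center[OF cA, of z] that by simp
  show "aone (op_alg A) \<in> J" if "idl (op_alg A) J" "x \<in> J" "x \<noteq> 0" for J x
    using cs_idl[OF cA, of J x] that idl_op[OF cs_galg[OF cA]] cA by simp
qed

abbreviation hop :: "('i, 'k, 'g) hmalg \<Rightarrow> ('i, 'k, 'g) hmalg" where
  "hop A \<equiv> h_op H R A"

lemma hop_simps [simp]:
  "basis (hop A) = basis A" "aone (hop A) = aone A" "act (hop A) = act A"
  by (simp_all add: h_op_def)

lemma hop_mul:
  assumes A: "galg A"
  shows "amul (hop A) a b = vscale (1 / 2) (amul A b a + amul A (ac A u b) a + amul A b (ac A u a)
    - amul A (ac A u b) (ac A u a))"
  by (simp add: h_op_def linext_R galg_simps[OF A] add_ac)

lemma galg_hop: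
  assumes A: "galg A" shows "galg (hop A)"
proof (rule galgI; (simp only: hop_simps)?)
  note tl = galg_tlin[OF A]
  have "amul (hop A) a = (\<lambda>b. vscale (1 / 2) (amul A b a + amul A (ac A u b) a + amul A b (ac A u a)
    - amul A (ac A u b) (ac A u a)))" for a by (rule ext) (rule hop_mul[OF A])
  then show "tlin (basis A) (amul (hop A) a)" for a
    by (simp only:) (intro tlin_intros tl u_closed)
  have "(\<lambda>a. amul (hop A) a b) = (\<lambda>a. vscale (1 / 2) (amul A b a + amul A (ac A u b) a + amul A b (ac A u a)
    - amul A (ac A u b) (ac A u a)))" for b by (rule ext) (rule hop_mul[OF A])
  then show "tlin (basis A) (\<lambda>a. amul (hop A) a b)" for b
    by (simp only:) (intro tlin_intros tl u_closed)
  show "act A h v = (\<Sum>g\<in>carrier G. vscale (h g) (ac A g v))" for h v by (rule galgD(9)[OF A])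
  show "amul (hop A) (amul (hop A) a b) c = amul (hop A) a (amul (hop A) b c)" for a b c
    by (simp add: hop_mul[OF A] galg_simps[OF A]) ((simp add: fun_eq_iff lincomb)?)
  show "amul (hop A) a b \<in> V A" for a b using A by (simp add: hop_mul)
  fix g assume g: "g \<in> carrier G"
  show "ac A g (amul (hop A) a b) = amul (hop A) (ac A g a) (ac A g b)" for a b
    using g by (simp add: hop_mul[OF A] galg_simps[OF A] u_central)
next
  fix a assume a: "a \<in> V A"
  show "amul (hop A) (aone A) a = a" "amul (hop A) a (aone A) = a"
    using a A by (simp_all add: hop_mul galg_simps) ((simp_all add: fun_eq_iff lincomb)?)
qed (use A in \<open>simp_all add: galg_simps galgD(1) galgD(3) galgD(10)\<close>)

text \<open>With the even unit implementing \<open>u\<close> no sign occurs, so multiplying by it in the \<open>H\<close>-opposite is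
  multiplying by it in \<open>A\<close> on the other side. Hence ideals of the \<open>H\<close>-opposite are \<open>u\<close>-stable, so they are
  ideals of \<open>A\<close>, and central elements are even, so they are central in \<open>A\<close>.\<close>

lemma cs_hop:
  assumes cA: "cs A" shows "cs (hop A)"
proof -
  have A: "galg A" using cA by simp
  note hA = galg_hop[OF A]
  from grading_unit[OF cA] obtain x y where x: "x \<in> V A" "y \<in> V A" "amul A x y = aone A" "amul A y x = aone A"
    "ac A u x = x" "ac A u y = y" "\<And>a. amul A x a = amul A (ac A u a) x"
    "\<And>a. amul A a y = amul A y (ac A u a)" by metis
  have hx: "amul (hop A) x a = amul A a x" and hx': "amul (hop A) a x = amul A x a"
    and hy: "amul (hop A) a y = amul A y a" for a
    using x by (simp_all add: hop_mul[OF A] galg_simps[OF A]) ((simp_all add: fun_eq_iff lincomb)?)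
  show ?thesis
  proof (rule csI[OF hA])
    show "basis (hop A) \<noteq> {}" using cs_nonempty[OF cA] by simp
    { fix z assume zV: "z \<in> V (hop A)" and z: "\<And>v. v \<in> V (hop A) \<Longrightarrow> amul (hop A) z v = amul (hop A) v z"
      have "amul A z x = amul A x z" using z[of x] x(1) by (simp add: hx hx')
      then have "amul A z x = amul A (ac A u z) x" using x(7)[of z] by simp
      then have "amul A (amul A z x) y = amul A (amul A (ac A u z) x) y" by simp
      then have uz: "ac A u z = z" using x(3) zV A by (simp add: galg_simps)
      have "amul A z v = amul A v z" if "v \<in> V A" for v
      proof -
        have "amul (hop A) z v = amul A v z" "amul (hop A) v z = amul A z v"
          by (simp_all add: hop_mul[OF A] uz) ((simp_all add: fun_eq_iff lincomb)?)
        then show ?thesis using z[of v] that by simp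
      qed
      then show "\<exists>c. z = vscale c (aone (hop A))" using cs_center[OF cA] zV by simp }
    { fix J s assume J: "idl (hop A) J" and s: "s \<in> J" "s \<noteq> 0"
      have JV: "J \<subseteq> V A" using J by (simp add: idl_def)
      have m: "amul (hop A) a t \<in> J" "amul (hop A) t a \<in> J" if "t \<in> J" "a \<in> V A" for t a
        using J that unfolding idl_def hop_simps by blast+
      have uJ: "ac A u t \<in> J" if t: "t \<in> J" for t
      proof -
        have "amul (hop A) (amul (hop A) x t) y \<in> J" using m t x by blast
        moreover have "amul (hop A) (amul (hop A) x t) y = amul A y (amul A t x)" by (simp add: hx hy)
        moreover have "amul A y (amul A t x) = ac A u t"
        proof -
          have "amul A y (amul A t x) = amul A (amul A y (ac A u (ac A u t))) x"
            using JV t by (auto simp: galg_simps[OF A])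
          also have "\<dots> = amul A (amul A (ac A u t) y) x" using x(8)[of "ac A u t"] by simp
          also have "\<dots> = ac A u t" using x(4) A by (simp add: galg_simps)
          finally show ?thesis .
        qed
        ultimately show ?thesis by simp
      qed
      note Jc = idl_scale[OF hA J] idl_diff[OF hA J]
      have Ja: "s + t \<in> J" if "s \<in> J" "t \<in> J" for s t using J that unfolding idl_def by blast
      have "idl A J"
        unfolding idl_def
      proof (intro conjI ballI JV)
        show "0 \<in> J" using J by (simp add: idl_def)
        fix t a assume t: "t \<in> J" and a: "a \<in> V A"
        have ua: "ac A u a \<in> V A" using A by simp
        have "amul A a t = vscale (1 / 2) (amul (hop A) t a + amul (hop A) t (ac A u a)
            + amul (hop A) (ac A u t) a - amul (hop A) (ac A u t) (ac A u a))"
          using t JV a by (auto simp: hop_mul[OF A] galg_simps[OF A]) ((simp add: fun_eq_iff lincomb)?)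
        then show "amul A a t \<in> J" using t a ua by (simp add: Jc Ja m uJ)
        have "amul A t a = vscale (1 / 2) (amul (hop A) a t + amul (hop A) (ac A u a) t
            + amul (hop A) a (ac A u t) - amul (hop A) (ac A u a) (ac A u t))"
          using t JV a by (auto simp: hop_mul[OF A] galg_simps[OF A]) ((simp add: fun_eq_iff lincomb)?)
        then show "amul A t a \<in> J" using t a ua by (simp add: Jc Ja m uJ)
      qed (use Ja in auto)
      then show "aone (hop A) \<in> J" using cs_idl[OF cA _ s] A by simp }
  qed
qed

section \<open>Azumaya algebras\<close>

abbreviation regrep :: "('i, 'k, 'g) hmalg \<Rightarrow> 'g \<Rightarrow> 'i \<times> 'i \<Rightarrow> 'k" where
  "regrep A g \<equiv> mat_of (basis A) (ac A g)"

lemma grep_regrep: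
  assumes A: "galg A" "basis A \<noteq> {}" shows "grep (basis A) (regrep A)"
  unfolding grep_def
proof (intro conjI ballI galgD(1)[OF A(1)] A(2) mat_of_vspace)
  show "regrep A \<one> = idm (basis A)" by (rule mat_of_cong) (simp add: galg_simps[OF A(1)])
  show "mm (basis A) (regrep A g) (regrep A h) = regrep A (g \<otimes> h)" if "g \<in> carrier G" "h \<in> carrier G" for g h
    using that A(1) by (subst mm_mat_of) (simp_all add: galgD(1,10) galg_simps)
qed

lemma mat_of_tlin:
  assumes "\<And>v. tlin I (\<lambda>a. F a v)" shows "tlin I (\<lambda>a. mat_of J (F a))"
  unfolding tlin_def
proof
  fix a
  have "F a = (\<lambda>v. \<Sum>i\<in>I. vscale (a i) (F (bvec i) v))"
    by (rule ext) (rule tlinD[OF assms])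
  then have "mat_of J (F a) = mat_of J (\<lambda>v. \<Sum>i\<in>I. vscale (a i) (F (bvec i) v))" by simp
  also have "\<dots> = (\<Sum>i\<in>I. vscale (a i) (mat_of J (F (bvec i))))"
    by (simp add: mat_of_sum mat_of_scale)
  finally show "mat_of J (F a) = (\<Sum>i\<in>I. vscale (a i) (mat_of J (F (bvec i))))" .
qed

text \<open>If \<open>B\<close> acts on a space with \<open>G\<close>-action \<open>r\<close> and the two actions are compatible, then \<open>B\<close> maps
  equivariantly to the endomorphism algebra of that space.\<close>

lemma ghom_operators_rep:
  fixes r :: "'g \<Rightarrow> ('i \<Rightarrow> 'k) \<Rightarrow> 'i \<Rightarrow> 'k" and F :: "('j \<Rightarrow> 'k) \<Rightarrow> ('i \<Rightarrow> 'k) \<Rightarrow> 'i \<Rightarrow> 'k"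
  assumes I: "finite I" and r: "\<And>g. g \<in> carrier G \<Longrightarrow> tlin I (r g)"
      "\<And>g v. g \<in> carrier G \<Longrightarrow> r g v \<in> vspace I" "\<And>g v. g \<in> carrier G \<Longrightarrow> r g (r (inv g) v) = crop I v"
    and lin: "\<And>v. tlin (basis B) (\<lambda>b. F b v)" "\<And>b. tlin I (F b)" "\<And>b v. F b v \<in> vspace I"
    and mult: "\<And>b c v. F (amul B b c) v = F b (F c v)" and one: "\<And>v. v \<in> vspace I \<Longrightarrow> F (aone B) v = v"
    and equiv: "\<And>g b v. g \<in> carrier G \<Longrightarrow> F (ac B g b) (r g v) = r g (F b v)"
  shows "ghom B (EndG I (\<lambda>g. mat_of I (r g))) (\<lambda>b. mat_of I (F b))"
proof (rule ghomI)
  let ?E = "EndG I (\<lambda>g. mat_of I (r g))"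
  have mmF: "mm I (mat_of I (F b)) (mat_of I T) = mat_of I (\<lambda>v. F b (T v))"
    if "\<And>v. T v \<in> vspace I" for b T by (rule mm_mat_of[OF I lin(2) that])
  show "tlin (basis B) (\<lambda>b. mat_of I (F b))" by (rule mat_of_tlin[OF lin(1)])
  show "mat_of I (F b) \<in> V ?E" for b by simp
  show "mat_of I (F (aone B)) = aone ?E"
    by (simp, rule mat_of_cong) (simp add: one)
  show "mat_of I (F (amul B b c)) = amul ?E (mat_of I (F b)) (mat_of I (F c))" for b c
  proof -
    have "F (amul B b c) = (\<lambda>v. F b (F c v))" by (rule ext) (rule mult)
    then show ?thesis by (simp add: mmF lin(3))
  qed
  fix g b assume g: "g \<in> carrier G"
  have "mm I (mat_of I (r g)) (mat_of I (\<lambda>v. F b (r (inv g) v)))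
      = mat_of I (\<lambda>v. r g (F b (r (inv g) v)))"
    by (rule mm_mat_of[OF I r(1)[OF g]]) (rule lin(3))
  also have "\<dots> = mat_of I (F (ac B g b))"
  proof (rule mat_of_cong)
    fix v :: "'i \<Rightarrow> 'k" assume v: "v \<in> vspace I"
    have "r g (F b (r (inv g) v)) = F (ac B g b) (r g (r (inv g) v))" using equiv[OF g] by simp
    also have "\<dots> = F (ac B g b) v" using r(3)[OF g] v by simp
    finally show "r g (F b (r (inv g) v)) = F (ac B g b) v" .
  qed
  finally show "mat_of I (F (ac B g b)) = ac ?E g (mat_of I (F b))"
    using g r(2) by (simp add: mmF)
qed

lemma ghom_operators:
  assumes A: "galg A" "basis A \<noteq> {}"
    and lin: "\<And>v. tlin (basis B) (\<lambda>b. F b v)" "\<And>b. tlin (basis A) (F b)" "\<And>b v. F b v \<in> V A"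
    and mult: "\<And>b c v. F (amul B b c) v = F b (F c v)" and one: "\<And>v. v \<in> V A \<Longrightarrow> F (aone B) v = v"
    and equiv: "\<And>g b v. g \<in> carrier G \<Longrightarrow> F (ac B g b) (ac A g v) = ac A g (F b v)"
  shows "ghom B (EndG (basis A) (regrep A)) (\<lambda>b. mat_of (basis A) (F b))"
  by (rule ghom_operators_rep[OF galgD(1)[OF A(1)], where r = "ac A"])
    (use assms in \<open>simp_all add: galgD(10) galg_simps\<close>)

lemma mat_of_comb: "mat_of I (\<lambda>v. vscale c (S v + T v + U v - W v)) = vscale c (mat_of I S + mat_of I T + mat_of I U - mat_of I W)"
  by (auto simp: mat_of_def fun_eq_iff vec_apply)

text \<open>\<open>F1\<close> is the copairing of left multiplications with signed right multiplications, which supercommute,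
  so it is a homomorphism; \<open>F2\<close> is treated in the same way inside the opposite algebra. Bijectivity follows
  from simplicity and the dimension.\<close>

lemma F1_bij:
  assumes cA: "cs A"
  defines "E \<equiv> EndG (basis A) (regrep A)"
  shows "ghom (bp A (hop A)) E (F1 H R A)"
    and "bij_betw (F1 H R A) (V (bp A (hop A))) (V E)"
    and "ghom (bp (hop A) A) (op_alg E) (F2 H R A)"
    and "bij_betw (F2 H R A) (V (bp (hop A) A)) (V (op_alg E))"
proof -
  have A: "galg A" using cA by simp
  note ne = cs_nonempty[OF cA]
  note hA = galg_hop[OF A]
  have E: "galg E" unfolding E_def by (rule galg_EndG[OF grep_regrep[OF A ne]])
  have bE: "basis E = basis A \<times> basis A" by (simp add: E_def)
  note I = galgD(1)[OF A]
  note [simp] = galg_simps[OF A] hop_mul[OF A]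
  note tl = galg_tlin[OF A]
  \<comment> \<open>Signed right and left multiplications, so that the two maps are \<open>a \<sharp> b \<mapsto> a \<rho>\<^sub>b(c)\<close> and \<open>a \<sharp> b \<mapsto> \<mu>\<^sub>a(c) b\<close>.\<close>
  define \<rho> where "\<rho> b c = vscale (1 / 2) (amul A c b + amul A (ac A u c) b + amul A c (ac A u b) - amul A (ac A u c) (ac A u b))" for b c
  define \<mu> where "\<mu> a c = vscale (1 / 2) (amul A a c + amul A (ac A u a) c + amul A a (ac A u c) - amul A (ac A u a) (ac A u c))" for a c
  have \<rho>t: "tlin (basis A) (\<lambda>b. \<rho> b c)" "tlin (basis A) (\<rho> b)" "\<rho> b c \<in> V A" for b c
  proof -
    have "\<rho> b = (\<lambda>c. vscale (1 / 2) (amul A c b + amul A (ac A u c) b + amul A c (ac A u b) - amul A (ac A u c) (ac A u b)))"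
      by (rule ext) (rule \<rho>_def)
    then show "tlin (basis A) (\<rho> b)" by (simp only:) (intro tlin_intros tl u_closed)
    show "tlin (basis A) (\<lambda>b. \<rho> b c)" unfolding \<rho>_def by (intro tlin_intros tl u_closed)
    show "\<rho> b c \<in> V A" unfolding \<rho>_def using A by simp
  qed
  have \<mu>t: "tlin (basis A) (\<lambda>b. \<mu> b c)" "tlin (basis A) (\<mu> b)" "\<mu> b c \<in> V A" for b c
  proof -
    have "\<mu> b = (\<lambda>c. vscale (1 / 2) (amul A b c + amul A (ac A u b) c + amul A b (ac A u c) - amul A (ac A u b) (ac A u c)))"
      by (rule ext) (rule \<mu>_def)
    then show "tlin (basis A) (\<mu> b)" by (simp only:) (intro tlin_intros tl u_closed)
    show "tlin (basis A) (\<lambda>b. \<mu> b c)" unfolding \<mu>_def by (intro tlin_intros tl u_closed)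
    show "\<mu> b c \<in> V A" unfolding \<mu>_def using A by simp
  qed
  let ?f = "\<lambda>a. mat_of (basis A) (amul A a)" and ?g = "\<lambda>b. mat_of (basis A) (\<rho> b)"
  have f: "ghom A E ?f" unfolding E_def
    by (rule ghom_operators[OF A ne]) (use A tl in simp_all)
  have g: "ghom (hop A) E ?g" unfolding E_def
  proof (rule ghom_operators[OF A ne])
    show "\<rho> (amul (hop A) b c) v = \<rho> b (\<rho> c v)" for b c v
      unfolding \<rho>_def by simp ((simp add: fun_eq_iff lincomb)?)
    show "\<rho> (aone (hop A)) v = v" if "v \<in> V A" for v
      unfolding \<rho>_def using that A by simp ((simp add: fun_eq_iff lincomb)?)
    show "\<rho> (ac (hop A) g b) (ac A g v) = ac A g (\<rho> b v)" if "g \<in> carrier G" for g b v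
      unfolding \<rho>_def using that by (simp add: u_central)
  qed (use \<rho>t in simp_all)
  let ?f' = "\<lambda>a. mat_of (basis A) (\<mu> a)" and ?g' = "\<lambda>b. mat_of (basis A) (\<lambda>c. amul A c b)"
  have mmt: "mm (basis A) (mat_of (basis A) S) (mat_of (basis A) T) = mat_of (basis A) (\<lambda>v. S (T v))"
    if "tlin (basis A) S" "\<And>v. T v \<in> V A" for S T by (rule mm_mat_of[OF I that])
  have copF1: "F1 H R A = copair A (hop A) E ?f ?g"
  proof
    fix t
    have mf: "mm (basis A) (?f a) (?g b) = mat_of (basis A) (\<lambda>c. amul A a (\<rho> b c))" for a b
      by (rule mmt) (use \<rho>t tl in auto)
    have "F1 H R A t = mat_of (basis A) (\<lambda>c. \<Sum>x\<in>basis A \<times> basis A. vscale (t x) (amul A (bvec (fst x)) (\<rho> (bvec (snd x)) c)))"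
      unfolding F1_def basis_H linext_R by (simp add: linext_sum case_prod_beta \<rho>_def add_ac)
    also have "\<dots> = copair A (hop A) E ?f ?g t"
      unfolding copair_def linext_sum mat_of_sum mat_of_scale by (simp add: case_prod_beta E_def mf)
    finally show "F1 H R A t = copair A (hop A) E ?f ?g t" .
  qed
  have sc: "supercommute E (?g x) (?f a)" for x a
  proof -
    have "mat_of (basis A) (\<lambda>v. \<rho> x (amul A a v)) = mat_of (basis A) (\<lambda>v. vscale (1 / 2)
       (amul A a (\<rho> x v) + amul A (ac A u a) (\<rho> x v) + amul A a (\<rho> (ac A u x) v) - amul A (ac A u a) (\<rho> (ac A u x) v)))"
      by (rule mat_of_cong) (simp add: \<rho>_def, (simp add: fun_eq_iff lincomb)?)
    then show ?thesis
      unfolding supercommute_def ghomD(5)[OF f u_closed, symmetric] ghomD(5)[OF g u_closed, symmetric] mat_of_comb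
      using A \<rho>t tl by (simp add: E_def mmt)
  qed
  show F: "ghom (bp A (hop A)) E (F1 H R A)"
    unfolding copF1 by (rule copair_ghom[OF A hA E f g sc])
  show "bij_betw (F1 H R A) (V (bp A (hop A))) (V E)"
    by (rule ghom_bij[OF cs_bp[OF cA cs_hop[OF cA]] E _ F]) (use ne in \<open>simp_all add: bE\<close>)
  have oE: "galg (op_alg E)" by (rule galg_op[OF E])
  let ?O = "op_alg A"
  have g': "ghom A (op_alg E) ?g'"
  proof -
    have "ghom (op_alg A) E ?g'" unfolding E_def
      by (rule ghom_operators[OF A ne]) (use A tl in simp_all)
    then show ?thesis unfolding ghom_def by simp
  qed
  have f': "ghom (hop A) (op_alg E) ?f'"
  proof -
    have "ghom (op_alg (hop A)) E ?f'" unfolding E_def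
    proof (rule ghom_operators[OF A ne])
      show "\<mu> (amul (op_alg (hop A)) b c) v = \<mu> b (\<mu> c v)" for b c v
        unfolding \<mu>_def by simp ((simp add: fun_eq_iff lincomb)?)
      show "\<mu> (aone (op_alg (hop A))) v = v" if "v \<in> V A" for v
        unfolding \<mu>_def using that A by simp ((simp add: fun_eq_iff lincomb)?)
      show "\<mu> (ac (op_alg (hop A)) g b) (ac A g v) = ac A g (\<mu> b v)" if "g \<in> carrier G" for g b v
        unfolding \<mu>_def using that by (simp add: u_central)
    qed (use \<mu>t in simp_all)
    then show ?thesis unfolding ghom_def by simp
  qed
  have copF2: "F2 H R A = copair (hop A) A (op_alg E) ?f' ?g'"
  proof
    fix t
    have mf: "mm (basis A) (?g' b) (?f' a) = mat_of (basis A) (\<lambda>c. amul A (\<mu> a c) b)" for a b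
      by (rule mmt) (use \<mu>t tl in auto)
    have "F2 H R A t = mat_of (basis A) (\<lambda>c. \<Sum>x\<in>basis A \<times> basis A. vscale (t x) (amul A (\<mu> (bvec (fst x)) c) (bvec (snd x))))"
      unfolding F2_def basis_H linext_R by (simp add: linext_sum case_prod_beta \<mu>_def add_ac)
    also have "\<dots> = copair (hop A) A (op_alg E) ?f' ?g' t"
      unfolding copair_def linext_sum mat_of_sum mat_of_scale by (simp add: case_prod_beta E_def mf)
    finally show "F2 H R A t = copair (hop A) A (op_alg E) ?f' ?g' t" .
  qed
  have sc': "supercommute (op_alg E) (?g' x) (?f' a)" for x a
  proof -
    have "mat_of (basis A) (\<lambda>v. \<mu> a (amul A v x)) = mat_of (basis A) (\<lambda>v. vscale (1 / 2)
       (amul A (\<mu> a v) x + amul A (\<mu> (ac A u a) v) x + amul A (\<mu> a v) (ac A u x) - amul A (\<mu> (ac A u a) v) (ac A u x)))"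
      by (rule mat_of_cong) (simp add: \<mu>_def, (simp add: fun_eq_iff lincomb)?)
    then show ?thesis
      unfolding supercommute_def ghomD(5)[OF f' u_closed, symmetric] ghomD(5)[OF g' u_closed, symmetric] mat_of_comb
      using A \<mu>t tl by (simp add: E_def mmt)
  qed
  show F': "ghom (bp (hop A) A) (op_alg E) (F2 H R A)"
    unfolding copF2 by (rule copair_ghom[OF hA A oE f' g' sc'])
  show "bij_betw (F2 H R A) (V (bp (hop A) A)) (V (op_alg E))"
    by (rule ghom_bij[OF cs_bp[OF cs_hop[OF cA] cA] oE _ F']) (use ne in \<open>simp_all add: bE\<close>)
qed

lemma bp_hop:
  assumes cA: "cs A" shows "giso (bp A (hop A)) (EndG (basis A) (regrep A))"
  using F1_bij(1,2)[OF cA] unfolding giso_def by blast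

lemma ghom_alg_iso:
  assumes f: "ghom A B f" "bij_betw f (V A) (V B)"
    and C: "basis C = basis B" "aone C = aone B" "\<And>x y. x \<in> V B \<Longrightarrow> y \<in> V B \<Longrightarrow> amul C x y = amul B x y"
  shows "alg_iso A C f"
  using f(2) ghomD[OF f(1)] C by (auto simp: alg_iso_def ring_iso_def ring_hom_def vlin_rules)

lemma mm_End_alg:
  assumes "S \<in> vspace (I \<times> I)" "T \<in> vspace (I \<times> I)" shows "amul (End_alg I) S T = mm I S T"
proof -
  have "amul (End_alg I) S T (i, j) = mm I S T (i, j)" for i j
    using assms by (auto simp: End_alg_def mm_def vspace_def intro!: sum.neutral)
  then show ?thesis by (simp add: fun_eq_iff)
qed

lemma End_alg_simps [simp]: "basis (End_alg I) = I \<times> I" "aone (End_alg I) = idm I"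
  by (simp_all add: End_alg_def)

lemma cs_azumaya:
  assumes cA: "cs A" shows "azumaya H R A"
proof -
  let ?E = "EndG (basis A) (regrep A)"
  have "alg_iso (bp A (hop A)) (End_alg (basis A)) (F1 H R A)"
    by (rule ghom_alg_iso[OF F1_bij(1,2)[OF cA]]) (simp_all add: mm_End_alg)
  moreover have "alg_iso (bp (hop A) A) (op_alg (End_alg (basis A))) (F2 H R A)"
    by (rule ghom_alg_iso[OF F1_bij(3,4)[OF cA]]) (simp_all add: mm_End_alg op_alg_def)
  ultimately show ?thesis
    unfolding azumaya_def using galg_hmodule_algebra[OF cs_galg[OF cA]] cs_nonempty[OF cA] by simp
qed

lemma gen_u: "generate G {u} = {\<one>, u}"
proof
  show "generate G {u} \<subseteq> {\<one>, u}"
  proof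
    fix x assume "x \<in> generate G {u}"
    then show "x \<in> {\<one>, u}" by induction auto
  qed
  show "{\<one>, u} \<subseteq> generate G {u}" by (auto intro: generate.one generate.incl)
qed

text \<open>A character that is nontrivial on \<open>u\<close> splits off \<open>U\<close>: its kernel is a complement.\<close>

lemma sign_character_direct_factor:
  assumes chi: "\<And>g h. g \<in> carrier G \<Longrightarrow> h \<in> carrier G \<Longrightarrow> \<chi> (g \<otimes> h) = \<chi> g * (\<chi> h :: 'k)"
    and pm: "\<And>g. g \<in> carrier G \<Longrightarrow> \<chi> g = 1 \<or> \<chi> g = - 1" and u: "\<chi> u = - 1"
  shows "direct_factor G (generate G {u})"
proof -
  have n1: "(1::'k) \<noteq> - 1" using two by (metis add.inverse_unique add.right_inverse one_add_one)
  have one: "\<chi> \<one> = 1"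
    using chi[of u u] u by simp
  have inv: "\<chi> (inv g) = \<chi> g" if g: "g \<in> carrier G" for g
    using chi[of g "inv g"] g one pm[of g] pm[of "inv g"] n1 by auto
  let ?N = "{g \<in> carrier G. \<chi> g = 1}"
  have "subgroup ?N G"
    by (rule subgroupI) (auto simp: inv chi one intro: one_closed)
  then have N: "?N \<lhd> G"
  proof (rule normal_invI)
    fix x h assume "x \<in> carrier G" "h \<in> ?N"
    then show "x \<otimes> h \<otimes> inv x \<in> ?N" using pm[of x] by (auto simp: chi inv)
  qed
  have "subgroup {\<one>, u} G" by (rule subgroupI) (auto intro: inv_equality)
  then have U: "{\<one>, u} \<lhd> G"
  proof (rule normal_invI)
    fix x h assume x: "x \<in> carrier G" and "h \<in> {\<one>, u}"
    moreover have "x \<otimes> u \<otimes> inv x = u" using x u_central[OF x] by (metis inv_solve_right' m_closed u_closed)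
    ultimately show "x \<otimes> h \<otimes> inv x \<in> {\<one>, u}" using x by auto
  qed
  have "?N \<inter> {\<one>, u} = {\<one>}" using one u n1 by auto
  moreover have "?N <#> {\<one>, u} = carrier G"
  proof
    show "?N <#> {\<one>, u} \<subseteq> carrier G" by (auto simp: set_mult_def)
    show "carrier G \<subseteq> ?N <#> {\<one>, u}"
    proof
      fix g assume g: "g \<in> carrier G"
      show "g \<in> ?N <#> {\<one>, u}"
      proof (cases "\<chi> g = 1")
        case True
        then have "g \<in> ?N" "g = g \<otimes> \<one>" using g by auto
        then show ?thesis unfolding set_mult_def by blast
      next
        case False
        then have "\<chi> (g \<otimes> u) = 1" using pm[OF g] g by (simp add: chi u)
        moreover have "g = (g \<otimes> u) \<otimes> u" using g by (simp add: m_assoc)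
        ultimately show ?thesis
          unfolding set_mult_def by (intro UN_I[of "g \<otimes> u"] UN_I[of u]) (use g in auto)
      qed
    qed
  qed
  ultimately show ?thesis using N U unfolding direct_factor_def gen_u by blast
qed

text \<open>Surjectivity of \<open>F1\<close>, written out.\<close>

lemma azumaya_operators:
  assumes A: "galg A" and az: "azumaya H R A" and S: "S \<in> vspace (basis A \<times> basis A)"
  shows "\<exists>t. \<forall>v\<in>V A. mat_app (basis A) S v = (\<Sum>x\<in>basis A \<times> basis A. vscale (t x)
    (amul A (bvec (fst x)) (vscale (1 / 2) (amul A v (bvec (snd x)) + amul A (ac A u v) (bvec (snd x))
      + amul A v (ac A u (bvec (snd x))) - amul A (ac A u v) (ac A u (bvec (snd x)))))))"
proof -
  let ?r = "\<lambda>b v. vscale (1 / 2) (amul A v b + amul A (ac A u v) b + amul A v (ac A u b) - amul A (ac A u v) (ac A u b))"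
  let ?F = "\<lambda>t v. \<Sum>x\<in>basis A \<times> basis A. vscale (t x) (amul A (bvec (fst x)) (?r (bvec (snd x)) v))"
  have "bij_betw (F1 H R A) (V (bp A (hop A))) (vspace (basis A \<times> basis A))"
    using az by (auto simp: azumaya_def alg_iso_def ring_iso_def)
  then obtain t where t: "F1 H R A t = S" using S by (force simp: bij_betw_def)
  have "F1 H R A t = mat_of (basis A) (?F t)"
    unfolding F1_def basis_H linext_R
    by (simp add: linext_sum case_prod_beta galg_simps[OF A] add_ac)
  then have "mat_app (basis A) S v = ?F t v" if "v \<in> V A" for v
  proof -
    have "tlin (basis A) (?F t)"
      by (intro tlin_intros galg_tlin[OF A] u_closed)
    moreover have "?F t v \<in> V A" for v using A by simp
    ultimately show ?thesis using mat_app_mat_of[of "basis A" "?F t" v] \<open>F1 H R A t = mat_of (basis A) (?F t)\<close> t by simp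
  qed
  then show ?thesis by blast
qed

lemma mat_app_unit: "finite I \<Longrightarrow> i \<in> I \<Longrightarrow> mat_app I (bvec (a, i)) v = vscale (v i) (bvec a :: 'i \<Rightarrow> 'k)"
proof -
  assume f: "finite I" and i: "i \<in> I"
  have "(\<Sum>j\<in>I. bvec (a, i) (l, j) * v j) = (\<Sum>j\<in>I. if j = i then (if l = a then v i else 0) else (0::'k))" for l
    by (auto simp: bvec_def intro!: sum.cong)
  then show ?thesis using f i by (auto simp: mat_app_def fun_eq_iff vec_apply bvec_def)
qed

text \<open>By surjectivity of \<open>F1\<close>, a \<open>u\<close>-stable ideal is stable under all linear operators.\<close>

lemma azumaya_graded_simple:
  assumes A: "galg A" and az: "azumaya H R A" and J: "idl A J" and uJ: "\<And>x. x \<in> J \<Longrightarrow> ac A u x \<in> J"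
    and x: "x \<in> J" "x \<noteq> 0"
  shows "aone A \<in> J"
proof -
  have JV: "J \<subseteq> V A" using J by (simp add: idl_def)
  have m: "amul A a t \<in> J" "amul A t a \<in> J" if "t \<in> J" for t a
  proof -
    have "amul A (crop (basis A) a) t \<in> J" "amul A t (crop (basis A) a) \<in> J"
      using J that crop_vspace unfolding idl_def by blast+
    then show "amul A a t \<in> J" "amul A t a \<in> J" by (simp_all add: galg_simps[OF A])
  qed
  have Ja: "s + t \<in> J" if "s \<in> J" "t \<in> J" for s t using J that unfolding idl_def by blast
  note Jc = idl_scale[OF A J] idl_diff[OF A J]
  have J0: "0 \<in> J" using J by (simp add: idl_def)
  have sum: "(\<Sum>x\<in>S. F x) \<in> J" if "\<And>x. x \<in> S \<Longrightarrow> F x \<in> J" for S and F :: "_ \<Rightarrow> _"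
    using that by (induction S rule: infinite_finite_induct) (auto simp: J0 Ja)
  have ops: "mat_app (basis A) S v \<in> J" if S: "S \<in> vspace (basis A \<times> basis A)" and v: "v \<in> J" for S v
  proof -
    from azumaya_operators[OF A az S] v JV obtain t where t: "mat_app (basis A) S v = (\<Sum>x\<in>basis A \<times> basis A. vscale (t x)
    (amul A (bvec (fst x)) (vscale (1 / 2) (amul A v (bvec (snd x)) + amul A (ac A u v) (bvec (snd x))
      + amul A v (ac A u (bvec (snd x))) - amul A (ac A u v) (ac A u (bvec (snd x)))))))" by blast
    show ?thesis unfolding t by (intro sum Jc m Ja uJ v)
  qed
  obtain i where i: "i \<in> basis A" "x i \<noteq> 0"
    using x JV by (auto simp: vspace_def fun_eq_iff vec_apply)
  have "bvec a \<in> J" if a: "a \<in> basis A" for a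
  proof -
    have "vscale (x i) (bvec a) \<in> J"
      using ops[of "bvec (a, i)" x] a i x mat_app_unit[OF galgD(1)[OF A] i(1), of a x] by simp
    from Jc(1)[OF this, of "inverse (x i)"] i show ?thesis by simp
  qed
  then have "(\<Sum>a\<in>basis A. vscale (aone A a) (bvec a)) \<in> J" by (intro sum Jc) auto
  then show ?thesis using vspace_expand[OF galgD(1)[OF A], of "aone A"] A by simp
qed

text \<open>Multiplication by an even central element commutes with the image of \<open>F1\<close>, that is, with all linear
  operators, so it is a scalar.\<close>

lemma azumaya_even_center:
  assumes A: "galg A" and az: "azumaya H R A" and z: "z \<in> V A" "ac A u z = z" "\<And>v. amul A z v = amul A v z"
  shows "\<exists>c. z = vscale c (aone A)"
proof -
  have ne: "basis A \<noteq> {}" using az by (simp add: azumaya_def)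
  have comm: "mat_app (basis A) S (amul A z v) = amul A z (mat_app (basis A) S v)"
    if S: "S \<in> vspace (basis A \<times> basis A)" and v: "v \<in> V A" for S v
  proof -
    from azumaya_operators[OF A az S] obtain t where t: "\<forall>v\<in>V A. mat_app (basis A) S v = (\<Sum>x\<in>basis A \<times> basis A. vscale (t x)
    (amul A (bvec (fst x)) (vscale (1 / 2) (amul A v (bvec (snd x)) + amul A (ac A u v) (bvec (snd x))
      + amul A v (ac A u (bvec (snd x))) - amul A (ac A u v) (ac A u (bvec (snd x)))))))" by blast
    have zl: "amul A b (amul A z w) = amul A z (amul A b w)" for b w
      using z(3)[of b] by (metis galgD(5)[OF A])
    have "amul A z v \<in> V A" using A by simp
    with t v show ?thesis
      by (simp add: galg_sum[OF A] galg_simps[OF A] z(2) zl)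
  qed
  obtain i where i: "i \<in> basis A" "aone A i \<noteq> 0"
    using galg_one_nonzero[OF A ne] galg_closed(2)[OF A] by (auto simp: vspace_def fun_eq_iff vec_apply)
  define c where "c = z i / aone A i"
  have "amul A z v = amul A (vscale c (aone A)) v" for v
  proof (rule tlin_ext[OF galg_tlin(4)[OF A] galg_tlin(4)[OF A]])
    fix a assume a: "a \<in> basis A"
    have "vscale (z i) (bvec a) = amul A z (vscale (aone A i) (bvec a))"
      using comm[of "bvec (a, i)" "aone A"] a i A z(1) mat_app_unit[OF galgD(1)[OF A] i(1), of a]
      by (simp add: galg_simps)
    then have "vscale (inverse (aone A i)) (vscale (z i) (bvec a)) = amul A z (bvec a)"
      using i(2) by (simp add: galg_simps[OF A])
    then show "amul A z (bvec a) = amul A (vscale c (aone A)) (bvec a)"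
      using a i(2) by (simp add: galg_simps[OF A] c_def divide_inverse mult.commute)
  qed
  then have "amul A z (aone A) = amul A (vscale c (aone A)) (aone A)" .
  then show ?thesis using z(1) A by (auto simp: galg_simps)
qed

text \<open>The product of two odd central elements is even and central, hence a scalar. In particular \<open>z\<^sup>2 = c\<close>,
  and \<open>c \<noteq> 0\<close> because otherwise \<open>z A\<close> would be a nonzero \<open>u\<close>-stable ideal killed by \<open>z\<close>. As \<open>g z\<close> is also odd and
  central, \<open>(g z) z\<close> is a scalar, so \<open>g z\<close> is a multiple of \<open>z\<close>. The resulting character takes the value
  \<open>-1\<close> at \<open>u\<close>.\<close>

lemma azumaya_no_odd_center:
  assumes A: "galg A" and az: "azumaya H R A" and ndf: "\<not> direct_factor G (generate G {u})"
    and z: "z \<in> V A" "ac A u z = - z" "\<And>v. amul A z v = amul A v z"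
  shows "z = 0"
proof (rule ccontr)
  assume z0: "z \<noteq> 0"
  note [simp] = galg_simps[OF A]
  have ne: "basis A \<noteq> {}" using az by (simp add: azumaya_def)
  have zc: "amul A a (amul A z b) = amul A z (amul A a b)" for a b
    using z(3)[of a] by (metis galgD(5)[OF A])
  have prod: "\<exists>c. amul A z' z = vscale c (aone A)"
    if z': "z' \<in> V A" "ac A u z' = - z'" "\<And>v. amul A z' v = amul A v z'" for z'
  proof (rule azumaya_even_center[OF A az])
    show "amul A (amul A z' z) v = amul A v (amul A z' z)" for v
    proof -
      have "amul A (amul A z' z) v = amul A z' (amul A v z)" using z(3)[of v] by simp
      also have "\<dots> = amul A (amul A z' v) z" by simp
      also have "\<dots> = amul A (amul A v z') z" using z'(3)[of v] by simp
      finally show ?thesis by simp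
    qed
  qed (use A z(1,2) z'(1,2) in simp_all)
  from prod[OF z] obtain c where c: "amul A z z = vscale c (aone A)" by blast
  have c0: "c \<noteq> 0"
  proof
    assume "c = 0"
    have "idl A {amul A z a | a. a \<in> V A}"
      unfolding idl_def
    proof (intro conjI ballI)
      show "0 \<in> {amul A z a | a. a \<in> V A}" by (intro CollectI exI[of _ 0]) simp
      fix y b assume "y \<in> {amul A z a | a. a \<in> V A}" and b: "b \<in> V A"
      then obtain a where a: "y = amul A z a" "a \<in> V A" by blast
      show "amul A b y \<in> {amul A z a | a. a \<in> V A}"
        using a A by (intro CollectI exI[of _ "amul A b a"]) (simp add: zc)
      show "amul A y b \<in> {amul A z a | a. a \<in> V A}"
        using a A by (intro CollectI exI[of _ "amul A a b"]) simp
    next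
      fix x y assume "x \<in> {amul A z a | a. a \<in> V A}" "y \<in> {amul A z a | a. a \<in> V A}"
      then obtain a b where "x = amul A z a" "y = amul A z b" "a \<in> V A" "b \<in> V A" by blast
      then show "x + y \<in> {amul A z a | a. a \<in> V A}" by (intro CollectI exI[of _ "a + b"]) simp
    next
      show "{amul A z a | a. a \<in> V A} \<subseteq> V A" using galg_closed(1)[OF A] by blast
    qed
    moreover have "ac A u x \<in> {amul A z a | a. a \<in> V A}" if "x \<in> {amul A z a | a. a \<in> V A}" for x
    proof -
      from that obtain a where a: "x = amul A z a" "a \<in> V A" by blast
      then show ?thesis using A z by (intro CollectI exI[of _ "- ac A u a"]) simp
    qed
    moreover have "z \<in> {amul A z a | a. a \<in> V A}"
      using z(1) A by (intro CollectI exI[of _ "aone A"]) simp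
    ultimately have "aone A \<in> {amul A z a | a. a \<in> V A}"
      using azumaya_graded_simple[OF A az _ _ _ z0] by blast
    then obtain a where a: "a \<in> V A" "aone A = amul A z a" by blast
    have "z = amul A z (amul A z a)" using z(1) a(2) by (metis crop_id galg_simps(15)[OF A])
    also have "\<dots> = amul A (amul A z z) a" by simp
    also have "\<dots> = 0" unfolding c \<open>c = 0\<close> by simp
    finally show False using z0 by simp
  qed
  have "\<exists>x. ac A g z = vscale x z" if g: "g \<in> carrier G" for g
  proof -
    have "\<exists>e. amul A (ac A g z) z = vscale e (aone A)"
    proof (rule prod)
      show "ac A g z \<in> V A" using A g by simp
      show "ac A u (ac A g z) = - ac A g z"
      proof -
        have "ac A u (ac A g z) = ac A g (ac A u z)" using g by (simp add: u_central)
        then show ?thesis using g z by simp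
      qed
      fix v
      have "amul A (ac A g z) v = ac A g (amul A z (ac A (inv g) v))" using g by simp
      also have "\<dots> = ac A g (amul A (ac A (inv g) v) z)" using z(3) by simp
      also have "\<dots> = amul A v (ac A g z)" using g by simp
      finally show "amul A (ac A g z) v = amul A v (ac A g z)" .
    qed
    then obtain e where e: "amul A (ac A g z) z = vscale e (aone A)" by blast
    have "vscale c (ac A g z) = amul A (ac A g z) (amul A z z)"
      unfolding c using A g by simp
    also have "\<dots> = amul A (amul A (ac A g z) z) z" by simp
    also have "\<dots> = vscale e z" unfolding e using z(1) by simp
    finally have "vscale (inverse c) (vscale c (ac A g z)) = vscale (inverse c) (vscale e z)" by simp
    then show ?thesis using c0 by auto
  qed
  then obtain \<chi> where chi: "\<And>g. g \<in> carrier G \<Longrightarrow> ac A g z = vscale (\<chi> g) z" by metis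
  have "direct_factor G (generate G {u})"
  proof (rule sign_character_direct_factor[of \<chi>])
    show "\<chi> (g \<otimes> h) = \<chi> g * \<chi> h" if "g \<in> carrier G" "h \<in> carrier G" for g h
    proof -
      have "vscale (\<chi> (g \<otimes> h)) z = ac A g (ac A h z)" using that chi[of "g \<otimes> h"] by simp
      also have "\<dots> = vscale (\<chi> g * \<chi> h) z" using that by (simp add: chi mult.commute del: galg_simps(24))
      finally show ?thesis using z0 by simp
    qed
    show "\<chi> g = 1 \<or> \<chi> g = - 1" if g: "g \<in> carrier G" for g
    proof -
      have "vscale c (aone A) = ac A g (amul A z z)" unfolding c using g by simp
      also have "\<dots> = amul A (ac A g z) (ac A g z)" by (rule galgD(12)[OF A g])
      also have "\<dots> = vscale (\<chi> g * \<chi> g * c) (aone A)" using g by (simp add: chi c)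
      finally have "c = \<chi> g * \<chi> g * c" using galg_one_nonzero[OF A ne] by (simp only: fv.scale_cancel_right simp_thms)
      then have "\<chi> g * \<chi> g = 1" using c0 by simp
      then show ?thesis by (simp add: square_eq_1_iff)
    qed
    have "vscale (\<chi> u) z = vscale (- 1) z" using chi[of u] z(2) by simp
    then show "\<chi> u = - 1" using z0 by (simp only: fv.scale_cancel_right simp_thms)
  qed
  then show False using ndf by simp
qed

text \<open>The centre is \<open>u\<close>-stable, so it is the sum of its even part, which consists of scalars, and its odd part,
  which vanishes. For a proper nonzero ideal \<open>J\<close>, graded simplicity gives \<open>J \<inter> u J = 0\<close> and
  \<open>J + u J = A\<close>. Writing \<open>1 = e + f\<close> accordingly, \<open>u\<close> exchanges the central idempotents \<open>e\<close> and \<open>f\<close>, and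
  \<open>e - f\<close> is an odd central element; so \<open>e = f\<close>, which is absurd.\<close>

theorem azumaya_cs:
  assumes A: "galg A" and az: "azumaya H R A" and ndf: "\<not> direct_factor G (generate G {u})"
  shows "cs A"
proof (rule csI[OF A])
  note [simp] = galg_simps[OF A]
  show ne: "basis A \<noteq> {}" using az by (simp add: azumaya_def)
  { fix z assume zV: "z \<in> V A" and z: "\<And>v. v \<in> V A \<Longrightarrow> amul A z v = amul A v z"
    have z': "amul A z v = amul A v z" for v using z[of "crop (basis A) v"] by simp
    have uz: "amul A (ac A u z) v = amul A v (ac A u z)" for v
    proof -
      have "amul A (ac A u z) v = ac A u (amul A z (ac A u v))" by simp
      also have "\<dots> = ac A u (amul A (ac A u v) z)" using z' by simp
      finally show ?thesis by simp
    qed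
    have "z - ac A u z = 0"
      by (rule azumaya_no_odd_center[OF A az ndf]) (use A zV z' uz in simp_all)
    then have "ac A u z = z" by simp
    then show "\<exists>c. z = vscale c (aone A)" using azumaya_even_center[OF A az zV _ z'] by blast }
  { fix J x assume J: "idl A J" and x: "x \<in> J" "x \<noteq> 0"
    have JV: "J \<subseteq> V A" using J by (simp add: idl_def)
    have m: "amul A a t \<in> J" "amul A t a \<in> J" if "t \<in> J" for t a
    proof -
      have "amul A (crop (basis A) a) t \<in> J" "amul A t (crop (basis A) a) \<in> J"
        using J that crop_vspace unfolding idl_def by blast+
      then show "amul A a t \<in> J" "amul A t a \<in> J" by simp_all
    qed
    have Ja: "s + t \<in> J" if "s \<in> J" "t \<in> J" for s t using J that unfolding idl_def by blast
    have J0: "0 \<in> J" using J by (simp add: idl_def)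
    have uu: "ac A u (ac A u t) = t" if "t \<in> J" for t using that JV by auto
    let ?K = "{t \<in> J. ac A u t \<in> J}"
    have K: "idl A ?K"
      unfolding idl_def using JV by (auto simp: J0 Ja m)
    show "aone A \<in> J"
    proof (rule ccontr)
      assume no: "aone A \<notin> J"
      have K0: "t = 0" if "t \<in> J" "ac A u t \<in> J" for t
      proof (rule ccontr)
        assume "t \<noteq> 0"
        have "aone A \<in> ?K"
          by (rule azumaya_graded_simple[OF A az K _ _ \<open>t \<noteq> 0\<close>]) (use that uu in auto)
        then show False using no by simp
      qed
      let ?L = "{s + ac A u t | s t. s \<in> J \<and> t \<in> J}"
      have L: "idl A ?L"
        unfolding idl_def
      proof (intro conjI ballI)
        show "?L \<subseteq> V A" using JV A by auto
        show "0 \<in> ?L" using J0 by (intro CollectI exI[of _ 0]) simp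
        fix p assume "p \<in> ?L"
        then obtain s t where st: "p = s + ac A u t" "s \<in> J" "t \<in> J" by blast
        fix q assume "q \<in> ?L"
        then obtain s' t' where st': "q = s' + ac A u t'" "s' \<in> J" "t' \<in> J" by blast
        show "p + q \<in> ?L"
          using st st' by (intro CollectI exI[of _ "s + s'"] exI[of _ "t + t'"]) (simp add: Ja)
      next
        fix p a assume "p \<in> ?L" and a: "a \<in> V A"
        then obtain s t where st: "p = s + ac A u t" "s \<in> J" "t \<in> J" by blast
        show "amul A a p \<in> ?L" using st a
          by (intro CollectI exI[of _ "amul A a s"] exI[of _ "amul A (ac A u a) t"]) (simp add: m)
        show "amul A p a \<in> ?L" using st a
          by (intro CollectI exI[of _ "amul A s a"] exI[of _ "amul A t (ac A u a)"]) (simp add: m)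
      qed
      have "aone A \<in> ?L"
      proof (rule azumaya_graded_simple[OF A az L _ _ x(2)])
        show "x \<in> ?L" using x(1) J0 by (intro CollectI exI[of _ x] exI[of _ 0]) simp
        fix p assume "p \<in> ?L"
        then obtain s t where st: "p = s + ac A u t" "s \<in> J" "t \<in> J" by blast
        then show "ac A u p \<in> ?L"
          using uu by (intro CollectI exI[of _ t] exI[of _ s]) (simp add: add.commute del: galg_simps(24))
      qed
      then obtain e y where ey: "aone A = e + ac A u y" "e \<in> J" "y \<in> J" by blast
      define f where "f = ac A u y"
      have fJ: "ac A u f \<in> J" unfolding f_def using ey(3) uu[OF ey(3)] by (simp del: galg_simps(24))
      have eV: "e \<in> V A" using ey JV by blast
      have fV: "f \<in> V A" unfolding f_def using A by simp
      have ef1: "e + f = aone A" by (simp add: ey f_def)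
      have eaf: "amul A e (amul A a f) = 0" "amul A f (amul A a e) = 0" for a
        by (rule K0; use ey(2) fJ in \<open>simp add: m\<close>)+
      have "ac A u e + ac A u f = e + f" using ef1 A by (metis galg_simps(16,23)[OF A] u_closed)
      then have d: "e - ac A u f = ac A u e - f" by (simp add: algebra_simps)
      \<comment> \<open>Both sides of \<open>e - u f = u e - f\<close> show membership: it lies in \<open>J\<close> and in the translate of \<open>J\<close>.\<close>
      have "e - ac A u f = 0"
      proof (rule K0)
        show "e - ac A u f \<in> J" using idl_diff[OF A J ey(2) fJ] .
        have "ac A u (e - ac A u f) = ac A u (ac A u e - f)" by (simp add: d)
        also have "\<dots> = e - ac A u f" using eV by simp
        finally show "ac A u (e - ac A u f) \<in> J" using idl_diff[OF A J ey(2) fJ] by simp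
      qed
      then have uf: "ac A u f = e" and ue: "ac A u e = f" using d by simp_all
      have ec: "amul A e a = amul A a e" if a: "a \<in> V A" for a
      proof -
        have "amul A e a = amul A e (amul A a (e + f))" unfolding ef1 using a A by simp
        also have "\<dots> = amul A e (amul A a e)" using eaf by simp
        also have "\<dots> = amul A (e + f) (amul A a e)" using eaf by simp
        also have "\<dots> = amul A a e" unfolding ef1 using A by simp
        finally show ?thesis .
      qed
      have ec': "amul A e a = amul A a e" for a using ec[of "crop (basis A) a"] by simp
      have fe: "f = aone A - e" using ef1 by (simp add: algebra_simps)
      have fc: "amul A f v = amul A v f" for v by (simp add: fe ec')
      have "e - f = 0"
        by (rule azumaya_no_odd_center[OF A az ndf]) (use eV fV in \<open>simp_all add: uf ue ec' fc\<close>)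
      then have eq: "e = f" by simp
      have "amul A e e = 0" using eaf(1)[of "aone A"] eq fV by simp
      then have "amul A e (e + f) = 0" using eq by simp
      then have "e = 0" unfolding ef1 using eV by simp
      then show False using ey(2) no ef1 eq by (simp add: J0)
    qed }
qed

section \<open>Copies with basis in the natural numbers\<close>

definition push :: "'i set \<Rightarrow> ('i \<Rightarrow> 'j) \<Rightarrow> ('i \<Rightarrow> 'k) \<Rightarrow> 'j \<Rightarrow> 'k" where
  "push I b v = (\<lambda>n. if n \<in> b ` I then v (inv_into I b n) else 0)"

definition pull :: "'i set \<Rightarrow> ('i \<Rightarrow> 'j) \<Rightarrow> ('j \<Rightarrow> 'k) \<Rightarrow> 'i \<Rightarrow> 'k" where
  "pull I b x = (\<lambda>i. if i \<in> I then x (b i) else 0)"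

lemma push_pull:
  assumes "inj_on b I"
  shows "push I b (pull I b x) = crop (b ` I) x" "pull I b (push I b v) = crop I v"
  using assms by (auto simp: push_def pull_def crop_def fun_eq_iff f_inv_into_f)

lemma push_vspace [simp]: "push I b v \<in> vspace (b ` I)" and pull_vspace [simp]: "pull I b x \<in> vspace I"
  by (auto simp: push_def pull_def vspace_def)

lemma vlin_push: "vlin (push I b)" and vlin_pull: "vlin (pull I b)"
  by (auto simp: vlin_def push_def pull_def fun_eq_iff vec_apply)

lemma tlin_push: "finite I \<Longrightarrow> tlin I (push I b)"
  by (rule tlinI_crop[OF _ vlin_push]) (auto simp: push_def crop_def fun_eq_iff inv_into_into)

lemma tlin_pull: "finite I \<Longrightarrow> tlin (b ` I) (pull I b)"
  by (rule tlinI_crop[OF _ vlin_pull]) (auto simp: pull_def crop_def fun_eq_iff)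

definition gcopy :: "('i \<Rightarrow> 'j) \<Rightarrow> ('i, 'k, 'g) hmalg \<Rightarrow> ('j, 'k, 'g) hmalg" where
  "gcopy b A = \<lparr>basis = b ` basis A,
     amul = \<lambda>x y. push (basis A) b (amul A (pull (basis A) b x) (pull (basis A) b y)),
     aone = push (basis A) b (aone A),
     act = \<lambda>h x. push (basis A) b (act A h (pull (basis A) b x))\<rparr>"

lemma gcopy_simps [simp]:
  "basis (gcopy b A) = b ` basis A"
  "amul (gcopy b A) x y = push (basis A) b (amul A (pull (basis A) b x) (pull (basis A) b y))"
  "aone (gcopy b A) = push (basis A) b (aone A)"
  "act (gcopy b A) h x = push (basis A) b (act A h (pull (basis A) b x))"
  by (simp_all add: gcopy_def)

lemma gcopy:
  assumes A: "galg A" and b: "inj_on b (basis A)"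
  shows "galg (gcopy b A)" "giso A (gcopy b A)"
proof -
  note I = galgD(1)[OF A]
  note [simp] = push_pull[OF b] galg_simps[OF A]
  note vp = vlin_rules[OF vlin_push]
  have t: "tlin (b ` basis A) (\<lambda>x. push (basis A) b (F (pull (basis A) b x)))" if "vlin F" for F :: "('a \<Rightarrow> 'k) \<Rightarrow> 'a \<Rightarrow> 'k"
    by (rule tlin_comp[OF vlin_comp[OF vlin_push that] tlin_pull[OF I]])
  show B: "galg (gcopy b A)"
  proof (rule galgI)
    show "tlin (basis (gcopy b A)) (amul (gcopy b A) x)" for x
      using t[OF tlin_vlin[OF galgD(3)[OF A]]] by (simp add: gcopy_def)
    show "tlin (basis (gcopy b A)) (\<lambda>y. amul (gcopy b A) y x)" for x
      using t[OF tlin_vlin[OF galgD(4)[OF A]]] by (simp add: gcopy_def)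
    show "tlin (basis (gcopy b A)) (ac (gcopy b A) g)" if "g \<in> carrier G" for g
      using t[OF tlin_vlin[OF galgD(10)[OF A that]]] by (simp add: gcopy_def)
    show "act (gcopy b A) h v = (\<Sum>g\<in>carrier G. vscale (h g) (ac (gcopy b A) g v))" for h v
      by (simp, subst galgD(9)[OF A]) (simp add: vp)
  qed (use A I in simp_all)
  show "giso A (gcopy b A)"
    unfolding giso_def
  proof (intro exI conjI)
    show "ghom A (gcopy b A) (push (basis A) b)"
      by (rule ghomI) (use A I in \<open>simp_all add: tlin_push\<close>)
    show "bij_betw (push (basis A) b) (V A) (V (gcopy b A))"
      by (rule bij_betwI[of _ _ _ "pull (basis A) b"]) auto
  qed
qed

lemma giso_cs:
  assumes i: "giso A B" and cA: "cs A" and B: "galg B" shows "cs B"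
proof -
  have A: "galg A" using cA by simp
  from giso_sym[OF i A B] obtain f where f: "ghom B A f" "bij_betw f (V B) (V A)" unfolding giso_def by blast
  note F = ghomD[OF f(1)]
  have inj: "x = y" if "x \<in> V B" "y \<in> V B" "f x = f y" for x y
    using f(2) that unfolding bij_betw_def inj_on_def by blast
  have onto: "\<exists>b\<in>V B. f b = a" if "a \<in> V A" for a
  proof -
    have "a \<in> f ` V B" using f(2) that by (simp add: bij_betw_def)
    then show ?thesis by blast
  qed
  show ?thesis
  proof (rule csI[OF B])
    show "basis B \<noteq> {}" using giso_dim[OF i galgD(1)[OF A] galgD(1)[OF B]] cs_nonempty[OF cA] galgD(1)[OF A] by auto
    { fix z assume z: "z \<in> V B" "\<And>v. v \<in> V B \<Longrightarrow> amul B z v = amul B v z"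
      have "amul A (f z) v = amul A v (f z)" if v: "v \<in> V A" for v
      proof -
        from onto[OF v] obtain b where "b \<in> V B" "f b = v" by blast
        then show ?thesis using z(2)[of b] F(4) by metis
      qed
      from cs_center[OF cA F(2) this] obtain c where "f z = vscale c (aone A)" by blast
      then have "f z = f (vscale c (aone B))" by (simp add: F(3) vlin_rules[OF F(6)])
      then show "\<exists>c. z = vscale c (aone B)" using inj[OF z(1), of "vscale c (aone B)"] B by (intro exI[of _ c]) simp }
    { fix J x assume J: "idl B J" and x: "x \<in> J" "x \<noteq> 0"
      have JV: "J \<subseteq> V B" using J by (simp add: idl_def)
      have "idl A (f ` J)"
        unfolding idl_def
      proof (intro conjI ballI)
        show "f ` J \<subseteq> V A" using F(2) by blast
        show "0 \<in> f ` J" using J vlin_zero[OF F(6)] by (force simp: idl_def)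
        fix p assume "p \<in> f ` J"
        then obtain s where s: "s \<in> J" "p = f s" by blast
        { fix q assume "q \<in> f ` J"
          then obtain t where t: "t \<in> J" "q = f t" by blast
          have "s + t \<in> J" using J s t by (simp add: idl_def)
          then show "p + q \<in> f ` J" using s t by (auto simp: vlin_add[OF F(6)] intro!: image_eqI[of _ f "s + t"]) }
        { fix a assume "a \<in> V A"
          then obtain b where b: "b \<in> V B" "f b = a" using onto by blast
          have "amul B b s \<in> J" "amul B s b \<in> J" using J s b by (auto simp: idl_def)
          then show "amul A a p \<in> f ` J" "amul A p a \<in> f ` J" using F(4) b s by (metis imageI)+ }
      qed
      moreover have "f x \<noteq> 0" using inj[of x 0] x JV vlin_zero[OF F(6)] by auto
      ultimately have "f ` J = V A" using cs_idl[OF cA] x by blast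
      then obtain y where "y \<in> J" "f y = aone A" using A by (metis galg_closed(2) imageE)
      then show "aone B \<in> J" using inj[of y "aone B"] JV B F(3) by auto }
  qed
qed

text \<open>The classes that make up the Brauer groups contain only algebras with basis in the natural numbers.\<close>

lemma nat_copy:
  assumes "galg A" obtains B :: "(nat, 'k, 'g) hmalg" where "galg B" "giso A B"
proof -
  obtain b :: "_ \<Rightarrow> nat" where "inj_on b (basis A)"
    using finite_imp_inj_to_nat_seg[OF galgD(1)[OF assms]] by blast
  then show thesis using gcopy[OF assms] that by blast
qed

lemma grep_copy:
  assumes w: "grep I w" and b: "inj_on b I"
  shows "\<exists>w'. grep (b ` I) w' \<and> giso (EndG I w) (EndG (b ` I) w')"
proof -
  let ?J = "b ` I" and ?i = "inv_into I b"
  define \<theta> where "\<theta> S = (\<lambda>(m, n). if m \<in> ?J \<and> n \<in> ?J then S (?i m, ?i n) else 0)" for S :: "_ \<Rightarrow> 'k"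
  have I: "finite I" using grepD[OF w] by simp
  have i [simp]: "?i (b l) = l" if "l \<in> I" for l using b that by simp
  have mm: "\<theta> (mm I S T) = mm ?J (\<theta> S) (\<theta> T)" for S T
  proof -
    have "(\<Sum>n\<in>?J. F (?i n)) = (\<Sum>l\<in>I. F l)" for F :: "_ \<Rightarrow> 'k"
      using b by (subst sum.reindex) (auto intro!: sum.cong)
    note s = this[of "\<lambda>l. S (_, l) * T (l, _)"]
    have "\<theta> (mm I S T) (m, n) = mm ?J (\<theta> S) (\<theta> T) (m, n)" for m n
    proof (cases "m \<in> ?J \<and> n \<in> ?J")
      case True
      then have "mm ?J (\<theta> S) (\<theta> T) (m, n) = (\<Sum>l\<in>?J. S (?i m, ?i l) * T (?i l, ?i n))"
        by (simp add: mm_def \<theta>_def)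
      also have "\<dots> = (\<Sum>l\<in>I. S (?i m, l) * T (l, ?i n))" by (rule s)
      finally show ?thesis using True by (auto simp: mm_def \<theta>_def)
    qed (auto simp: mm_def \<theta>_def)
    then show ?thesis by (simp add: fun_eq_iff)
  qed
  have V: "\<theta> S \<in> vspace (?J \<times> ?J)" for S by (auto simp: \<theta>_def vspace_def)
  have one: "\<theta> (idm I) = idm ?J" using b by (auto simp: \<theta>_def mat_of_def bvec_def fun_eq_iff)
  have vl: "vlin \<theta>" by (auto simp: vlin_def \<theta>_def fun_eq_iff vec_apply)
  have cr: "\<theta> (crop (I \<times> I) S) = \<theta> S" for S by (auto simp: \<theta>_def crop_def fun_eq_iff)
  have w': "grep ?J (\<lambda>g. \<theta> (w g))"
    using grepD[OF w] unfolding grep_def by (auto simp: V mm[symmetric] one)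
  moreover have "giso (EndG I w) (EndG ?J (\<lambda>g. \<theta> (w g)))"
  proof (rule ghom_giso[OF cs_EndG[OF w] galg_EndG[OF w']])
    show "ghom (EndG I w) (EndG ?J (\<lambda>g. \<theta> (w g))) \<theta>"
    proof (rule ghomI)
      show "tlin (basis (EndG I w)) \<theta>" using I tlinI_crop[OF _ vl, of "I \<times> I"] cr by simp
    qed (simp_all add: V one mm)
    show "card (basis (EndG I w)) = card (basis (EndG ?J (\<lambda>g. \<theta> (w g))))"
      using b by (simp add: card_cartesian_product card_image)
  qed (use grepD[OF w] in simp)
  ultimately show ?thesis by blast
qed

lemma nat_grep_copy:
  assumes w: "grep I w"
  obtains J :: "nat set" and v where "grep J v" "giso (EndG I w) (EndG J v)"
proof -
  obtain b :: "_ \<Rightarrow> nat" where "inj_on b I"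
    using finite_imp_inj_to_nat_seg[OF grepD(1)[OF w]] by blast
  from grep_copy[OF w this] that show thesis by blast
qed

section \<open>Independence of values off the carrier\<close>

text \<open>The definitions only see the structure maps on vectors supported on the basis.\<close>

definition agree :: "('i, 'k, 'g) hmalg \<Rightarrow> ('i, 'k, 'g) hmalg \<Rightarrow> bool" where
  "agree A A' \<longleftrightarrow> basis A = basis A' \<and> aone A = aone A'
     \<and> (\<forall>a\<in>V A. \<forall>b\<in>V A. amul A a b = amul A' a b \<and> amul A a b \<in> V A)
     \<and> (\<forall>g\<in>carrier G. \<forall>a\<in>V A. ac A g a = ac A' g a \<and> ac A g a \<in> V A)"

lemma agree_nrm': "(\<And>a b. a \<in> V A \<Longrightarrow> b \<in> V A \<Longrightarrow> amul A a b \<in> V A)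
    \<Longrightarrow> (\<And>g a. g \<in> carrier G \<Longrightarrow> a \<in> V A \<Longrightarrow> ac A g a \<in> V A) \<Longrightarrow> agree A (nrm A)"
  unfolding agree_def by (simp add: nrm_amul nrm_ac)

lemma agree_nrm:
  assumes A: "hmodule_algebra H A" shows "agree A (nrm A)"
proof (rule agree_nrm')
  show "amul A a b \<in> V A" if "a \<in> V A" "b \<in> V A" for a b
    using hmodule_algebraD(1)[OF A] that unfolding fd_algebra_iff by blast
qed (simp add: hmodule_algebraD(2)[OF A])

lemma agreeD:
  assumes "agree A A'"
  shows "basis A' = basis A" "aone A' = aone A" "\<And>a b. a \<in> V A \<Longrightarrow> b \<in> V A \<Longrightarrow> amul A' a b = amul A a b"
    "\<And>a b. a \<in> V A \<Longrightarrow> b \<in> V A \<Longrightarrow> amul A a b \<in> V A"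
    "\<And>g a. g \<in> carrier G \<Longrightarrow> a \<in> V A \<Longrightarrow> ac A' g a = ac A g a"
    "\<And>g a. g \<in> carrier G \<Longrightarrow> a \<in> V A \<Longrightarrow> ac A g a \<in> V A"
proof -
  note D = assms[unfolded agree_def]
  note D1 = D[THEN conjunct1] and D2 = D[THEN conjunct2, THEN conjunct1]
    and D3 = D[THEN conjunct2, THEN conjunct2, THEN conjunct1] and D4 = D[THEN conjunct2, THEN conjunct2, THEN conjunct2]
  show "basis A' = basis A" "aone A' = aone A" using D1 D2 by simp_all
  show "amul A' a b = amul A a b" "amul A a b \<in> V A" if "a \<in> V A" "b \<in> V A" for a b
  proof -
    note c = D3[THEN bspec, OF that(1), THEN bspec, OF that(2)]
    show "amul A' a b = amul A a b" by (rule c[THEN conjunct1, symmetric])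
    show "amul A a b \<in> V A" by (rule c[THEN conjunct2])
  qed
  show "ac A' g a = ac A g a" "ac A g a \<in> V A" if "g \<in> carrier G" "a \<in> V A" for g a
  proof -
    note c = D4[THEN bspec, OF that(1), THEN bspec, OF that(2)]
    show "ac A' g a = ac A g a" by (rule c[THEN conjunct1, symmetric])
    show "ac A g a \<in> V A" by (rule c[THEN conjunct2])
  qed
qed

lemma linext_cong: "(\<And>i. i \<in> I \<Longrightarrow> f i = f' i) \<Longrightarrow> linext I f = linext I f'"
  by (simp add: linext_def fun_eq_iff)

text \<open>Equality, not only agreement: the braided product is defined by evaluating the factors on basis
  vectors.\<close>

lemma agree_bp:
  assumes "agree A A'" "agree B B'" shows "bp A B = bp A' B'"
proof -
  note A = agreeD[OF assms(1)] and B = agreeD[OF assms(2)]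
  have m: "linext (basis A \<times> basis B) (\<lambda>(i, j). linext (basis A \<times> basis B) (\<lambda>(i', j').
        linext (basis H \<times> basis H) (\<lambda>(p, q).
           tens (amul A (bvec i) (act A (bvec q) (bvec i'))) (amul B (act B (bvec p) (bvec j)) (bvec j'))) R) t)
     = linext (basis A \<times> basis B) (\<lambda>(i, j). linext (basis A \<times> basis B) (\<lambda>(i', j').
        linext (basis H \<times> basis H) (\<lambda>(p, q).
           tens (amul A' (bvec i) (act A' (bvec q) (bvec i'))) (amul B' (act B' (bvec p) (bvec j)) (bvec j'))) R) t)" for t
  proof (rule linext_cong, clarify)
    fix i j assume ij: "i \<in> basis A" "j \<in> basis B"
    have "linext (basis A \<times> basis B) (\<lambda>(i', j').
        linext (basis H \<times> basis H) (\<lambda>(p, q).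
           tens (amul A (bvec i) (act A (bvec q) (bvec i'))) (amul B (act B (bvec p) (bvec j)) (bvec j'))) R)
      = linext (basis A \<times> basis B) (\<lambda>(i', j').
        linext (basis H \<times> basis H) (\<lambda>(p, q).
           tens (amul A' (bvec i) (act A' (bvec q) (bvec i'))) (amul B' (act B' (bvec p) (bvec j)) (bvec j'))) R)"
    proof (rule linext_cong, clarify)
      fix i' j' assume ij': "i' \<in> basis A" "j' \<in> basis B"
      have "linext (basis H \<times> basis H) (\<lambda>(p, q).
           tens (amul A (bvec i) (act A (bvec q) (bvec i'))) (amul B (act B (bvec p) (bvec j)) (bvec j')))
         = linext (basis H \<times> basis H) (\<lambda>(p, q).
           tens (amul A' (bvec i) (act A' (bvec q) (bvec i'))) (amul B' (act B' (bvec p) (bvec j)) (bvec j')))"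
        by (rule linext_cong) (use ij ij' A B in auto)
      then show "linext (basis H \<times> basis H) (\<lambda>(p, q).
           tens (amul A (bvec i) (act A (bvec q) (bvec i'))) (amul B (act B (bvec p) (bvec j)) (bvec j'))) R
         = linext (basis H \<times> basis H) (\<lambda>(p, q).
           tens (amul A' (bvec i) (act A' (bvec q) (bvec i'))) (amul B' (act B' (bvec p) (bvec j)) (bvec j'))) R" by simp
    qed
    then show "linext (basis A \<times> basis B) (\<lambda>(i', j').
        linext (basis H \<times> basis H) (\<lambda>(p, q).
           tens (amul A (bvec i) (act A (bvec q) (bvec i'))) (amul B (act B (bvec p) (bvec j)) (bvec j'))) R) t
      = linext (basis A \<times> basis B) (\<lambda>(i', j').
        linext (basis H \<times> basis H) (\<lambda>(p, q).
           tens (amul A' (bvec i) (act A' (bvec q) (bvec i'))) (amul B' (act B' (bvec p) (bvec j)) (bvec j'))) R) t" by simp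
  qed
  have a: "linext (basis A \<times> basis B) (\<lambda>(i, j). linext (basis H \<times> basis H) (\<lambda>(p, q).
                tens (act A (bvec p) (bvec i)) (act B (bvec q) (bvec j))) (comult H h))
     = linext (basis A \<times> basis B) (\<lambda>(i, j). linext (basis H \<times> basis H) (\<lambda>(p, q).
                tens (act A' (bvec p) (bvec i)) (act B' (bvec q) (bvec j))) (comult H h))" for h
  proof (rule linext_cong, clarify)
    fix i j assume ij: "i \<in> basis A" "j \<in> basis B"
    have "linext (basis H \<times> basis H) (\<lambda>(p, q). tens (act A (bvec p) (bvec i)) (act B (bvec q) (bvec j)))
      = linext (basis H \<times> basis H) (\<lambda>(p, q). tens (act A' (bvec p) (bvec i)) (act B' (bvec q) (bvec j)))"
      by (rule linext_cong) (use ij A B in auto)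
    then show "linext (basis H \<times> basis H) (\<lambda>(p, q). tens (act A (bvec p) (bvec i)) (act B (bvec q) (bvec j))) (comult H h)
      = linext (basis H \<times> basis H) (\<lambda>(p, q). tens (act A' (bvec p) (bvec i)) (act B' (bvec q) (bvec j))) (comult H h)" by simp
  qed
  show ?thesis unfolding braided_prod_def A(1,2) B(1,2) m a ..
qed

lemma agree_hop:
  assumes "agree A A'" shows "agree (hop A) (hop A')"
proof -
  note A = agreeD[OF assms]
  have "amul (hop A') a b = amul (hop A) a b" if "a \<in> V A" "b \<in> V A" for a b
    using that A by (simp add: h_op_def linext_R)
  moreover have "amul (hop A) a b \<in> V A" if "a \<in> V A" "b \<in> V A" for a b
    using that A by (simp add: h_op_def linext_R)
  ultimately show ?thesis using A unfolding agree_def by simp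
qed

lemma agree_F:
  assumes "agree A A'" shows "F1 H R A = F1 H R A'" "F2 H R A = F2 H R A'"
proof -
  note A = agreeD[OF assms]
  show "F1 H R A = F1 H R A'"
    unfolding F1_def A(1) basis_H linext_R
    by (intro ext fun_cong[OF mat_of_cong] fun_cong[OF linext_cong]) (use A in auto)
  show "F2 H R A = F2 H R A'"
    unfolding F2_def A(1) basis_H linext_R
    by (intro ext fun_cong[OF mat_of_cong] fun_cong[OF linext_cong]) (use A in auto)
qed

lemma azumaya_nrm:
  assumes "azumaya H R A" shows "galg (nrm A)" "azumaya H R (nrm A)"
proof -
  have A: "hmodule_algebra H A" using assms by (simp add: azumaya_def)
  note ag = agree_nrm[OF A]
  show g: "galg (nrm A)" by (rule galg_nrm[OF A])
  have "bp A (hop A) = bp (nrm A) (hop (nrm A))" "bp (hop A) A = bp (hop (nrm A)) (nrm A)"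
    by (intro agree_bp ag agree_hop)+
  then show "azumaya H R (nrm A)"
    using assms galg_hmodule_algebra[OF g] unfolding azumaya_def agree_F[OF ag] by simp
qed

text \<open>The structure maps of a \<open>galg\<close> already ignore coordinates off the basis.\<close>

lemma nrm_galg:
  assumes A: "galg A" shows "nrm A = A"
proof -
  have "act A (crop (carrier G) h) (crop (basis A) v) = act A h v" for h v
  proof -
    have "act A (crop (carrier G) h) (crop (basis A) v)
        = (\<Sum>g\<in>carrier G. vscale (crop (carrier G) h g) (ac A g (crop (basis A) v)))" by (rule galgD(9)[OF A])
    also have "\<dots> = (\<Sum>g\<in>carrier G. vscale (h g) (ac A g v))"
      by (rule sum.cong) (simp_all add: galg_simps[OF A] crop_def[of "carrier G"])
    also have "\<dots> = act A h v" by (rule galgD(9)[OF A, symmetric])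
    finally show ?thesis .
  qed
  then show ?thesis by (simp add: nrm_def galg_simps[OF A])
qed

lemma agree_End:
  assumes "hmodule H M" shows "agree (End_hma H M) (nrm (End_hma H M))"
proof (rule agree_nrm')
  fix S T :: "_ \<Rightarrow> 'k" assume "S \<in> V (End_hma H M)" "T \<in> V (End_hma H M)"
  then show "amul (End_hma H M) S T \<in> V (End_hma H M)"
    by (simp add: End_hma_def mm_End_alg)
qed (simp add: End_hma_def)

section \<open>Brauer equivalence\<close>

text \<open>Brauer equivalence of \<open>G\<close>-algebras in terms of matrix representations.\<close>

definition beq :: "('i, 'k, 'g) hmalg \<Rightarrow> ('j, 'k, 'g) hmalg \<Rightarrow> bool" where
  "beq A B \<longleftrightarrow> (\<exists>(I :: nat set) w (J :: nat set) v. grep I w \<and> grep J v \<and> giso (bp A (EndG I w)) (bp B (EndG J v)))"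

lemma BM_equiv_beq:
  assumes A: "agree A A'" "galg A'" and B: "agree B B'" "galg B'"
  shows "BM_equiv H R A B \<longleftrightarrow> beq A' B'"
proof
  assume "BM_equiv H R A B"
  then obtain M N :: "('g, nat, 'k) hmod" and f where M: "hmodule H M" "mbasis M \<noteq> {}" and N: "hmodule H N" "mbasis N \<noteq> {}"
    and f: "hma_iso H (bp A (End_hma H M)) (bp B (End_hma H N)) f"
    unfolding BM_equiv_def by blast
  define w where "w g = mat_of (mbasis M) (mact M (bvec g))" for g
  define v where "v g = mat_of (mbasis N) (mact N (bvec g))" for g
  have w: "grep (mbasis M) w" "nrm (End_hma H M) = EndG (mbasis M) w"
    unfolding w_def using grep_hmodule[OF M] by auto
  have v: "grep (mbasis N) v" "nrm (End_hma H N) = EndG (mbasis N) v"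
    unfolding v_def using grep_hmodule[OF N] by auto
  have "bp A (End_hma H M) = bp A' (EndG (mbasis M) w)" "bp B (End_hma H N) = bp B' (EndG (mbasis N) v)"
    unfolding w(2)[symmetric] v(2)[symmetric] by (intro agree_bp A B agree_End M N)+
  then have "giso (bp A' (EndG (mbasis M) w)) (bp B' (EndG (mbasis N) v))"
    using f giso_iff[OF galg_bp[OF A(2) galg_EndG[OF w(1)]] galg_bp[OF B(2) galg_EndG[OF v(1)]]] by auto
  then show "beq A' B'" unfolding beq_def using w(1) v(1) by blast
next
  assume "beq A' B'"
  then obtain I J :: "nat set" and w v where w: "grep I w" and v: "grep J v"
    and i: "giso (bp A' (EndG I w)) (bp B' (EndG J v))" unfolding beq_def by blast
  have M: "hmodule H (gmod I w)" "mbasis (gmod I w) \<noteq> {}" and N: "hmodule H (gmod J v)" "mbasis (gmod J v) \<noteq> {}"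
    using hmodule_gmod w v grepD(2) by (auto simp: gmod_def)
  have "bp A (End_hma H (gmod I w)) = bp A' (EndG I w)" "bp B (End_hma H (gmod J v)) = bp B' (EndG J v)"
    unfolding nrm_End_gmod[OF w, symmetric] nrm_End_gmod[OF v, symmetric]
    by (intro agree_bp A B agree_End M N)+
  then have "\<exists>f. hma_iso H (bp A (End_hma H (gmod I w))) (bp B (End_hma H (gmod J v))) f"
    using i giso_iff[OF galg_bp[OF A(2) galg_EndG[OF w]] galg_bp[OF B(2) galg_EndG[OF v]]] by simp
  then show "BM_equiv H R A B" unfolding BM_equiv_def using M N by blast
qed

lemma agree_refl: "galg A \<Longrightarrow> agree A A"
  by (simp add: agree_def)

lemma grep_trivial: "finite I \<Longrightarrow> I \<noteq> {} \<Longrightarrow> grep I (\<lambda>_. idm I)"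
  by (simp add: grep_def mm_idm)

text \<open>The index set \<open>I \<times> J\<close> is not a set of natural numbers, so the tensor product is copied.\<close>

lemma nat_tensor:
  assumes w: "grep (I :: nat set) w" and v: "grep (J :: nat set) v"
  obtains N :: "nat set" and x where "grep N x" "giso (bp (EndG I w) (EndG J v)) (EndG N x)"
proof -
  obtain N :: "nat set" and x where "grep N x" "giso (EndG (I \<times> J) (\<lambda>g. kron (w g) (v g))) (EndG N x)"
    by (rule nat_grep_copy[OF grep_kron[OF w v]])
  then show thesis using that giso_trans[OF EndG_tensor[OF w v]] by blast
qed

text \<open>Both sides are multiplied by the trivial representation of dimension one.\<close>

lemma giso_beq:
  assumes "giso A B" "cs A" "cs B" shows "beq A B"
proof -
  have w: "grep {0::nat} (\<lambda>_. idm {0})" by (rule grep_trivial) simp_all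
  have "giso (bp A (EndG {0::nat} (\<lambda>_. idm {0}))) (bp B (EndG {0::nat} (\<lambda>_. idm {0})))"
    using assms w by (intro bp_cong cs_EndG giso_refl galg_EndG)
  then show ?thesis unfolding beq_def using w by blast
qed

lemma beq_refl: "cs A \<Longrightarrow> beq A A"
  by (simp add: giso_beq giso_refl)

lemma beq_sym:
  assumes "beq A B" "cs A" "cs B" shows "beq B A"
proof -
  from assms(1) obtain I J :: "nat set" and w v where wv: "grep I w" "grep J v"
    and i: "giso (bp A (EndG I w)) (bp B (EndG J v))" unfolding beq_def by blast
  have "giso (bp B (EndG J v)) (bp A (EndG I w))"
    by (rule giso_sym[OF i]) (use wv assms in \<open>auto intro!: galg_bp galg_EndG\<close>)
  then show ?thesis unfolding beq_def using wv by blast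
qed

lemma bp_EndG_swap:
  assumes A: "cs A" and w: "grep I w" and v: "grep J v"
  shows "giso (bp (bp A (EndG I w)) (EndG J v)) (bp (bp A (EndG J v)) (EndG I w))"
proof -
  note E = cs_EndG[OF w] and F = cs_EndG[OF v]
  have g: "galg (bp (bp A (EndG I w)) (EndG J v))" "galg (bp A (bp (EndG I w) (EndG J v)))"
    using A E F by (auto intro!: cs_galg cs_bp)
  have "giso (bp (bp A (EndG I w)) (EndG J v)) (bp A (bp (EndG I w) (EndG J v)))"
    by (rule giso_sym[OF bp_assoc[OF A E F] g(2,1)])
  moreover have "giso (bp A (bp (EndG I w) (EndG J v))) (bp A (bp (EndG J v) (EndG I w)))"
    by (intro bp_cong A cs_bp E F giso_refl cs_galg bp_comm)
  moreover have "giso (bp A (bp (EndG J v) (EndG I w))) (bp (bp A (EndG J v)) (EndG I w))"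
    by (rule bp_assoc[OF A F E])
  ultimately show ?thesis by (rule giso_trans[OF giso_trans])
qed

lemma bp_EndG_merge:
  assumes A: "cs A" and w: "grep I w" and v: "grep J v" and x: "grep N x"
    and i: "giso (bp (EndG I w) (EndG J v)) (EndG N x)"
  shows "giso (bp (bp A (EndG I w)) (EndG J v)) (bp A (EndG N x))"
proof -
  note E = cs_EndG[OF w] and F = cs_EndG[OF v]
  have g: "galg (bp (bp A (EndG I w)) (EndG J v))" "galg (bp A (bp (EndG I w) (EndG J v)))"
    using A E F by (auto intro!: cs_galg cs_bp)
  have "giso (bp (bp A (EndG I w)) (EndG J v)) (bp A (bp (EndG I w) (EndG J v)))"
    by (rule giso_sym[OF bp_assoc[OF A E F] g(2,1)])
  moreover have "giso (bp A (bp (EndG I w) (EndG J v))) (bp A (EndG N x))"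
    by (intro bp_cong A cs_bp E F giso_refl cs_galg i cs_EndG[OF x])
  ultimately show ?thesis by (rule giso_trans)
qed

text \<open>If \<open>A \<sharp> End(I) \<cong> B \<sharp> End(J)\<close> and \<open>B \<sharp> End(I') \<cong> C \<sharp> End(J')\<close>, multiply the first by \<open>End(I')\<close>
  and the second by \<open>End(J)\<close>. Since endomorphism algebras may be permuted and merged, the middle
  terms become isomorphic.\<close>

lemma beq_trans:
  assumes AB: "beq A B" and BC: "beq B C" and A: "cs A" and B: "cs B" and C: "cs C"
  shows "beq A C"
proof -
  from AB obtain I1 I2 :: "nat set" and w1 w2 where 1: "grep I1 w1" "grep I2 w2" "giso (bp A (EndG I1 w1)) (bp B (EndG I2 w2))"
    unfolding beq_def by blast
  from BC obtain I3 I4 :: "nat set" and w3 w4 where 2: "grep I3 w3" "grep I4 w4" "giso (bp B (EndG I3 w3)) (bp C (EndG I4 w4))"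
    unfolding beq_def by blast
  obtain N :: "nat set" and x where N: "grep N x" "giso (bp (EndG I1 w1) (EndG I3 w3)) (EndG N x)"
    by (rule nat_tensor[OF 1(1) 2(1)])
  obtain L :: "nat set" and y where L: "grep L y" "giso (bp (EndG I4 w4) (EndG I2 w2)) (EndG L y)"
    by (rule nat_tensor[OF 2(2) 1(2)])
  note E = cs_EndG[OF 1(1)] cs_EndG[OF 1(2)] cs_EndG[OF 2(1)] cs_EndG[OF 2(2)]
  have 3: "giso (bp A (EndG N x)) (bp (bp A (EndG I1 w1)) (EndG I3 w3))"
    by (rule giso_sym[OF bp_EndG_merge[OF A 1(1) 2(1) N]]) (auto intro!: cs_galg cs_bp A E cs_EndG N)
  have 4: "giso (bp (bp A (EndG I1 w1)) (EndG I3 w3)) (bp (bp B (EndG I2 w2)) (EndG I3 w3))"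
    by (intro bp_cong cs_bp A B E giso_refl cs_galg 1(3))
  have 5: "giso (bp (bp B (EndG I2 w2)) (EndG I3 w3)) (bp (bp B (EndG I3 w3)) (EndG I2 w2))"
    by (rule bp_EndG_swap[OF B 1(2) 2(1)])
  have 6: "giso (bp (bp B (EndG I3 w3)) (EndG I2 w2)) (bp (bp C (EndG I4 w4)) (EndG I2 w2))"
    by (intro bp_cong cs_bp B C E giso_refl cs_galg 2(3))
  have 7: "giso (bp (bp C (EndG I4 w4)) (EndG I2 w2)) (bp C (EndG L y))"
    by (rule bp_EndG_merge[OF C 2(2) 1(2) L])
  have "giso (bp A (EndG N x)) (bp C (EndG L y))"
    by (rule giso_trans[OF giso_trans[OF giso_trans[OF giso_trans[OF 3 4] 5] 6] 7])
  then show ?thesis unfolding beq_def using N(1) L(1) by blast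
qed

lemma beq_bp_left:
  assumes AA: "beq A A'" and A: "cs A" and A': "cs A'" and B: "cs B"
  shows "beq (bp A B) (bp A' B)"
proof -
  from AA obtain I J :: "nat set" and w v where w: "grep I w" and v: "grep J v"
    and i: "giso (bp A (EndG I w)) (bp A' (EndG J v))" unfolding beq_def by blast
  note E = cs_EndG[OF w] cs_EndG[OF v]
  have swap: "giso (bp (bp C B) (EndG I w)) (bp (bp C (EndG I w)) B)" if C: "cs C" and w: "grep I w"
    for C :: "('z, 'k, 'g) hmalg" and I :: "nat set" and w
  proof -
    note E = cs_EndG[OF w]
    have "giso (bp (bp C B) (EndG I w)) (bp C (bp B (EndG I w)))"
      by (rule giso_sym[OF bp_assoc[OF C B E]]) (auto intro!: cs_galg cs_bp C B E)
    moreover have "giso (bp C (bp B (EndG I w))) (bp C (bp (EndG I w) B))"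
      by (intro bp_cong C cs_bp B E giso_refl cs_galg bp_comm)
    moreover have "giso (bp C (bp (EndG I w) B)) (bp (bp C (EndG I w)) B)"
      by (rule bp_assoc[OF C E B])
    ultimately show ?thesis by (rule giso_trans[OF giso_trans])
  qed
  have "giso (bp (bp A B) (EndG I w)) (bp (bp A (EndG I w)) B)" by (rule swap[OF A w])
  moreover have "giso (bp (bp A (EndG I w)) B) (bp (bp A' (EndG J v)) B)"
    by (intro bp_cong cs_bp A A' B E giso_refl cs_galg i)
  moreover have "giso (bp (bp A' (EndG J v)) B) (bp (bp A' B) (EndG J v))"
    by (rule giso_sym[OF swap[OF A' v]]) (auto intro!: cs_galg cs_bp A' B E)
  ultimately have "giso (bp (bp A B) (EndG I w)) (bp (bp A' B) (EndG J v))" by (rule giso_trans[OF giso_trans])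
  then show ?thesis unfolding beq_def using w v by blast
qed

lemma beq_comm: "cs A \<Longrightarrow> cs B \<Longrightarrow> beq (bp A B) (bp B A)"
  by (simp add: giso_beq bp_comm cs_bp)

lemma beq_bp:
  assumes AA: "beq A A'" and BB: "beq B B'" and A: "cs A" and A': "cs A'" and B: "cs B" and B': "cs B'"
  shows "beq (bp A B) (bp A' B')"
proof -
  note c = cs_bp[OF A B] cs_bp[OF A' B] cs_bp[OF B A'] cs_bp[OF B' A'] cs_bp[OF A' B']
  have "beq (bp A B) (bp B A')"
    by (rule beq_trans[OF beq_bp_left[OF AA A A' B] beq_comm[OF A' B] c(1,2,3)])
  moreover have "beq (bp B A') (bp A' B')"
    by (rule beq_trans[OF beq_bp_left[OF BB B B' A'] beq_comm[OF B' A'] c(3,4,5)])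
  ultimately show ?thesis using beq_trans c by blast
qed

lemma beq_EndG:
  assumes w: "grep I w" shows "beq (EndG I w) (base_hma H)"
proof -
  obtain J :: "nat set" and v where v: "grep J v" "giso (EndG I w) (EndG J v)" using nat_grep_copy[OF w] by blast
  have o: "grep {0::nat} (\<lambda>_. idm {0})" by (rule grep_trivial) simp_all
  have 1: "giso (EndG {0::nat} (\<lambda>_. idm {0})) (base_hma H)"
  proof (rule giso_sym[OF ghom_giso[OF cs_base galg_EndG[OF o]]])
    have [simp]: "idm {0::nat} \<in> vspace {(0, 0)}"
      using mat_of_vspace[of "{0::nat}" "\<lambda>v. v"] by (simp del: mat_of_vspace)
    show "ghom (base_hma H) (EndG {0::nat} (\<lambda>_. idm {0})) (\<lambda>c. vscale (c ()) (idm {0}))"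
      by (rule ghomI) (auto simp: mm_scale mm_idm counit_bvec vec_apply intro!: tlin_unit simp: vlin_def fv.scale_left_distrib)
  qed (simp_all add: galg_base galg_EndG[OF o])
  note E = cs_EndG[OF w] cs_EndG[OF v(1)] cs_EndG[OF o]
  have "giso (bp (EndG I w) (EndG {0::nat} (\<lambda>_. idm {0}))) (bp (EndG J v) (base_hma H))"
    by (intro bp_cong E cs_base v 1)
  moreover have "giso (bp (EndG J v) (base_hma H)) (bp (base_hma H) (EndG J v))"
    by (intro bp_comm E cs_base)
  ultimately have "giso (bp (EndG I w) (EndG {0::nat} (\<lambda>_. idm {0}))) (bp (base_hma H) (EndG J v))"
    by (rule giso_trans)
  then show ?thesis unfolding beq_def using o v(1) by blast
qed

end

section \<open>The Brauer group of the group algebra\<close>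

locale nonsplit_involution = central_involution G u K
  for G :: "('g, 'm) monoid_scheme" (structure) and u :: 'g and K :: "'k::field itself" +
  assumes ndf: "\<not> direct_factor G (generate G {u})"
begin

abbreviation azu :: "(nat, 'k, 'g) hmalg set" where
  "azu \<equiv> {A. azumaya H R A}"

definition cls :: "(nat, 'k, 'g) hmalg \<Rightarrow> (nat, 'k, 'g) hmalg set" where
  "cls A = {C. azumaya H R C \<and> beq (nrm A) (nrm C)}"

lemma azu_nrm:
  assumes "azumaya H R A" shows "cs (nrm A)" "agree A (nrm A)" "azumaya H R (nrm A)"
  using azumaya_cs[OF azumaya_nrm[OF assms] ndf] azumaya_nrm(2)[OF assms] agree_nrm assms
  by (auto simp: azumaya_def)

lemma BM_equiv_azu: "azumaya H R A \<Longrightarrow> azumaya H R B \<Longrightarrow> BM_equiv H R A B \<longleftrightarrow> beq (nrm A) (nrm B)"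
  by (intro BM_equiv_beq azu_nrm cs_galg)

lemma cls_eq:
  assumes A: "azumaya H R A" and B: "azumaya H R B"
  shows "cls A = cls B \<longleftrightarrow> beq (nrm A) (nrm B)"
proof
  assume "cls A = cls B"
  moreover have "B \<in> cls B" using B by (simp add: cls_def beq_refl azu_nrm(1))
  ultimately show "beq (nrm A) (nrm B)" by (auto simp: cls_def)
next
  assume b: "beq (nrm A) (nrm B)"
  have b': "beq (nrm B) (nrm A)" using beq_sym[OF b] azu_nrm(1) A B by blast
  show "cls A = cls B"
    unfolding cls_def using beq_trans[OF b] beq_trans[OF b'] azu_nrm(1) A B by blast
qed

lemma cls_self: "azumaya H R A \<Longrightarrow> A \<in> cls A"
  by (simp add: cls_def beq_refl azu_nrm(1))

lemma BM_carrier: "carrier (BM TYPE('k) H R) = {cls A | A. azumaya H R A}"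
proof -
  have "{(A, B). A \<in> azu \<and> B \<in> azu \<and> BM_equiv H R A B} `` {A} = cls A" if "A \<in> azu" for A
    using that BM_equiv_azu[of A] by (auto simp: cls_def)
  then show ?thesis by (auto simp: BM_def Let_def quotient_def)
qed

lemma cls_cs: "P \<in> carrier (BM TYPE('k) H R) \<Longrightarrow> \<exists>A. cs A \<and> P = cls A"
proof -
  assume "P \<in> carrier (BM TYPE('k) H R)"
  then obtain A where A: "azumaya H R A" "P = cls A" unfolding BM_carrier by blast
  have "nrm (nrm A) = nrm A" by (rule nrm_galg[OF cs_galg[OF azu_nrm(1)[OF A(1)]]])
  then have "P = cls (nrm A)" using A(2) by (simp add: cls_def)
  then show ?thesis using azu_nrm(1)[OF A(1)] by blast
qed

lemma cls_carrier: "cs A \<Longrightarrow> cls A \<in> carrier (BM TYPE('k) H R)"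
  unfolding BM_carrier using cs_azumaya by blast

lemma cls_eq_cs: "cs A \<Longrightarrow> cs B \<Longrightarrow> cls A = cls B \<longleftrightarrow> beq A B"
  by (simp add: cls_eq cs_azumaya nrm_galg)

lemma cs_nat:
  assumes "cs A" obtains B :: "(nat, 'k, 'g) hmalg" where "cs B" "beq A B" "giso A B"
proof -
  obtain B :: "(nat, 'k, 'g) hmalg" where B: "galg B" "giso A B" using nat_copy[OF cs_galg[OF assms]] by blast
  have "cs B" by (rule giso_cs[OF B(2) assms B(1)])
  then show thesis using that B(2) giso_beq assms by blast
qed

text \<open>The product of two classes is defined elementwise; compatibility of \<open>\<sharp>\<close> with the equivalence shows
  that it is a single class.\<close>

lemma BM_mult:
  assumes A: "cs A" and B: "cs B" and D: "cs D" and DAB: "beq D (bp A B)"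
  shows "cls A \<otimes>\<^bsub>BM TYPE('k) H R\<^esub> cls B = cls D"
proof -
  have nA: "nrm A = A" "nrm B = B" "nrm D = D" using A B D by (simp_all add: nrm_galg)
  have AB: "cs (bp A B)" by (rule cs_bp[OF A B])
  have "(\<exists>A'\<in>cls A. \<exists>B'\<in>cls B. BM_equiv H R C (bp A' B')) \<longleftrightarrow> beq D (nrm C)" if C: "azumaya H R C" for C
  proof
    note nC = azu_nrm[OF C]
    assume "\<exists>A'\<in>cls A. \<exists>B'\<in>cls B. BM_equiv H R C (bp A' B')"
    then obtain A' B' :: "(nat, 'k, 'g) hmalg" where A': "azumaya H R A'" "beq A (nrm A')" and B': "azumaya H R B'" "beq B (nrm B')"
      and C': "BM_equiv H R C (bp A' B')" by (auto simp: cls_def nA)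
    have AB': "cs (bp (nrm A') (nrm B'))" by (intro cs_bp azu_nrm A' B')
    have "bp A' B' = bp (nrm A') (nrm B')" by (intro agree_bp azu_nrm A' B')
    then have "BM_equiv H R C (bp (nrm A') (nrm B'))" using C' by simp
    then have e: "beq (nrm C) (bp (nrm A') (nrm B'))"
      using BM_equiv_beq[OF nC(2) cs_galg[OF nC(1)] agree_refl cs_galg] AB' cs_galg by blast
    have "beq (bp A B) (bp (nrm A') (nrm B'))" by (intro beq_bp A B azu_nrm A' B')
    then have "beq D (bp (nrm A') (nrm B'))" using beq_trans[OF DAB] D AB AB' by blast
    then show "beq D (nrm C)" using beq_trans[OF _ beq_sym[OF e nC(1) AB']] D AB' nC(1) by blast
  next
    note nC = azu_nrm[OF C]
    assume "beq D (nrm C)"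
    then have "beq (nrm C) (bp A B)" using beq_sym beq_trans DAB D AB nC(1) by blast
    then have "BM_equiv H R C (bp A B)"
      using BM_equiv_beq[OF nC(2) cs_galg[OF nC(1)] agree_refl cs_galg] AB cs_galg by blast
    then show "\<exists>A'\<in>cls A. \<exists>B'\<in>cls B. BM_equiv H R C (bp A' B')"
      using cls_self cs_azumaya A B by blast
  qed
  then show ?thesis by (auto simp: BM_def Let_def cls_def nA)
qed

lemma BM_one:
  assumes D: "cs D" "beq D (base_hma H)" shows "\<one>\<^bsub>BM TYPE('k) H R\<^esub> = cls D"
proof -
  have "BM_equiv H R C (base_hma H) \<longleftrightarrow> beq D (nrm C)" if C: "azumaya H R C" for C
  proof -
    note nC = azu_nrm[OF C]
    have "BM_equiv H R C (base_hma H) \<longleftrightarrow> beq (nrm C) (base_hma H)"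
      by (rule BM_equiv_beq) (auto simp: nC galg_base agree_refl)
    also have "\<dots> \<longleftrightarrow> beq D (nrm C)"
    proof
      assume "beq (nrm C) (base_hma H)"
      from beq_trans[OF D(2) beq_sym[OF this nC(1) cs_base] D(1) cs_base nC(1)] show "beq D (nrm C)" .
    next
      assume "beq D (nrm C)"
      from beq_trans[OF beq_sym[OF this D(1) nC(1)] D(2) nC(1) D(1) cs_base] show "beq (nrm C) (base_hma H)" .
    qed
    finally show ?thesis .
  qed
  then show ?thesis using D(1) by (auto simp: BM_def Let_def cls_def nrm_galg)
qed

lemma BM_inverse:
  assumes A: "cs A" shows "beq (bp (hop A) A) (base_hma H)"
proof -
  note h = cs_hop[OF A]
  note r = grep_regrep[OF cs_galg[OF A] cs_nonempty[OF A]]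
  have "giso (bp (hop A) A) (EndG (basis A) (regrep A))"
    by (rule giso_trans[OF bp_comm[OF h A] bp_hop[OF A]])
  then have "beq (bp (hop A) A) (EndG (basis A) (regrep A))"
    by (intro giso_beq cs_bp h A cs_EndG r)
  then show ?thesis using beq_trans[OF _ beq_EndG[OF r]] cs_bp[OF h A] cs_EndG[OF r] cs_base by blast
qed

lemma BM_l_inv:
  assumes A: "cs A" shows "cls (hop A) \<otimes>\<^bsub>BM TYPE('k) H R\<^esub> cls A = \<one>\<^bsub>BM TYPE('k) H R\<^esub>"
proof -
  obtain E :: "(nat, 'k, 'g) hmalg" where E: "cs E" "beq (base_hma H) E" using cs_nat[OF cs_base] by blast
  have Eb: "beq E (base_hma H)" using beq_sym[OF E(2) cs_base E(1)] .
  note h = cs_hop[OF A]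
  have "beq E (bp (hop A) A)"
    by (rule beq_trans[OF Eb beq_sym[OF BM_inverse[OF A] cs_bp[OF h A] cs_base] E(1) cs_base cs_bp[OF h A]])
  then show ?thesis unfolding BM_one[OF E(1) Eb] by (rule BM_mult[OF h A E(1)])
qed

theorem BM_group: "group (BM TYPE('k) H R)"
proof (rule groupI)
  let ?BM = "BM TYPE('k) H R"
  obtain E :: "(nat, 'k, 'g) hmalg" where E: "cs E" "beq (base_hma H) E" "giso (base_hma H) E" using cs_nat[OF cs_base] by blast
  have Eb: "beq E (base_hma H)" using beq_sym[OF E(2) cs_base E(1)] .
  note one = BM_one[OF E(1) Eb]
  have prod: "\<exists>D :: (nat, 'k, 'g) hmalg. cs D \<and> beq D (bp A B)" if "cs A" "cs B" for A B :: "(nat, 'k, 'g) hmalg"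
    using cs_nat[OF cs_bp[OF that]] beq_sym cs_bp[OF that] by metis
  show "\<one>\<^bsub>?BM\<^esub> \<in> carrier ?BM" unfolding one by (rule cls_carrier[OF E(1)])
  fix P assume "P \<in> carrier ?BM"
  then obtain A where A: "cs A" "P = cls A" using cls_cs by blast
  have "beq A (bp E A)"
  proof -
    have "giso (bp (base_hma H) A) A" by (rule bp_base[OF A(1)])
    then have "beq (bp (base_hma H) A) A" by (intro giso_beq cs_bp cs_base A)
    moreover have "beq (bp E A) (bp (base_hma H) A)" by (rule beq_bp_left[OF Eb E(1) cs_base A(1)])
    ultimately have "beq (bp E A) A"
      using beq_trans[OF _ _ cs_bp[OF E(1) A(1)] cs_bp[OF cs_base A(1)] A(1)] by blast
    then show ?thesis by (rule beq_sym[OF _ cs_bp[OF E(1) A(1)] A(1)])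
  qed
  then show "\<one>\<^bsub>?BM\<^esub> \<otimes>\<^bsub>?BM\<^esub> P = P" unfolding one A(2) by (rule BM_mult[OF E(1) A(1) A(1)])
  have "cls (hop A) \<otimes>\<^bsub>?BM\<^esub> P = \<one>\<^bsub>?BM\<^esub>" unfolding A(2) by (rule BM_l_inv[OF A(1)])
  then show "\<exists>Q\<in>carrier ?BM. Q \<otimes>\<^bsub>?BM\<^esub> P = \<one>\<^bsub>?BM\<^esub>" using cls_carrier[OF cs_hop[OF A(1)]] by blast
  fix Q assume "Q \<in> carrier ?BM"
  then obtain B where B: "cs B" "Q = cls B" using cls_cs by blast
  obtain AB :: "(nat, 'k, 'g) hmalg" where AB: "cs AB" "beq AB (bp A B)" using prod[OF A(1) B(1)] by blast
  note PQ = BM_mult[OF A(1) B(1) AB]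
  show "P \<otimes>\<^bsub>?BM\<^esub> Q \<in> carrier ?BM" unfolding A(2) B(2) PQ by (rule cls_carrier[OF AB(1)])
  fix S assume "S \<in> carrier ?BM"
  then obtain C where C: "cs C" "S = cls C" using cls_cs by blast
  obtain BC :: "(nat, 'k, 'g) hmalg" where BC: "cs BC" "beq BC (bp B C)" using prod[OF B(1) C(1)] by blast
  note QS = BM_mult[OF B(1) C(1) BC]
  obtain D :: "(nat, 'k, 'g) hmalg" where D: "cs D" "beq D (bp AB C)" using prod[OF AB(1) C(1)] by blast
  have c: "cs (bp AB C)" "cs (bp (bp A B) C)" "cs (bp A (bp B C))" "cs (bp A BC)"
    by (intro cs_bp AB A B C BC)+
  have 1: "beq D (bp (bp A B) C)"
    by (rule beq_trans[OF D(2) beq_bp_left[OF AB(2) AB(1) cs_bp[OF A(1) B(1)] C(1)] D(1) c(1,2)])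
  have 2: "beq (bp A (bp B C)) (bp (bp A B) C)"
    by (rule giso_beq[OF bp_assoc[OF A(1) B(1) C(1)] c(3,2)])
  have 3: "beq (bp A BC) (bp A (bp B C))"
    by (rule beq_bp[OF beq_refl[OF A(1)] BC(2) A(1) A(1) BC(1) cs_bp[OF B(1) C(1)]])
  have "beq (bp A BC) (bp (bp A B) C)" by (rule beq_trans[OF 3 2 c(4,3,2)])
  then have "beq D (bp A BC)" by (rule beq_trans[OF 1 beq_sym[OF _ c(4,2)] D(1) c(2,4)])
  then have "P \<otimes>\<^bsub>?BM\<^esub> (Q \<otimes>\<^bsub>?BM\<^esub> S) = cls D"
    unfolding A(2) B(2) C(2) QS by (rule BM_mult[OF A(1) BC(1) D(1)])
  moreover have "P \<otimes>\<^bsub>?BM\<^esub> Q \<otimes>\<^bsub>?BM\<^esub> S = cls D"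
    unfolding A(2) B(2) C(2) PQ by (rule BM_mult[OF AB(1) C(1) D])
  ultimately show "P \<otimes>\<^bsub>?BM\<^esub> Q \<otimes>\<^bsub>?BM\<^esub> S = P \<otimes>\<^bsub>?BM\<^esub> (Q \<otimes>\<^bsub>?BM\<^esub> S)" by simp
qed

end

section \<open>Trivial actions\<close>

context central_involution begin

definition trivact :: "('i, 'k, 'g) hmalg \<Rightarrow> bool" where
  "trivact A \<longleftrightarrow> (\<forall>g\<in>carrier G. \<forall>v. ac A g v = crop (basis A) v)"

definition untwist :: "('i, 'k, 'g) hmalg \<Rightarrow> ('i, 'k, 'g) hmalg" where
  "untwist A = A\<lparr>act := \<lambda>h v. \<Sum>g\<in>carrier G. vscale (h g) (crop (basis A) v)\<rparr>"

lemma untwist_simps [simp]: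
  "basis (untwist A) = basis A" "amul (untwist A) = amul A" "aone (untwist A) = aone A"
  "g \<in> carrier G \<Longrightarrow> ac (untwist A) g v = crop (basis A) v"
  by (simp_all add: untwist_def sum_bvec)

lemma trivact_untwist: "trivact (untwist A)"
  by (simp add: trivact_def)

lemma galg_untwist:
  assumes A: "galg A" shows "galg (untwist A)"
proof (rule galgI)
  show "act (untwist A) h v = (\<Sum>g\<in>carrier G. vscale (h g) (ac (untwist A) g v))" for h v
    by (simp add: untwist_def sum_bvec)
  fix g assume g: "g \<in> carrier G"
  have "ac (untwist A) g = crop (basis A)" using g by (intro ext) simp
  then show "tlin (basis (untwist A)) (ac (untwist A) g)" using tlin_crop[OF galgD(1)[OF A]] by simp
qed (use A in \<open>simp_all add: galg_simps galgD(1,3,4)\<close>)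

lemma untwist_id: "galg A \<Longrightarrow> trivact A \<Longrightarrow> untwist A = A"
proof -
  assume A: "galg A" "trivact A"
  have "act A h v = (\<Sum>g\<in>carrier G. vscale (h g) (crop (basis A) v))" for h v
    by (subst galgD(9)[OF A(1)], rule sum.cong) (use A(2) in \<open>simp_all add: trivact_def\<close>)
  then have "act A = (\<lambda>h v. \<Sum>g\<in>carrier G. vscale (h g) (crop (basis A) v))" by blast
  then show ?thesis by (simp add: untwist_def)
qed

lemma giso_untwist:
  assumes "giso A B" "galg A" "galg B" shows "giso (untwist A) (untwist B)"
proof -
  from assms(1) obtain f where f: "ghom A B f" "bij_betw f (V A) (V B)" unfolding giso_def by blast
  have "ghom (untwist A) (untwist B) f"
    using ghomD[OF f(1)] by (intro ghomI) auto
  then show ?thesis using f(2) unfolding giso_def by auto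
qed

lemma cs_untwist:
  assumes cA: "cs A" shows "cs (untwist A)"
  using assms galg_untwist[OF cs_galg[OF cA]] unfolding cs_def idl_def by simp

abbreviation EndT :: "'i set \<Rightarrow> ('i \<times> 'i, 'k, 'g) hmalg" where
  "EndT I \<equiv> EndG I (\<lambda>_. idm I)"

lemma galg_EndT: "finite I \<Longrightarrow> I \<noteq> {} \<Longrightarrow> galg (EndT I)"
  using galg_EndG[OF grep_trivial] .

lemma trivact_EndT: "finite I \<Longrightarrow> trivact (EndT I)"
  by (simp add: trivact_def mm_idm mm_crop)

lemma untwist_EndG: "finite I \<Longrightarrow> untwist (EndG I w) = EndT I"
  by (simp add: untwist_def matalg_def mm_idm mm_crop)

lemma untwist_EndT: "finite I \<Longrightarrow> untwist (EndT I) = EndT I"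
  using untwist_EndG[of I "\<lambda>_. idm I"] .

lemma trivact_bp:
  assumes A: "galg A" and B: "galg B" and t: "trivact A" "trivact B" shows "trivact (bp A B)"
  unfolding trivact_def
proof (intro ballI allI)
  fix g v assume g: "g \<in> carrier G"
  have "ac (bp A B) g = crop (basis A \<times> basis B)"
    by (rule tlin_ext_prod_fun[OF bp_tlin_ac[OF A B g]])
      (use galgD(1)[OF A] galgD(1)[OF B] t g in \<open>simp_all add: tlin_crop bp_ac[OF A B] trivact_def crop_tens\<close>)
  then show "ac (bp A B) g v = crop (basis (bp A B)) v" by simp
qed

text \<open>If \<open>u\<close> acts trivially on one factor, no sign ever occurs in the braided product, so its multiplication
  does not depend on the action on the other factor.\<close>

lemma untwist_bp:
  assumes A: "galg A" and B: "galg B" and t: "trivact A"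
  shows "untwist (bp A B) = bp A (untwist B)"
proof -
  have uB: "galg (untwist B)" by (rule galg_untwist[OF B])
  have e: "ac A q v = crop (basis A) v" if "q \<in> carrier G" for q v using t that by (simp add: trivact_def)
  have m: "amul (bp A B) = amul (bp A (untwist B))"
    unfolding braided_prod_def basis_H linext_R
    by (simp add: e galg_simps[OF A] galg_simps[OF B])
  have t2: "trivact (bp A (untwist B))" by (rule trivact_bp[OF A uB t trivact_untwist])
  have "bp A (untwist B) = untwist (bp A (untwist B))"
    by (rule untwist_id[symmetric, OF galg_bp[OF A uB] t2])
  also have "\<dots> = untwist (bp A B)"
  proof -
    have "amul (untwist (bp A (untwist B))) = amul (untwist (bp A B))" using m by simp
    moreover have "basis (untwist (bp A (untwist B))) = basis (untwist (bp A B))"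
      "aone (untwist (bp A (untwist B))) = aone (untwist (bp A B))"
      "act (untwist (bp A (untwist B))) = act (untwist (bp A B))"
      by (simp_all add: untwist_def)
    ultimately show ?thesis by (cases "untwist (bp A (untwist B))", cases "untwist (bp A B)") simp
  qed
  finally show ?thesis by simp
qed

section \<open>Plain algebras as algebras with trivial action\<close>

text \<open>A plain algebra as an algebra with trivial action, normalised as in \<open>nrm\<close>.\<close>

definition triv :: "('i, 'k) falg \<Rightarrow> ('i, 'k, 'g) hmalg" where
  "triv A = \<lparr>basis = basis A, amul = \<lambda>a b. amul A (crop (basis A) a) (crop (basis A) b), aone = aone A,
     act = \<lambda>h v. \<Sum>g\<in>carrier G. vscale (h g) (crop (basis A) v)\<rparr>"

definition forget :: "('i, 'k, 'g) hmalg \<Rightarrow> ('i, 'k) falg" where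
  "forget A = \<lparr>basis = basis A, amul = amul A, aone = aone A\<rparr>"

lemma triv_simps [simp]:
  "basis (triv A) = basis A" "aone (triv A) = aone A"
  "amul (triv A) a b = amul A (crop (basis A) a) (crop (basis A) b)"
  "g \<in> carrier G \<Longrightarrow> ac (triv A) g v = crop (basis A) v"
  by (simp_all add: triv_def sum_bvec)

lemma forget_simps [simp]:
  "basis (forget A) = basis A" "aone (forget A) = aone A" "amul (forget A) = amul A"
  by (simp_all add: forget_def)

lemma trivact_triv: "trivact (triv A)"
  by (simp add: trivact_def)

lemma galg_triv:
  assumes A: "fd_algebra A" shows "galg (triv A)"
proof -
  note D = A[unfolded fd_algebra_iff]
  have I: "finite (basis A)" using D by blast
  show ?thesis
  proof (rule galgI)
    show "tlin (basis (triv A)) (amul (triv A) a)" for a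
    proof -
      have "amul (triv A) a = (\<lambda>b. amul A (crop (basis A) a) (crop (basis A) b))" by (rule ext) simp
      then show ?thesis using tlin_cropI[OF I, of "amul A (crop (basis A) a)"] D by simp
    qed
    show "tlin (basis (triv A)) (\<lambda>a. amul (triv A) a b)" for b
      using tlin_cropI[OF I, of "\<lambda>a. amul A a (crop (basis A) b)"] D by simp
    show "act (triv A) h v = (\<Sum>g\<in>carrier G. vscale (h g) (ac (triv A) g v))" for h v
      by (simp add: triv_def sum_bvec)
    fix g assume g: "g \<in> carrier G"
    have "ac (triv A) g = crop (basis A)" using g by (intro ext) simp
    then show "tlin (basis (triv A)) (ac (triv A) g)" using tlin_crop[OF I] by simp
  qed (use D in simp_all)
qed

lemma triv_forget:
  assumes A: "galg A" "trivact A" shows "triv (forget A) = A"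
proof -
  have "triv (forget A) = untwist A"
    by (simp add: triv_def forget_def untwist_def galg_simps[OF A(1)])
  then show ?thesis using untwist_id[OF A] by simp
qed

lemma fd_forget: "galg A \<Longrightarrow> fd_algebra (forget A)"
  using galg_fd[of A] by (simp add: fd_algebra_iff)

lemma cs_triv:
  assumes A: "central_simple A" shows "cs (triv A)"
proof -
  have fd: "fd_algebra A" using A by (simp add: central_simple_def)
  have i: "idl A J" if J: "idl (triv A) J" for J
  proof -
    have JV: "J \<subseteq> V A" using J by (simp add: idl_def)
    have "amul (triv A) a x = amul A a x" "amul (triv A) x a = amul A x a" if "x \<in> J" "a \<in> V A" for a x
      using JV that by auto
    then show ?thesis using J unfolding idl_def by simp
  qed
  have z: "\<exists>c. z = vscale c (aone A)" if "z \<in> V A" "\<forall>v\<in>V A. amul A z v = amul A v z" for z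
    using A that unfolding central_simple_def by blast
  show ?thesis
    unfolding cs_def
  proof (intro conjI galg_triv[OF fd] ballI impI allI)
    show "basis (triv A) \<noteq> {}" using A by (simp add: central_simple_def)
    show "\<exists>c. x = vscale c (aone (triv A))" if "x \<in> V (triv A)" "\<forall>v\<in>V (triv A). amul (triv A) x v = amul (triv A) v x" for x
      using z[of x] that by simp
    show "J = {0} \<or> J = V (triv A)" if "idl (triv A) J" for J
      using i[OF that] A unfolding central_simple_def ideal_iff_idl[OF fd] by (simp add: zero_fun_eq)
  qed
qed

lemma central_simple_forget: "cs A \<Longrightarrow> central_simple (forget A)"
proof -
  assume A: "cs A"
  have r: "ring_of (forget A) = ring_of A" by (simp add: ring_of_def)
  have "central_simple (forget A) = central_simple A"
    unfolding central_simple_def fd_algebra_def r forget_simps ..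
  then show ?thesis using cs_iff[OF cs_galg[OF A]] A by simp
qed

text \<open>With a trivially acting factor the braided product is the ordinary tensor product.\<close>

lemma tensor_alg_forget:
  assumes A: "galg (triv A)" and B: "galg B" and AB: "basis B = basis B'" "aone B = aone B'"
    "\<And>a b. a \<in> V B \<Longrightarrow> b \<in> V B \<Longrightarrow> amul B a b = amul B' a b"
  shows "tensor_alg A B' = forget (bp (triv A) B)"
proof -
  have r: "vscale (1 / 2) (tens (amul (triv A) (bvec i) (ac (triv A) \<one> (bvec i'))) (amul B (ac B \<one> (bvec j)) (bvec j'))
       + tens (amul (triv A) (bvec i) (ac (triv A) u (bvec i'))) (amul B (ac B \<one> (bvec j)) (bvec j'))
       + tens (amul (triv A) (bvec i) (ac (triv A) \<one> (bvec i'))) (amul B (ac B u (bvec j)) (bvec j'))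
       - tens (amul (triv A) (bvec i) (ac (triv A) u (bvec i'))) (amul B (ac B u (bvec j)) (bvec j')))
     = tens (amul A (bvec i) (bvec i')) (amul B' (bvec j) (bvec j'))"
    if "i \<in> basis A" "i' \<in> basis A" "j \<in> basis B" "j' \<in> basis B" for i i' j j'
    using that by (simp add: galg_simps[OF B] AB(3)) ((simp add: fun_eq_iff lincomb)?)
  have "amul (tensor_alg A B') s t = amul (bp (triv A) B) s t" for s t
  proof -
    have 1: "linext (basis A \<times> basis B) (\<lambda>(i', j'). tens (amul A (bvec i) (bvec i')) (amul B' (bvec j) (bvec j')))
      = linext (basis (triv A) \<times> basis B) (\<lambda>(i', j'). linext (basis H \<times> basis H) (\<lambda>(p, q).
          tens (amul (triv A) (bvec i) (act (triv A) (bvec q) (bvec i'))) (amul B (act B (bvec p) (bvec j)) (bvec j'))) R)"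
      if "i \<in> basis A" "j \<in> basis B" for i j
      unfolding basis_H linext_R triv_simps(1)
      by (rule linext_cong) (use that in \<open>auto simp: r[symmetric]\<close>)
    show ?thesis
      unfolding braided_prod_def tensor_alg_def falg.simps AB(1)[symmetric]
      by (simp only: falg.simps hmalg.simps triv_simps(1), rule fun_cong[OF linext_cong]) (use 1 in \<open>auto simp: fun_eq_iff\<close>)
  qed
  then show ?thesis by (simp add: tensor_alg_def forget_def AB fun_eq_iff)
qed

lemma tensor_alg_triv:
  assumes "fd_algebra A" "fd_algebra B" shows "tensor_alg A B = forget (bp (triv A) (triv B))"
  by (rule tensor_alg_forget) (use assms in \<open>simp_all add: galg_triv\<close>)

lemma tensor_alg_End:
  assumes "fd_algebra A" "finite I" "I \<noteq> {}" shows "tensor_alg A (End_alg I) = forget (bp (triv A) (EndT I))"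
  by (rule tensor_alg_forget)
    (use assms in \<open>simp_all add: galg_triv mm_End_alg galg_EndT\<close>)

lemma giso_trivact:
  assumes A: "galg A" "trivact A" and B: "galg B" "trivact B"
  shows "giso A B \<longleftrightarrow> (\<exists>f. alg_iso (forget A) (forget B) f)"
proof -
  have r: "ring_of (forget A) = ring_of A" "ring_of (forget B) = ring_of B" by (simp_all add: ring_of_def)
  have ai: "alg_iso (forget A) (forget B) f \<longleftrightarrow> alg_iso A B f" for f
    by (simp add: alg_iso_def r)
  have t: "act C h v = vscale (\<Sum>g\<in>carrier G. h g) v" if "galg C" "trivact C" "v \<in> V C" for C :: "('z, 'k, 'g) hmalg" and h v
    by (subst galgD(9)[OF that(1)]) (use that in \<open>simp add: trivact_def fv.scale_sum_left\<close>)
  have "hma_iso H A B f" if "alg_iso A B f" for f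
  proof -
    have "bij_betw f (V A) (V B)" using that by (simp add: alg_iso_def ring_iso_def)
    then have "f v \<in> V B" if "v \<in> V A" for v using that by (rule bij_betw_apply)
    then show ?thesis using that t[OF A] t[OF B] unfolding hma_iso_def by (simp add: alg_iso_def)
  qed
  moreover have "alg_iso A B f" if "hma_iso H A B f" for f using that by (simp add: hma_iso_def)
  ultimately show ?thesis unfolding giso_iff[OF A(1) B(1)] ai by blast
qed

lemma EndT_card:
  assumes I: "finite I" "I \<noteq> {}" shows "giso (EndT I) (EndT {..<card I})"
proof -
  note w = grep_trivial[OF I]
  obtain b where b: "bij_betw b I {..<card I}"
    using ex_bij_betw_finite_nat[OF I(1)] by (auto simp: atLeast0LessThan)
  then have bI: "inj_on b I" "b ` I = {..<card I}" by (auto simp: bij_betw_def)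
  from grep_copy[OF w bI(1)] obtain w' where w': "grep (b ` I) w'" "giso (EndT I) (EndG (b ` I) w')" by blast
  have "giso (untwist (EndT I)) (untwist (EndG (b ` I) w'))"
    by (rule giso_untwist[OF w'(2) galg_EndG[OF w] galg_EndG[OF w'(1)]])
  then show ?thesis using I unfolding bI(2) by (simp add: untwist_EndG untwist_EndT)
qed

text \<open>Ordinary endomorphism algebras are those of trivial representations. Conversely, an isomorphism
  \<open>A \<sharp> End(M) \<cong> B \<sharp> End(N)\<close> with \<open>A\<close> and \<open>B\<close> trivially acted upon remains one when the actions on
  \<open>M\<close> and \<open>N\<close> are made trivial.\<close>

lemma Br_equiv_beq:
  assumes A: "fd_algebra A" "cs (triv A)" and B: "fd_algebra B" "cs (triv B)"
  shows "Br_equiv A B \<longleftrightarrow> beq (triv A) (triv B)"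
proof -
  note gA = cs_galg[OF A(2)] and gB = cs_galg[OF B(2)]
  have e: "(\<exists>f. alg_iso (tensor_alg A (End_alg I)) (tensor_alg B (End_alg J)) f)
       \<longleftrightarrow> giso (bp (triv A) (EndT I)) (bp (triv B) (EndT J))"
    if "finite I" "I \<noteq> {}" "finite J" "J \<noteq> {}" for I J :: "nat set"
  proof -
    have E: "galg (EndT I)" "galg (EndT J)" using that by (auto intro: galg_EndT)
    show ?thesis
      unfolding tensor_alg_End[OF A(1) that(1,2)] tensor_alg_End[OF B(1) that(3,4)]
      by (rule giso_trivact[symmetric]; intro galg_bp trivact_bp gA gB E trivact_triv trivact_EndT that)
  qed
  show ?thesis
  proof
    assume "Br_equiv A B"
    then obtain m n :: nat where mn: "0 < m" "0 < n"
      and f: "\<exists>f. alg_iso (tensor_alg A (End_alg {..<m})) (tensor_alg B (End_alg {..<n})) f"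
      unfolding Br_equiv_def by blast
    have ne: "{..<m} \<noteq> {}" "{..<n} \<noteq> {}" using mn by auto
    from f have "giso (bp (triv A) (EndT {..<m})) (bp (triv B) (EndT {..<n}))"
      using e[of "{..<m}" "{..<n}"] ne by simp
    then show "beq (triv A) (triv B)"
      unfolding beq_def using grep_trivial[of "{..<m}"] grep_trivial[of "{..<n}"] ne by blast
  next
    assume "beq (triv A) (triv B)"
    then obtain I J :: "nat set" and w v where w: "grep I w" and v: "grep J v"
      and i: "giso (bp (triv A) (EndG I w)) (bp (triv B) (EndG J v))" unfolding beq_def by blast
    note I = grepD(1,2)[OF w] and J = grepD(1,2)[OF v]
    have c: "card I > 0" "card J > 0" using I J by (simp_all add: card_gt_0_iff)
    have ne: "{..<card I} \<noteq> {}" "{..<card J} \<noteq> {}" using c by auto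
    have E: "cs (EndT I)" "cs (EndT J)" "cs (EndT {..<card I})" "cs (EndT {..<card J})"
      using I J ne by (auto intro!: cs_EndG grep_trivial)
    have gE: "galg (EndG I w)" "galg (EndG J v)" using w v by (simp_all add: galg_EndG)
    have 1: "giso (bp (triv A) (EndT I)) (bp (triv B) (EndT J))"
      using giso_untwist[OF i galg_bp[OF gA gE(1)] galg_bp[OF gB gE(2)]]
      by (simp add: untwist_bp gA gB gE trivact_triv untwist_EndG I J)
    have 2: "giso (bp (triv A) (EndT {..<card I})) (bp (triv A) (EndT I))"
      by (rule giso_sym[OF bp_cong[OF A(2) E(1) A(2) E(3) giso_refl[OF gA] EndT_card[OF I]]])
        (intro galg_bp gA cs_galg E)+
    have 3: "giso (bp (triv B) (EndT J)) (bp (triv B) (EndT {..<card J}))"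
      by (rule bp_cong[OF B(2) E(2) B(2) E(4) giso_refl[OF gB] EndT_card[OF J]])
    have "giso (bp (triv A) (EndT {..<card I})) (bp (triv B) (EndT {..<card J}))"
      by (rule giso_trans[OF giso_trans[OF 2 1] 3])
    then show "Br_equiv A B"
      unfolding Br_equiv_def using e[of "{..<card I}" "{..<card J}"] ne c by blast
  qed
qed

end

section \<open>The classical Brauer group as a subgroup\<close>

context nonsplit_involution begin

lemma central_simple_fd: "central_simple A \<Longrightarrow> fd_algebra A"
  by (simp add: central_simple_def)

definition brcls :: "(nat, 'k) falg \<Rightarrow> (nat, 'k) falg set" where
  "brcls A = {C. central_simple C \<and> beq (triv A) (triv C)}"

lemma brcls_eq:
  assumes A: "central_simple A" and B: "central_simple B"
  shows "brcls A = brcls B \<longleftrightarrow> beq (triv A) (triv B)"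
proof
  assume "brcls A = brcls B"
  moreover have "B \<in> brcls B" using B by (simp add: brcls_def beq_refl cs_triv)
  ultimately show "beq (triv A) (triv B)" by (auto simp: brcls_def)
next
  assume b: "beq (triv A) (triv B)"
  note cA = cs_triv[OF A] and cB = cs_triv[OF B]
  note b' = beq_sym[OF b cA cB]
  have "beq (triv A) (triv C) \<longleftrightarrow> beq (triv B) (triv C)" if "central_simple C" for C :: "(nat, 'k) falg"
    using beq_trans[OF b _ cA cB cs_triv[OF that]] beq_trans[OF b' _ cB cA cs_triv[OF that]] by blast
  then show "brcls A = brcls B" unfolding brcls_def by auto
qed

lemma Br_carrier: "carrier (Br TYPE('k)) = {brcls A | A. central_simple A}"
proof -
  have "{(A, B). A \<in> {A. central_simple A} \<and> B \<in> {A. central_simple A} \<and> Br_equiv A B} `` {A} = brcls A"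
    if "central_simple A" for A
    using that by (auto simp: brcls_def Br_equiv_beq central_simple_fd cs_triv)
  then show ?thesis by (auto simp: Br_def Let_def quotient_def)
qed

lemma Br_mult:
  assumes A: "central_simple A" and B: "central_simple B"
  shows "brcls A \<otimes>\<^bsub>Br TYPE('k)\<^esub> brcls B = {C. central_simple C \<and> beq (bp (triv A) (triv B)) (triv C)}"
proof -
  note cA = cs_triv[OF A] and cB = cs_triv[OF B]
  have t: "Br_equiv C (tensor_alg A' B') \<longleftrightarrow> beq (triv C) (bp (triv A') (triv B'))"
    if "central_simple C" "central_simple A'" "central_simple B'" for A' B' C :: "(nat, 'k) falg"
  proof -
    note c = cs_triv[OF that(1)] cs_triv[OF that(2)] cs_triv[OF that(3)]
    note P = cs_bp[OF c(2,3)]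
    have ta: "trivact (bp (triv A') (triv B'))"
      by (rule trivact_bp[OF cs_galg[OF c(2)] cs_galg[OF c(3)] trivact_triv trivact_triv])
    have T: "tensor_alg A' B' = forget (bp (triv A') (triv B'))"
      by (rule tensor_alg_triv) (use that in \<open>simp_all add: central_simple_fd\<close>)
    show ?thesis
      unfolding T using Br_equiv_beq[OF central_simple_fd[OF that(1)] c(1) fd_forget[OF cs_galg[OF P]]] P
      by (simp add: triv_forget[OF cs_galg[OF P] ta])
  qed
  have "(\<exists>A'\<in>brcls A. \<exists>B'\<in>brcls B. Br_equiv C (tensor_alg A' B')) \<longleftrightarrow> beq (bp (triv A) (triv B)) (triv C)"
    if C: "central_simple C" for C :: "(nat, 'k) falg"
  proof
    note cC = cs_triv[OF C]
    assume "\<exists>A'\<in>brcls A. \<exists>B'\<in>brcls B. Br_equiv C (tensor_alg A' B')"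
    then obtain A' B' :: "(nat, 'k) falg" where A': "central_simple A'" "beq (triv A) (triv A')"
      and B': "central_simple B'" "beq (triv B) (triv B')" and e: "Br_equiv C (tensor_alg A' B')"
      unfolding brcls_def by blast
    note c' = cs_triv[OF A'(1)] cs_triv[OF B'(1)]
    have "beq (bp (triv A) (triv B)) (bp (triv A') (triv B'))" by (intro beq_bp A' B' cA cB c')
    moreover have "beq (bp (triv A') (triv B')) (triv C)"
      by (rule beq_sym[OF _ cC cs_bp[OF c']]) (use e t[OF C A'(1) B'(1)] in simp)
    ultimately show "beq (bp (triv A) (triv B)) (triv C)"
      by (rule beq_trans) (intro cs_bp cA cB c' cC)+
  next
    note cC = cs_triv[OF C]
    assume "beq (bp (triv A) (triv B)) (triv C)"
    then have "beq (triv C) (bp (triv A) (triv B))" by (rule beq_sym[OF _ cs_bp[OF cA cB] cC])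
    then have "Br_equiv C (tensor_alg A B)" using t[OF C A B] by simp
    moreover have "A \<in> brcls A" "B \<in> brcls B" using A B by (simp_all add: brcls_def beq_refl cA cB)
    ultimately show "\<exists>A'\<in>brcls A. \<exists>B'\<in>brcls B. Br_equiv C (tensor_alg A' B')" by blast
  qed
  then show ?thesis by (auto simp: Br_def Let_def)
qed

lemma Br_one: "\<one>\<^bsub>Br TYPE('k)\<^esub> = {C. central_simple C \<and> beq (triv C) (base_hma H)}"
proof -
  have b: "forget (base_hma H) = base_alg" by (simp add: forget_def base_alg_def)
  have ta: "trivact (base_hma H)"
    using counit_bvec by (simp add: trivact_def) (simp add: crop_def)
  have "Br_equiv C base_alg \<longleftrightarrow> beq (triv C) (base_hma H)" if C: "central_simple C" for C :: "(nat, 'k) falg"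
    unfolding b[symmetric]
    using Br_equiv_beq[OF central_simple_fd[OF C] cs_triv[OF C] fd_forget[OF galg_base]] cs_base
    by (simp add: triv_forget[OF galg_base ta])
  then show ?thesis by (auto simp: Br_def Let_def)
qed

definition br_bm :: "(nat, 'k) falg set \<Rightarrow> (nat, 'k, 'g) hmalg set" where
  "br_bm P = {C. azumaya H R C \<and> (\<exists>A\<in>P. beq (triv A) (nrm C))}"

lemma br_bm:
  assumes A: "central_simple A" shows "br_bm (brcls A) = cls (triv A)"
proof -
  note cA = cs_triv[OF A]
  have "(\<exists>A'\<in>brcls A. beq (triv A') (nrm C)) \<longleftrightarrow> beq (triv A) (nrm C)" if "azumaya H R C" for C
  proof
    assume "\<exists>A'\<in>brcls A. beq (triv A') (nrm C)"
    then obtain A' :: "(nat, 'k) falg" where "central_simple A'" "beq (triv A) (triv A')" "beq (triv A') (nrm C)"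
      unfolding brcls_def by blast
    then show "beq (triv A) (nrm C)" using beq_trans[OF _ _ cA cs_triv azu_nrm(1)[OF that]] by blast
  next
    have "A \<in> brcls A" using A by (simp add: brcls_def beq_refl cA)
    moreover assume "beq (triv A) (nrm C)"
    ultimately show "\<exists>A'\<in>brcls A. beq (triv A') (nrm C)" by blast
  qed
  then show ?thesis by (auto simp: br_bm_def cls_def nrm_galg[OF cs_galg[OF cA]])
qed

lemma trivact_triv_cs:
  assumes "cs A" "trivact A" obtains B where "central_simple B" "triv B = A"
  using central_simple_forget[OF assms(1)] triv_forget[OF cs_galg[OF assms(1)] assms(2)] that by blast

lemma trivact_nat:
  assumes A: "cs A" "trivact A" obtains B :: "(nat, 'k) falg" where "central_simple B" "beq A (triv B)"
proof -
  obtain D :: "(nat, 'k, 'g) hmalg" where D: "cs D" "giso A D" using cs_nat[OF A(1)] by blast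
  have "giso A (untwist D)"
    using giso_untwist[OF D(2) cs_galg[OF A(1)] cs_galg[OF D(1)]] untwist_id[OF cs_galg[OF A(1)] A(2)] by simp
  then have "beq A (untwist D)" by (rule giso_beq[OF _ A(1) cs_untwist[OF D(1)]])
  then show thesis using trivact_triv_cs[OF cs_untwist[OF D(1)] trivact_untwist] that by metis
qed

lemma br_bm_image: "br_bm ` carrier (Br TYPE('k)) = {cls A | A. cs A \<and> trivact A}"
proof -
  have "br_bm ` carrier (Br TYPE('k)) = {cls (triv A) | A. central_simple A}"
    unfolding Br_carrier using br_bm by force
  also have "\<dots> = {cls A | A. cs A \<and> trivact A}"
  proof (intro equalityI subsetI)
    fix P assume "P \<in> {cls A | A. cs A \<and> trivact A}"
    then obtain A :: "(nat, 'k, 'g) hmalg" where A: "cs A" "trivact A" "P = cls A" by blast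
    obtain B where "central_simple B" "triv B = A" by (rule trivact_triv_cs[OF A(1,2)])
    then show "P \<in> {cls (triv A) | A. central_simple A}" using A(3) by blast
  qed (use cs_triv trivact_triv in blast)
  finally show ?thesis .
qed

text \<open>The group axioms for \<open>Br(k)\<close> are pulled back from \<open>BM\<close> along the injective multiplicative map.\<close>

theorem Br_BM:
  "group (Br TYPE('k))" "br_bm \<in> mon (Br TYPE('k)) (BM TYPE('k) H R)"
proof -
  let ?Br = "Br TYPE('k)" and ?BM = "BM TYPE('k) H R"
  interpret BM: group ?BM by (rule BM_group)
  have ex: "\<exists>C :: (nat, 'k) falg. central_simple C \<and> beq (bp (triv A) (triv B)) (triv C)"
    if "central_simple A" "central_simple B" for A B :: "(nat, 'k) falg"
  proof -
    note c = cs_triv[OF that(1)] cs_triv[OF that(2)]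
    have "trivact (bp (triv A) (triv B))"
      by (rule trivact_bp[OF cs_galg[OF c(1)] cs_galg[OF c(2)] trivact_triv trivact_triv])
    from trivact_nat[OF cs_bp[OF c] this] obtain C :: "(nat, 'k) falg"
      where "central_simple C" "beq (bp (triv A) (triv B)) (triv C)" .
    then show ?thesis by blast
  qed
  have mult: "\<exists>C. central_simple C \<and> brcls A \<otimes>\<^bsub>?Br\<^esub> brcls B = brcls C \<and> cls (triv A) \<otimes>\<^bsub>?BM\<^esub> cls (triv B) = cls (triv C)"
    if A: "central_simple A" and B: "central_simple B" for A B
  proof -
    note c = cs_triv[OF A] cs_triv[OF B]
    obtain C :: "(nat, 'k) falg" where C: "central_simple C" "beq (bp (triv A) (triv B)) (triv C)" using ex[OF A B] by blast
    note cC = cs_triv[OF C(1)]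
    note s = beq_sym[OF C(2) cs_bp[OF c] cC]
    have "beq (bp (triv A) (triv B)) (triv D) \<longleftrightarrow> beq (triv C) (triv D)" if "central_simple D" for D :: "(nat, 'k) falg"
      using beq_trans[OF s _ cC cs_bp[OF c] cs_triv[OF that]] beq_trans[OF C(2) _ cs_bp[OF c] cC cs_triv[OF that]] by blast
    then have "brcls A \<otimes>\<^bsub>?Br\<^esub> brcls B = brcls C" unfolding Br_mult[OF A B] by (auto simp: brcls_def)
    moreover have "cls (triv A) \<otimes>\<^bsub>?BM\<^esub> cls (triv B) = cls (triv C)" by (rule BM_mult[OF c cC s])
    ultimately show ?thesis using C(1) by blast
  qed
  have closed: "P \<otimes>\<^bsub>?Br\<^esub> Q \<in> carrier ?Br" and hom: "br_bm (P \<otimes>\<^bsub>?Br\<^esub> Q) = br_bm P \<otimes>\<^bsub>?BM\<^esub> br_bm Q"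
    if "P \<in> carrier ?Br" "Q \<in> carrier ?Br" for P Q
  proof -
    from that obtain A B where A: "central_simple A" "P = brcls A" and B: "central_simple B" "Q = brcls B"
      unfolding Br_carrier by blast
    from mult[OF A(1) B(1)] obtain C where C: "central_simple C" "brcls A \<otimes>\<^bsub>?Br\<^esub> brcls B = brcls C"
      "cls (triv A) \<otimes>\<^bsub>?BM\<^esub> cls (triv B) = cls (triv C)" by blast
    show "P \<otimes>\<^bsub>?Br\<^esub> Q \<in> carrier ?Br" unfolding A(2) B(2) C(2) Br_carrier using C(1) by blast
    show "br_bm (P \<otimes>\<^bsub>?Br\<^esub> Q) = br_bm P \<otimes>\<^bsub>?BM\<^esub> br_bm Q"
      unfolding A(2) B(2) C(2) br_bm[OF A(1)] br_bm[OF B(1)] br_bm[OF C(1)] C(3) ..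
  qed
  have into: "br_bm P \<in> carrier ?BM" if "P \<in> carrier ?Br" for P
    using that unfolding Br_carrier by (auto simp: br_bm cls_carrier cs_triv)
  have inj: "P = Q" if P: "P \<in> carrier ?Br" and Q: "Q \<in> carrier ?Br" and eq: "br_bm P = br_bm Q" for P Q
  proof -
    from P Q obtain A B where A: "central_simple A" "P = brcls A" and B: "central_simple B" "Q = brcls B"
      unfolding Br_carrier by blast
    have "cls (triv A) = cls (triv B)" using eq unfolding A(2) B(2) br_bm[OF A(1)] br_bm[OF B(1)] .
    then have "beq (triv A) (triv B)" using cls_eq_cs[OF cs_triv[OF A(1)] cs_triv[OF B(1)]] by blast
    then show ?thesis using brcls_eq[OF A(1) B(1)] A(2) B(2) by simp
  qed
  have one: "\<one>\<^bsub>?Br\<^esub> \<in> carrier ?Br" "br_bm \<one>\<^bsub>?Br\<^esub> = \<one>\<^bsub>?BM\<^esub>"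
  proof -
    have ta: "trivact (base_hma H)" using counit_bvec by (simp add: trivact_def) (simp add: crop_def)
    obtain E :: "(nat, 'k) falg" where E: "central_simple E" "beq (base_hma H) (triv E)"
      using trivact_nat[OF cs_base ta] by blast
    note cE = cs_triv[OF E(1)]
    note s = beq_sym[OF E(2) cs_base cE]
    have "beq (triv C) (base_hma H) \<longleftrightarrow> beq (triv E) (triv C)" if C: "central_simple C" for C :: "(nat, 'k) falg"
      using beq_trans[OF s beq_sym[OF _ cs_triv[OF C] cs_base] cE cs_base cs_triv[OF C]]
        beq_trans[OF beq_sym[OF _ cE cs_triv[OF C]] s cs_triv[OF C] cE cs_base] by blast
    then have "\<one>\<^bsub>?Br\<^esub> = brcls E" unfolding Br_one brcls_def by auto
    then show "\<one>\<^bsub>?Br\<^esub> \<in> carrier ?Br" "br_bm \<one>\<^bsub>?Br\<^esub> = \<one>\<^bsub>?BM\<^esub>"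
      using E(1) br_bm[OF E(1)] BM_one[OF cE s] by (auto simp: Br_carrier)
  qed
  show "group ?Br"
  proof (rule groupI)
    show "\<one>\<^bsub>?Br\<^esub> \<in> carrier ?Br" by (rule one)
    fix P assume P: "P \<in> carrier ?Br"
    show "\<one>\<^bsub>?Br\<^esub> \<otimes>\<^bsub>?Br\<^esub> P = P"
      by (rule inj) (use P one closed hom into in simp_all)
    from P obtain A where A: "central_simple A" "P = brcls A" unfolding Br_carrier by blast
    note cA = cs_triv[OF A(1)]
    have "trivact (hop (triv A))" using trivact_triv[of A] by (simp add: trivact_def)
    then obtain B where B: "central_simple B" "triv B = hop (triv A)" using trivact_triv_cs[OF cs_hop[OF cA]] by blast
    have BC: "brcls B \<in> carrier ?Br" unfolding Br_carrier using B(1) by blast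
    have "br_bm (brcls B) \<otimes>\<^bsub>?BM\<^esub> br_bm P = \<one>\<^bsub>?BM\<^esub>"
      unfolding A(2) br_bm[OF A(1)] br_bm[OF B(1)] B(2) by (rule BM_l_inv[OF cA])
    then have "brcls B \<otimes>\<^bsub>?Br\<^esub> P = \<one>\<^bsub>?Br\<^esub>"
      by (intro inj closed BC P one) (simp add: hom BC P one)
    then show "\<exists>Q\<in>carrier ?Br. Q \<otimes>\<^bsub>?Br\<^esub> P = \<one>\<^bsub>?Br\<^esub>" using BC by blast
    fix Q S assume Q: "Q \<in> carrier ?Br" and S: "S \<in> carrier ?Br"
    show "P \<otimes>\<^bsub>?Br\<^esub> Q \<in> carrier ?Br" by (rule closed[OF P Q])
    show "P \<otimes>\<^bsub>?Br\<^esub> Q \<otimes>\<^bsub>?Br\<^esub> S = P \<otimes>\<^bsub>?Br\<^esub> (Q \<otimes>\<^bsub>?Br\<^esub> S)"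
      by (rule inj) (use P Q S closed hom into in \<open>simp_all add: BM.m_assoc\<close>)
  qed
  show "br_bm \<in> mon ?Br ?BM"
    using hom into inj by (auto simp: mon_def hom_def inj_on_def)
qed

end

section \<open>The groups of cocycles\<close>

context central_involution begin

abbreviation Z :: "('g \<Rightarrow> 'g \<Rightarrow> 'k) monoid" where "Z \<equiv> Z2 TYPE('k) G"
abbreviation Zs :: "('g \<Rightarrow> 'g \<Rightarrow> 'k) monoid" where "Zs \<equiv> Z2_sharp TYPE('k) G u"
abbreviation Bd :: "('g \<Rightarrow> 'g \<Rightarrow> 'k) set" where "Bd \<equiv> B2 TYPE('k) G"

lemma Z_mult [simp]: "\<sigma> \<otimes>\<^bsub>Z\<^esub> \<omega> = (\<lambda>g h. \<sigma> g h * \<omega> g h)" and Z_one [simp]: "\<one>\<^bsub>Z\<^esub> = (\<lambda>_ _. 1)"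
  by (simp_all add: Z2_def)

lemma Zs_carrier [simp]: "carrier Zs = carrier Z" and Zs_one [simp]: "\<one>\<^bsub>Zs\<^esub> = (\<lambda>_ _. 1)"
  by (simp_all add: Z2_sharp_def Z2_def)

lemma ZI:
  assumes "\<And>g h. g \<notin> carrier G \<or> h \<notin> carrier G \<Longrightarrow> \<sigma> g h = 1"
    "\<And>g h. g \<in> carrier G \<Longrightarrow> h \<in> carrier G \<Longrightarrow> \<sigma> g h \<noteq> 0"
    "\<And>g h l. g \<in> carrier G \<Longrightarrow> h \<in> carrier G \<Longrightarrow> l \<in> carrier G \<Longrightarrow>
       \<sigma> g h * \<sigma> (g \<otimes> h) l = \<sigma> h l * \<sigma> g (h \<otimes> l)"
    "\<And>g. g \<in> carrier G \<Longrightarrow> \<sigma> \<one> g = 1" "\<And>g. g \<in> carrier G \<Longrightarrow> \<sigma> g \<one> = 1"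
  shows "\<sigma> \<in> carrier Z"
  using assms by (auto simp: Z2_def)

lemma ZD:
  assumes "\<sigma> \<in> carrier Z"
  shows "g \<notin> carrier G \<or> h \<notin> carrier G \<Longrightarrow> \<sigma> g h = 1" "\<sigma> g h \<noteq> 0"
    "g \<in> carrier G \<Longrightarrow> h \<in> carrier G \<Longrightarrow> l \<in> carrier G \<Longrightarrow>
       \<sigma> g h * \<sigma> (g \<otimes> h) l = \<sigma> h l * \<sigma> g (h \<otimes> l)"
    "\<sigma> \<one> g = 1" "\<sigma> g \<one> = 1"
proof -
  have a: "\<forall>g h. g \<notin> carrier G \<or> h \<notin> carrier G \<longrightarrow> \<sigma> g h = 1"
    and b: "\<forall>g\<in>carrier G. \<forall>h\<in>carrier G. \<sigma> g h \<noteq> 0"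
    and c: "\<forall>g\<in>carrier G. \<forall>h\<in>carrier G. \<forall>l\<in>carrier G. \<sigma> g h * \<sigma> (g \<otimes> h) l = \<sigma> h l * \<sigma> g (h \<otimes> l)"
    and d: "\<forall>g\<in>carrier G. \<sigma> \<one> g = 1 \<and> \<sigma> g \<one> = 1"
    using assms by (simp_all add: Z2_def)
  show "g \<notin> carrier G \<or> h \<notin> carrier G \<Longrightarrow> \<sigma> g h = 1" using a by blast
  show "\<sigma> g h \<noteq> 0" using a b by (cases "g \<in> carrier G \<and> h \<in> carrier G") auto
  show "g \<in> carrier G \<Longrightarrow> h \<in> carrier G \<Longrightarrow> l \<in> carrier G \<Longrightarrow>
       \<sigma> g h * \<sigma> (g \<otimes> h) l = \<sigma> h l * \<sigma> g (h \<otimes> l)" using c by blast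
  show "\<sigma> \<one> g = 1" "\<sigma> g \<one> = 1" using a d by (cases "g \<in> carrier G"; simp)+
qed

text \<open>Degrees are truth values, so that the sum of two degrees modulo \<open>2\<close> is \<open>d \<noteq> e\<close>.\<close>

definition sg :: "bool \<Rightarrow> 'k" where "sg b = (if b then - 1 else 1)"

lemma sg_simps [simp]: "sg True = - 1" "sg False = 1" "sg b \<noteq> 0" "sg b * sg b = 1" "inverse (sg b) = sg b"
  by (auto simp: sg_def)

lemma one_neq_minus_one: "(1::'k) \<noteq> - 1"
  using two by (metis add.inverse_unique add.right_inverse one_add_one)

lemma sg_inj: "sg a = sg b \<longleftrightarrow> a = b"
  using one_neq_minus_one by (auto simp: sg_def)

lemma sg_mult: "sg a * sg b = sg (a \<noteq> b)"
  by (auto simp: sg_def)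

text \<open>The degree \<open>|g|\<^sub>\<sigma>\<close> modulo \<open>2\<close>.\<close>

definition dgr :: "('g \<Rightarrow> 'g \<Rightarrow> 'k) \<Rightarrow> 'g \<Rightarrow> bool" where
  "dgr \<sigma> g \<longleftrightarrow> theta \<sigma> g u \<noteq> 1"

text \<open>Combine the cocycle identities for the triples \<open>(g, h, u)\<close>, \<open>(u, g, h)\<close> and \<open>(g, u, h)\<close>.\<close>

lemma theta_mult:
  assumes s: "\<sigma> \<in> carrier Z" and g: "g \<in> carrier G" and h: "h \<in> carrier G"
  shows "theta \<sigma> (g \<otimes> h) u = theta \<sigma> g u * theta \<sigma> h u"
proof -
  note nz = ZD(2)[OF s]
  have 1: "\<sigma> g h * \<sigma> (g \<otimes> h) u = \<sigma> h u * \<sigma> g (h \<otimes> u)" using ZD(3)[OF s g h u_closed] .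
  have 2: "\<sigma> u g * \<sigma> (g \<otimes> u) h = \<sigma> g h * \<sigma> u (g \<otimes> h)" using ZD(3)[OF s u_closed g h] u_central[OF g] by simp
  have 3: "\<sigma> g u * \<sigma> (g \<otimes> u) h = \<sigma> u h * \<sigma> g (h \<otimes> u)" using ZD(3)[OF s g u_closed h] u_central[OF h] by simp
  have "\<sigma> (g \<otimes> h) u * (\<sigma> u g * \<sigma> u h) * (\<sigma> g h * \<sigma> g (h \<otimes> u))
      = (\<sigma> g h * \<sigma> (g \<otimes> h) u) * (\<sigma> u h * \<sigma> g (h \<otimes> u)) * \<sigma> u g" by (simp add: mult_ac)
  also have "\<dots> = (\<sigma> h u * \<sigma> g (h \<otimes> u)) * (\<sigma> g u * \<sigma> (g \<otimes> u) h) * \<sigma> u g" by (simp add: 1 3)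
  also have "\<dots> = (\<sigma> g u * \<sigma> h u) * \<sigma> g (h \<otimes> u) * (\<sigma> u g * \<sigma> (g \<otimes> u) h)" by (simp add: mult_ac)
  also have "\<dots> = (\<sigma> g u * \<sigma> h u) * \<sigma> u (g \<otimes> h) * (\<sigma> g h * \<sigma> g (h \<otimes> u))" by (simp add: 2 mult_ac)
  finally have "\<sigma> (g \<otimes> h) u * (\<sigma> u g * \<sigma> u h) = (\<sigma> g u * \<sigma> h u) * \<sigma> u (g \<otimes> h)" using nz by simp
  then show ?thesis using nz by (simp add: theta_def field_simps)
qed

lemma theta_sign:
  assumes s: "\<sigma> \<in> carrier Z" shows "theta \<sigma> g u = sg (dgr \<sigma> g)"
proof (cases "g \<in> carrier G")
  case g: True
  note nz = ZD(2)[OF s]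
  have "theta \<sigma> g u * theta \<sigma> g u = 1"
  proof -
    have 1: "\<sigma> g u * \<sigma> (g \<otimes> u) u = \<sigma> u u" using ZD(3)[OF s g u_closed u_closed] ZD(5)[OF s] by simp
    have 2: "\<sigma> u g * \<sigma> (g \<otimes> u) u = \<sigma> g u * \<sigma> u (g \<otimes> u)" using ZD(3)[OF s u_closed g u_closed] u_central[OF g] by simp
    have 3: "\<sigma> u u = \<sigma> u g * \<sigma> u (g \<otimes> u)" using ZD(3)[OF s u_closed u_closed g] ZD(4)[OF s] u_central[OF g] by simp
    have "\<sigma> u g * \<sigma> u g * (\<sigma> u u) = \<sigma> u g * \<sigma> u g * (\<sigma> g u * \<sigma> (g \<otimes> u) u)" by (simp add: 1)
    also have "\<dots> = \<sigma> u g * \<sigma> g u * (\<sigma> u g * \<sigma> (g \<otimes> u) u)" by (simp add: mult_ac)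
    also have "\<dots> = \<sigma> g u * \<sigma> g u * (\<sigma> u g * \<sigma> u (g \<otimes> u))" by (simp add: 2 mult_ac)
    also have "\<dots> = \<sigma> g u * \<sigma> g u * \<sigma> u u" by (simp add: 3)
    finally have "\<sigma> u g * \<sigma> u g = \<sigma> g u * \<sigma> g u" using nz by simp
    then show ?thesis using nz by (simp add: theta_def field_simps)
  qed
  then have "theta \<sigma> g u = 1 \<or> theta \<sigma> g u = - 1" by (simp add: square_eq_1_iff)
  then show ?thesis by (auto simp: dgr_def sg_def)
next
  case False
  then show ?thesis using ZD(1)[OF s] by (simp add: dgr_def theta_def sg_def)
qed

lemma deg_mult: "\<sigma> \<in> carrier Z \<Longrightarrow> g \<in> carrier G \<Longrightarrow> h \<in> carrier G \<Longrightarrow> dgr \<sigma> (g \<otimes> h) = (dgr \<sigma> g \<noteq> dgr \<sigma> h)"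
  using theta_mult[of \<sigma> g h] by (simp add: theta_sign sg_mult sg_inj)

lemma deg_special: "\<sigma> \<in> carrier Z \<Longrightarrow> \<not> dgr \<sigma> u" "\<sigma> \<in> carrier Z \<Longrightarrow> \<not> dgr \<sigma> \<one>"
  "\<sigma> \<in> carrier Z \<Longrightarrow> g \<notin> carrier G \<Longrightarrow> \<not> dgr \<sigma> g"
  by (simp_all add: dgr_def theta_def ZD)

lemma deg_eqI: "\<sigma> \<in> carrier Z \<Longrightarrow> \<sigma> g u = sg d * \<sigma> u g \<Longrightarrow> dgr \<sigma> g = d"
proof -
  assume s: "\<sigma> \<in> carrier Z" and e: "\<sigma> g u = sg d * \<sigma> u g"
  have "theta \<sigma> g u = sg d" using ZD(2)[OF s] by (simp add: theta_def e)
  then show ?thesis using theta_sign[OF s] sg_inj by simp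
qed

lemma cdeg_deg: "\<sigma> \<in> carrier Z \<Longrightarrow> cdeg u \<sigma> g = of_bool (dgr \<sigma> g)"
  unfolding cdeg_def
  by (rule the_equality) (use one_neq_minus_one in \<open>auto simp: theta_sign sg_def split: if_splits\<close>)

lemma sharp_eq:
  assumes "\<sigma> \<in> carrier Z" "\<omega> \<in> carrier Z"
  shows "\<sigma> \<otimes>\<^bsub>Zs\<^esub> \<omega> = (\<lambda>g h. \<sigma> g h * \<omega> g h * sg (dgr \<sigma> g \<and> dgr \<omega> h))"
  using assms by (simp add: Z2_sharp_def cdeg_deg fun_eq_iff sg_def of_bool_def)

text \<open>Characters of \<open>G / U\<close> with values in \<open>\<int>/2\<close>: these are the possible degrees of cocycles.\<close>

definition parity :: "('g \<Rightarrow> bool) \<Rightarrow> bool" where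
  "parity d \<longleftrightarrow> (\<forall>g\<in>carrier G. \<forall>h\<in>carrier G. d (g \<otimes> h) = (d g \<noteq> d h)) \<and> (\<forall>g. g \<notin> carrier G \<longrightarrow> \<not> d g) \<and> \<not> d u"

lemma parityD:
  assumes "parity d"
  shows "g \<in> carrier G \<Longrightarrow> h \<in> carrier G \<Longrightarrow> d (g \<otimes> h) = (d g \<noteq> d h)" "g \<notin> carrier G \<Longrightarrow> \<not> d g" "\<not> d u" "\<not> d \<one>"
proof -
  show "g \<in> carrier G \<Longrightarrow> h \<in> carrier G \<Longrightarrow> d (g \<otimes> h) = (d g \<noteq> d h)" "g \<notin> carrier G \<Longrightarrow> \<not> d g" "\<not> d u"
    using assms unfolding parity_def by blast+
  have "d (\<one> \<otimes> \<one>) = (d \<one> \<noteq> d \<one>)" using assms unfolding parity_def by blast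
  then show "\<not> d \<one>" by simp
qed

lemma parity_deg: "\<sigma> \<in> carrier Z \<Longrightarrow> parity (dgr \<sigma>)"
  by (simp add: parity_def deg_mult deg_special)

text \<open>The sign is the cup product of two characters, hence a cocycle; it is symmetric in \<open>g\<close> and \<open>u\<close>
  because both characters vanish at \<open>u\<close>, so it does not affect the degree.\<close>

lemma Z_twist:
  assumes s: "\<sigma> \<in> carrier Z" and o: "\<omega> \<in> carrier Z" and d: "parity d" and e: "parity e"
  shows "(\<lambda>g h. \<sigma> g h * \<omega> g h * sg (d g \<and> e h)) \<in> carrier Z"
    "dgr (\<lambda>g h. \<sigma> g h * \<omega> g h * sg (d g \<and> e h)) = (\<lambda>g. dgr \<sigma> g \<noteq> dgr \<omega> g)"
proof -
  let ?p = "\<lambda>g h. \<sigma> g h * \<omega> g h * sg (d g \<and> e h)"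
  show p: "?p \<in> carrier Z"
  proof (rule ZI)
    show "?p g h = 1" if "g \<notin> carrier G \<or> h \<notin> carrier G" for g h
      using that ZD(1)[OF s] ZD(1)[OF o] parityD(2)[OF d] parityD(2)[OF e] by auto
    show "?p g h \<noteq> 0" for g h using ZD(2)[OF s] ZD(2)[OF o] by simp
    show "?p \<one> g = 1" "?p g \<one> = 1" for g
      using ZD(4,5)[OF s] ZD(4,5)[OF o] parityD(4)[OF d] parityD(4)[OF e] by simp_all
    fix g h l assume m: "g \<in> carrier G" "h \<in> carrier G" "l \<in> carrier G"
    have t: "sg (d g \<and> e h) * sg (d (g \<otimes> h) \<and> e l) = sg (d h \<and> e l) * sg (d g \<and> e (h \<otimes> l))"
      using m by (auto simp: sg_def parityD(1)[OF d] parityD(1)[OF e])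
    have "?p g h * ?p (g \<otimes> h) l = (\<sigma> g h * \<sigma> (g \<otimes> h) l) * (\<omega> g h * \<omega> (g \<otimes> h) l)
        * (sg (d g \<and> e h) * sg (d (g \<otimes> h) \<and> e l))" by (simp only: mult_ac)
    also have "\<dots> = (\<sigma> h l * \<sigma> g (h \<otimes> l)) * (\<omega> h l * \<omega> g (h \<otimes> l)) * (sg (d h \<and> e l) * sg (d g \<and> e (h \<otimes> l)))"
      by (simp only: ZD(3)[OF s m] ZD(3)[OF o m] t)
    also have "\<dots> = ?p h l * ?p g (h \<otimes> l)" by (simp only: mult_ac)
    finally show "?p g h * ?p (g \<otimes> h) l = ?p h l * ?p g (h \<otimes> l)" .
  qed
  have "theta ?p g u = theta \<sigma> g u * theta \<omega> g u" for g
    using parityD(3)[OF d] parityD(3)[OF e] by (simp add: theta_def)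
  then have "sg (dgr ?p g) = sg (dgr \<sigma> g \<noteq> dgr \<omega> g)" for g
    using theta_sign[OF p] theta_sign[OF s] theta_sign[OF o] by (simp add: sg_mult)
  then show "dgr ?p = (\<lambda>g. dgr \<sigma> g \<noteq> dgr \<omega> g)" by (simp add: sg_inj fun_eq_iff)
qed

lemma parity_False: "parity (\<lambda>_. False)"
  by (simp add: parity_def)

lemma Z_one_closed: "(\<lambda>_ _. 1) \<in> carrier Z" and deg_one: "dgr (\<lambda>_ _. 1) = (\<lambda>_. False)"
  by (auto simp: Z2_def dgr_def theta_def)

lemma Z_closed: "\<sigma> \<in> carrier Z \<Longrightarrow> \<omega> \<in> carrier Z \<Longrightarrow> (\<lambda>g h. \<sigma> g h * \<omega> g h) \<in> carrier Z"
  and deg_Z_mult: "\<sigma> \<in> carrier Z \<Longrightarrow> \<omega> \<in> carrier Z \<Longrightarrow> dgr (\<lambda>g h. \<sigma> g h * \<omega> g h) = (\<lambda>g. dgr \<sigma> g \<noteq> dgr \<omega> g)"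
  using Z_twist[OF _ _ parity_False parity_False, of \<sigma> \<omega>] by simp_all

lemma Z_inverse:
  assumes s: "\<sigma> \<in> carrier Z"
  shows "(\<lambda>g h. inverse (\<sigma> g h)) \<in> carrier Z" "dgr (\<lambda>g h. inverse (\<sigma> g h)) = dgr \<sigma>"
proof -
  show i: "(\<lambda>g h. inverse (\<sigma> g h)) \<in> carrier Z"
  proof (rule ZI)
    fix g h l assume m: "g \<in> carrier G" "h \<in> carrier G" "l \<in> carrier G"
    have "inverse (\<sigma> g h * \<sigma> (g \<otimes> h) l) = inverse (\<sigma> h l * \<sigma> g (h \<otimes> l))" by (simp only: ZD(3)[OF s m])
    then show "inverse (\<sigma> g h) * inverse (\<sigma> (g \<otimes> h) l) = inverse (\<sigma> h l) * inverse (\<sigma> g (h \<otimes> l))"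
      by (simp add: mult.commute)
  qed (use ZD[OF s] in auto)
  have "theta (\<lambda>g h. inverse (\<sigma> g h)) g u = inverse (theta \<sigma> g u)" for g by (simp add: theta_def)
  then have "sg (dgr (\<lambda>g h. inverse (\<sigma> g h)) g) = sg (dgr \<sigma> g)" for g
    using theta_sign[OF i] theta_sign[OF s] by simp
  then show "dgr (\<lambda>g h. inverse (\<sigma> g h)) = dgr \<sigma>" by (simp add: sg_inj fun_eq_iff)
qed

lemma sharp_closed:
  assumes "\<sigma> \<in> carrier Z" "\<omega> \<in> carrier Z"
  shows "\<sigma> \<otimes>\<^bsub>Zs\<^esub> \<omega> \<in> carrier Z" "dgr (\<sigma> \<otimes>\<^bsub>Zs\<^esub> \<omega>) = (\<lambda>g. dgr \<sigma> g \<noteq> dgr \<omega> g)"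
  unfolding sharp_eq[OF assms] by (intro Z_twist assms parity_deg)+

theorem Zs_group: "group Zs"
proof (rule groupI; (simp only: Zs_carrier Zs_one)?)
  show "(\<lambda>_ _. 1) \<in> carrier Z" by (rule Z_one_closed)
  fix \<sigma> assume s: "\<sigma> \<in> carrier Z"
  show "(\<lambda>_ _. 1) \<otimes>\<^bsub>Zs\<^esub> \<sigma> = \<sigma>" by (simp add: sharp_eq[OF Z_one_closed s] deg_one)
  show "\<exists>\<tau>\<in>carrier Z. \<tau> \<otimes>\<^bsub>Zs\<^esub> \<sigma> = (\<lambda>_ _. 1)"
  proof
    let ?t = "\<lambda>g h. inverse (\<sigma> g h) * 1 * sg (dgr \<sigma> g \<and> dgr \<sigma> h)"
    note tw = Z_twist[OF Z_inverse(1)[OF s] Z_one_closed parity_deg[OF s] parity_deg[OF s]]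
    show t: "?t \<in> carrier Z" by (rule tw(1))
    have "dgr ?t = dgr \<sigma>" using tw(2) by (simp add: Z_inverse(2)[OF s] deg_one)
    then show "?t \<otimes>\<^bsub>Zs\<^esub> \<sigma> = (\<lambda>_ _. 1)"
      unfolding sharp_eq[OF t s] using ZD(2)[OF s] by (auto simp: fun_eq_iff sg_def)
  qed
  fix \<omega> assume o: "\<omega> \<in> carrier Z"
  show "\<sigma> \<otimes>\<^bsub>Zs\<^esub> \<omega> \<in> carrier Z" by (rule sharp_closed[OF s o])
  fix \<rho> assume r: "\<rho> \<in> carrier Z"
  note so = sharp_closed[OF s o] and or = sharp_closed[OF o r]
  show "\<sigma> \<otimes>\<^bsub>Zs\<^esub> \<omega> \<otimes>\<^bsub>Zs\<^esub> \<rho> = \<sigma> \<otimes>\<^bsub>Zs\<^esub> (\<omega> \<otimes>\<^bsub>Zs\<^esub> \<rho>)"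
    unfolding sharp_eq[OF so(1) r] sharp_eq[OF s or(1)] so(2) or(2)
    unfolding sharp_eq[OF s o] sharp_eq[OF o r]
    by (auto simp: fun_eq_iff sg_def)
qed

theorem Z_comm_group: "comm_group Z"
proof (rule comm_groupI; (simp only: Z_mult Z_one)?)
  show "(\<lambda>_ _. 1) \<in> carrier Z" by (rule Z_one_closed)
  fix \<sigma> assume s: "\<sigma> \<in> carrier Z"
  show "\<exists>\<tau>\<in>carrier Z. (\<lambda>g h. \<tau> g h * \<sigma> g h) = (\<lambda>_ _. 1)"
    using ZD(2)[OF s] Z_inverse(1)[OF s] by (intro bexI[of _ "\<lambda>g h. inverse (\<sigma> g h)"]) auto
qed (auto simp: Z_closed mult_ac)

definition cob :: "('g \<Rightarrow> 'k) \<Rightarrow> 'g \<Rightarrow> 'g \<Rightarrow> 'k" where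
  "cob \<gamma> = (\<lambda>g h. if g \<in> carrier G \<and> h \<in> carrier G then \<gamma> g * \<gamma> h * inverse (\<gamma> (g \<otimes> h)) else 1)"

lemma Bd_cob: "Bd = {cob \<gamma> | \<gamma>. (\<forall>g\<in>carrier G. \<gamma> g \<noteq> 0) \<and> \<gamma> \<one> = 1}"
  by (simp add: B2_def cob_def)

lemma cob_closed:
  assumes n: "\<And>g. g \<in> carrier G \<Longrightarrow> \<gamma> g \<noteq> 0" and o: "\<gamma> \<one> = 1"
  shows "cob \<gamma> \<in> carrier Z" "dgr (cob \<gamma>) = (\<lambda>_. False)"
proof -
  show c: "cob \<gamma> \<in> carrier Z"
  proof (rule ZI)
    fix g h l assume m: "g \<in> carrier G" "h \<in> carrier G" "l \<in> carrier G"
    then show "cob \<gamma> g h * cob \<gamma> (g \<otimes> h) l = cob \<gamma> h l * cob \<gamma> g (h \<otimes> l)"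
      using n[of "g \<otimes> h"] n[of "h \<otimes> l"] by (simp add: cob_def m_assoc field_simps)
  qed (use n o in \<open>auto simp: cob_def\<close>)
  have "dgr (cob \<gamma>) g = False" for g
  proof (rule deg_eqI[OF c])
    show "cob \<gamma> g u = sg False * cob \<gamma> u g"
      using u_central[of g] by (auto simp: cob_def mult_ac)
  qed
  then show "dgr (cob \<gamma>) = (\<lambda>_. False)" by blast
qed

lemma Bd_closed: "\<beta> \<in> Bd \<Longrightarrow> \<beta> \<in> carrier Z" "\<beta> \<in> Bd \<Longrightarrow> dgr \<beta> = (\<lambda>_. False)"
  unfolding Bd_cob using cob_closed by auto

lemma Bd_sharp:
  assumes "\<beta> \<in> Bd" "\<sigma> \<in> carrier Z"
  shows "\<beta> \<otimes>\<^bsub>Zs\<^esub> \<sigma> = \<beta> \<otimes>\<^bsub>Z\<^esub> \<sigma>" "\<sigma> \<otimes>\<^bsub>Zs\<^esub> \<beta> = \<beta> \<otimes>\<^bsub>Z\<^esub> \<sigma>"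
  using assms Bd_closed[OF assms(1)] by (simp_all add: sharp_eq fun_eq_iff mult.commute)

lemma Bd_mult: "\<beta> \<in> Bd \<Longrightarrow> \<beta>' \<in> Bd \<Longrightarrow> (\<lambda>g h. \<beta> g h * \<beta>' g h) \<in> Bd"
proof -
  assume "\<beta> \<in> Bd" "\<beta>' \<in> Bd"
  then obtain \<gamma> \<gamma>' where c: "\<beta> = cob \<gamma>" "\<beta>' = cob \<gamma>'" "\<forall>g\<in>carrier G. \<gamma> g \<noteq> 0" "\<gamma> \<one> = 1"
    "\<forall>g\<in>carrier G. \<gamma>' g \<noteq> 0" "\<gamma>' \<one> = 1" unfolding Bd_cob by blast
  have "(\<lambda>g h. \<beta> g h * \<beta>' g h) = cob (\<lambda>g. \<gamma> g * \<gamma>' g)" unfolding c(1,2) by (auto simp: cob_def fun_eq_iff mult_ac)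
  then show ?thesis unfolding Bd_cob using c(3-) by (intro CollectI exI[of _ "\<lambda>g. \<gamma> g * \<gamma>' g"]) auto
qed

lemma Bd_inverse: "\<beta> \<in> Bd \<Longrightarrow> (\<lambda>g h. inverse (\<beta> g h)) \<in> Bd"
proof -
  assume "\<beta> \<in> Bd"
  then obtain \<gamma> where c: "\<beta> = cob \<gamma>" "\<forall>g\<in>carrier G. \<gamma> g \<noteq> 0" "\<gamma> \<one> = 1" unfolding Bd_cob by blast
  have "(\<lambda>g h. inverse (\<beta> g h)) = cob (\<lambda>g. inverse (\<gamma> g))" unfolding c(1) by (auto simp: cob_def fun_eq_iff mult_ac)
  then show ?thesis unfolding Bd_cob using c(2-) by (intro CollectI exI[of _ "\<lambda>g. inverse (\<gamma> g)"]) auto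
qed

lemma Bd_one: "(\<lambda>_ _. 1) \<in> Bd"
  unfolding Bd_cob by (intro CollectI exI[of _ "\<lambda>_. 1"]) (auto simp: cob_def fun_eq_iff)

lemma Bd_subgroup: "subgroup Bd Z" "subgroup Bd Zs"
proof -
  interpret Z: comm_group Z by (rule Z_comm_group)
  interpret Zs: group Zs by (rule Zs_group)
  have i: "\<beta> \<in> Bd \<Longrightarrow> (\<lambda>g h. inverse (\<beta> g h) * \<beta> g h) = (\<lambda>_ _. 1)" for \<beta>
    using ZD(2)[OF Bd_closed(1)] by (auto simp: fun_eq_iff)
  show "subgroup Bd Z"
  proof (rule Z.subgroupI)
    fix \<beta> assume b: "\<beta> \<in> Bd"
    have "inv\<^bsub>Z\<^esub> \<beta> = (\<lambda>g h. inverse (\<beta> g h))"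
      by (rule Z.inv_equality) (use b i Bd_inverse Bd_closed in auto)
    then show "inv\<^bsub>Z\<^esub> \<beta> \<in> Bd" using Bd_inverse[OF b] by simp
  qed (use Bd_closed Bd_one Bd_mult in auto)
  show "subgroup Bd Zs"
  proof (rule Zs.subgroupI)
    fix \<beta> assume b: "\<beta> \<in> Bd"
    have "inv\<^bsub>Zs\<^esub> \<beta> = (\<lambda>g h. inverse (\<beta> g h))"
      by (rule Zs.inv_equality) (use b i Bd_inverse Bd_closed in \<open>auto simp: Bd_sharp\<close>)
    then show "inv\<^bsub>Zs\<^esub> \<beta> \<in> Bd" using Bd_inverse[OF b] by simp
    fix \<beta>' assume b': "\<beta>' \<in> Bd"
    show "\<beta> \<otimes>\<^bsub>Zs\<^esub> \<beta>' \<in> Bd" using Bd_sharp(1)[OF b Bd_closed(1)[OF b']] Bd_mult[OF b b'] by simp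
  qed (use Bd_closed Bd_one in auto)
qed

lemma rcos_sharp: "\<sigma> \<in> carrier Z \<Longrightarrow> Bd #>\<^bsub>Zs\<^esub> \<sigma> = Bd #>\<^bsub>Z\<^esub> \<sigma>"
  unfolding r_coset_def by (simp add: Bd_sharp)

lemma lcos_sharp: "\<sigma> \<in> carrier Z \<Longrightarrow> \<sigma> <#\<^bsub>Zs\<^esub> Bd = Bd #>\<^bsub>Z\<^esub> \<sigma>"
  unfolding r_coset_def l_coset_def by (simp add: Bd_sharp)

text \<open>Coboundaries have degree zero, so the twisted and the ordinary product agree when one factor is a
  coboundary. Hence the cosets are the same for both group structures.\<close>

lemma Bd_normal: "Bd \<lhd> Zs" "Bd \<lhd> Z"
proof -
  interpret Z: comm_group Z by (rule Z_comm_group)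
  interpret Zs: group Zs by (rule Zs_group)
  show "Bd \<lhd> Zs" using Bd_subgroup(2) by (simp add: normal_def normal_axioms_def rcos_sharp lcos_sharp Zs_group)
  show "Bd \<lhd> Z" using Bd_subgroup(1) Z.subgroup_imp_normal by blast
qed

lemma H2_sharp_Mod: "H2_sharp TYPE('k) G u = Zs Mod Bd"
  by (simp add: H2_sharp_def H2_def FactGroup_def RCOSETS_def rcos_sharp)

lemma H2_groups: "group (H2_sharp TYPE('k) G u)" "group (H2 TYPE('k) G)"
  unfolding H2_sharp_Mod H2_def using Bd_normal normal.factorgroup_is_group by blast+

definition coset :: "('g \<Rightarrow> 'g \<Rightarrow> 'k) \<Rightarrow> ('g \<Rightarrow> 'g \<Rightarrow> 'k) set" where
  "coset \<sigma> = Bd #>\<^bsub>Z\<^esub> \<sigma>"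

lemma H2_carriers:
  "carrier (H2_sharp TYPE('k) G u) = coset ` carrier Z" "carrier (H2 TYPE('k) G) = coset ` carrier Z"
  by (auto simp: H2_sharp_def H2_def FactGroup_def RCOSETS_def coset_def)

lemma H2_mults:
  assumes s: "\<sigma> \<in> carrier Z" and o: "\<omega> \<in> carrier Z"
  shows "coset \<sigma> \<otimes>\<^bsub>H2_sharp TYPE('k) G u\<^esub> coset \<omega> = coset (\<sigma> \<otimes>\<^bsub>Zs\<^esub> \<omega>)"
    "coset \<sigma> \<otimes>\<^bsub>H2 TYPE('k) G\<^esub> coset \<omega> = coset (\<lambda>g h. \<sigma> g h * \<omega> g h)"
proof -
  interpret N: normal Bd Zs by (rule Bd_normal)
  interpret N': normal Bd Z by (rule Bd_normal)
  show "coset \<sigma> \<otimes>\<^bsub>H2_sharp TYPE('k) G u\<^esub> coset \<omega> = coset (\<sigma> \<otimes>\<^bsub>Zs\<^esub> \<omega>)"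
    unfolding H2_sharp_Mod FactGroup_def coset_def
    using N.rcos_sum[of \<sigma> \<omega>] s o by (simp add: rcos_sharp sharp_closed)
  show "coset \<sigma> \<otimes>\<^bsub>H2 TYPE('k) G\<^esub> coset \<omega> = coset (\<lambda>g h. \<sigma> g h * \<omega> g h)"
    unfolding H2_def FactGroup_def coset_def
    using N'.rcos_sum[of \<sigma> \<omega>] s o by simp
qed

lemma H2_ones: "\<one>\<^bsub>H2_sharp TYPE('k) G u\<^esub> = coset (\<lambda>_ _. 1)" "\<one>\<^bsub>H2 TYPE('k) G\<^esub> = coset (\<lambda>_ _. 1)"
  by (simp_all add: H2_sharp_def H2_def FactGroup_def coset_def r_coset_def)

lemma coset_eq:
  assumes s: "\<sigma> \<in> carrier Z" and o: "\<omega> \<in> carrier Z"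
  shows "coset \<sigma> = coset \<omega> \<longleftrightarrow> (\<exists>\<beta>\<in>Bd. \<omega> = (\<lambda>g h. \<beta> g h * \<sigma> g h))"
proof -
  interpret Z: comm_group Z by (rule Z_comm_group)
  note sub = Bd_subgroup(1)
  have m: "\<omega> \<in> coset \<sigma> \<longleftrightarrow> (\<exists>\<beta>\<in>Bd. \<omega> = (\<lambda>g h. \<beta> g h * \<sigma> g h))" by (auto simp: coset_def r_coset_def)
  have "\<omega> \<in> coset \<omega>" unfolding coset_def by (rule Z.rcos_self[OF o sub])
  then have "coset \<sigma> = coset \<omega> \<longleftrightarrow> \<omega> \<in> coset \<sigma>"
    unfolding coset_def using Z.repr_independence[OF _ s sub] by metis
  then show ?thesis using m by simp
qed

section \<open>Implementing the action by units\<close>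

text \<open>A homogeneous unit \<open>x\<close> of degree \<open>d\<close> with \<open>x a = (-1)\<^bsup>d |a|\<^esup> g(a) x\<close> for homogeneous \<open>a\<close>: the sign is
  absorbed into the action of \<open>u\<close> on \<open>a\<close>.\<close>

definition superimp :: "('i, 'k, 'g) hmalg \<Rightarrow> 'g \<Rightarrow> bool \<Rightarrow> ('i \<Rightarrow> 'k) \<Rightarrow> bool" where
  "superimp A g d x \<longleftrightarrow> x \<in> V A \<and> x \<noteq> 0 \<and> ac A u x = vscale (sg d) x
     \<and> (\<forall>a. amul A x a = amul A (ac A (if d then g \<otimes> u else g) a) x)"

lemma superimpD:
  assumes "superimp A g d x"
  shows "x \<in> V A" "x \<noteq> 0" "ac A u x = vscale (sg d) x" "amul A x a = amul A (ac A (if d then g \<otimes> u else g) a) x"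
  using assms unfolding superimp_def by blast+

lemma superimp_unit:
  assumes cA: "cs A" and g: "g \<in> carrier G" and x: "superimp A g d x"
  shows "\<exists>y\<in>V A. amul A x y = aone A \<and> amul A y x = aone A"
  by (rule implementing_unit[OF cA, of "if d then g \<otimes> u else g"]) (use superimpD[OF x] g in auto)

lemma superimp_one: "cs A \<Longrightarrow> superimp A \<one> False (aone A)"
  by (simp add: superimp_def cs_one_nonzero galg_simps)

lemma superimp_scale: "galg A \<Longrightarrow> superimp A g d x \<Longrightarrow> c \<noteq> 0 \<Longrightarrow> superimp A g d (vscale c x)"
proof -
  assume A: "galg A" and x: "superimp A g d x" and c: "c \<noteq> 0"
  note D = superimpD[OF x]
  have "amul A (vscale c x) a = amul A (ac A (if d then g \<otimes> u else g) a) (vscale c x)" for a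
    using D(4)[of a] by (simp only: galg_simps[OF A])
  then show ?thesis unfolding superimp_def using D(1-3) c by (simp add: galg_simps[OF A] mult.commute)
qed

lemma superimp_mult:
  assumes cA: "cs A" and g: "g \<in> carrier G" and h: "h \<in> carrier G"
    and x: "superimp A g d x" and y: "superimp A h e y"
  shows "superimp A (g \<otimes> h) (d \<noteq> e) (amul A x y)"
proof -
  have A: "galg A" using cA by simp
  note X = superimpD[OF x] and Y = superimpD[OF y]
  let ?g = "if d then g \<otimes> u else g" and ?h = "if e then h \<otimes> u else h"
  have gh: "?g \<in> carrier G" "?h \<in> carrier G" using g h by auto
  have "u \<otimes> (h \<otimes> u) = h" using h u_central[OF h] by (metis m_assoc r_one u_closed u_sq)
  then have prod: "?g \<otimes> ?h = (if d \<noteq> e then g \<otimes> h \<otimes> u else g \<otimes> h)"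
    using g h by (auto simp: m_assoc u_central)
  have "amul A x y \<noteq> 0"
  proof
    assume z: "amul A x y = 0"
    from superimp_unit[OF cA h y] obtain y' where "y' \<in> V A" "amul A y y' = aone A" by blast
    then have "amul A (amul A x y) y' = x" using X(1) A by (simp add: galg_simps)
    then show False using z X(2) by (simp add: galg_simps[OF A])
  qed
  moreover have "ac A u (amul A x y) = vscale (sg (d \<noteq> e)) (amul A x y)"
    by (simp add: galg_simps[OF A] X(3) Y(3) sg_mult mult.commute)
  moreover have "amul A (amul A x y) a = amul A (ac A (?g \<otimes> ?h) a) (amul A x y)" for a
  proof -
    have "amul A (amul A x y) a = amul A x (amul A (ac A ?h a) y)" using Y(4)[of a] by (simp add: galg_simps[OF A])
    also have "\<dots> = amul A (amul A x (ac A ?h a)) y" by (simp add: galg_simps[OF A])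
    also have "amul A x (ac A ?h a) = amul A (ac A (?g \<otimes> ?h) a) x"
      using X(4)[of "ac A ?h a"] gh by (simp only: galg_simps[OF A])
    finally show ?thesis by (simp add: galg_simps[OF A])
  qed
  ultimately show ?thesis unfolding superimp_def prod using A by simp
qed

lemma superimp_inverse:
  assumes cA: "cs A" and g: "g \<in> carrier G" and x: "superimp A g d x"
    and y: "y \<in> V A" "amul A x y = aone A" "amul A y x = aone A"
  shows "superimp A (inv g) d y"
proof -
  have A: "galg A" using cA by simp
  note X = superimpD[OF x]
  let ?g = "if d then g \<otimes> u else g"
  have gg: "?g \<in> carrier G" using g by simp
  have ig: "inv ?g = (if d then inv g \<otimes> u else inv g)" using g by (simp add: inv_mult_group u_central)
  have cancel: "a = b" if "a \<in> V A" "b \<in> V A" "amul A x a = amul A x b" for a b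
  proof -
    have "amul A (amul A y x) a = amul A (amul A y x) b" using that(3) by (simp add: galg_simps[OF A])
    then show ?thesis using that(1,2) y(3) by (simp add: galg_simps[OF A])
  qed
  have y0: "y \<noteq> 0" using y(2) cs_one_nonzero[OF cA] by (auto simp: galg_simps[OF A])
  have "amul A x (ac A u y) = vscale (sg d) (ac A u (amul A x y))"
    by (simp add: galg_simps[OF A] X(3))
  then have "amul A x (ac A u y) = amul A x (vscale (sg d) y)" using y A by (simp add: galg_simps)
  then have uy: "ac A u y = vscale (sg d) y" 
    by (rule cancel[rotated 2]) (use y A in simp_all)
  have "amul A y a = amul A (ac A (inv ?g) a) y" for a
  proof (rule cancel)
    have "amul A x (amul A (ac A (inv ?g) a) y) = amul A (amul A x (ac A (inv ?g) a)) y" by (simp add: galg_simps[OF A])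
    also have "amul A x (ac A (inv ?g) a) = amul A (ac A ?g (ac A (inv ?g) a)) x" by (rule X(4))
    also have "ac A ?g (ac A (inv ?g) a) = crop (basis A) a"
      using gg by (simp only: galg_simps[OF A] inv_closed r_inv)
    finally have "amul A x (amul A (ac A (inv ?g) a) y) = amul A a (amul A x y)" by (simp add: galg_simps[OF A])
    also have "\<dots> = amul A x (amul A y a)"
    proof -
      have "amul A x (amul A y a) = amul A (amul A x y) a" by (simp add: galg_simps[OF A])
      then show ?thesis using y(2) by (simp add: galg_simps[OF A])
    qed
    finally show "amul A x (amul A y a) = amul A x (amul A (ac A (inv ?g) a) y)" by simp
  qed (use A in simp_all)
  then show ?thesis unfolding superimp_def using y(1) y0 uy ig by simp
qed

text \<open>An element that supercommutes with everything is an even scalar: if it were odd it would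
  anticommute with itself, so its square would vanish, but it is invertible.\<close>

lemma superimp_scalar:
  assumes cA: "cs A" and t: "superimp A \<one> d t" shows "\<not> d" "\<exists>c. c \<noteq> 0 \<and> t = vscale c (aone A)"
proof -
  have A: "galg A" using cA by simp
  note T = superimpD[OF t]
  show nd: "\<not> d"
  proof
    assume d: d
    have "amul A t t = amul A (ac A u t) t" using T(4)[of t] d by simp
    also have "\<dots> = - amul A t t" using T(3) d by (simp add: galg_simps[OF A])
    finally have "amul A t t = - amul A t t" .
    then have "amul A t t + amul A t t = 0" by (simp only: add_eq_0_iff)
    then have "vscale 2 (amul A t t) = 0" by (simp add: fun_eq_iff vec_apply)
    then have z: "amul A t t = 0" using two by simp
    from superimp_unit[OF cA one_closed t] obtain y where "y \<in> V A" "amul A t y = aone A" by blast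
    then have "amul A (amul A t t) y = t" using T(1) A by (simp add: galg_simps)
    then show False using z T(2) by (simp add: galg_simps[OF A])
  qed
  have "amul A t v = amul A v t" for v using T(4)[of v] nd by (simp add: galg_simps[OF A])
  from cs_center[OF cA T(1) this] obtain c where "t = vscale c (aone A)" by blast
  then show "\<exists>c. c \<noteq> 0 \<and> t = vscale c (aone A)" using T(2) by auto
qed

text \<open>The quotient of two such elements super-implements the identity.\<close>

lemma superimp_unique:
  assumes cA: "cs A" and g: "g \<in> carrier G" and x: "superimp A g d x" and y: "superimp A g e y"
  shows "d = e" "\<exists>c. c \<noteq> 0 \<and> y = vscale c x"
proof -
  have A: "galg A" using cA by simp
  from superimp_unit[OF cA g x] obtain x' where x': "x' \<in> V A" "amul A x x' = aone A" "amul A x' x = aone A" by blast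
  have "superimp A (inv g \<otimes> g) (d \<noteq> e) (amul A x' y)"
    by (rule superimp_mult[OF cA _ g superimp_inverse[OF cA g x x'] y]) (use g in simp)
  then have t: "superimp A \<one> (d \<noteq> e) (amul A x' y)" using g by simp
  show "d = e" using superimp_scalar(1)[OF cA t] by simp
  from superimp_scalar(2)[OF cA t] obtain c where c: "c \<noteq> 0" "amul A x' y = vscale c (aone A)" by blast
  have "y = amul A (amul A x x') y" using x'(2) superimpD(1)[OF y] by (simp add: galg_simps[OF A])
  also have "\<dots> = amul A x (amul A x' y)" by (simp add: galg_simps[OF A])
  also have "\<dots> = vscale c x" using c(2) superimpD(1)[OF x] by (simp add: galg_simps[OF A])
  finally show "\<exists>c. c \<noteq> 0 \<and> y = vscale c x" using c(1) by blast
qed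

text \<open>By Skolem-Noether there is a unit \<open>x\<close> implementing \<open>g\<close>. As \<open>g\<close> and \<open>u\<close> commute, \<open>u x\<close> implements \<open>g\<close> too, so
  \<open>x\<close> is an eigenvector of \<open>u\<close>. If it is odd, multiplying it by an even unit implementing \<open>u\<close> gives an odd
  element implementing \<open>g \<otimes> u\<close>.\<close>

lemma superimp_exists:
  assumes cA: "cs A" and g: "g \<in> carrier G" shows "\<exists>d x. superimp A g d x"
proof -
  have A: "galg A" using cA by simp
  from action_inner[OF cA g] obtain x x' where x: "x \<in> V A" "x' \<in> V A" "amul A x x' = aone A" "amul A x' x = aone A"
    and c: "\<And>a. amul A x a = amul A (ac A g a) x" by blast
  have x0: "x \<noteq> 0" using x(3) cs_one_nonzero[OF cA] by (auto simp: galg_simps[OF A])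
  obtain z z' where z: "z \<in> V A" "z' \<in> V A" "amul A z z' = aone A" "ac A u z = z" "\<And>a. amul A z a = amul A (ac A u a) z"
    using grading_unit[OF cA] by metis
  have cu: "amul A (ac A u x) a = amul A (ac A g a) (ac A u x)" for a
  proof -
    have "amul A (ac A u x) a = ac A u (amul A x (ac A u a))" by (simp add: galg_simps[OF A])
    also have "\<dots> = ac A u (amul A (ac A g (ac A u a)) x)" using c by metis
    also have "\<dots> = amul A (ac A g a) (ac A u x)" using g by (simp add: galg_simps[OF A] u_central m_assoc)
    finally show ?thesis .
  qed
  let ?t = "amul A x' (ac A u x)"
  have cx': "amul A x' (ac A g a) = amul A a x'" for a
  proof -
    have "amul A x' (ac A g a) = amul A x' (amul A (amul A (ac A g a) x) x')"
      using x(3) A by (simp add: galg_simps)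
    also have "\<dots> = amul A x' (amul A (amul A x a) x')" using c by metis
    also have "\<dots> = amul A (amul A x' x) (amul A a x')" by (simp add: galg_simps[OF A])
    finally show ?thesis using x(4) A by (simp add: galg_simps)
  qed
  have "amul A ?t v = amul A v ?t" for v
  proof -
    have "amul A ?t v = amul A x' (amul A (ac A u x) v)" by (simp add: galg_simps[OF A])
    also have "\<dots> = amul A x' (amul A (ac A g v) (ac A u x))" using cu by metis
    also have "\<dots> = amul A (amul A x' (ac A g v)) (ac A u x)" by (simp add: galg_simps[OF A])
    also have "\<dots> = amul A (amul A v x') (ac A u x)" using cx' by metis
    finally show ?thesis by (simp add: galg_simps[OF A])
  qed
  from cs_center[OF cA _ this] A obtain l where l: "?t = vscale l (aone A)" by auto
  have "ac A u x = amul A (amul A x x') (ac A u x)" using x(3) A by (simp add: galg_simps)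
  also have "\<dots> = amul A x ?t" by (simp add: galg_simps[OF A])
  finally have ux: "ac A u x = vscale l x" using l x(1) by (simp add: galg_simps[OF A])
  have "x = ac A u (ac A u x)" using x(1) by (simp add: galg_simps[OF A])
  also have "\<dots> = vscale (l * l) x" by (simp add: ux galg_simps(19)[OF A])
  finally have "vscale (l * l) x = vscale 1 x" by simp
  then have "l * l = 1" using x0 by (simp only: fv.scale_cancel_right simp_thms)
  then have "l = 1 \<or> l = - 1" by (simp add: square_eq_1_iff)
  then show ?thesis
  proof
    assume "l = 1"
    then have "superimp A g False x" using x(1) x0 ux c by (simp add: superimp_def)
    then show ?thesis by blast
  next
    assume l: "l = - 1"
    have "amul A (amul A x z) a = amul A (ac A (g \<otimes> u) a) (amul A x z)" for a
    proof -
      have "amul A (amul A x z) a = amul A x (amul A (ac A u a) z)" using z(5)[of a] by (simp add: galg_simps[OF A])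
      also have "\<dots> = amul A (amul A x (ac A u a)) z" by (simp add: galg_simps[OF A])
      also have "amul A x (ac A u a) = amul A (ac A (g \<otimes> u) a) x" using c[of "ac A u a"] g by (simp only: galg_simps[OF A] u_closed)
      finally show ?thesis by (simp add: galg_simps[OF A])
    qed
    moreover have "amul A x z \<noteq> 0"
    proof
      assume "amul A x z = 0"
      then have "amul A (amul A x z) z' = 0" by (simp add: galg_simps[OF A])
      then show False using x0 x(1) z(3) by (simp add: galg_simps[OF A])
    qed
    moreover have "ac A u (amul A x z) = vscale (sg True) (amul A x z)"
      by (simp add: galg_simps[OF A] ux z(4) l)
    ultimately have "superimp A g True (amul A x z)" using A by (simp add: superimp_def)
    then show ?thesis by blast
  qed
qed

text \<open>A system of super-implementing units, their degrees, and the cocycle by which they fail to be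
  multiplicative.\<close>

definition impl :: "('i, 'k, 'g) hmalg \<Rightarrow> ('g \<Rightarrow> 'i \<Rightarrow> 'k) \<Rightarrow> ('g \<Rightarrow> bool) \<Rightarrow> ('g \<Rightarrow> 'g \<Rightarrow> 'k) \<Rightarrow> bool" where
  "impl A w d \<sigma> \<longleftrightarrow> (\<forall>g\<in>carrier G. superimp A g (d g) (w g)) \<and> w \<one> = aone A
     \<and> (\<forall>g\<in>carrier G. \<forall>h\<in>carrier G. amul A (w g) (w h) = vscale (\<sigma> g h) (w (g \<otimes> h)))
     \<and> (\<forall>g h. g \<notin> carrier G \<or> h \<notin> carrier G \<longrightarrow> \<sigma> g h = 1)"

lemma implD:
  assumes "impl A w d \<sigma>"
  shows "g \<in> carrier G \<Longrightarrow> superimp A g (d g) (w g)" "w \<one> = aone A"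
    "g \<in> carrier G \<Longrightarrow> h \<in> carrier G \<Longrightarrow> amul A (w g) (w h) = vscale (\<sigma> g h) (w (g \<otimes> h))"
    "g \<notin> carrier G \<or> h \<notin> carrier G \<Longrightarrow> \<sigma> g h = 1"
  using assms unfolding impl_def by blast+

lemma impl_exists:
  assumes cA: "cs A" shows "\<exists>w d \<sigma>. impl A w d \<sigma>"
proof -
  have "\<exists>p. superimp A g (fst p) (snd p) \<and> (g = \<one> \<longrightarrow> p = (False, aone A))" if "g \<in> carrier G" for g
    using superimp_exists[OF cA that] superimp_one[OF cA] by (cases "g = \<one>") auto
  then obtain p where p: "\<And>g. g \<in> carrier G \<Longrightarrow> superimp A g (fst (p g)) (snd (p g)) \<and> (g = \<one> \<longrightarrow> p g = (False, aone A))"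
    by metis
  let ?w = "\<lambda>g. snd (p g)" and ?d = "\<lambda>g. fst (p g)"
  have "\<exists>c. amul A (?w g) (?w h) = vscale c (?w (g \<otimes> h))" if "g \<in> carrier G" "h \<in> carrier G" for g h
  proof -
    have "superimp A (g \<otimes> h) (?d g \<noteq> ?d h) (amul A (?w g) (?w h))"
      using superimp_mult[OF cA that] p that by blast
    from superimp_unique(2)[OF cA _ _ this, of "?d (g \<otimes> h)" "?w (g \<otimes> h)"] p[of "g \<otimes> h"] that show ?thesis by auto
  qed
  then obtain c where c: "\<And>g h. g \<in> carrier G \<Longrightarrow> h \<in> carrier G \<Longrightarrow> amul A (?w g) (?w h) = vscale (c g h) (?w (g \<otimes> h))"
    by metis
  have "impl A ?w ?d (\<lambda>g h. if g \<in> carrier G \<and> h \<in> carrier G then c g h else 1)"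
    unfolding impl_def using p c p[OF one_closed] by auto
  then show ?thesis by blast
qed

text \<open>The element for \<open>u\<close> is even: if it were odd, it would implement \<open>u \<otimes> u = \<one>\<close>, so it would be central,
  hence a scalar, which is even. Commuting it past \<open>w(g)\<close> in two ways compares \<open>\<sigma>(u, g)\<close> with \<open>\<sigma>(g, u)\<close>.\<close>

lemma impl_cocycle:
  assumes cA: "cs A" and i: "impl A w d \<sigma>"
  shows "\<sigma> \<in> carrier Z" "g \<in> carrier G \<Longrightarrow> dgr \<sigma> g = d g"
proof -
  have A: "galg A" using cA by simp
  note D = implD[OF i] and S = superimpD[OF implD(1)[OF i]]
  have nz: "vscale a (w g) = vscale b (w g) \<longleftrightarrow> a = b" if "g \<in> carrier G" for a b g
    using S(2)[OF that] by simp
  show s: "\<sigma> \<in> carrier Z"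
  proof (rule ZI)
    show "\<sigma> g h = 1" if "g \<notin> carrier G \<or> h \<notin> carrier G" for g h using D(4)[OF that] .
    show "\<sigma> g h \<noteq> 0" if m: "g \<in> carrier G" "h \<in> carrier G" for g h
      using superimpD(2)[OF superimp_mult[OF cA m D(1)[OF m(1)] D(1)[OF m(2)]]] D(3)[OF m] by auto
    show "\<sigma> \<one> g = 1" if g: "g \<in> carrier G" for g
    proof -
      have "vscale (\<sigma> \<one> g) (w g) = vscale 1 (w g)"
        using D(3)[OF one_closed g] S(1)[OF g] g by (simp add: D(2) galg_simps[OF A])
      then show ?thesis using nz[OF g] by blast
    qed
    show "\<sigma> g \<one> = 1" if g: "g \<in> carrier G" for g
    proof -
      have "vscale (\<sigma> g \<one>) (w g) = vscale 1 (w g)"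
        using D(3)[OF g one_closed] S(1)[OF g] g by (simp add: D(2) galg_simps[OF A])
      then show ?thesis using nz[OF g] by blast
    qed
    fix g h l assume m: "g \<in> carrier G" "h \<in> carrier G" "l \<in> carrier G"
    have "amul A (amul A (w g) (w h)) (w l) = vscale (\<sigma> g h * \<sigma> (g \<otimes> h) l) (w (g \<otimes> h \<otimes> l))"
      using m by (simp only: D(3) galg_simps[OF A] m_closed fv.scale_scale)
    moreover have "amul A (w g) (amul A (w h) (w l)) = vscale (\<sigma> h l * \<sigma> g (h \<otimes> l)) (w (g \<otimes> h \<otimes> l))"
      using m by (simp only: D(3) galg_simps[OF A] m_closed fv.scale_scale m_assoc)
    ultimately show "\<sigma> g h * \<sigma> (g \<otimes> h) l = \<sigma> h l * \<sigma> g (h \<otimes> l)"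
      using nz[of "g \<otimes> h \<otimes> l"] m galgD(5)[OF A] by (metis m_closed)
  qed
  have du: "\<not> d u"
  proof
    assume du: "d u"
    have "amul A (w u) a = amul A a (w u)" for a
      using S(4)[OF u_closed, of a] du by (simp add: galg_simps[OF A])
    from cs_center[OF cA S(1)[OF u_closed] this] obtain c where "w u = vscale c (aone A)" by blast
    then have "ac A u (w u) = w u" by (simp add: galg_simps[OF A])
    then have "vscale (- 1) (w u) = vscale 1 (w u)" using S(3)[OF u_closed] du by simp
    then show False using nz[OF u_closed] one_neq_minus_one by metis
  qed
  assume g: "g \<in> carrier G"
  have "vscale (\<sigma> u g) (w (g \<otimes> u)) = amul A (w u) (w g)" using D(3)[OF u_closed g] u_central[OF g] by simp
  also have "\<dots> = amul A (ac A u (w g)) (w u)" using S(4)[OF u_closed, of "w g"] du by simp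
  also have "\<dots> = vscale (sg (d g) * \<sigma> g u) (w (g \<otimes> u))"
    using S(3)[OF g] D(3)[OF g u_closed] by (simp add: galg_simps[OF A])
  finally have "\<sigma> u g = sg (d g) * \<sigma> g u" using nz[of "g \<otimes> u"] g by simp
  then have "\<sigma> g u = sg (d g) * \<sigma> u g" by (auto simp: sg_def)
  then show "dgr \<sigma> g = d g" by (rule deg_eqI[OF s])
qed

text \<open>Two systems differ by scalars \<open>c(g)\<close>, and the cocycles by the coboundary of \<open>c\<close>.\<close>

lemma impl_unique:
  assumes cA: "cs A" and i: "impl A w d \<sigma>" and i': "impl A w' d' \<sigma>'"
  shows "coset \<sigma> = coset \<sigma>'"
proof -
  have A: "galg A" using cA by simp
  note D = implD[OF i] and D' = implD[OF i']
  have "\<exists>c. c \<noteq> 0 \<and> w' g = vscale c (w g)" if "g \<in> carrier G" for g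
    using superimp_unique(2)[OF cA that D(1)[OF that] D'(1)[OF that]] .
  then obtain c where c: "\<And>g. g \<in> carrier G \<Longrightarrow> c g \<noteq> 0 \<and> w' g = vscale (c g) (w g)" by metis
  have nz: "vscale a (w g) = vscale b (w g) \<longleftrightarrow> a = b" if "g \<in> carrier G" for a b g
    using superimpD(2)[OF D(1)[OF that]] by simp
  have c1: "c \<one> = 1"
  proof -
    have "vscale (c \<one>) (w \<one>) = vscale 1 (w \<one>)" using c[of \<one>] D(2) D'(2) by simp
    then show ?thesis using nz by blast
  qed
  have "\<sigma>' g h = cob c g h * \<sigma> g h" for g h
  proof (cases "g \<in> carrier G \<and> h \<in> carrier G")
    case True
    then have m: "g \<in> carrier G" "h \<in> carrier G" "g \<otimes> h \<in> carrier G" by auto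
    have "amul A (w' g) (w' h) = vscale (c g * c h * \<sigma> g h) (w (g \<otimes> h))"
      using m c by (simp add: galg_simps[OF A] D(3) mult_ac)
    moreover have "amul A (w' g) (w' h) = vscale (\<sigma>' g h * c (g \<otimes> h)) (w (g \<otimes> h))"
      using D'(3)[OF m(1,2)] c[OF m(3)] by simp
    ultimately have "\<sigma>' g h * c (g \<otimes> h) = c g * c h * \<sigma> g h" using nz[OF m(3)] by metis
    then show ?thesis using m c[OF m(3)] by (simp add: cob_def field_simps)
  next
    case False
    then show ?thesis using D(4) D'(4) by (auto simp: cob_def)
  qed
  then have "\<sigma>' = (\<lambda>g h. cob c g h * \<sigma> g h)" by (simp add: fun_eq_iff)
  moreover have "cob c \<in> Bd" unfolding Bd_cob using c c1 by blast
  ultimately show ?thesis using coset_eq impl_cocycle(1)[OF cA] i i' by blast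
qed

lemma impl_giso:
  assumes A: "galg A" and B: "galg B" and f: "ghom A B f" "bij_betw f (V A) (V B)" and i: "impl A w d \<sigma>"
  shows "impl B (\<lambda>g. f (w g)) d \<sigma>"
  unfolding impl_def
proof (intro conjI ballI allI impI)
  note D = implD[OF i] and F = ghomD[OF f(1)]
  show "f (w \<one>) = aone B" by (simp add: D(2) F(3))
  show "\<sigma> g h = 1" if "g \<notin> carrier G \<or> h \<notin> carrier G" for g h by (rule D(4)[OF that])
  fix g assume g: "g \<in> carrier G"
  note S = superimpD[OF D(1)[OF g]]
  show "amul B (f (w g)) (f (w h)) = vscale (\<sigma> g h) (f (w (g \<otimes> h)))" if "h \<in> carrier G" for h
    using D(3)[OF g that] by (simp add: F(4)[symmetric] vlin_scale[OF F(6)])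
  have "f (w g) \<noteq> 0"
  proof
    assume "f (w g) = 0"
    then have "f (w g) = f 0" by (simp add: vlin_zero[OF F(6)])
    then have "w g = 0" using f(2) S(1) unfolding bij_betw_def inj_on_def by simp
    then show False using S(2) by simp
  qed
  moreover have "amul B (f (w g)) b = amul B (ac B (if d g then g \<otimes> u else g) b) (f (w g))" for b
  proof -
    have "crop (basis B) b \<in> f ` V A" using f(2) by (simp add: bij_betw_def)
    then obtain a where a: "crop (basis B) b = f a" by blast
    have "f (amul A (w g) a) = f (amul A (ac A (if d g then g \<otimes> u else g) a) (w g))" using S(4)[of a] by simp
    then have "amul B (f (w g)) (f a) = amul B (ac B (if d g then g \<otimes> u else g) (f a)) (f (w g))"
      using g by (simp add: F(4,5))
    then show ?thesis using g unfolding a[symmetric] by (simp add: galg_simps[OF B])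
  qed
  ultimately show "superimp B g (d g) (f (w g))"
    unfolding superimp_def using S(3) F(2) F(5)[OF u_closed, of "w g"] by (simp add: vlin_scale[OF F(6)])
qed

lemma superimp_bp:
  assumes A: "galg A" and B: "galg B" and g: "g \<in> carrier G"
    and x: "superimp A g d x" and y: "superimp B g e y"
  shows "superimp (bp A B) g (d \<noteq> e) (tens x y)"
proof -
  note X = superimpD[OF x] and Y = superimpD[OF y]
  note P = galg_bp[OF A B]
  have "tens x y \<noteq> 0"
  proof
    assume z: "tens x y = 0"
    obtain i j where "x i \<noteq> 0" "y j \<noteq> 0" using X(2) Y(2) by (auto simp: fun_eq_iff vec_apply)
    moreover have "x i * y j = 0" using fun_cong[OF z, of "(i, j)"] by (simp add: tens_def vec_apply)
    ultimately show False by simp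
  qed
  moreover have "ac (bp A B) u (tens x y) = vscale (sg (d \<noteq> e)) (tens x y)"
    by (simp add: bp_ac[OF A B] X(3) Y(3) tens_simps sg_mult mult.commute)
  moreover have "amul (bp A B) (tens x y) s = amul (bp A B) (ac (bp A B) (if d \<noteq> e then g \<otimes> u else g) s) (tens x y)" for s
  proof -
    let ?k = "if d \<noteq> e then g \<otimes> u else g"
    have k: "?k \<in> carrier G" using g by simp
    have ug: "u \<otimes> g = g \<otimes> u" "g \<otimes> u \<otimes> u = g" "u \<otimes> (g \<otimes> u) = g"
    proof -
      show "u \<otimes> g = g \<otimes> u" by (rule u_central[OF g])
      show guu: "g \<otimes> u \<otimes> u = g" using m_assoc[OF g u_closed u_closed] u_sq r_one[OF g] by simp
      show "u \<otimes> (g \<otimes> u) = g" using u_central[OF m_closed[OF g u_closed]] guu by simp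
    qed
    have "amul (bp A B) (tens x y) = (\<lambda>s. amul (bp A B) (ac (bp A B) ?k s) (tens x y))"
    proof (rule tlin_ext_prod_fun[OF bp_tlin_right[OF A B]])
      show "tlin (basis A \<times> basis B) (\<lambda>s. amul (bp A B) (ac (bp A B) ?k s) (tens x y))"
        by (rule tlin_comp[OF tlin_vlin[OF bp_tlin_left[OF A B]] bp_tlin_ac[OF A B k]])
      fix i j
      show "amul (bp A B) (tens x y) (tens (bvec i) (bvec j))
          = amul (bp A B) (ac (bp A B) ?k (tens (bvec i) (bvec j))) (tens x y)"
        using g ug X(4)[of "bvec i"] X(4)[of "ac A u (bvec i)"] Y(4)[of "bvec j"]
        by (cases d; cases e)
          (simp_all add: bp_mul[OF A B] bp_ac[OF A B] X(3) Y(3) tens_simps galg_simps[OF A] galg_simps[OF B] fv.scale_right_distrib fv.scale_right_diff_distrib)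
    qed
    then show ?thesis by (rule fun_cong)
  qed
  ultimately show ?thesis unfolding superimp_def using X(1) Y(1) by simp
qed

text \<open>Multiplying \<open>w(g) \<otimes> v(g)\<close> with \<open>w(h) \<otimes> v(h)\<close> gives the sign \<open>(-1)\<^bsup>e(g) d(h)\<^esup>\<close>. Rescaling by
  \<open>(-1)\<^bsup>d(g) e(g)\<^esup>\<close>, whose coboundary is \<open>(-1)\<^bsup>d(g) e(h) + e(g) d(h)\<^esup>\<close>, turns it into
  \<open>(-1)\<^bsup>d(g) e(h)\<^esup>\<close>, the sign in the definition of \<open>\<sharp>\<close> for cocycles.\<close>

lemma impl_bp:
  assumes cA: "cs A" and cB: "cs B" and i: "impl A w d \<sigma>" and j: "impl B v e \<omega>"
  shows "impl (bp A B) (\<lambda>g. vscale (sg (d g \<and> e g)) (tens (w g) (v g))) (\<lambda>g. d g \<noteq> e g) (\<sigma> \<otimes>\<^bsub>Zs\<^esub> \<omega>)"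
  unfolding impl_def
proof (intro conjI ballI allI impI)
  have A: "galg A" and B: "galg B" using cA cB by auto
  note D = implD[OF i] and E = implD[OF j]
  note P = galg_bp[OF A B]
  note sZ = impl_cocycle(1)[OF cA i] and oZ = impl_cocycle(1)[OF cB j]
  have dd: "dgr \<sigma> g = d g" and ee: "dgr \<omega> g = e g" if "g \<in> carrier G" for g
    using impl_cocycle(2)[OF cA i that] impl_cocycle(2)[OF cB j that] by auto
  have d1: "\<not> d \<one>" "\<not> e \<one>" using dd[of \<one>] ee[of \<one>] deg_special(2) sZ oZ by auto
  show "vscale (sg (d \<one> \<and> e \<one>)) (tens (w \<one>) (v \<one>)) = aone (bp A B)" using d1 by (simp add: D(2) E(2))
  show "(\<sigma> \<otimes>\<^bsub>Zs\<^esub> \<omega>) g h = 1" if "g \<notin> carrier G \<or> h \<notin> carrier G" for g h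
    using ZD(1)[OF sharp_closed(1)[OF sZ oZ] that] .
  fix g assume g: "g \<in> carrier G"
  show "superimp (bp A B) g (d g \<noteq> e g) (vscale (sg (d g \<and> e g)) (tens (w g) (v g)))"
    by (rule superimp_scale[OF P superimp_bp[OF A B g D(1)[OF g] E(1)[OF g]]]) simp
  fix h assume h: "h \<in> carrier G"
  note gh = m_closed[OF g h]
  have dm: "d (g \<otimes> h) = (d g \<noteq> d h)" "e (g \<otimes> h) = (e g \<noteq> e h)"
    using deg_mult[OF sZ g h] deg_mult[OF oZ g h] dd ee g h gh by simp_all
  have "amul (bp A B) (tens (w g) (v g)) (tens (w h) (v h)) = vscale (sg (e g \<and> d h) * (\<sigma> g h * \<omega> g h)) (tens (w (g \<otimes> h)) (v (g \<otimes> h)))"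
    using superimpD(3)[OF D(1)[OF h]] superimpD(3)[OF E(1)[OF g]] D(3)[OF g h] E(3)[OF g h]
    by (cases "d h"; cases "e g") (simp_all add: bp_mul[OF A B] galg_simps[OF A] galg_simps[OF B] tens_simps,
        (simp_all add: fun_eq_iff lincomb)?)
  then show "amul (bp A B) (vscale (sg (d g \<and> e g)) (tens (w g) (v g))) (vscale (sg (d h \<and> e h)) (tens (w h) (v h)))
      = vscale ((\<sigma> \<otimes>\<^bsub>Zs\<^esub> \<omega>) g h) (vscale (sg (d (g \<otimes> h) \<and> e (g \<otimes> h))) (tens (w (g \<otimes> h)) (v (g \<otimes> h))))"
    using g h by (auto simp: galg_simps[OF P] sharp_eq[OF sZ oZ] dm dd ee sg_def)
qed

lemma impl_EndG:
  assumes w: "grep I w" shows "impl (EndG I w) w (\<lambda>_. False) (\<lambda>_ _. 1)"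
  unfolding impl_def
proof (intro conjI ballI allI impI)
  note D = grepD[OF w]
  show "w \<one> = aone (EndG I w)" using D by simp
  fix g assume g: "g \<in> carrier G"
  show "amul (EndG I w) (w g) (w h) = vscale 1 (w (g \<otimes> h))" if "h \<in> carrier G" for h using D(4)[OF g that] by simp
  have "w g \<noteq> 0"
  proof
    assume "w g = 0"
    then have "idm I = (0 :: _ \<Rightarrow> 'k)" using D(4)[OF g inv_closed[OF g]] D(5) g by (simp add: mm_rules)
    then show False using galg_one_nonzero[OF galg_EndG[OF w]] D(2) by simp
  qed
  moreover have "u \<otimes> (g \<otimes> u) = g" using g u_central[OF g] by (metis m_assoc r_one u_closed u_sq)
  ultimately have x: "w g \<in> V (EndG I w)" "w g \<noteq> 0" "ac (EndG I w) u (w g) = vscale (sg False) (w g)"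
    using g D(3)[OF g] by (simp_all add: D(4))
  have comm: "amul (EndG I w) (w g) a = amul (EndG I w) (ac (EndG I w) (if False then g \<otimes> u else g) a) (w g)" for a
  proof -
    have "amul (EndG I w) (ac (EndG I w) g a) (w g) = mm I (w g) (mm I a (mm I (w (inv g)) (w g)))"
      using g by (simp add: mm_assoc)
    also have "\<dots> = mm I (w g) a" using g by (simp add: D(4,5) mm_idm[OF D(1)] mm_crop)
    finally show ?thesis by simp
  qed
  show "superimp (EndG I w) g False (w g)"
    unfolding superimp_def using x comm by blast
qed simp

lemma impl_beq:
  assumes AB: "beq A B" and cA: "cs A" and cB: "cs B" and i: "impl A w d \<sigma>" and j: "impl B v e \<omega>"
  shows "coset \<sigma> = coset \<omega>"
proof -
  from AB obtain I J :: "nat set" and x y where x: "grep I x" and y: "grep J y"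
    and iso: "giso (bp A (EndG I x)) (bp B (EndG J y))" unfolding beq_def by blast
  from iso obtain f where f: "ghom (bp A (EndG I x)) (bp B (EndG J y)) f" "bij_betw f (V (bp A (EndG I x))) (V (bp B (EndG J y)))"
    unfolding giso_def by blast
  note E = cs_EndG[OF x] cs_EndG[OF y]
  note P = cs_bp[OF cA E(1)] cs_bp[OF cB E(2)]
  note iP = impl_bp[OF cA E(1) i impl_EndG[OF x]] and jP = impl_bp[OF cB E(2) j impl_EndG[OF y]]
  have "\<sigma> \<otimes>\<^bsub>Zs\<^esub> (\<lambda>_ _. 1) = \<sigma>" "\<omega> \<otimes>\<^bsub>Zs\<^esub> (\<lambda>_ _. 1) = \<omega>"
    using sharp_eq[OF impl_cocycle(1)[OF cA i] Z_one_closed] sharp_eq[OF impl_cocycle(1)[OF cB j] Z_one_closed]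
    by (simp_all add: deg_one)
  with impl_unique[OF P(2) impl_giso[OF cs_galg[OF P(1)] cs_galg[OF P(2)] f iP] jP]
  show ?thesis by simp
qed

end

lemma mat_of_cong_bvec: "(\<And>i. i \<in> I \<Longrightarrow> S (bvec i) = T (bvec i)) \<Longrightarrow> mat_of I S = mat_of I T"
  by (auto simp: mat_of_def fun_eq_iff)

context central_involution begin

section \<open>Every class of cocycles is attained\<close>

text \<open>Conjugation ignores scalars, so a projective representation makes a matrix algebra a
  \<open>G\<close>-algebra.\<close>

lemma galg_projective:
  fixes w :: "'g \<Rightarrow> 'i \<times> 'i \<Rightarrow> 'k"
  assumes I: "finite I" and w1: "w \<one> = idm I" and wV: "\<And>g. g \<in> carrier G \<Longrightarrow> w g \<in> vspace (I \<times> I)"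
    and mult: "\<And>g h. g \<in> carrier G \<Longrightarrow> h \<in> carrier G \<Longrightarrow> \<exists>c. c \<noteq> 0 \<and> mm I (w g) (w h) = vscale c (w (g \<otimes> h))"
  obtains w' where "galg (matalg I w w')"
    "\<And>g. g \<in> carrier G \<Longrightarrow> mm I (w g) (w' g) = idm I" "\<And>g. g \<in> carrier G \<Longrightarrow> mm I (w' g) (w g) = idm I"
proof -
  have "\<exists>y\<in>vspace (I \<times> I). mm I (w g) y = idm I \<and> mm I y (w g) = idm I" if g: "g \<in> carrier G" for g
  proof -
    note ig = inv_closed[OF g]
    obtain a where a: "a \<noteq> 0" "mm I (w g) (w (inv g)) = vscale a (w \<one>)" using mult[OF g ig] g by auto
    obtain b where b: "b \<noteq> 0" "mm I (w (inv g)) (w g) = vscale b (w \<one>)" using mult[OF ig g] g by auto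
    let ?y = "vscale (inverse a) (w (inv g))" and ?z = "vscale (inverse b) (w (inv g))"
    have y: "mm I (w g) ?y = idm I" and z: "mm I ?z (w g) = idm I"
      using a b by (simp_all add: mm_scale w1)
    have "?z = mm I ?z (mm I (w g) ?y)" using wV[OF ig] by (simp add: y mm_idm[OF I])
    also have "\<dots> = mm I (mm I ?z (w g)) ?y" by (simp only: mm_assoc)
    also have "\<dots> = ?y" unfolding z using wV[OF ig] by (simp add: mm_idm[OF I])
    finally have "mm I ?y (w g) = idm I" using z by (simp only:)
    with y show ?thesis using wV[OF ig] by (intro bexI[of _ ?y] conjI vspace_scale)
  qed
  then obtain w' where w': "\<And>g. g \<in> carrier G \<Longrightarrow> w' g \<in> vspace (I \<times> I)"
    "\<And>g. g \<in> carrier G \<Longrightarrow> mm I (w g) (w' g) = idm I" "\<And>g. g \<in> carrier G \<Longrightarrow> mm I (w' g) (w g) = idm I"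
    by metis
  have uniq: "w' g = y" if "g \<in> carrier G" "y \<in> vspace (I \<times> I)" "mm I (w g) y = idm I" for g y
  proof -
    have "w' g = mm I (w' g) (mm I (w g) y)" using that w'(1) by (simp add: mm_idm[OF I])
    also have "\<dots> = mm I (mm I (w' g) (w g)) y" by (simp only: mm_assoc)
    finally show ?thesis using that w'(3) by (simp add: mm_idm[OF I])
  qed
  have w'1: "w' \<one> = idm I" by (rule uniq) (simp_all add: w1 mm_idm[OF I])
  have "galg (matalg I w w')"
  proof (rule galg_matalg[OF I w'(3,2)])
    show "mm I (w \<one>) (mm I T (w' \<one>)) = T" if "T \<in> vspace (I \<times> I)" for T
      using that by (simp add: w1 w'1 mm_idm[OF I])
    fix g h and T :: "'i \<times> 'i \<Rightarrow> 'k" assume g: "g \<in> carrier G" and h: "h \<in> carrier G"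
    obtain c where c: "c \<noteq> 0" "mm I (w g) (w h) = vscale c (w (g \<otimes> h))" using mult[OF g h] by blast
    have wgh: "w (g \<otimes> h) = vscale (inverse c) (mm I (w g) (w h))" using c by simp
    have w'gh: "w' (g \<otimes> h) = vscale c (mm I (w' h) (w' g))"
    proof (rule uniq)
      have "mm I (mm I (w g) (w h)) (mm I (w' h) (w' g)) = mm I (w g) (mm I (mm I (w h) (w' h)) (w' g))"
        by (simp only: mm_assoc)
      also have "\<dots> = idm I" using g h w'(1,2) by (simp add: mm_idm[OF I])
      finally show "mm I (w (g \<otimes> h)) (vscale c (mm I (w' h) (w' g))) = idm I"
        using c(1) by (simp add: wgh mm_scale)
    qed (use g h in simp_all)
    show "mm I (w (g \<otimes> h)) (mm I T (w' (g \<otimes> h))) = mm I (w g) (mm I (mm I (w h) (mm I T (w' h))) (w' g))"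
      unfolding wgh w'gh using c(1) by (simp add: mm_scale mm_assoc)
  qed auto
  then show thesis using that w' by blast
qed

text \<open>Left multiplication in the twisted group algebra of \<open>\<sigma>\<close>.\<close>

lemma twisted_regular:
  assumes s: "\<sigma> \<in> carrier Z"
  obtains L where "\<And>g. L g \<in> vspace (carrier G \<times> carrier G)" "L \<one> = idm (carrier G)"
    "\<And>g h. g \<in> carrier G \<Longrightarrow> h \<in> carrier G \<Longrightarrow> mm (carrier G) (L g) (L h) = vscale (\<sigma> g h) (L (g \<otimes> h))"
proof -
  let ?C = "carrier G"
  let ?T = "\<lambda>g. linext ?C (\<lambda>h. vscale (\<sigma> g h) (bvec (g \<otimes> h)))"
  let ?L = "\<lambda>g. mat_of ?C (?T g)"
  have b: "?T g (bvec h) = vscale (\<sigma> g h) (bvec (g \<otimes> h))" if "h \<in> ?C" for g h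
    using that fin by (simp add: linext_bvec)
  have TV: "?T g v \<in> vspace ?C" if "g \<in> ?C" for g v
    using that by (simp add: linext_sum)
  have "?L \<one> = idm ?C" by (rule mat_of_cong_bvec, subst b) (simp_all add: ZD(4)[OF s])
  moreover have "mm ?C (?L g) (?L h) = vscale (\<sigma> g h) (?L (g \<otimes> h))" if g: "g \<in> ?C" and h: "h \<in> ?C" for g h
  proof -
    have "mm ?C (?L g) (?L h) = mat_of ?C (\<lambda>v. ?T g (?T h v))"
      by (rule mm_mat_of[OF fin tlin_linext[OF fin] TV[OF h]])
    also have "\<dots> = mat_of ?C (\<lambda>v. vscale (\<sigma> g h) (?T (g \<otimes> h) v))"
    proof (rule mat_of_cong_bvec)
      fix l assume l: "l \<in> ?C"
      have "?T g (?T h (bvec l)) = vscale (\<sigma> h l) (?T g (bvec (h \<otimes> l)))"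
        by (simp only: b[OF l] vlin_scale[OF vlin_linext])
      also have "\<dots> = vscale (\<sigma> h l * \<sigma> g (h \<otimes> l)) (bvec (g \<otimes> (h \<otimes> l)))"
        using h l by (simp add: b)
      also have "\<dots> = vscale (\<sigma> g h * \<sigma> (g \<otimes> h) l) (bvec (g \<otimes> h \<otimes> l))"
        using ZD(3)[OF s g h l] g h l by (simp add: m_assoc)
      finally show "?T g (?T h (bvec l)) = vscale (\<sigma> g h) (?T (g \<otimes> h) (bvec l))" using l by (simp add: b)
    qed
    finally show ?thesis by (simp add: mat_of_scale)
  qed
  ultimately show thesis using that[of ?L] by simp
qed

text \<open>Let \<open>L\<close> be the twisted regular representation. Conjugation by \<open>L(g)\<close> is the wrong action when \<open>g\<close> is
  odd, since an odd implementing element must implement \<open>g \<otimes> u\<close>; so \<open>g\<close> acts by conjugation with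
  \<open>L(g) L(u)\<close> in that case. Then \<open>u\<close> acts by conjugation with \<open>L(u)\<close>, and \<open>L(u) L(g) = (-1)\<^bsup>|g|\<^esup> L(g) L(u)\<close>
  says that \<open>L(g)\<close> has the right degree.\<close>

lemma impl_surjective:
  assumes s: "\<sigma> \<in> carrier Z"
  shows "\<exists>(A :: (nat, 'k, 'g) hmalg) w. cs A \<and> impl A w (dgr \<sigma>) \<sigma>"
proof -
  let ?C = "carrier G"
  obtain L where LV: "\<And>g. L g \<in> vspace (?C \<times> ?C)" and L1: "L \<one> = idm ?C"
    and LL: "\<And>g h. g \<in> ?C \<Longrightarrow> h \<in> ?C \<Longrightarrow> mm ?C (L g) (L h) = vscale (\<sigma> g h) (L (g \<otimes> h))"
    using twisted_regular[OF s] by blast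
  note nz = ZD(2)[OF s] and dm = deg_mult[OF s] and d0 = deg_special[OF s]
  have sgu: "\<sigma> g u = sg (dgr \<sigma> g) * \<sigma> u g" for g
    using theta_sign[OF s, of g] nz by (simp add: theta_def field_simps)
  have uL: "mm ?C (L u) (L h) = vscale (sg (dgr \<sigma> h)) (mm ?C (L h) (L u))" if h: "h \<in> ?C" for h
  proof -
    have "sg (dgr \<sigma> h) * \<sigma> h u = sg (dgr \<sigma> h) * sg (dgr \<sigma> h) * \<sigma> u h" by (simp only: sgu mult.assoc)
    then show ?thesis using h by (simp add: LL u_central)
  qed
  have Luu: "mm ?C (L u) (L u) = vscale (\<sigma> u u) (idm ?C)" by (simp add: LL u_sq L1)
  \<comment> \<open>The matrices by which \<open>G\<close> acts; \<open>L\<close> itself is the implementing system.\<close>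
  define w where "w g = (if dgr \<sigma> g then mm ?C (L g) (L u) else L g)" for g
  have w1: "w \<one> = idm ?C" and wu: "w u = L u" by (simp_all add: w_def d0 L1)
  have uLa: "mm ?C (L u) (mm ?C (L h) T) = vscale (sg (dgr \<sigma> h)) (mm ?C (L h) (mm ?C (L u) T))"
    if h: "h \<in> ?C" for h T
    using arg_cong[OF uL[OF h], of "\<lambda>S. mm ?C S T"] by (simp add: mm_assoc mm_scale)
  have LLa: "mm ?C (L g) (mm ?C (L h) T) = vscale (\<sigma> g h) (mm ?C (L (g \<otimes> h)) T)"
    if "g \<in> ?C" "h \<in> ?C" for g h T
    using arg_cong[OF LL[OF that], of "\<lambda>S. mm ?C S T"] by (simp add: mm_assoc mm_scale)
  have ww: "\<exists>c. c \<noteq> 0 \<and> mm ?C (w g) (w h) = vscale c (w (g \<otimes> h))" if g: "g \<in> ?C" and h: "h \<in> ?C" for g h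
  proof -
    have c: "mm ?C (w g) (w h) = vscale ((if dgr \<sigma> g \<and> dgr \<sigma> h then - \<sigma> u u else 1) * \<sigma> g h) (w (g \<otimes> h))"
    proof (cases "dgr \<sigma> g"; cases "dgr \<sigma> h")
      assume d: "dgr \<sigma> g" "dgr \<sigma> h"
      have "mm ?C (w g) (w h) = mm ?C (L g) (mm ?C (L u) (mm ?C (L h) (L u)))" using d by (simp add: w_def mm_assoc)
      also have "\<dots> = vscale (- 1) (mm ?C (L g) (mm ?C (L h) (mm ?C (L u) (L u))))"
        by (simp only: uLa[OF h] d sg_simps mm_scale)
      also have "\<dots> = vscale (- \<sigma> u u) (mm ?C (L g) (L h))"
        using LV[of h] by (simp only: Luu mm_scale mm_idm[OF fin] crop_id) simp
      finally show ?thesis using d g h by (simp add: w_def dm LL)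
    next
      assume "dgr \<sigma> g" "\<not> dgr \<sigma> h"
      then show ?thesis using g h by (simp add: w_def dm mm_assoc uL LLa)
    next
      assume d: "\<not> dgr \<sigma> g" "dgr \<sigma> h"
      have "w g = L g" "w h = mm ?C (L h) (L u)" "w (g \<otimes> h) = mm ?C (L (g \<otimes> h)) (L u)"
        using d by (simp_all add: w_def dm[OF g h])
      then show ?thesis using d LLa[OF g h, of "L u"] by (simp only: simp_thms if_False mult_1)
    next
      assume "\<not> dgr \<sigma> g" "\<not> dgr \<sigma> h"
      then show ?thesis using LL[OF g h] by (simp add: w_def dm[OF g h])
    qed
    have "(if dgr \<sigma> g \<and> dgr \<sigma> h then - \<sigma> u u else 1) * \<sigma> g h \<noteq> 0" using nz by simp
    with c show ?thesis by blast
  qed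
  have wV: "w g \<in> vspace (?C \<times> ?C)" for g using LV by (simp add: w_def)
  obtain w' where M: "galg (matalg ?C w w')" and i1: "\<And>g. g \<in> ?C \<Longrightarrow> mm ?C (w g) (w' g) = idm ?C"
    and i2: "\<And>g. g \<in> ?C \<Longrightarrow> mm ?C (w' g) (w g) = idm ?C"
    using galg_projective[OF fin w1 wV ww] by blast
  let ?A = "matalg ?C w w'"
  have ne: "?C \<noteq> {}" using one_closed by blast
  have cA: "cs ?A" by (rule cs_matalg[OF M fin ne])
  have comm: "amul ?A x a = amul ?A (ac ?A k a) x"
    if k: "k \<in> ?C" and c: "c \<noteq> 0" "w k = vscale c x" for k c x a
  proof -
    have x: "x = vscale (inverse c) (w k)" using c by simp
    have "mm ?C (mm ?C (w k) (mm ?C a (w' k))) (w k) = mm ?C (w k) (mm ?C a (mm ?C (w' k) (w k)))"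
      by (simp only: mm_assoc)
    also have "\<dots> = mm ?C (w k) a" by (simp only: i2[OF k] mm_idm[OF fin] mm_crop)
    finally show ?thesis using k by (simp only: matalg_simps x mm_scale)
  qed
  have "impl ?A L (dgr \<sigma>) \<sigma>"
    unfolding impl_def
  proof (intro conjI ballI allI impI)
    show "L \<one> = aone ?A" by (simp add: L1)
    show "\<sigma> g h = 1" if "g \<notin> ?C \<or> h \<notin> ?C" for g h by (rule ZD(1)[OF s that])
    fix g assume g: "g \<in> ?C"
    show "amul ?A (L g) (L h) = vscale (\<sigma> g h) (L (g \<otimes> h))" if "h \<in> ?C" for h using LL[OF g that] by simp
    have L0: "L g \<noteq> 0"
    proof
      assume "L g = 0"
      then have "vscale (\<sigma> g (inv g)) (idm ?C) = 0" using LL[OF g inv_closed[OF g]] g L1 by (simp add: mm_rules)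
      then have "aone ?A = 0" using nz by simp
      then show False using cs_one_nonzero[OF cA] by blast
    qed
    have uLg: "ac ?A u (L g) = vscale (sg (dgr \<sigma> g)) (L g)"
    proof -
      have "mm ?C (L u) (w' u) = idm ?C" using i1[OF u_closed] by (simp add: wu)
      then show ?thesis using LV[of g] by (simp add: wu uLa[OF g] mm_idm[OF fin])
    qed
    let ?k = "if dgr \<sigma> g then g \<otimes> u else g"
    have "\<exists>c. c \<noteq> 0 \<and> w ?k = vscale c (L g)"
    proof (cases "dgr \<sigma> g")
      case True
      have "vscale (\<sigma> g u) (w (g \<otimes> u)) = mm ?C (mm ?C (L g) (L u)) (L u)"
        using True g by (simp add: w_def dm d0 LL mm_scale)
      also have "\<dots> = vscale (\<sigma> u u) (L g)" using LV[of g] by (simp add: mm_assoc Luu mm_scale mm_idm[OF fin])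
      finally have "vscale (inverse (\<sigma> g u)) (vscale (\<sigma> g u) (w (g \<otimes> u))) = vscale (inverse (\<sigma> g u) * \<sigma> u u) (L g)" by simp
      then have "w (g \<otimes> u) = vscale (inverse (\<sigma> g u) * \<sigma> u u) (L g)" using nz by simp
      then show ?thesis using True nz by (intro exI[of _ "inverse (\<sigma> g u) * \<sigma> u u"]) simp
    qed (auto simp: w_def intro: exI[of _ 1])
    then obtain c where c: "c \<noteq> 0" "w ?k = vscale c (L g)" by blast
    have k: "?k \<in> ?C" using g by simp
    show "superimp ?A g (dgr \<sigma> g) (L g)"
      unfolding superimp_def using L0 LV[of g] uLg comm[OF k c] by simp
  qed
  moreover obtain B :: "(nat, 'k, 'g) hmalg" where B: "cs B" "giso ?A B" using nat_copy[OF M] giso_cs[OF _ cA] by metis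
  ultimately show ?thesis using impl_giso[OF cs_galg[OF cA] cs_galg[OF B(1)]] B unfolding giso_def by blast
qed

section \<open>The kernel\<close>

lemma impl_trivact:
  assumes cA: "cs A" and t: "trivact A" shows "impl A (\<lambda>_. aone A) (\<lambda>_. False) (\<lambda>_ _. 1)"
proof -
  have A: "galg A" using cA by simp
  have "superimp A g False (aone A)" if "g \<in> carrier G" for g
    unfolding superimp_def using that cs_one_nonzero[OF cA] t A by (simp add: trivact_def galg_simps[OF A])
  then show ?thesis using A by (simp add: impl_def galg_simps[OF A])
qed

text \<open>Dividing the implementing units by a cochain with coboundary \<open>\<sigma>\<close> makes them multiplicative; they are
  even because coboundaries have degree zero.\<close>

lemma impl_coboundary:
  assumes cA: "cs A" and i: "impl A w d \<sigma>" and c: "coset \<sigma> = coset (\<lambda>_ _. 1)"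
  shows "\<exists>v. impl A v (\<lambda>_. False) (\<lambda>_ _. 1)"
proof -
  have A: "galg A" using cA by simp
  note D = implD[OF i] and s = impl_cocycle[OF cA i]
  have "\<sigma> \<in> Bd" using c coset_eq[OF Z_one_closed s(1)] by auto
  then obtain \<gamma> where \<gamma>: "\<sigma> = cob \<gamma>" "\<And>g. g \<in> carrier G \<Longrightarrow> \<gamma> g \<noteq> 0" "\<gamma> \<one> = 1" unfolding Bd_cob by blast
  have d: "\<not> d g" if "g \<in> carrier G" for g using s(2)[OF that] Bd_closed(2)[OF \<open>\<sigma> \<in> Bd\<close>] by simp
  let ?v = "\<lambda>g. vscale (inverse (\<gamma> g)) (w g)"
  have "impl A ?v (\<lambda>_. False) (\<lambda>_ _. 1)"
    unfolding impl_def
  proof (intro conjI ballI allI impI)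
    show "?v \<one> = aone A" by (simp add: \<gamma>(3) D(2))
    fix g assume g: "g \<in> carrier G"
    show "superimp A g False (?v g)" using superimp_scale[OF A D(1)[OF g]] \<gamma>(2)[OF g] d[OF g] by simp
    fix h assume h: "h \<in> carrier G"
    have "amul A (?v g) (?v h) = vscale (inverse (\<gamma> h) * (inverse (\<gamma> g) * cob \<gamma> g h)) (w (g \<otimes> h))"
      using D(3)[OF g h] by (simp add: galg_simps[OF A] \<gamma>(1))
    also have "inverse (\<gamma> h) * (inverse (\<gamma> g) * cob \<gamma> g h) = inverse (\<gamma> (g \<otimes> h))"
      using g h \<gamma>(2)[OF g] \<gamma>(2)[OF h] by (simp add: cob_def field_simps)
    finally show "amul A (?v g) (?v h) = vscale 1 (?v (g \<otimes> h))" by simp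
  qed simp
  then show ?thesis by blast
qed

lemma hop_trivact:
  assumes A: "galg A" and t: "trivact A" shows "hop A = op_alg A"
proof -
  have e: "amul (hop A) a b = amul A b a" for a b
    using t two by (simp add: hop_mul[OF A] trivact_def galg_simps[OF A])
  have "amul (hop A) = (\<lambda>a b. amul A b a)" by (rule ext, rule ext, rule e)
  then show ?thesis unfolding op_alg_def h_op_def by simp
qed

text \<open>The representation \<open>W\<close> is left multiplication by the implementing units. With it, the left multiplications
  form a copy of \<open>A\<close> in the endomorphism algebra, since \<open>g\<close> acts on \<open>A\<close> by conjugation, and the right
  multiplications are fixed by \<open>G\<close>, so they form a copy of the opposite of \<open>A\<close> with trivial action. The
  two copies commute, and fixed elements are even, so they also supercommute.\<close>

lemma untwisted_inverse:
  assumes cA: "cs A" and i: "impl A w (\<lambda>_. False) (\<lambda>_ _. 1)"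
  defines "W \<equiv> \<lambda>g. mat_of (basis A) (amul A (w g))"
  shows "grep (basis A) W" "giso (bp (hop (untwist A)) A) (EndG (basis A) W)"
proof -
  have A: "galg A" using cA by simp
  let ?I = "basis A" and ?B = "op_alg (untwist A)" and ?E = "EndG (basis A) W"
  have cB: "cs ?B" by (rule cs_op[OF cs_untwist[OF cA]])
  have B: "galg ?B" using cB by simp
  have I: "finite ?I" by (rule galgD(1)[OF A])
  note D = implD[OF i] and S = superimpD[OF implD(1)[OF i]]
  have ww: "amul A (w g) (amul A (w h) v) = amul A (w (g \<otimes> h)) v" if "g \<in> carrier G" "h \<in> carrier G" for g h v
  proof -
    have "amul A (w g) (amul A (w h) v) = amul A (amul A (w g) (w h)) v" by (simp add: galg_simps[OF A])
    then show ?thesis using D(3)[OF that] by simp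
  qed
  have w1: "amul A (w \<one>) v = crop ?I v" for v by (simp add: D(2) galg_simps[OF A])
  have inv: "amul A (w g) (amul A (w (inv g)) v) = crop ?I v" if g: "g \<in> carrier G" for g v
    using ww[OF g inv_closed[OF g]] g w1 by simp
  have V: "amul A a v \<in> vspace ?I" for a v using A by simp
  note tl = galg_tlin[OF A]
  show gr: "grep ?I W"
    unfolding grep_def
  proof (intro conjI ballI)
    show "W \<one> = idm ?I" unfolding W_def by (rule mat_of_cong) (simp add: w1)
    show "mm ?I (W g) (W h) = W (g \<otimes> h)" if "g \<in> carrier G" "h \<in> carrier G" for g h
      unfolding W_def mm_mat_of[OF I galgD(3)[OF A] V] by (simp only: ww[OF that])
  qed (simp_all add: I cs_nonempty[OF cA] W_def)
  note E = galg_EndG[OF gr]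
  have f: "ghom ?B ?E (\<lambda>b. mat_of ?I (\<lambda>v. amul A v b))"
    unfolding W_def
    by (rule ghom_operators_rep[where r = "\<lambda>g. amul A (w g)", OF I galgD(3)[OF A] V inv])
      (simp_all add: galgD(3,4)[OF A] V galg_simps[OF A])
  have g: "ghom A ?E (\<lambda>a. mat_of ?I (amul A a))"
    unfolding W_def
  proof (rule ghom_operators_rep[where r = "\<lambda>g. amul A (w g)", OF I galgD(3)[OF A] V inv])
    fix g b v assume g: "g \<in> carrier G"
    have "amul A (ac A g b) (amul A (w g) v) = amul A (amul A (ac A g b) (w g)) v" by (simp add: galg_simps[OF A])
    also have "\<dots> = amul A (amul A (w g) b) v" using S(4)[OF g, of b] by simp
    finally show "amul A (ac A g b) (amul A (w g) v) = amul A (w g) (amul A b v)" by (simp add: galg_simps[OF A])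
  qed (simp_all add: galgD(3,4)[OF A] V galg_simps[OF A])
  have sc: "supercommute ?E (mat_of ?I (amul A x)) (mat_of ?I (\<lambda>v. amul A v b))" if "b \<in> V ?B" for x b
  proof -
    have u: "ac ?E u (mat_of ?I (\<lambda>v. amul A v b)) = mat_of ?I (\<lambda>v. amul A v b)"
      using ghomD(5)[OF f u_closed, of b] that by simp
    have "mm ?I (mat_of ?I (amul A x)) (mat_of ?I (\<lambda>v. amul A v b))
        = mm ?I (mat_of ?I (\<lambda>v. amul A v b)) (mat_of ?I (amul A x))"
      unfolding mm_mat_of[OF I galgD(3)[OF A] V] mm_mat_of[OF I galgD(4)[OF A] V]
      by (simp add: galg_simps[OF A])
    then show ?thesis unfolding supercommute_def u using two by simp
  qed
  have "giso (bp ?B A) ?E"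
  proof (rule ghom_giso[OF cs_bp[OF cB cA] E])
    show "ghom (bp ?B A) ?E (copair ?B A ?E (\<lambda>b. mat_of ?I (\<lambda>v. amul A v b)) (\<lambda>a. mat_of ?I (amul A a)))"
      by (rule copair_ghom[OF B A E f g sc])
  qed (simp_all add: cs_nonempty[OF cA])
  then show "giso (bp (hop (untwist A)) A) ?E"
    by (simp only: hop_trivact[OF galg_untwist[OF A] trivact_untwist])
qed

end

section \<open>The map to cohomology\<close>

context nonsplit_involution begin

text \<open>The choice is immaterial: Brauer equivalent algebras have cohomologous cocycles.\<close>

definition bm_h2 :: "(nat, 'k, 'g) hmalg set \<Rightarrow> ('g \<Rightarrow> 'g \<Rightarrow> 'k) set" where
  "bm_h2 P = (SOME c. \<exists>A w d \<sigma>. cs A \<and> P = cls A \<and> impl A w d \<sigma> \<and> c = coset \<sigma>)"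

lemma bm_h2_cls:
  assumes cA: "cs A" and i: "impl A w d \<sigma>" shows "bm_h2 (cls A) = coset \<sigma>"
proof -
  have "\<exists>c A' w d \<sigma>. cs A' \<and> cls A = cls A' \<and> impl A' w d \<sigma> \<and> c = coset \<sigma>" using cA i by blast
  from someI_ex[OF this] obtain A' w' d' \<sigma>' where *: "cs A'" "cls A = cls A'" "impl A' w' d' \<sigma>'" "bm_h2 (cls A) = coset \<sigma>'"
    unfolding bm_h2_def by blast
  have "beq A A'" using *(2) cls_eq_cs[OF cA *(1)] by blast
  then show ?thesis using impl_beq[OF _ cA *(1) i *(3)] *(4) by simp
qed

lemma bm_h2_hom: "bm_h2 \<in> hom (BM TYPE('k) H R) (H2_sharp TYPE('k) G u)"
proof (rule homI)
  fix P assume "P \<in> carrier (BM TYPE('k) H R)"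
  then obtain A where A: "cs A" "P = cls A" using cls_cs by blast
  obtain w d \<sigma> where i: "impl A w d \<sigma>" using impl_exists[OF A(1)] by blast
  note s = impl_cocycle(1)[OF A(1) i]
  show "bm_h2 P \<in> carrier (H2_sharp TYPE('k) G u)" unfolding A(2) bm_h2_cls[OF A(1) i] H2_carriers using s by blast
  fix Q assume "Q \<in> carrier (BM TYPE('k) H R)"
  then obtain B where B: "cs B" "Q = cls B" using cls_cs by blast
  obtain v e \<omega> where j: "impl B v e \<omega>" using impl_exists[OF B(1)] by blast
  note o = impl_cocycle(1)[OF B(1) j]
  note AB = cs_bp[OF A(1) B(1)]
  obtain D :: "(nat, 'k, 'g) hmalg" where D: "cs D" "beq (bp A B) D" using cs_nat[OF AB] by blast
  obtain x f \<rho> where k: "impl D x f \<rho>" using impl_exists[OF D(1)] by blast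
  have "P \<otimes>\<^bsub>BM TYPE('k) H R\<^esub> Q = cls D"
    unfolding A(2) B(2) by (rule BM_mult[OF A(1) B(1) D(1) beq_sym[OF D(2) AB D(1)]])
  then have "bm_h2 (P \<otimes>\<^bsub>BM TYPE('k) H R\<^esub> Q) = coset \<rho>" using bm_h2_cls[OF D(1) k] by simp
  also have "\<dots> = coset (\<sigma> \<otimes>\<^bsub>Zs\<^esub> \<omega>)"
    using impl_beq[OF D(2) AB D(1) impl_bp[OF A(1) B(1) i j] k] by simp
  finally show "bm_h2 (P \<otimes>\<^bsub>BM TYPE('k) H R\<^esub> Q) = bm_h2 P \<otimes>\<^bsub>H2_sharp TYPE('k) G u\<^esub> bm_h2 Q"
    unfolding A(2) B(2) bm_h2_cls[OF A(1) i] bm_h2_cls[OF B(1) j] by (simp only: H2_mults[OF s o])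
qed

lemma bm_h2_epi: "bm_h2 \<in> epi (BM TYPE('k) H R) (H2_sharp TYPE('k) G u)"
proof -
  have "coset \<sigma> \<in> bm_h2 ` carrier (BM TYPE('k) H R)" if s: "\<sigma> \<in> carrier Z" for \<sigma>
  proof -
    obtain A :: "(nat, 'k, 'g) hmalg" and w where A: "cs A" "impl A w (dgr \<sigma>) \<sigma>" using impl_surjective[OF s] by blast
    show ?thesis using bm_h2_cls[OF A(1,2)] cls_carrier[OF A(1)] by (metis imageI)
  qed
  then show ?thesis using bm_h2_hom unfolding epi_def hom_def H2_carriers by blast
qed

text \<open>Both classes are inverse to that of the \<open>H\<close>-opposite of the algebra with trivial action.\<close>

lemma inner_action_cls:
  assumes cA: "cs A" and i: "impl A w (\<lambda>_. False) (\<lambda>_ _. 1)" shows "cls A = cls (untwist A)"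
proof -
  interpret BM: group "BM TYPE('k) H R" by (rule BM_group)
  obtain E :: "(nat, 'k, 'g) hmalg" where E: "cs E" "beq (base_hma H) E" using cs_nat[OF cs_base] by blast
  have Eb: "beq E (base_hma H)" using beq_sym[OF E(2) cs_base E(1)] .
  note cB = cs_untwist[OF cA]
  note h = cs_hop[OF cB]
  note P = cs_bp[OF h cA]
  note op = untwisted_inverse[OF cA i]
  have "beq (bp (hop (untwist A)) A) (base_hma H)"
    by (rule beq_trans[OF giso_beq[OF op(2) P cs_EndG[OF op(1)]] beq_EndG[OF op(1)] P cs_EndG[OF op(1)] cs_base])
  then have "beq E (bp (hop (untwist A)) A)"
    by (rule beq_trans[OF Eb beq_sym[OF _ P cs_base] E(1) cs_base P])
  then have "cls (hop (untwist A)) \<otimes>\<^bsub>BM TYPE('k) H R\<^esub> cls A = cls E" by (rule BM_mult[OF h cA E(1)])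
  also have "\<dots> = cls (hop (untwist A)) \<otimes>\<^bsub>BM TYPE('k) H R\<^esub> cls (untwist A)"
    using BM_l_inv[OF cB] BM_one[OF E(1) Eb] by simp
  finally show ?thesis using cls_carrier h cA cB by simp
qed

text \<open>A trivial class means that \<open>A\<close> may be replaced by the same algebra with trivial action.\<close>

lemma bm_h2_kernel: "kernel (BM TYPE('k) H R) (H2_sharp TYPE('k) G u) bm_h2 = br_bm ` carrier (Br TYPE('k))"
proof -
  have "P \<in> br_bm ` carrier (Br TYPE('k))"
    if P: "P \<in> carrier (BM TYPE('k) H R)" "bm_h2 P = coset (\<lambda>_ _. 1)" for P
  proof -
    obtain A where A: "cs A" "P = cls A" using cls_cs[OF P(1)] by blast
    obtain w d \<sigma> where i: "impl A w d \<sigma>" using impl_exists[OF A(1)] by blast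
    have "coset \<sigma> = coset (\<lambda>_ _. 1)" using P(2) unfolding A(2) bm_h2_cls[OF A(1) i] .
    from impl_coboundary[OF A(1) i this] obtain v where "impl A v (\<lambda>_. False) (\<lambda>_ _. 1)" by blast
    from inner_action_cls[OF A(1) this] show ?thesis
      unfolding br_bm_image A(2) using cs_untwist[OF A(1)] trivact_untwist by blast
  qed
  moreover have "bm_h2 (cls A) = coset (\<lambda>_ _. 1)" if "cs A" "trivact A" for A
    by (rule bm_h2_cls[OF that(1) impl_trivact[OF that]])
  ultimately show ?thesis
    using cls_carrier unfolding kernel_def H2_ones br_bm_image by auto
qed

end

section \<open>Removing the twist when minus one is a square\<close>

text \<open>Extending along one new vector at a time, a symmetric bilinear pairing on an elementary abelian
  \<open>2\<close>-group which vanishes on the diagonal is the defect of additivity of some function.\<close>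

lemma quadratic_refinement:
  fixes Q :: "('q, 'm) monoid_scheme" (structure) and C :: "('x \<Rightarrow> bool) \<Rightarrow> ('x \<Rightarrow> bool) \<Rightarrow> 'q"
  assumes Q: "comm_group Q" and N: "subgroup N Q" and P: "finite P" "(\<lambda>_. False) \<in> P"
    and xor: "\<And>d e. d \<in> P \<Longrightarrow> e \<in> P \<Longrightarrow> (\<lambda>x. d x \<noteq> e x) \<in> P"
    and CN: "\<And>d e. d \<in> P \<Longrightarrow> e \<in> P \<Longrightarrow> C d e \<in> N"
    and bilin: "\<And>d e f. d \<in> P \<Longrightarrow> e \<in> P \<Longrightarrow> f \<in> P \<Longrightarrow> C (\<lambda>x. d x \<noteq> e x) f = C d f \<otimes> C e f"
    and sym: "\<And>d e. d \<in> P \<Longrightarrow> e \<in> P \<Longrightarrow> C d e = C e d"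
    and alt: "\<And>d. d \<in> P \<Longrightarrow> C d d = \<one>"
  shows "\<exists>T. \<forall>d\<in>P. T d \<in> N \<and> (\<forall>e\<in>P. T (\<lambda>x. d x \<noteq> e x) = T d \<otimes> T e \<otimes> C d e)"
proof -
  interpret Q: comm_group Q by (rule Q)
  interpret N: subgroup N Q by (rule N)
  define A where "A d e = (\<lambda>x. d x \<noteq> e x)" for d e :: "'x \<Rightarrow> bool"
  define zr where "zr = (\<lambda>_::'x. False)"
  have Aac: "A d e = A e d" "A (A d e) f = A d (A e f)" "A d (A e f) = A e (A d f)" for d e f
    by (auto simp: A_def)
  have AO: "A d d = zr" "A zr d = d" "A d zr = d" "A d (A d e) = e" for d e by (auto simp: A_def zr_def)
  note OP = P(2)[folded zr_def] and AP = xor[folded A_def] and bl = bilin[folded A_def]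
  have CQ [simp]: "C d e \<in> carrier Q" if "d \<in> P" "e \<in> P" for d e using CN[OF that] by simp
  have br: "C d (A e f) = C d e \<otimes> C d f" if "d \<in> P" "e \<in> P" "f \<in> P" for d e f
    using bl[of e f d] sym[of d "A e f"] sym[of d e] sym[of d f] that AP by simp
  have CO: "C zr e = \<one>" if "e \<in> P" for e
    using bl[OF OP OP that] CQ[OF OP that] by (simp add: AO)
  have CC: "C d e \<otimes> C d e = \<one>" if "d \<in> P" "e \<in> P" for d e
    using bl[OF that(1) that(1) that(2)] CO[OF that(2)] by (simp add: AO)
  \<comment> \<open>Partial solutions on subgroups; a maximal one is defined everywhere.\<close>
  define good where "good S \<longleftrightarrow> S \<subseteq> P \<and> zr \<in> S \<and> (\<forall>d\<in>S. \<forall>e\<in>S. A d e \<in> S)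
    \<and> (\<exists>T. \<forall>d\<in>S. T d \<in> N \<and> (\<forall>e\<in>S. T (A d e) = T d \<otimes> T e \<otimes> C d e))" for S
  have g0: "good {zr}" unfolding good_def using OP by (auto simp: AO CO intro!: exI[of _ "\<lambda>_. \<one>"])
  have "finite {S. good S}" by (rule finite_subset[of _ "Pow P"]) (use P in \<open>auto simp: good_def\<close>)
  from finite_has_maximal[OF this] g0 obtain S where S: "good S"
    and max: "\<And>S'. good S' \<Longrightarrow> S \<subseteq> S' \<Longrightarrow> S = S'" by blast
  from S obtain T where SP: "S \<subseteq> P" and SO: "zr \<in> S" and SA: "\<And>d e. d \<in> S \<Longrightarrow> e \<in> S \<Longrightarrow> A d e \<in> S"
    and TN: "\<And>d. d \<in> S \<Longrightarrow> T d \<in> N"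
    and T: "\<And>d e. d \<in> S \<Longrightarrow> e \<in> S \<Longrightarrow> T (A d e) = T d \<otimes> T e \<otimes> C d e"
    unfolding good_def by blast
  have "P \<subseteq> S"
  proof
    fix e assume e: "e \<in> P"
    show "e \<in> S"
    proof (rule ccontr)
      assume eS: "e \<notin> S"
      define T' where "T' x = (if x \<in> S then T x else T (A e x) \<otimes> C (A e x) e)" for x
      \<comment> \<open>The new domain is \<open>S\<close> together with the disjoint translate of \<open>S\<close> by \<open>e\<close>, on which \<open>T\<close> is extended by \<open>T'(e) = 1\<close>.\<close>
      have new: "A e d \<notin> S" if "d \<in> S" for d
        using SA[OF that, of "A e d"] eS by (auto simp: Aac(3)[of d e d] AO)
      have T'1: "T' d = T d" and T'2: "T' (A e d) = T d \<otimes> C d e" if "d \<in> S" for d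
        using that new[OF that] by (simp_all add: T'_def AO)
      have cl [simp]: "T d \<in> carrier Q" "d \<in> P" if "d \<in> S" for d using TN[OF that] that SP by auto
      have step: "T' (A x y) = T' x \<otimes> T' y \<otimes> C x y"
        if x: "x \<in> S \<or> (\<exists>d\<in>S. x = A e d)" and y: "y \<in> S \<or> (\<exists>d\<in>S. y = A e d)" for x y
      proof -
        have two: "T' (A d (A e f)) = T' d \<otimes> T' (A e f) \<otimes> C d (A e f)" if d: "d \<in> S" and f: "f \<in> S" for d f
        proof -
          have "T' (A d (A e f)) = T d \<otimes> T f \<otimes> C d f \<otimes> (C d e \<otimes> C f e)"
            unfolding Aac(3)[of d e f] T'2[OF SA[OF d f]] using T[OF d f] bl[OF cl(2)[OF d] cl(2)[OF f] e] by simp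
          then show ?thesis unfolding T'1[OF d] T'2[OF f] br[OF cl(2)[OF d] e cl(2)[OF f]]
            using d f e by (simp add: Q.m_ac)
        qed
        have four: "T' (A (A e d) (A e f)) = T' (A e d) \<otimes> T' (A e f) \<otimes> C (A e d) (A e f)" if d: "d \<in> S" and f: "f \<in> S" for d f
        proof -
          have "A (A e d) (A e f) = A d f" by (simp add: Aac AO)
          then have "T' (A (A e d) (A e f)) = T d \<otimes> T f \<otimes> C d f" using T'1[OF SA[OF d f]] T[OF d f] by simp
          moreover have "C (A e d) (A e f) = C f e \<otimes> (C d e \<otimes> C d f)"
            using bl[OF e cl(2)[OF d] AP[OF e cl(2)[OF f]]] br[OF e e cl(2)[OF f]] br[OF cl(2)[OF d] e cl(2)[OF f]]
              alt[OF e] sym[OF e cl(2)[OF f]] e d f by simp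
          moreover have "T d \<otimes> C d e \<otimes> (T f \<otimes> C f e) \<otimes> (C f e \<otimes> (C d e \<otimes> C d f))
              = T d \<otimes> T f \<otimes> C d f \<otimes> (C d e \<otimes> C d e) \<otimes> (C f e \<otimes> C f e)"
            using e d f by (simp add: Q.m_ac del: Q.r_one Q.l_one)
          ultimately show ?thesis unfolding T'2[OF d] T'2[OF f] using CC e d f by simp
        qed
        have three: "T' (A (A e f) d) = T' (A e f) \<otimes> T' d \<otimes> C (A e f) d" if d: "d \<in> S" and f: "f \<in> S" for d f
          using two[OF d f] T'1[OF d] T'2[OF f] sym[OF cl(2)[OF d] AP[OF e cl(2)[OF f]]] d f e
          by (simp add: Aac(1)[of "A e f" d] Q.m_comm)
        have one: "T' (A d f) = T' d \<otimes> T' f \<otimes> C d f" if "d \<in> S" "f \<in> S" for d f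
          using T[OF that] by (simp only: T'1 SA that)
        show ?thesis
        proof (cases "x \<in> S")
          case xS: True
          show ?thesis
          proof (cases "y \<in> S")
            case True
            then show ?thesis by (rule one[OF xS])
          next
            case False
            then obtain f where "f \<in> S" "y = A e f" using y by blast
            then show ?thesis using two[OF xS] by simp
          qed
        next
          case False
          then obtain d where d: "d \<in> S" "x = A e d" using x by blast
          show ?thesis
          proof (cases "y \<in> S")
            case True
            then show ?thesis using three[OF _ d(1)] d(2) by simp
          next
            case False
            then obtain f where "f \<in> S" "y = A e f" using y by blast
            then show ?thesis using four[OF d(1)] d(2) by simp
          qed
        qed
      qed
      have "good (S \<union> A e ` S)"
        unfolding good_def
      proof (intro conjI exI ballI)
        show "S \<union> A e ` S \<subseteq> P" using SP AP[OF e] by auto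
        show "zr \<in> S \<union> A e ` S" using SO by simp
        fix d assume d: "d \<in> S \<union> A e ` S"
        show "T' d \<in> N" using d T'1 T'2 TN CN[OF _ e] by auto
        fix f assume f: "f \<in> S \<union> A e ` S"
        show "A d f \<in> S \<union> A e ` S"
        proof -
          have m: "A x y \<in> S \<union> A e ` S" "A (A e x) (A e y) \<in> S \<union> A e ` S"
            "A x (A e y) \<in> S \<union> A e ` S" "A (A e x) y \<in> S \<union> A e ` S" if xy: "x \<in> S" "y \<in> S" for x y
          proof -
            have "A (A e x) (A e y) = A x y" by (simp add: Aac AO)
            then show "A x y \<in> S \<union> A e ` S" "A (A e x) (A e y) \<in> S \<union> A e ` S" using SA[OF xy] by simp_all
            show "A x (A e y) \<in> S \<union> A e ` S" unfolding Aac(3)[of x e y] by (intro UnI2 imageI SA xy)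
            show "A (A e x) y \<in> S \<union> A e ` S" unfolding Aac(2)[of e x y] by (intro UnI2 imageI SA xy)
          qed
          from d f show ?thesis by (elim UnE imageE) (simp_all only: m)
        qed
        show "T' (A d f) = T' d \<otimes> T' f \<otimes> C d f" by (rule step) (use d f in auto)
      qed
      from max[OF this] have "A e zr \<in> S" using SO by blast
      then show False using eS by (simp add: AO)
    qed
  qed
  then have "S = P" using SP by blast
  then show ?thesis using TN T unfolding A_def by blast
qed

context central_involution begin

lemma parity_finite: "finite {d. parity d}"
proof (rule finite_subset)
  show "{d. parity d} \<subseteq> (\<lambda>S g. g \<in> S) ` Pow (carrier G)"
  proof
    fix d assume "d \<in> {d. parity d}"
    then have "d = (\<lambda>g. g \<in> {g \<in> carrier G. d g})" using parityD(2)[of d] by auto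
    then show "d \<in> (\<lambda>S g. g \<in> S) ` Pow (carrier G)" by blast
  qed
qed (simp add: fin)

lemma parity_xor: "parity d \<Longrightarrow> parity e \<Longrightarrow> parity (\<lambda>g. d g \<noteq> e g)"
  unfolding parity_def by auto

text \<open>The cup product of two characters with values in \<open>\<int>/2\<close>, as a cocycle of signs.\<close>

definition cup :: "('g \<Rightarrow> bool) \<Rightarrow> ('g \<Rightarrow> bool) \<Rightarrow> 'g \<Rightarrow> 'g \<Rightarrow> 'k" where
  "cup d e = (\<lambda>g h. sg (d g \<and> e h))"

lemma cup_closed: "parity d \<Longrightarrow> parity e \<Longrightarrow> cup d e \<in> carrier Z" "parity d \<Longrightarrow> parity e \<Longrightarrow> dgr (cup d e) = (\<lambda>_. False)"
  using Z_twist[OF Z_one_closed Z_one_closed, of d e] by (simp_all add: cup_def deg_one)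

lemma coset_cob:
  assumes "\<sigma> \<in> carrier Z" "\<omega> \<in> carrier Z" "\<And>g. g \<in> carrier G \<Longrightarrow> \<gamma> g \<noteq> 0" "\<gamma> \<one> = 1"
    "\<And>g h. \<omega> g h = cob \<gamma> g h * \<sigma> g h"
  shows "coset \<sigma> = coset \<omega>"
proof -
  have "cob \<gamma> \<in> Bd" unfolding Bd_cob using assms(3,4) by blast
  then show ?thesis unfolding coset_eq[OF assms(1,2)] using assms(5) by (intro bexI[of _ "cob \<gamma>"]) (simp_all add: fun_eq_iff)
qed

text \<open>The two cocycles differ by the coboundary of \<open>g \<mapsto> (-1)\<^bsup>d(g) e(g)\<^esup>\<close>.\<close>

lemma cup_sym:
  assumes d: "parity d" and e: "parity e" shows "coset (cup d e) = coset (cup e d)"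
proof (rule coset_cob[of _ _ "\<lambda>g. sg (d g \<and> e g)"])
  show "cup e d g h = cob (\<lambda>g. sg (d g \<and> e g)) g h * cup d e g h" for g h
  proof (cases "g \<in> carrier G \<and> h \<in> carrier G")
    case True
    then show ?thesis using parityD(1)[OF d, of g h] parityD(1)[OF e, of g h]
      by (cases "d g"; cases "d h"; cases "e g"; cases "e h") (simp_all add: cup_def cob_def)
  next
    case False
    then show ?thesis using parityD(2)[OF d] parityD(2)[OF e] by (auto simp: cup_def cob_def)
  qed
qed (use parityD(4)[OF d] in \<open>simp_all add: cup_closed d e\<close>)

text \<open>Here the coboundary is that of \<open>g \<mapsto> i\<^bsup>d(g)\<^esup>\<close>.\<close>

lemma cup_square:
  assumes d: "parity d" and i: "i ^ 2 = (- 1 :: 'k)" shows "coset (cup d d) = coset (\<lambda>_ _. 1)"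
proof (rule coset_cob[symmetric, of _ _ "\<lambda>g. if d g then i else 1"])
  have i0: "i \<noteq> 0" using i by auto
  have ii: "i * i = - 1" using i by (simp add: power2_eq_square)
  show "(if d g then i else 1) \<noteq> 0" for g using i0 by simp
  show "cup d d g h = cob (\<lambda>g. if d g then i else 1) g h * 1" for g h
  proof (cases "g \<in> carrier G \<and> h \<in> carrier G")
    case True
    then show ?thesis using parityD(1)[OF d, of g h] i0 ii
      by (cases "d g"; cases "d h") (simp_all add: cup_def cob_def)
  next
    case False
    then show ?thesis using parityD(2)[OF d] by (auto simp: cup_def cob_def)
  qed
qed (use parityD(4)[OF d] in \<open>simp_all add: cup_closed d Z_one_closed\<close>)

lemma coset_deg: "\<sigma> \<in> carrier Z \<Longrightarrow> \<omega> \<in> carrier Z \<Longrightarrow> coset \<sigma> = coset \<omega> \<Longrightarrow> dgr \<sigma> = dgr \<omega>"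
  using coset_eq[of \<sigma> \<omega>] deg_Z_mult Bd_closed by auto

text \<open>The map is \<open>c \<mapsto> c T(|c|)\<close> for a quadratic refinement \<open>T\<close> of the cup product pairing. Requiring the values
  of \<open>T\<close> to have degree zero makes the map preserve degrees, which gives surjectivity and the trivial
  kernel.\<close>

lemma H2_sharp_to_H2:
  assumes i: "i ^ 2 = (- 1 :: 'k)"
  obtains f where "f \<in> epi (H2_sharp TYPE('k) G u) (H2 TYPE('k) G)"
    "kernel (H2_sharp TYPE('k) G u) (H2 TYPE('k) G) f = {\<one>\<^bsub>H2_sharp TYPE('k) G u\<^esub>}"
proof -
  let ?Q = "H2 TYPE('k) G" and ?S = "H2_sharp TYPE('k) G u"
  have "comm_group ?Q" unfolding H2_def by (rule comm_group.abelian_FactGroup[OF Z_comm_group Bd_subgroup(1)])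
  then interpret Q: comm_group ?Q .
  note QC = H2_carriers(2) and Qm = H2_mults(2)
  let ?N = "coset ` {\<sigma> \<in> carrier Z. dgr \<sigma> = (\<lambda>_. False)}"
  have N: "subgroup ?N ?Q"
  proof (rule Q.subgroupI)
    show "?N \<subseteq> carrier ?Q" using QC by auto
    show "?N \<noteq> {}" using Z_one_closed deg_one by blast
    fix a assume "a \<in> ?N"
    then obtain \<sigma> where s: "a = coset \<sigma>" "\<sigma> \<in> carrier Z" "dgr \<sigma> = (\<lambda>_. False)" by blast
    note j = Z_inverse[OF s(2)]
    have "coset (\<lambda>g h. inverse (\<sigma> g h)) \<otimes>\<^bsub>?Q\<^esub> a = \<one>\<^bsub>?Q\<^esub>"
      unfolding s(1) Qm[OF j(1) s(2)] H2_ones using ZD(2)[OF s(2)] by simp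
    then have "inv\<^bsub>?Q\<^esub> a = coset (\<lambda>g h. inverse (\<sigma> g h))"
      by (rule Q.inv_equality) (use s j QC in auto)
    then show "inv\<^bsub>?Q\<^esub> a \<in> ?N" using s(3) j by auto
    fix b assume "b \<in> ?N"
    then obtain \<omega> where o: "b = coset \<omega>" "\<omega> \<in> carrier Z" "dgr \<omega> = (\<lambda>_. False)" by blast
    show "a \<otimes>\<^bsub>?Q\<^esub> b \<in> ?N"
      unfolding s(1) o(1) Qm[OF s(2) o(2)] using s o by (intro imageI) (simp add: Z_closed deg_Z_mult)
  qed
  obtain T where TN: "\<And>d. parity d \<Longrightarrow> T d \<in> ?N"
    and T: "\<And>d e. parity d \<Longrightarrow> parity e \<Longrightarrow> T (\<lambda>g. d g \<noteq> e g) = T d \<otimes>\<^bsub>?Q\<^esub> T e \<otimes>\<^bsub>?Q\<^esub> coset (cup d e)"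
  proof -
    have "\<exists>T. \<forall>d\<in>{d. parity d}. T d \<in> ?N \<and> (\<forall>e\<in>{d. parity d}. T (\<lambda>x. d x \<noteq> e x) = T d \<otimes>\<^bsub>?Q\<^esub> T e \<otimes>\<^bsub>?Q\<^esub> coset (cup d e))"
    proof (rule quadratic_refinement[OF Q.comm_group_axioms N parity_finite]; (simp only: mem_Collect_eq)?)
      show "parity (\<lambda>_. False)" by (rule parity_False)
      fix d e assume d: "parity d" and e: "parity e"
      show "parity (\<lambda>x. d x \<noteq> e x)" by (rule parity_xor[OF d e])
      show "coset (cup d e) \<in> ?N" using cup_closed[OF d e] by blast
      show "coset (cup d e) = coset (cup e d)" by (rule cup_sym[OF d e])
      fix f assume f: "parity f"
      have "cup (\<lambda>x. d x \<noteq> e x) f = (\<lambda>g h. cup d f g h * cup e f g h)"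
        by (auto simp: cup_def sg_def fun_eq_iff)
      then show "coset (cup (\<lambda>x. d x \<noteq> e x) f) = coset (cup d f) \<otimes>\<^bsub>?Q\<^esub> coset (cup e f)"
        using Qm[OF cup_closed(1)[OF d f] cup_closed(1)[OF e f]] by simp
    next
      fix d assume "parity d"
      then show "coset (cup d d) = \<one>\<^bsub>?Q\<^esub>" unfolding H2_ones by (rule cup_square[OF _ i])
    qed
    then obtain T where "\<forall>d\<in>{d. parity d}. T d \<in> ?N \<and> (\<forall>e\<in>{d. parity d}. T (\<lambda>x. d x \<noteq> e x) = T d \<otimes>\<^bsub>?Q\<^esub> T e \<otimes>\<^bsub>?Q\<^esub> coset (cup d e))" ..
    then show thesis by (intro that[of T]) blast+
  qed
  have NQ: "a \<in> carrier ?Q" if "a \<in> ?N" for a using that QC by auto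
  \<comment> \<open>Representatives of a class differ by coboundaries, which have degree zero.\<close>
  define dg where "dg c = dgr (SOME \<sigma>. \<sigma> \<in> carrier Z \<and> c = coset \<sigma>)" for c
  have dg: "dg (coset \<sigma>) = dgr \<sigma>" if "\<sigma> \<in> carrier Z" for \<sigma>
  proof -
    from someI[of "\<lambda>\<tau>. \<tau> \<in> carrier Z \<and> coset \<sigma> = coset \<tau>" \<sigma>] that
    show ?thesis unfolding dg_def by (metis (mono_tags, lifting) coset_deg)
  qed
  have dgN: "dg (coset \<sigma> \<otimes>\<^bsub>?Q\<^esub> n) = dgr \<sigma>" if "\<sigma> \<in> carrier Z" "n \<in> ?N" for \<sigma> n
    using that by (auto simp: Qm dg Z_closed deg_Z_mult)
  let ?f = "\<lambda>c. c \<otimes>\<^bsub>?Q\<^esub> T (dg c)"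
  have TQ: "T (dgr \<sigma>) \<in> carrier ?Q" "T (dgr \<sigma>) \<in> ?N" if "\<sigma> \<in> carrier Z" for \<sigma>
    using TN[OF parity_deg[OF that]] NQ by blast+
  have cQ: "coset \<sigma> \<in> carrier ?Q" if "\<sigma> \<in> carrier Z" for \<sigma> using that QC by blast
  have T0: "T (\<lambda>_. False) = \<one>\<^bsub>?Q\<^esub>"
  proof -
    have "coset (cup (\<lambda>_. False) (\<lambda>_. False)) = \<one>\<^bsub>?Q\<^esub>" by (simp add: cup_def H2_ones)
    then show ?thesis using T[OF parity_False parity_False] NQ[OF TN[OF parity_False]] by simp
  qed
  have hom: "?f (coset \<sigma> \<otimes>\<^bsub>?S\<^esub> coset \<omega>) = ?f (coset \<sigma>) \<otimes>\<^bsub>?Q\<^esub> ?f (coset \<omega>)"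
    if s: "\<sigma> \<in> carrier Z" and o: "\<omega> \<in> carrier Z" for \<sigma> \<omega>
  proof -
    let ?c = "coset (cup (dgr \<sigma>) (dgr \<omega>))"
    note cz = cup_closed(1)[OF parity_deg[OF s] parity_deg[OF o]]
    have "\<sigma> \<otimes>\<^bsub>Zs\<^esub> \<omega> = (\<lambda>g h. \<sigma> g h * \<omega> g h * cup (dgr \<sigma>) (dgr \<omega>) g h)" by (simp add: sharp_eq[OF s o] cup_def)
    then have 1: "coset \<sigma> \<otimes>\<^bsub>?S\<^esub> coset \<omega> = coset \<sigma> \<otimes>\<^bsub>?Q\<^esub> coset \<omega> \<otimes>\<^bsub>?Q\<^esub> ?c"
      by (simp add: H2_mults(1)[OF s o] Qm s o cz Z_closed)
    have cc: "?c \<otimes>\<^bsub>?Q\<^esub> ?c = \<one>\<^bsub>?Q\<^esub>"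
      by (simp add: Qm[OF cz cz] H2_ones) (simp add: cup_def)
    have 2: "dg (coset \<sigma> \<otimes>\<^bsub>?S\<^esub> coset \<omega>) = (\<lambda>g. dgr \<sigma> g \<noteq> dgr \<omega> g)"
      using sharp_closed[OF s o] by (simp add: H2_mults(1)[OF s o] dg)
    have "?f (coset \<sigma> \<otimes>\<^bsub>?S\<^esub> coset \<omega>) = coset \<sigma> \<otimes>\<^bsub>?Q\<^esub> coset \<omega> \<otimes>\<^bsub>?Q\<^esub> ?c
        \<otimes>\<^bsub>?Q\<^esub> (T (dgr \<sigma>) \<otimes>\<^bsub>?Q\<^esub> T (dgr \<omega>) \<otimes>\<^bsub>?Q\<^esub> ?c)"
      unfolding 2 T[OF parity_deg[OF s] parity_deg[OF o]] by (simp only: 1)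
    also have "\<dots> = coset \<sigma> \<otimes>\<^bsub>?Q\<^esub> T (dgr \<sigma>) \<otimes>\<^bsub>?Q\<^esub> (coset \<omega> \<otimes>\<^bsub>?Q\<^esub> T (dgr \<omega>)) \<otimes>\<^bsub>?Q\<^esub> (?c \<otimes>\<^bsub>?Q\<^esub> ?c)"
      using TQ[OF s] TQ[OF o] cQ[OF s] cQ[OF o] cQ[OF cz] by (simp add: Q.m_ac)
    finally show ?thesis using TQ[OF s] TQ[OF o] cQ[OF s] cQ[OF o] by (simp add: cc dg[OF s] dg[OF o])
  qed
  have clo: "?f (coset \<sigma>) \<in> carrier ?Q" if "\<sigma> \<in> carrier Z" for \<sigma>
    using TQ[OF that] cQ[OF that] by (simp add: dg[OF that])
  have surj: "c \<in> ?f ` carrier ?S" if "c \<in> carrier ?Q" for c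
  proof -
    from that obtain \<tau> where t: "\<tau> \<in> carrier Z" "c = coset \<tau>" using QC by blast
    have n: "inv\<^bsub>?Q\<^esub> T (dgr \<tau>) \<in> ?N" by (rule subgroup.m_inv_closed[OF N TQ(2)[OF t(1)]])
    let ?c = "coset \<tau> \<otimes>\<^bsub>?Q\<^esub> inv\<^bsub>?Q\<^esub> T (dgr \<tau>)"
    have "?f ?c = coset \<tau> \<otimes>\<^bsub>?Q\<^esub> (inv\<^bsub>?Q\<^esub> T (dgr \<tau>) \<otimes>\<^bsub>?Q\<^esub> T (dgr \<tau>))"
      unfolding dgN[OF t(1) n] using cQ[OF t(1)] TQ[OF t(1)] by (simp add: Q.m_assoc)
    then have "c = ?f ?c" using cQ[OF t(1)] TQ[OF t(1)] t(2) by simp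
    moreover have "?c \<in> carrier ?S" using cQ[OF t(1)] TQ[OF t(1)] unfolding H2_carriers(1) QC[symmetric] by simp
    ultimately show ?thesis by (rule image_eqI)
  qed
  have ker: "coset \<sigma> = coset (\<lambda>_ _. 1)" if s: "\<sigma> \<in> carrier Z" and e: "?f (coset \<sigma>) = \<one>\<^bsub>?Q\<^esub>" for \<sigma>
  proof -
    have "dgr \<sigma> = dg (?f (coset \<sigma>))" using dgN[OF s TQ(2)[OF s]] by (simp add: dg[OF s])
    also have "\<dots> = (\<lambda>_. False)" unfolding e H2_ones dg[OF Z_one_closed] by (rule deg_one)
    finally have "coset \<sigma> = \<one>\<^bsub>?Q\<^esub>" using e cQ[OF s] by (simp add: dg[OF s] T0)
    then show ?thesis by (simp only: H2_ones)
  qed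
  show thesis
  proof (rule that)
    show "?f \<in> epi ?S ?Q"
      unfolding epi_def hom_def using hom clo surj by (auto simp: H2_carriers(1))
    show "kernel ?S ?Q ?f = {\<one>\<^bsub>?S\<^esub>}"
    proof -
      have k1: "?f (coset (\<lambda>_ _. 1)) = \<one>\<^bsub>?Q\<^esub>"
        using cQ[OF Z_one_closed] by (simp add: dg[OF Z_one_closed] deg_one T0) (simp add: H2_ones)
      have k2: "c = coset (\<lambda>_ _. 1)" if c: "c \<in> carrier ?S" "?f c = \<one>\<^bsub>?Q\<^esub>" for c
      proof -
        obtain \<sigma> where s: "\<sigma> \<in> carrier Z" "c = coset \<sigma>" using c(1) unfolding H2_carriers(1) by blast
        show ?thesis unfolding s(2) by (rule ker[OF s(1) c(2)[unfolded s(2)]])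
      qed
      have k3: "coset (\<lambda>_ _. 1) \<in> carrier ?S" using Z_one_closed H2_carriers(1) by blast
      show ?thesis
        unfolding kernel_def H2_ones(1)
      proof (intro equalityI subsetI)
        fix c assume "c \<in> {c \<in> carrier ?S. ?f c = \<one>\<^bsub>?Q\<^esub>}"
        then have "c = coset (\<lambda>_ _. 1)" by (elim CollectE conjE) (rule k2)
        then show "c \<in> {coset (\<lambda>_ _. 1)}" by (simp only: singleton_iff)
      next
        fix c assume "c \<in> {coset (\<lambda>_ _. 1)}"
        then have "c = coset (\<lambda>_ _. 1)" by (rule singletonD)
        then show "c \<in> {c \<in> carrier ?S. ?f c = \<one>\<^bsub>?Q\<^esub>}" using k1 k3 by (intro CollectI conjI) (simp_all only:)
      qed
    qed
  qed
qed

end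

section \<open>The exact sequences\<close>

context nonsplit_involution begin

lemma exact_sharp:
  "short_exact (Br TYPE('k)) (BM TYPE('k) H R) (H2_sharp TYPE('k) G u) br_bm bm_h2"
  unfolding short_exact_def using Br_BM BM_group H2_groups bm_h2_epi bm_h2_kernel by blast

lemma exact_H2:
  assumes "i ^ 2 = (- 1 :: 'k)"
  shows "\<exists>\<pi>. short_exact (Br TYPE('k)) (BM TYPE('k) H R) (H2 TYPE('k) G) br_bm \<pi>"
proof -
  let ?B = "BM TYPE('k) H R" and ?S = "H2_sharp TYPE('k) G u" and ?Q = "H2 TYPE('k) G"
  obtain f where f: "f \<in> epi ?S ?Q" and k: "kernel ?S ?Q f = {\<one>\<^bsub>?S\<^esub>}"
    using H2_sharp_to_H2[OF assms] by blast
  have p: "bm_h2 \<in> hom ?B ?S" "bm_h2 ` carrier ?B = carrier ?S" and h: "f \<in> hom ?S ?Q" "f ` carrier ?S = carrier ?Q"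
    using bm_h2_epi f by (simp_all add: epi_def)
  have "f \<circ> bm_h2 \<in> hom ?B ?Q" by (rule homI) (use p(1) h(1) in \<open>simp_all add: hom_mult hom_in_carrier\<close>)
  moreover have "(f \<circ> bm_h2) ` carrier ?B = carrier ?Q" unfolding image_comp[symmetric] p(2) h(2) ..
  ultimately have "f \<circ> bm_h2 \<in> epi ?B ?Q" by (simp only: epi_def mem_Collect_eq simp_thms)
  moreover have "kernel ?B ?Q (f \<circ> bm_h2) = kernel ?B ?S bm_h2"
  proof -
    have "f (bm_h2 P) = \<one>\<^bsub>?Q\<^esub> \<longleftrightarrow> bm_h2 P = \<one>\<^bsub>?S\<^esub>" if "P \<in> carrier ?B" for P
    proof -
      have "bm_h2 P \<in> carrier ?S" using p(1) that by (auto simp: hom_def)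
      then show ?thesis using k unfolding kernel_def by blast
    qed
    then show ?thesis by (auto simp: kernel_def)
  qed
  ultimately show ?thesis unfolding short_exact_def using Br_BM BM_group H2_groups bm_h2_kernel by metis
qed

end

text \<open>The order of \<open>u\<close> is two and divides that of \<open>G\<close>, so the characteristic cannot be two.\<close>

lemma even_order_char:
  fixes G :: "('g, 'm) monoid_scheme" (structure)
  assumes "group G" and u: "u \<in> carrier G" "u \<otimes> u = \<one>" "u \<noteq> \<one>"
    and char: "CHAR('k::field) = 0 \<or> \<not> CHAR('k) dvd order G"
  shows "(2 :: 'k) \<noteq> 0"
proof
  interpret group G by fact
  assume "(2 :: 'k) = 0"
  then have "of_nat 2 = (0 :: 'k)" by simp
  then have c: "CHAR('k) dvd 2" unfolding of_nat_eq_0_iff_char_dvd .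
  have "u [^] (2::nat) = \<one>" using u by (simp add: numeral_2_eq_2)
  then have "ord u dvd 2" using pow_eq_id[OF u(1)] by simp
  moreover have "ord u \<noteq> 1" using ord_eq_1[OF u(1)] u(3) by simp
  ultimately have "ord u = 2" using prime_nat_iff two_is_prime_nat by blast
  then have "2 dvd order G" using ord_dvd_group_order[OF u(1)] by simp
  then have "CHAR('k) dvd order G" using c by (rule dvd_trans[rotated])
  then show False using char c by auto
qed

theorem theorem2p9:
  fixes G :: "('g, 'm) monoid_scheme" and u :: 'g
  assumes "group G" and "finite (carrier G)"
    and "u \<in> carrier G" and "\<forall>g\<in>carrier G. u \<otimes>\<^bsub>G\<^esub> g = g \<otimes>\<^bsub>G\<^esub> u"
    and "u \<otimes>\<^bsub>G\<^esub> u = \<one>\<^bsub>G\<^esub>" and "u \<noteq> \<one>\<^bsub>G\<^esub>"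
    and "CHAR('k::field) = 0 \<or> \<not> CHAR('k) dvd order G"
    and "\<not> direct_factor G (generate G {u})"
  shows "\<exists>\<iota> \<pi>.
      short_exact (Br TYPE('k)) (BM TYPE('k) (group_alg G) (R_mat G u)) (H2_sharp TYPE('k) G u) \<iota> \<pi>
    \<and> ((\<exists>i::'k. i ^ 2 = - 1) \<longrightarrow>
        (\<exists>\<pi>'. short_exact (Br TYPE('k)) (BM TYPE('k) (group_alg G) (R_mat G u)) (H2 TYPE('k) G) \<iota> \<pi>'))"
proof -
  have "nonsplit_involution TYPE('k) G u"
  proof (intro nonsplit_involution.intro central_involution.intro central_involution_axioms.intro nonsplit_involution_axioms.intro)
    show "u \<otimes>\<^bsub>G\<^esub> g = g \<otimes>\<^bsub>G\<^esub> u" if "g \<in> carrier G" for g using assms(4) that by blast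
    show "(2 :: 'k) \<noteq> 0" by (rule even_order_char[OF assms(1,3,5,6,7)])
  qed fact+
  then interpret nonsplit_involution G u "TYPE('k)" .
  show ?thesis using exact_sharp exact_H2 by blast
qed

end
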